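(* Let $p$ be a prime. Then the group $C_2^5\times C_p$ is a $\mathrm{DCI}$-group if and only if $p\neq 2$.
   Context: $C_n$ denotes the cyclic group of order $n$. For a finite group $G$ and $S\subseteq G$, the Cayley digraph $\mathrm{Cay}(G,S)$ has vertex set $G$ and arc set $\{(g,sg): g\in G, s\in S\}$. Two Cayley digraphs $\mathrm{Cay}(G,S)$ and $\mathrm{Cay}(G,T)$ are Cayley isomorphic if some automorphism of the group $G$ is a digraph isomorphism between them (equivalently $T=S^\varphi$ for some $\varphi\in\mathrm{Aut}(G)$). A subset $S\subseteq G$ is a CI-subset if for every $T\subseteq G$, $\mathrm{Cay}(G,S)\cong \mathrm{Cay}(G,T)$ implies that they are Cayley isomorphic. A finite group $G$ is a $\mathrm{DCI}$-group if every subset of $G$ is a CI-subset. *)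

theory Defs
  imports
    "HOL-Algebra.Bij"
    "HOL-Algebra.Elementary_Groups"
    "HOL-Algebra.Product_Groups"
    "HOL-Computational_Algebra.Primes"
    "Graph_Theory.Digraph_Isomorphism"
    "Graph_Theory.Pair_Digraph"
begin

definition group_power :: "('a, 'b) monoid_scheme \<Rightarrow> nat \<Rightarrow> (nat \<Rightarrow> 'a) monoid" where
  "group_power G n = product_group {..<n} (\<lambda>_. G)"

definition cayley_digraph :: "('a, 'b) monoid_scheme \<Rightarrow> 'a set \<Rightarrow> 'a pair_pre_digraph" where
  "cayley_digraph G S =
    \<lparr> pverts = carrier G, parcs = {(g, s \<otimes>\<^bsub>G\<^esub> g) | g s. g \<in> carrier G \<and> s \<in> S} \<rparr>"

text \<open>The first two conjuncts are the body of \<^const>\<open>digraph_iso\<close>, unfolded so that the vertex map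
  can be required to be a group automorphism.\<close>

definition cayley_isomorphic :: "('a, 'b) monoid_scheme \<Rightarrow> 'a set \<Rightarrow> 'a set \<Rightarrow> bool" where
  "cayley_isomorphic G S T \<longleftrightarrow>
    (\<exists>f. pre_digraph.digraph_isomorphism (with_proj (cayley_digraph G S)) f \<and>
         with_proj (cayley_digraph G T) = app_iso f (with_proj (cayley_digraph G S)) \<and>
         iso_verts f \<in> auto G)"

definition CI_subset :: "('a, 'b) monoid_scheme \<Rightarrow> 'a set \<Rightarrow> bool" where
  "CI_subset G S \<longleftrightarrow> S \<subseteq> carrier G \<and>
    (\<forall>T. T \<subseteq> carrier G \<longrightarrow>
      digraph_iso (with_proj (cayley_digraph G S)) (with_proj (cayley_digraph G T)) \<longrightarrow>
      cayley_isomorphic G S T)"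

definition DCI_group :: "('a, 'b) monoid_scheme \<Rightarrow> bool" where
  "DCI_group G \<longleftrightarrow> group G \<and> finite (carrier G) \<and> (\<forall>S. S \<subseteq> carrier G \<longrightarrow> CI_subset G S)"

end

theory Submission
  imports Defs "HOL-Combinatorics.Permutations" "HOL-Algebra.Sylow"
begin

text \<open>
  Babai's criterion reduces the claim for odd \<open>p\<close> to a conjugacy statement. Let \<open>A\<close> be the automorphism
  group of a Cayley digraph of \<open>G = E \<times> P\<close> with \<open>E\<close> elementary abelian of order 32 and \<open>P\<close> of order \<open>p\<close>;
  the only property of \<open>A\<close> that is used is that it is 2-closed. One has to conjugate, inside \<open>A\<close>, an
  arbitrary regular subgroup \<open>H = E' \<times> P'\<close> isomorphic to \<open>G\<close> onto \<open>G\<close>.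

  Counting walks of length \<open>p\<close> modulo \<open>p\<close> yields a subgroup \<open>L\<close> of \<open>E\<close>, depending only on \<open>A\<close>, whose orbits are blocks
  and such that \<open>P\<close> may be rotated independently on the orbits of \<open>L \<times> P\<close>. Sylow's theorem for these rotation
  groups makes the orbits of \<open>L \<times> P\<close> and \<open>L' \<times> P'\<close> coincide, and a Fourier argument over the integers, using
  that a unit modulo \<open>p\<close> is a unit of the localised group ring of a cyclic group of order \<open>p\<close>, lets one assume that
  \<open>P'\<close> acts on every orbit of \<open>L \<times> P\<close> by powers of the generator of \<open>P\<close>.

  After a second Sylow argument, \<open>E\<close> and \<open>E'\<close> generate a 2-group with an orbit of length 32, so that one is left
  with a pair of regular elementary abelian subgroups of a 2-group of permutations of \<open>E\<close>. For such a pair and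
  an invariant subgroup of index 2, either one can rotate one half so that \<open>E \<inter> E'\<close> grows, or \<open>E'\<close> acts by
  translations on another subgroup of index 2; both cases produce an element of \<open>A\<close> that moves \<open>H\<close> closer to \<open>G\<close>.

  For \<open>p = 2\<close> a quadric and a cubic hypersurface in a 6-dimensional space over the field with two elements
  define isomorphic Cayley digraphs but are not linearly equivalent.
\<close>

section \<open>Permutation groups\<close>

text \<open>Two obstacles shape the proof. The generator of \<open>P'\<close> becomes a power of the
  generator of \<open>P\<close> on each orbit of \<open>L \<times> P\<close> separately, but the
  exponent may change from orbit to orbit. So \<open>E'\<close> need not centralise
  \<open>P\<close>, and an exponent function \<open>\<kappa>\<close> has to be carried through every
  later conjugation. Moreover, a common 2-group for \<open>E\<close> and \<open>E'\<close> does not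
  make them equal; the measure of progress is the order of \<open>E \<inter> E'\<close>, and each
  move conjugates one more element of \<open>E'\<close> into \<open>E\<close>, unless it finishes at
  once. A new permutation is shown to lie in \<open>A\<close> by gluing: it agrees with different
  elements of \<open>A\<close> on different blocks, and 2-closedness reduces the check to one pair
  of points at a time. The coprimality of 2 and \<open>p\<close> is what drives the counting: a set
  that is a union of regular orbits of \<open>P\<close> and also an orbit of a 2-group cannot exist.
  The order 32 enters through sizes. The centre of the 2-group modulo an invariant subgroup never
  has index 2, so it has order at most 8 or is everything; the few configurations left are settled
  by hand.\<close>

abbreviation finv :: "('a \<Rightarrow> 'b) \<Rightarrow> 'b \<Rightarrow> 'a" where
  "finv \<equiv> inv_into UNIV"

text \<open>Permutations are functions on the whole type that fix everything outside
  \<open>S\<close>, so products and inverses are those of functions and equality of group elements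
  is equality of functions.\<close>

definition perm_group :: "'a set \<Rightarrow> ('a \<Rightarrow> 'a) set \<Rightarrow> bool" where
  "perm_group S G \<longleftrightarrow> (\<forall>f\<in>G. f permutes S) \<and> id \<in> G \<and>
     (\<forall>f\<in>G. \<forall>g\<in>G. f \<circ> g \<in> G) \<and> (\<forall>f\<in>G. finv f \<in> G)"

lemma perm_groupI:
  assumes "\<And>f. f \<in> G \<Longrightarrow> f permutes S" "id \<in> G"
    "\<And>f g. f \<in> G \<Longrightarrow> g \<in> G \<Longrightarrow> f \<circ> g \<in> G" "\<And>f. f \<in> G \<Longrightarrow> finv f \<in> G"
  shows "perm_group S G"
  using assms unfolding perm_group_def by blast

lemma perm_groupD:
  assumes "perm_group S G"
  shows "f \<in> G \<Longrightarrow> f permutes S" "id \<in> G" "f \<in> G \<Longrightarrow> g \<in> G \<Longrightarrow> f \<circ> g \<in> G" "f \<in> G \<Longrightarrow> finv f \<in> G"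
  using assms unfolding perm_group_def by blast+

lemma perm_group_finite:
  assumes "perm_group S G" "finite S" shows "finite G"
proof (rule finite_subset)
  show "G \<subseteq> {f. f permutes S}" using perm_groupD(1)[OF assms(1)] by blast
qed (use assms(2) finite_permutations in blast)

lemma perm_group_bij: "perm_group S G \<Longrightarrow> f \<in> G \<Longrightarrow> bij f"
  using perm_groupD(1) permutes_bij by blast

lemma perm_group_inv_apply:
  assumes "perm_group S G" "f \<in> G"
  shows "finv f (f x) = x" "f (finv f x) = x"
  using perm_groupD(1)[OF assms] permutes_inverses by metis+

lemma perm_group_mult_mem:
  assumes "perm_group S G" "f \<in> G" "g \<in> G" shows "(\<lambda>x. f (g x)) \<in> G"
  using perm_groupD(3)[OF assms] by (simp add: comp_def)

text \<open>Lagrange's theorem for this encoding, by the partition into right cosets.\<close>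

lemma perm_group_card_dvd:
  assumes G: "perm_group S G" and H: "perm_group S H" and sub: "H \<subseteq> G" and fin: "finite S"
  shows "card H dvd card G"
proof -
  let ?C = "(\<lambda>g. (\<lambda>h. h \<circ> g) ` H) ` G"
  have U: "\<Union> ?C = G"
  proof
    show "\<Union> ?C \<subseteq> G" using perm_groupD(3)[OF G] sub by auto
    show "G \<subseteq> \<Union> ?C"
    proof
      fix g assume "g \<in> G"
      moreover have "g = id \<circ> g" by simp
      ultimately show "g \<in> \<Union> ?C" using perm_groupD(2)[OF H] by blast
    qed
  qed
  have fG: "finite G" using perm_group_finite G fin by blast
  have card: "card c = card H" if c: "c \<in> ?C" for c
  proof -
    obtain g where g: "g \<in> G" "c = (\<lambda>h. h \<circ> g) ` H" using c by blast
    have "surj g" using perm_group_bij[OF G g(1)] bij_is_surj by blast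
    then have "inj_on (\<lambda>h. h \<circ> g) H" by (intro inj_onI) (simp add: fun_eq_iff, metis surj_def)
    then show ?thesis using g(2) card_image by blast
  qed
  have disj: "c \<inter> d = {}" if c: "c \<in> ?C" and d: "d \<in> ?C" and ne: "c \<noteq> d" for c d
  proof (rule ccontr)
    assume "c \<inter> d \<noteq> {}"
    obtain a b where a: "a \<in> G" "c = (\<lambda>h. h \<circ> a) ` H" and b: "b \<in> G" "d = (\<lambda>h. h \<circ> b) ` H"
      using c d by blast
    obtain h k where hk: "h \<in> H" "k \<in> H" "h \<circ> a = k \<circ> b" using \<open>c \<inter> d \<noteq> {}\<close> a b by auto
    have "(\<lambda>h. h \<circ> a) ` H \<subseteq> (\<lambda>h. h \<circ> b) ` H" if "h \<circ> a = k \<circ> b" "h \<in> H" "k \<in> H" for a b h k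
    proof
      fix x assume "x \<in> (\<lambda>h. h \<circ> a) ` H"
      then obtain l where l: "l \<in> H" "x = l \<circ> a" by blast
      have "finv h \<circ> k \<in> H" using perm_groupD(3)[OF H perm_groupD(4)[OF H that(2)] that(3)] .
      then have "l \<circ> (finv h \<circ> k) \<in> H" using perm_groupD(3)[OF H l(1)] by blast
      moreover have "x = (l \<circ> (finv h \<circ> k)) \<circ> b"
      proof
        fix y
        have "finv h (k (b y)) = a y"
          using fun_cong[OF that(1), of y] perm_group_inv_apply(1)[OF H that(2), of "a y"] by simp
        then show "x y = ((l \<circ> (finv h \<circ> k)) \<circ> b) y" using l(2) by simp
      qed
      ultimately show "x \<in> (\<lambda>h. h \<circ> b) ` H" by blast
    qed
    from this[OF hk(3,1,2)] this[OF hk(3)[symmetric] hk(2,1)] ne a b show False by blast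
  qed
  have "card H dvd card (\<Union> ?C)"
    by (rule dvd_partition) (use U fG card disj in auto)
  then show ?thesis using U by simp
qed

definition orb :: "('a \<Rightarrow> 'a) set \<Rightarrow> 'a \<Rightarrow> 'a set" where
  "orb G x = (\<lambda>f. f x) ` G"

lemma orb_iff: "y \<in> orb G x \<longleftrightarrow> (\<exists>f\<in>G. f x = y)"
  unfolding orb_def by auto

lemma orbI: "f \<in> G \<Longrightarrow> f x \<in> orb G x"
  unfolding orb_def by (rule imageI)

lemma orbE: assumes "y \<in> orb G x" obtains f where "f \<in> G" "f x = y"
  using assms unfolding orb_def by (elim imageE) simp

lemma orb_stabilizer_card:
  assumes G: "perm_group S G" and fin: "finite S"
  shows "card G = card (orb G x) * card {f\<in>G. f x = x}"
proof -
  have fG: "finite G" using perm_group_finite G fin by blast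
  have "card G = (\<Sum>y\<in>orb G x. card {f\<in>G. f x = y})"
  proof -
    have "G = (\<Union>y\<in>orb G x. {f\<in>G. f x = y})" by (auto simp: orb_def)
    moreover have "card (\<Union>y\<in>orb G x. {f\<in>G. f x = y}) = (\<Sum>y\<in>orb G x. card {f\<in>G. f x = y})"
      by (rule card_UN_disjoint) (use fG in \<open>auto simp: orb_def\<close>)
    ultimately show ?thesis by simp
  qed
  also have "\<dots> = (\<Sum>y\<in>orb G x. card {f\<in>G. f x = x})"
  proof (rule sum.cong[OF refl])
    fix y assume "y \<in> orb G x"
    then obtain g where g: "g \<in> G" "g x = y" by (auto simp: orb_iff)
    have c: "finv g \<circ> (g \<circ> f) = f" "g \<circ> (finv g \<circ> f) = f" for f
      using perm_group_inv_apply[OF G g(1)] by (simp_all add: comp_def)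
    have "bij_betw (\<lambda>f. g \<circ> f) {f\<in>G. f x = x} {f\<in>G. f x = y}"
    proof (rule bij_betwI[where g="\<lambda>f. finv g \<circ> f"])
      show "(\<lambda>f. g \<circ> f) \<in> {f \<in> G. f x = x} \<rightarrow> {f \<in> G. f x = y}" using g perm_groupD(3)[OF G g(1)] by simp
      have "finv g y = x" using g perm_group_inv_apply[OF G g(1)] by auto
      then show "(\<lambda>f. finv g \<circ> f) \<in> {f \<in> G. f x = y} \<rightarrow> {f \<in> G. f x = x}"
        using perm_groupD(3)[OF G perm_groupD(4)[OF G g(1)]] by simp
    qed (use c in auto)
    from bij_betw_same_card[OF this] show "card {f\<in>G. f x = y} = card {f\<in>G. f x = x}" by simp
  qed
  finally show ?thesis by simp
qed

lemma card_orb_prime_power: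
  fixes p :: nat
  assumes "perm_group S G" "finite S" "card G = p ^ k" "prime p"
  shows "\<exists>j. card (orb G x) = p ^ j"
  using orb_stabilizer_card[OF assms(1,2), of x] assms(3,4) divides_primepow_nat
  by (metis dvd_triv_left)

lemma orb_self: "perm_group S G \<Longrightarrow> x \<in> orb G x"
  using perm_groupD(2)[of S G] unfolding orb_iff by (metis id_apply)

lemma orb_eq:
  assumes G: "perm_group S G" and "y \<in> orb G x" shows "orb G y = orb G x"
proof -
  obtain f where f: "f \<in> G" "f x = y" using assms by (auto simp: orb_iff)
  have "finv f y = x" using f perm_group_inv_apply[OF G f(1)] by auto
  show ?thesis
  proof (intro equalityI subsetI)
    fix z assume "z \<in> orb G y"
    then obtain g where "g \<in> G" "g y = z" by (auto simp: orb_iff)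
    then have "(g \<circ> f) x = z" "g \<circ> f \<in> G" using f perm_groupD(3)[OF G] by auto
    then show "z \<in> orb G x" unfolding orb_iff by blast
  next
    fix z assume "z \<in> orb G x"
    then obtain g where "g \<in> G" "g x = z" by (auto simp: orb_iff)
    then have "(g \<circ> finv f) y = z" "g \<circ> finv f \<in> G" using \<open>finv f y = x\<close> f perm_groupD(3,4)[OF G] by auto
    then show "z \<in> orb G y" unfolding orb_iff by blast
  qed
qed

lemma orb_subset: "perm_group S G \<Longrightarrow> x \<in> S \<Longrightarrow> orb G x \<subseteq> S"
  using perm_groupD(1)[of S G] permutes_in_image by (fastforce simp: orb_iff)

section \<open>Pairs of regular elementary abelian groups of order 32\<close>

text \<open>The type is \<open>E\<close>, written additively and acting on itself by translations;
  \<open>ep v\<close> is the element of \<open>E'\<close> that takes 0 to \<open>v\<close>, and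
  \<open>Q\<close> is the 2-group that both generate. Generation is stated as an induction rule over
  words; inverses do not occur because the generators are involutions.\<close>

locale boolean_pair =
  fixes Q :: "('v::{ab_group_add,finite} \<Rightarrow> 'v) set" and ep :: "'v \<Rightarrow> 'v \<Rightarrow> 'v"
  assumes char2 [simp]: "(x::'v) + x = 0"
    and card_V: "card (UNIV :: 'v set) = 32"
    and pg: "perm_group UNIV Q"
    and card_Q: "\<exists>k. card Q = 2 ^ k"
    and shift_mem: "(\<lambda>x. x + v) \<in> Q"
    and ep_mem: "ep v \<in> Q"
    and ep_0 [simp]: "ep v 0 = v"
    and ep_comm: "ep u (ep v x) = ep v (ep u x)"
    and ep_invol [simp]: "ep v (ep v x) = x"
    and generated: "\<And>P q. \<lbrakk>q \<in> Q; P id; \<And>v r. P r \<Longrightarrow> P (\<lambda>x. r x + v);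
      \<And>v r. P r \<Longrightarrow> P (\<lambda>x. ep v (r x))\<rbrakk> \<Longrightarrow> P q"
begin

lemma char2_left [simp]: "(x::'v) + (x + y) = y"
  using char2[of x] by (metis add.assoc add_0)

lemma add_eq_0_iff2: "(x::'v) + y = 0 \<longleftrightarrow> x = y"
  by (metis char2 char2_left add.right_neutral)

lemmas nf = add.assoc add.commute add.left_commute

section \<open>Subgroups, blocks, suborbits and the centre modulo a block\<close>

definition sg :: "'v set \<Rightarrow> bool" where
  "sg K \<longleftrightarrow> 0 \<in> K \<and> (\<forall>x\<in>K. \<forall>y\<in>K. x + y \<in> K)"

text \<open>In characteristic 2 the condition \<open>x + y \<in> K\<close> says that
  \<open>x\<close> and \<open>y\<close> lie in the same coset. So the cosets of \<open>K\<close>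
  form a block system of \<open>Q\<close>; as \<open>Q\<close> contains the translations, all block
  systems are of this kind.\<close>

definition blk :: "'v set \<Rightarrow> bool" where
  "blk K \<longleftrightarrow> sg K \<and> (\<forall>q\<in>Q. \<forall>x y. x + y \<in> K \<longrightarrow> q x + q y \<in> K)"

lemma sgD: "sg K \<Longrightarrow> 0 \<in> K" "sg K \<Longrightarrow> x \<in> K \<Longrightarrow> y \<in> K \<Longrightarrow> x + y \<in> K"
  unfolding sg_def by auto

lemma sg_cancel: "sg K \<Longrightarrow> x \<in> K \<Longrightarrow> x + y \<in> K \<longleftrightarrow> y \<in> K"
  using sgD(2)[of K x "x + y"] sgD(2)[of K x y] by auto

lemma sg_cancel_right: "sg K \<Longrightarrow> x \<in> K \<Longrightarrow> y + x \<in> K \<longleftrightarrow> y \<in> K"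
  using sg_cancel[of K x y] by (simp add: add.commute)

lemma sg_trans: "sg K \<Longrightarrow> x + y \<in> K \<Longrightarrow> y + z \<in> K \<Longrightarrow> x + z \<in> K"
  using sgD(2)[of K "x + y" "y + z"] by (simp add: add.assoc)

lemma blk_sg: "blk K \<Longrightarrow> sg K"
  unfolding blk_def by auto

lemma blkD: "blk K \<Longrightarrow> q \<in> Q \<Longrightarrow> x + y \<in> K \<Longrightarrow> q x + q y \<in> K"
  unfolding blk_def by auto

lemma Q_inv:
  assumes "q \<in> Q" shows "finv q \<in> Q" "finv q (q x) = x" "q (finv q x) = x"
  using perm_groupD(4)[OF pg assms] perm_group_inv_apply[OF pg assms] by auto

lemma blk_iff: "blk K \<Longrightarrow> q \<in> Q \<Longrightarrow> q x + q y \<in> K \<longleftrightarrow> x + y \<in> K"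
  using blkD[of K q x y] blkD[of K "finv q" "q x" "q y"] Q_inv[of q] by auto

lemma Q_comp: "q \<in> Q \<Longrightarrow> r \<in> Q \<Longrightarrow> (\<lambda>x. q (r x)) \<in> Q"
  using perm_group_mult_mem[OF pg] .

lemma Q_add: "q \<in> Q \<Longrightarrow> (\<lambda>x. q x + v) \<in> Q"
  using Q_comp[OF shift_mem, of q v] .

lemma Q_centre: "q \<in> Q \<Longrightarrow> (\<lambda>u. q (u + x) + q x) \<in> Q"
  using Q_add[OF Q_comp[OF _ shift_mem], of q x "q x"] .

lemma blk_UNIV: "blk UNIV"
  unfolding blk_def sg_def by simp

lemma blk_zero: "blk {0}"
  unfolding blk_def sg_def by (auto simp: add_eq_0_iff2)

lemma sg_card_dvd:
  assumes K: "sg K" and W: "sg W" and sub: "K \<subseteq> W" shows "card K dvd card W"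
proof -
  let ?C = "(\<lambda>w. (\<lambda>k. k + w) ` K) ` W"
  have U: "\<Union> ?C = W"
  proof
    show "\<Union> ?C \<subseteq> W" using sgD(2)[OF W] sub by auto
    show "W \<subseteq> \<Union> ?C" using sgD(1)[OF K] by force
  qed
  have card: "card c = card K" if "c \<in> ?C" for c
    using that by (auto intro!: card_image inj_onI)
  have disj: "c \<inter> d = {}" if c: "c \<in> ?C" and d: "d \<in> ?C" and ne: "c \<noteq> d" for c d
  proof (rule ccontr)
    assume "c \<inter> d \<noteq> {}"
    obtain a b where ab: "c = (\<lambda>k. k + a) ` K" "d = (\<lambda>k. k + b) ` K" using c d by blast
    obtain h k where hk: "h \<in> K" "k \<in> K" "h + a = k + b" using \<open>c \<inter> d \<noteq> {}\<close> ab by auto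
    then have ab': "a + b = h + k" by (metis add.assoc add.commute char2_left)
    have "(\<lambda>k. k + a) ` K = (\<lambda>k. k + b) ` K"
    proof -
      have "x + a \<in> (\<lambda>k. k + b) ` K" "x + b \<in> (\<lambda>k. k + a) ` K" if "x \<in> K" for x
      proof -
        have "x + a = (x + (h + k)) + b" "x + b = (x + (h + k)) + a"
          unfolding ab'[symmetric] by (simp_all add: nf)
        moreover have "x + (h + k) \<in> K" using that hk sgD[OF K] by blast
        ultimately show "x + a \<in> (\<lambda>k. k + b) ` K" "x + b \<in> (\<lambda>k. k + a) ` K" by blast+
      qed
      then show ?thesis by blast
    qed
    then show False using ne ab by simp
  qed
  have "card K dvd card (\<Union> ?C)"
    by (rule dvd_partition) (use card disj in auto)
  then show ?thesis using U by simp
qed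

lemma sg_UNIV: "sg UNIV" unfolding sg_def by simp

lemma sg_card_pow: "sg K \<Longrightarrow> \<exists>i\<le>5. card K = 2 ^ i"
proof -
  assume K: "sg K"
  have "card K dvd 2 ^ 5" using sg_card_dvd[OF K sg_UNIV] card_V by simp
  then show ?thesis using divides_primepow_nat[OF two_is_prime_nat] by blast
qed

lemma sg_card_cases:
  assumes "sg K" shows "card K = 1 \<or> card K = 2 \<or> card K = 4 \<or> card K = 8 \<or> card K = 16 \<or> card K = 32"
proof -
  obtain i where i: "i \<le> 5" "card K = 2 ^ i" using sg_card_pow[OF assms] by blast
  then have "i = 0 \<or> i = 1 \<or> i = 2 \<or> i = 3 \<or> i = 4 \<or> i = 5" by linarith
  then show ?thesis using i(2) by auto
qed

lemma sg_card_pos: "sg K \<Longrightarrow> card K > 0"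
  using sgD(1) by (auto simp: card_gt_0_iff)

lemma sg_psubset_card:
  assumes K: "sg K" and W: "sg W" and "K \<subset> W" shows "2 * card K \<le> card W" "2 * card K dvd card W"
proof -
  obtain i j where ij: "card K = 2 ^ i" "card W = 2 ^ j" using sg_card_pow K W by metis
  have "card K < card W" using assms(3) by (simp add: psubset_card_mono)
  then have "i < j" using ij by (metis one_less_numeral_iff power_strict_increasing_iff semiring_norm(76))
  then have "Suc i \<le> j" by simp
  then have "2 ^ Suc i dvd (2::nat) ^ j" by (rule le_imp_power_dvd)
  then show d: "2 * card K dvd card W" using ij by simp
  show "2 * card K \<le> card W" using d dvd_imp_le sg_card_pos[OF W] by blast
qed

lemma sg_double:
  assumes K: "sg K" and v: "v \<notin> K"
  shows "sg (K \<union> (\<lambda>k. k + v) ` K)" "card (K \<union> (\<lambda>k. k + v) ` K) = 2 * card K"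
proof -
  have "x + (y + v) \<in> (\<lambda>k. k + v) ` K" "(x + v) + y \<in> (\<lambda>k. k + v) ` K" "(x + v) + (y + v) \<in> K"
    if "x \<in> K" "y \<in> K" for x y
  proof -
    have s: "x + y \<in> K" using that sgD[OF K] by blast
    have "x + (y + v) = (x + y) + v" "(x + v) + y = (x + y) + v" "(x + v) + (y + v) = x + y" by (simp_all add: nf)
    then show "x + (y + v) \<in> (\<lambda>k. k + v) ` K" "(x + v) + y \<in> (\<lambda>k. k + v) ` K" "(x + v) + (y + v) \<in> K"
      using s by (metis image_eqI)+
  qed
  note add = this
  show "sg (K \<union> (\<lambda>k. k + v) ` K)" unfolding sg_def
  proof (intro conjI ballI)
    fix a b assume "a \<in> K \<union> (\<lambda>k. k + v) ` K" "b \<in> K \<union> (\<lambda>k. k + v) ` K"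
    then show "a + b \<in> K \<union> (\<lambda>k. k + v) ` K"
      by (elim UnE imageE) (use add sgD(2)[OF K] in \<open>auto simp del: char2 char2_left\<close>)
  qed (use sgD(1)[OF K] in simp)
  have "K \<inter> (\<lambda>k. k + v) ` K = {}" using v sg_cancel[OF K] by auto
  moreover have "card ((\<lambda>k. k + v) ` K) = card K" by (rule card_image) (auto intro: inj_onI)
  ultimately show "card (K \<union> (\<lambda>k. k + v) ` K) = 2 * card K" by (simp add: card_Un_disjoint)
qed

lemma index2:
  assumes K: "sg K" and W: "sg W" and sub: "K \<subseteq> W" and c: "card W \<le> 2 * card K"
    and v: "v \<in> W" "v \<notin> K" and u: "u \<in> W" "u \<notin> K"
  shows "u + v \<in> K"
proof -
  let ?D = "K \<union> (\<lambda>k. k + v) ` K"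
  have "?D \<subseteq> W" using sub v sgD(2)[OF W] by auto
  moreover have "card W \<le> card ?D" using c sg_double(2)[OF K v(2)] by simp
  ultimately have "?D = W" by (simp add: card_seteq)
  then obtain k where "k \<in> K" "u = k + v" using u by blast
  then show ?thesis by (simp add: nf)
qed

text \<open>The setwise stabiliser of the block \<open>K\<close>; modulo \<open>K\<close> it is the
  stabiliser of the point 0.\<close>

definition Qk :: "'v set \<Rightarrow> ('v \<Rightarrow> 'v) set" where
  "Qk K = {q\<in>Q. q 0 \<in> K}"

lemma Qk_group: assumes K: "blk K" shows "perm_group UNIV (Qk K)"
proof (rule perm_groupI)
  fix f g assume f: "f \<in> Qk K" and g: "g \<in> Qk K"
  then have q: "f \<in> Q" "f 0 \<in> K" "g \<in> Q" "g 0 \<in> K" by (auto simp: Qk_def)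
  have "f (g 0) + f 0 \<in> K" using blkD[OF K q(1), of "g 0" 0] q(4) by simp
  then have "f (g 0) \<in> K" using q(2) sg_cancel_right[OF blk_sg[OF K]] by blast
  then show "f \<circ> g \<in> Qk K" using perm_groupD(3)[OF pg q(1,3)] by (simp add: Qk_def)
next
  fix f assume "f \<in> Qk K"
  then have q: "f \<in> Q" "f 0 \<in> K" by (auto simp: Qk_def)
  have "finv f (f 0) + finv f 0 \<in> K" using blkD[OF K Q_inv(1)[OF q(1)], of "f 0" 0] q(2) by simp
  then show "finv f \<in> Qk K" using Q_inv[OF q(1)] by (simp add: Qk_def)
qed (use perm_groupD[OF pg] sgD(1)[OF blk_sg[OF K]] in \<open>auto simp: Qk_def\<close>)

text \<open>Modulo \<open>K\<close> this is a suborbit: the orbit of \<open>v\<close> under the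
  stabiliser of 0 in the group induced on the cosets of \<open>K\<close>.\<close>

definition X :: "'v set \<Rightarrow> 'v \<Rightarrow> 'v set" where
  "X K v = orb (Qk K) v"

lemma card_X: assumes K: "blk K" shows "\<exists>j. card (X K v) = 2 ^ j"
proof -
  obtain k where k: "card Q = 2 ^ k" using card_Q by blast
  have "card (Qk K) dvd 2 ^ k"
    using perm_group_card_dvd[OF pg Qk_group[OF K]] k by (simp add: Qk_def)
  then obtain i where "card (Qk K) = 2 ^ i" using divides_primepow_nat[OF two_is_prime_nat] by blast
  then show ?thesis unfolding X_def
    using card_orb_prime_power[OF Qk_group[OF K] _ _ two_is_prime_nat] by simp
qed

lemma X_self: "blk K \<Longrightarrow> v \<in> X K v"
  unfolding X_def by (rule orb_self[OF Qk_group])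

lemma X_eq: "blk K \<Longrightarrow> u \<in> X K v \<Longrightarrow> X K u = X K v"
  unfolding X_def by (rule orb_eq[OF Qk_group])

lemma X_step: assumes K: "blk K" and "u \<in> X K v" "q \<in> Q" "q 0 \<in> K" shows "q u \<in> X K v"
proof -
  have "q \<in> Qk K" using assms(3,4) by (simp add: Qk_def)
  from orbI[OF this] have "q u \<in> X K u" unfolding X_def .
  then show ?thesis using X_eq[OF K assms(2)] by simp
qed

lemma X_sat: assumes K: "blk K" and "u \<in> X K v" "k \<in> K" shows "u + k \<in> X K v"
  using X_step[OF K assms(2) shift_mem, of k] assms(3) by simp

lemma X_elim: assumes "u \<in> X K v" obtains q where "q \<in> Q" "q 0 \<in> K" "q v = u"
proof -
  from assms obtain q where "q \<in> Qk K" "q v = u" unfolding X_def by (rule orbE)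
  then show thesis using that[of q] by (simp add: Qk_def)
qed

text \<open>Conjugating \<open>q\<close> with translations gives
  \<open>\<lambda>u. q (u + x) + q x\<close>, which fixes 0. Hence a suborbit, read as a set of
  differences, is an orbital of \<open>Q\<close>.\<close>

lemma X_pair: assumes K: "blk K" and "q \<in> Q" "y + x \<in> X K v" shows "q y + q x \<in> X K v"
proof -
  have "q ((y + x) + x) + q x \<in> X K v"
    using X_step[OF K assms(3) Q_centre[OF assms(2), of x]] sgD(1)[OF blk_sg[OF K]] by simp
  then show ?thesis by (simp add: nf)
qed

lemma X_pair_iff: assumes K: "blk K" and q: "q \<in> Q" shows "q y + q x \<in> X K v \<longleftrightarrow> y + x \<in> X K v"
  using X_pair[OF K q, of y x v] X_pair[OF K Q_inv(1)[OF q], of "q y" "q x" v] Q_inv(2)[OF q] by auto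

lemma X_blk: assumes K: "blk K" and T: "blk T" and sub: "K \<subseteq> T" and u: "u \<in> X K v" shows "u \<in> T \<longleftrightarrow> v \<in> T"
proof -
  obtain q where q: "q \<in> Q" "q 0 \<in> K" "q v = u" using X_elim[OF u] .
  have "q v + q 0 \<in> T \<longleftrightarrow> v + 0 \<in> T" by (rule blk_iff[OF T q(1)])
  moreover have "q v + q 0 \<in> T \<longleftrightarrow> q v \<in> T"
    by (rule sg_cancel_right[OF blk_sg[OF T]]) (use q sub in auto)
  ultimately show ?thesis using q(3) by simp
qed

text \<open>The translations that commute with \<open>Q\<close> modulo \<open>K\<close>. A regular
  abelian group is its own centraliser, so this is the whole centre of the group induced on the
  cosets of \<open>K\<close>.\<close>

definition Z :: "'v set \<Rightarrow> 'v set" where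
  "Z K = {v. \<forall>q\<in>Q. \<forall>x. q (x + v) + q x + v \<in> K}"

lemma Z_D: "v \<in> Z K \<Longrightarrow> q \<in> Q \<Longrightarrow> q (x + v) + q x + v \<in> K"
  unfolding Z_def by auto

lemma Z_blk: assumes K: "blk K" shows "blk (Z K)" "K \<subseteq> Z K"
proof -
  note sg = blk_sg[OF K]
  show sub: "K \<subseteq> Z K"
  proof
    fix v assume v: "v \<in> K"
    have "q (x + v) + q x \<in> K" if "q \<in> Q" for q x
      using blkD[OF K that, of "x + v" x] v by (simp add: nf)
    then show "v \<in> Z K" unfolding Z_def using v sgD(2)[OF sg] by blast
  qed
  have "u + v \<in> Z K" if u: "u \<in> Z K" and v: "v \<in> Z K" for u v
    unfolding Z_def
  proof (intro CollectI ballI allI)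
    fix q x assume q: "q \<in> Q"
    have "(q ((x + u) + v) + q (x + u) + v) + (q (x + u) + q x + u) \<in> K"
      using Z_D[OF v q] Z_D[OF u q] sgD(2)[OF sg] by blast
    then show "q (x + (u + v)) + q x + (u + v) \<in> K" by (simp add: nf)
  qed
  then have sgZ: "sg (Z K)" using sgD(1)[OF sg] sub unfolding sg_def by blast
  have "q x + q y \<in> Z K" if q: "q \<in> Q" and xy: "x + y \<in> Z K" for q x y
  proof -
    have "q (y + (x + y)) + q y + (x + y) \<in> K" using Z_D[OF xy q] .
    then have "(q x + q y) + (x + y) \<in> Z K" using sub by (auto simp: nf)
    then show ?thesis using sg_cancel_right[OF sgZ xy] by blast
  qed
  then show "blk (Z K)" unfolding blk_def using sgZ by blast
qed

text \<open>All elements \<open>q (v + x) + q x\<close> lie in the suborbit of \<open>v\<close>; so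
  \<open>v\<close> is central modulo \<open>K\<close> exactly if this suborbit is a single coset of
  \<open>K\<close>.\<close>

lemma Z_iff_X: assumes K: "blk K" shows "v \<in> Z K \<longleftrightarrow> (\<forall>u\<in>X K v. u + v \<in> K)"
proof
  assume v: "v \<in> Z K"
  show "\<forall>u\<in>X K v. u + v \<in> K"
  proof
    fix u assume "u \<in> X K v"
    then obtain q where q: "q \<in> Q" "q 0 \<in> K" "q v = u" by (rule X_elim)
    have "q (0 + v) + q 0 + v \<in> K" using Z_D[OF v q(1)] .
    then have "q 0 + (u + v) \<in> K" using q(3) by (simp add: nf)
    then show "u + v \<in> K" using sg_cancel[OF blk_sg[OF K] q(2)] by blast
  qed
next
  assume a: "\<forall>u\<in>X K v. u + v \<in> K"
  show "v \<in> Z K" unfolding Z_def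
  proof (intro CollectI ballI allI)
    fix q x assume q: "q \<in> Q"
    have "q (v + x) + q x \<in> X K v" using X_pair[OF K q, of "v + x" x v] X_self[OF K] by (simp add: nf)
    then have "q (v + x) + q x + v \<in> K" using a by blast
    then show "q (x + v) + q x + v \<in> K" by (simp only: add.commute[of x v])
  qed
qed

lemma card_X_ge: assumes K: "blk K" shows "card K \<le> card (X K v)" "v \<notin> Z K \<Longrightarrow> 2 * card K dvd card (X K v)"
proof -
  have sub: "(\<lambda>k. v + k) ` K \<subseteq> X K v" using X_sat[OF K X_self[OF K]] by auto
  have c: "card ((\<lambda>k. v + k) ` K) = card K" by (rule card_image) (auto intro: inj_onI)
  show "card K \<le> card (X K v)" using card_mono[OF _ sub] c by simp
  assume "v \<notin> Z K"
  then obtain u where u: "u \<in> X K v" "u + v \<notin> K" using Z_iff_X[OF K] by blast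
  have "u \<notin> (\<lambda>k. v + k) ` K" using u(2) by (auto simp: nf)
  then have "(\<lambda>k. v + k) ` K \<subset> X K v" using sub u(1) by blast
  then have lt: "card K < card (X K v)" using c by (metis finite psubset_card_mono)
  obtain i j where ij: "card K = 2 ^ i" "card (X K v) = 2 ^ j"
    using sg_card_pow[OF blk_sg[OF K]] card_X[OF K] by metis
  have "i < j" using lt ij by simp
  then have "2 ^ Suc i dvd (2::nat) ^ j" by (intro le_imp_power_dvd) simp
  then show "2 * card K dvd card (X K v)" using ij by simp
qed

text \<open>The fixed point count for a 2-group: suborbits have 2-power size, so without a central
  element in \<open>T - K\<close> all suborbits there, hence \<open>T - K\<close> and with it
  \<open>K\<close>, would have size divisible by \<open>2 * card K\<close>.\<close>

lemma Z_meets: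
  assumes K: "blk K" and T: "blk T" and sub: "K \<subset> T" shows "\<exists>v\<in>T. v \<notin> K \<and> v \<in> Z K"
proof (rule ccontr)
  assume "\<not> ?thesis"
  then have no: "v \<notin> Z K" if "v \<in> T" "v \<notin> K" for v using that by blast
  let ?C = "X K ` (T - K)"
  have U: "\<Union> ?C = T - K"
  proof
    show "T - K \<subseteq> \<Union> ?C" using X_self[OF K] by blast
    show "\<Union> ?C \<subseteq> T - K"
    proof
      fix u assume "u \<in> \<Union> ?C"
      then obtain v where v: "v \<in> T" "v \<notin> K" "u \<in> X K v" by blast
      show "u \<in> T - K" using X_blk[OF K T _ v(3)] X_blk[OF K K _ v(3)] v sub by blast
    qed
  qed
  have "2 * card K dvd card (\<Union> ?C)"
  proof (rule dvd_partition)
    show "\<forall>c\<in>?C. 2 * card K dvd card c" using card_X_ge(2)[OF K] no by blast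
    show "\<forall>c1\<in>?C. \<forall>c2\<in>?C. c1 \<noteq> c2 \<longrightarrow> c1 \<inter> c2 = {}" using X_eq[OF K] by blast
  qed simp
  then have 1: "2 * card K dvd card (T - K)" unfolding U .
  have 2: "card T = card K + card (T - K)"
    using card_Un_disjoint[of K "T - K"] sub by (simp add: Un_absorb1 less_le)
  have "2 * card K dvd card T" using sg_psubset_card(2)[OF blk_sg[OF K] blk_sg[OF T] sub] .
  then have "2 * card K dvd card K" unfolding 2 using dvd_add_left_iff[OF 1] by blast
  then have "2 * card K \<le> card K" by (rule dvd_imp_le) (rule sg_card_pos[OF blk_sg[OF K]])
  then show False using sg_card_pos[OF blk_sg[OF K]] by linarith
qed

lemma Z_grows: assumes K: "blk K" and "K \<noteq> UNIV" shows "K \<subset> Z K"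
proof -
  have "K \<subset> UNIV" using assms(2) by blast
  then show ?thesis using Z_meets[OF K blk_UNIV] Z_blk(2)[OF K] by blast
qed

text \<open>\<open>ep v\<close> commutes with \<open>E'\<close>, and the translation by
  \<open>v\<close> commutes with \<open>E\<close>. If the two agree modulo \<open>K\<close>, the
  translation commutes with all generators.\<close>

lemma ep_eq_shift_Z:
  assumes K: "blk K" and a: "\<And>x. ep v x + x + v \<in> K" shows "v \<in> Z K"
proof -
  note sg = blk_sg[OF K]
  have "\<forall>x. q (x + v) + q x + v \<in> K" if "q \<in> Q" for q
  proof (rule generated[OF that, where P="\<lambda>r. \<forall>x. r (x + v) + r x + v \<in> K"])
    fix w r assume "\<forall>x. r (x + v) + r x + v \<in> K"
    then show "\<forall>x. (r (x + v) + w) + (r x + w) + v \<in> K" by (simp add: nf)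
  next
    fix w r assume r: "\<forall>x. r (x + v) + r x + v \<in> K"
    show "\<forall>x. ep w (r (x + v)) + ep w (r x) + v \<in> K"
    proof
      fix x
      have "r (x + v) + ep v (r x) \<in> K"
        using sgD(2)[OF sg r[rule_format, of x] a[of "r x"]] by (simp add: nf)
      then have 1: "ep w (r (x + v)) + ep w (ep v (r x)) \<in> K" using blkD[OF K ep_mem] by blast
      have "ep v (ep w (r x)) + ep w (r x) + v \<in> K" using a .
      then have "ep w (ep v (r x)) + (ep w (r x) + v) \<in> K" by (simp add: ep_comm[of w v] nf)
      from sg_trans[OF sg 1 this] show "ep w (r (x + v)) + ep w (r x) + v \<in> K" by (simp add: nf)
    qed
  qed (use sgD(1)[OF sg] in \<open>simp add: nf\<close>)
  then show ?thesis unfolding Z_def by blast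
qed

text \<open>Commutativity evaluated at 0: \<open>ep\<close> is a second commutative group law with
  the same neutral element.\<close>

lemma ep_swap: "ep v x = ep x v"
  using ep_comm[of v x 0] by simp

lemma Z_ep: assumes "v \<in> Z K" shows "ep v x + x + v \<in> K"
  using Z_D[OF assms ep_mem, of x 0] by (simp add: ep_swap[of v x])

text \<open>The deviation of \<open>ep e\<close> from the translation by \<open>e\<close>. It is
  studied through its periods modulo a block.\<close>

definition zeta :: "'v \<Rightarrow> 'v \<Rightarrow> 'v" where
  "zeta e x = ep e x + x + e"

lemma ep_zeta: "ep e x = x + e + zeta e x"
  unfolding zeta_def by (simp add: nf)

lemma zeta_0 [simp]: "zeta e 0 = 0"
  unfolding zeta_def by simp

lemma zeta_mem: "e \<in> Z K \<Longrightarrow> zeta e x \<in> K"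
  unfolding zeta_def by (rule Z_ep)

lemma zeta_Z: assumes "z \<in> Z K" shows "zeta e (x + z) + zeta e x \<in> K"
  using Z_D[OF assms ep_mem, of e x] unfolding zeta_def by (simp add: nf)

text \<open>As \<open>ep e\<close> is an involution, \<open>zeta e\<close> takes the same value at
  \<open>x\<close> and at \<open>x + e + zeta e x\<close>. The last summand lies in
  \<open>Z K\<close> and is therefore a period modulo \<open>K\<close>.\<close>

lemma zeta_self: assumes K: "blk K" and e: "e \<in> Z (Z K)" shows "zeta e (x + e) + zeta e x \<in> K"
proof -
  have z: "zeta e x \<in> Z K" using zeta_mem[OF e] .
  have "ep e (ep e x) = x" by simp
  then have "(x + e + zeta e x) + e + zeta e (x + e + zeta e x) = x" unfolding ep_zeta[of e] .
  then have "x + (zeta e x + zeta e (x + e + zeta e x)) = x" by (simp add: nf)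
  then have "zeta e (x + e + zeta e x) = zeta e x" using add_eq_0_iff2 by (metis add.right_neutral add_left_cancel)
  then show ?thesis using zeta_Z[OF z, of e "x + e"] by (simp add: nf)
qed

lemma zeta_X: assumes K: "blk K" shows "v + (zeta e (x + v) + zeta e x) \<in> X K v"
proof -
  have "ep e (v + x) + ep e x \<in> X K v" using X_pair[OF K ep_mem, of "v + x" x v] X_self[OF K] by (simp add: nf)
  then show ?thesis unfolding zeta_def by (simp add: nf)
qed

lemma zeta_nonconst: assumes K: "blk K" and "e \<notin> Z K" shows "\<exists>x. zeta e x \<notin> K"
  using ep_eq_shift_Z[OF K, of e] assms(2) unfolding zeta_def by blast

lemma X_add_Z: assumes K: "blk K" and z: "z \<in> Z K" and u: "u \<in> X K v" shows "u + z \<in> X K (v + z)"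
proof -
  obtain q where q: "q \<in> Q" "q 0 \<in> K" "q v = u" using X_elim[OF u] .
  have 1: "q (v + z) \<in> X K (v + z)" using X_step[OF K X_self[OF K] q(1,2)] .
  have "q (v + z) + q v + z \<in> K" using Z_D[OF z q(1)] .
  from X_sat[OF K 1 this] show ?thesis using q(3) by (simp add: nf)
qed

text \<open>The central translations that preserve the suborbit of \<open>v\<close>; by
  \<open>TZ_eq\<close> it suffices that a single point of the suborbit stays in it.\<close>

definition TZ :: "'v set \<Rightarrow> 'v \<Rightarrow> 'v set" where
  "TZ K v = {z\<in>Z K. v + z \<in> X K v}"

lemma TZ_eq: assumes K: "blk K" and z: "z \<in> Z K" and u: "u \<in> X K v" and uz: "u + z \<in> X K v" shows "z \<in> TZ K v"
proof -
  have "u + z \<in> X K (v + z)" using X_add_Z[OF K z u] .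
  then have "X K (v + z) = X K v" using X_eq[OF K] uz by metis
  then show ?thesis using X_self[OF K, of "v + z"] z unfolding TZ_def by auto
qed

lemma TZ_sg: assumes K: "blk K" shows "sg (TZ K v)" "K \<subseteq> TZ K v"
proof -
  show K2: "K \<subseteq> TZ K v" using X_sat[OF K X_self[OF K]] Z_blk(2)[OF K] unfolding TZ_def by blast
  have "x + y \<in> TZ K v" if x: "x \<in> TZ K v" and y: "y \<in> TZ K v" for x y
  proof -
    have "v + x \<in> X K v" "v + y \<in> X K v" "x \<in> Z K" "y \<in> Z K" using x y unfolding TZ_def by auto
    moreover have "(v + x) + (x + y) = v + y" by (simp add: nf)
    moreover have "x + y \<in> Z K" using sgD(2)[OF blk_sg[OF Z_blk(1)[OF K]]] calculation by blast
    ultimately show ?thesis using TZ_eq[OF K, of "x + y" "v + x" v] by metis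
  qed
  then show "sg (TZ K v)" using K2 sgD(1)[OF blk_sg[OF K]] unfolding sg_def by blast
qed

text \<open>The analogue of the fact that a group modulo its centre is not cyclic of prime order. If
  \<open>Z K\<close> had index 2, an element \<open>w\<close> outside it would be a period of
  \<open>zeta w\<close> together with all of \<open>Z K\<close>; then \<open>zeta w\<close> vanishes
  modulo \<open>K\<close> and \<open>w\<close> is central after all.\<close>

lemma card_Z_small: assumes K: "blk K" and "Z K \<noteq> UNIV" shows "card (Z K) \<le> 8"
proof (rule ccontr)
  assume "\<not> ?thesis"
  note B = Z_blk[OF K] and sg = blk_sg[OF Z_blk(1)[OF K]]
  have "card (Z K) < 32" using assms(2) card_V by (metis finite psubset_card_mono top.not_eq_extremum)
  with \<open>\<not> ?thesis\<close> have c: "card (Z K) = 16" using sg_card_cases[OF sg] by auto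
  obtain w where w: "w \<notin> Z K" using assms(2) by blast
  have i2: "u + v \<in> Z K" if "u \<notin> Z K" "v \<notin> Z K" for u v
    using index2[OF sg sg_UNIV, of v u] that c card_V by simp
  have wZ: "w \<in> Z (Z K)" unfolding Z_def[of "Z K"]
  proof (intro CollectI ballI allI)
    fix q x assume "q \<in> Q"
    then have "q (x + w) + q x \<notin> Z K" using blk_iff[OF B(1), of q "x + w" x] w by (simp add: nf)
    then show "q (x + w) + q x + w \<in> Z K" using i2 w by blast
  qed
  have "zeta w x \<in> K" for x
  proof (cases "x \<in> Z K")
    case True
    then show ?thesis using zeta_Z[of x K w 0] by simp
  next
    case False
    then have "x + w \<in> Z K" using i2 w by blast
    from zeta_Z[OF this, of w w] have 1: "zeta w x + zeta w w \<in> K" by (simp add: nf)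
    have "zeta w w \<in> K" using zeta_self[OF K wZ, of 0] by simp
    then show ?thesis using 1 sg_cancel_right[OF blk_sg[OF K]] by blast
  qed
  then show False using zeta_nonconst[OF K w] by blast
qed

end

locale boolean_pair_half = boolean_pair Q ep
  for Q :: "('v::{ab_group_add,finite} \<Rightarrow> 'v) set" and ep :: "'v \<Rightarrow> 'v \<Rightarrow> 'v" +
  fixes E0 :: "'v set"
  assumes E0: "blk E0" and card_E0: "card E0 = 16"
begin

lemma E0_sg: "sg E0" using blk_sg[OF E0] .

lemma E0_index: "u \<notin> E0 \<Longrightarrow> v \<notin> E0 \<Longrightarrow> u + v \<in> E0"
  using index2[OF E0_sg sg_UNIV, of v u] card_E0 card_V by simp

lemma E0_mix: "u \<in> E0 \<Longrightarrow> u + v \<in> E0 \<longleftrightarrow> v \<in> E0"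
  using sg_cancel[OF E0_sg] .

lemma E0_proper: "\<exists>v. v \<notin> E0"
proof (rule ccontr)
  assume "\<not> ?thesis"
  then have "E0 = UNIV" by blast
  then show False using card_E0 card_V by simp
qed

text \<open>The permutation that is the identity on \<open>E0\<close> and
  \<open>y \<mapsto> ep w y + e\<close> off \<open>E0\<close> agrees modulo \<open>K\<close>, on
  each pair of points from different halves, with an element of \<open>Q\<close>; so it lies in the
  2-closure. Conjugation by it turns \<open>ep w\<close> into the translation by \<open>e\<close>,
  which enlarges the common part of \<open>E\<close> and \<open>E'\<close>.\<close>

definition star :: "'v set \<Rightarrow> bool" where
  "star K \<longleftrightarrow> (\<exists>e w. e \<notin> E0 \<and> w \<notin> E0 \<and> (\<forall>x\<in>E0. \<forall>y. y \<notin> E0 \<longrightarrow>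
     (\<exists>q\<in>Q. q x + x \<in> K \<and> q y + (ep w y + e) \<in> K)))"

text \<open>The alternative to \<open>star\<close>: the elements of \<open>E'\<close> with label in
  \<open>Y\<close> translate both cosets of \<open>Y\<close>, possibly by different vectors.\<close>

definition AB :: "'v set \<Rightarrow> bool" where
  "AB Y \<longleftrightarrow> blk Y \<and> card Y = 16 \<and> Y \<noteq> E0 \<and>
     (\<forall>y\<in>Y. (\<forall>x\<in>Y. ep y x = x + y) \<and> (\<exists>c\<in>Y. \<forall>x. x \<notin> Y \<longrightarrow> ep y x = x + c))"

lemma id_Q: "id \<in> Q" using perm_groupD(2)[OF pg] .

lemma star_Z: assumes K: "blk K" and v: "v \<in> Z K" "v \<notin> E0" shows "star K"
  unfolding star_def
proof (intro exI[of _ v] conjI ballI allI impI bexI[of _ id])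
  fix x y
  show "id x + x \<in> K" using sgD(1)[OF blk_sg[OF K]] by simp
  show "id y + (ep v y + v) \<in> K" using Z_ep[OF v(1), of y] by (simp add: nf)
qed (use v id_Q in auto)

text \<open>An element that works modulo \<open>K\<close> and \<open>z\<close> is off by at most
  \<open>z\<close> at each of the two points. A translation by \<open>z\<close> repairs the first
  point. For the second, \<open>z\<close> preserves the suborbit of \<open>x + f\<close>, which
  gives an element moving \<open>x + f\<close> to \<open>x + f + z\<close>; conjugated with the
  translation by \<open>x\<close> it fixes \<open>x\<close> modulo \<open>K\<close> and adds the
  missing \<open>z\<close>.\<close>

lemma star_lift:
  assumes K: "blk K" and z: "z \<in> Z K"
    and all: "\<And>v. v \<notin> E0 \<Longrightarrow> v + z \<in> X K v"
    and st: "star (K \<union> (\<lambda>k. k + z) ` K)"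
  shows "star K"
proof -
  let ?L = "K \<union> (\<lambda>k. k + z) ` K"
  note sg = blk_sg[OF K]
  have L: "t \<in> K \<or> t + z \<in> K" if "t \<in> ?L" for t
    using that by (auto simp: nf)
  obtain e w where ew: "e \<notin> E0" "w \<notin> E0"
    and main: "\<And>x y. x \<in> E0 \<Longrightarrow> y \<notin> E0 \<Longrightarrow> \<exists>q\<in>Q. q x + x \<in> ?L \<and> q y + (ep w y + e) \<in> ?L"
    using st unfolding star_def by blast
  have "\<exists>q\<in>Q. q x + x \<in> K \<and> q y + (ep w y + e) \<in> K" if x: "x \<in> E0" and y: "y \<notin> E0" for x y
  proof -
    obtain q where q: "q \<in> Q" "q x + x \<in> ?L" "q y + (ep w y + e) \<in> ?L" using main[OF x y] by blast
    define f where "f = ep w y + e"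
    obtain r where r: "r \<in> Q" "r x + x \<in> K" "r y + f \<in> K \<or> r y + f + z \<in> K"
    proof (cases "q x + x \<in> K")
      case True
      then show ?thesis using that[of q] q L[OF q(3)] unfolding f_def by blast
    next
      case False
      then have "q x + x + z \<in> K" using L[OF q(2)] by blast
      then have 1: "(q x + z) + x \<in> K" by (simp add: nf)
      have "(q y + z) + f + z \<in> K \<or> (q y + z) + f \<in> K"
        using L[OF q(3)] unfolding f_def by (simp add: nf)
      then show ?thesis using that[of "\<lambda>u. q u + z"] Q_add[OF q(1), of z] 1 by blast
    qed
    show ?thesis
    proof (cases "r y + f \<in> K")
      case True
      then show ?thesis using r unfolding f_def by blast
    next
      case False
      then have ryz: "r y + (f + z) \<in> K" using r(3) by (simp add: nf)
      have "ep w y + ep w 0 \<notin> E0" using blk_iff[OF E0 ep_mem, of w y 0] y by simp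
      then have "ep w y + w \<notin> E0" by simp
      moreover have "w + e \<in> E0" using E0_index ew by blast
      ultimately have "(w + e) + (ep w y + w) \<notin> E0" using E0_mix by blast
      then have "f \<notin> E0" unfolding f_def by (simp add: nf)
      then have v: "x + f \<notin> E0" using E0_mix[OF x] by blast
      from all[OF v] obtain s where s: "s \<in> Q" "s 0 \<in> K" "s (x + f) = x + f + z" by (rule X_elim)
      define s' where "s' u = s (r u + x) + x" for u
      have s'Q: "s' \<in> Q" unfolding s'_def
        using Q_add[OF Q_comp[OF s(1) Q_add[OF r(1), of x]], of x] .
      have "s (r x + x) + s 0 \<in> K" using blkD[OF K s(1), of "r x + x" 0] r(2) by simp
      then have "s (r x + x) \<in> K" using s(2) sg_cancel_right[OF sg] by blast
      then have 1: "s' x + x \<in> K" unfolding s'_def by (simp add: nf)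
      have "(r y + x) + ((x + f) + z) \<in> K" using ryz by (simp add: nf)
      then have "s (r y + x) + s ((x + f) + z) \<in> K" using blkD[OF K s(1)] by blast
      moreover have "s ((x + f) + z) + s (x + f) + z \<in> K" using Z_D[OF z s(1)] .
      ultimately have "s (r y + x) + (x + f) \<in> K"
        using sg_trans[OF sg, of "s (r y + x)" "s ((x + f) + z)" "x + f"] s(3) by (simp add: nf)
      then have "s' y + (ep w y + e) \<in> K" unfolding s'_def f_def by (simp add: nf)
      then show ?thesis using s'Q 1 by blast
    qed
  qed
  then show ?thesis unfolding star_def using ew by blast
qed

section \<open>Centre inside \<open>E0\<close> and no central translation to divide out\<close>

context
  fixes K :: "'v set"
  assumes K: "blk K" and ZE: "Z K \<subseteq> E0"
begin

lemma KZ: "K \<subseteq> Z K" using Z_blk(2)[OF K] .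

lemma ZnU: "Z K \<noteq> UNIV" using ZE E0_proper by blast

lemma X_E0: "u \<in> X K v \<Longrightarrow> u \<in> E0 \<longleftrightarrow> v \<in> E0"
  using X_blk[OF K E0] KZ ZE by blast

lemma exists_e: "\<exists>e. e \<in> Z (Z K) \<and> e \<notin> Z K"
  using Z_grows[OF Z_blk(1)[OF K] ZnU] by blast

context
  fixes v :: 'v
  assumes v: "v \<notin> E0" and tz: "TZ K v \<subseteq> K"
begin

abbreviation "x0 \<equiv> X K v"

lemma shift_TZ: "u \<in> x0 \<Longrightarrow> u + z \<in> x0 \<Longrightarrow> z \<in> Z K \<Longrightarrow> z \<in> K"
  using TZ_eq[OF K] tz by blast

text \<open>The translations that preserve the suborbit form a block. If it were larger than
  \<open>K\<close>, it would contain a central translation outside \<open>K\<close>, which is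
  excluded by \<open>tz\<close>.\<close>

lemma stab_trivial:
  assumes t: "\<And>u. u \<in> x0 \<longleftrightarrow> u + t \<in> x0" shows "t \<in> K"
proof -
  define T where "T = {t. \<forall>u. u \<in> x0 \<longleftrightarrow> u + t \<in> x0}"
  have mem: "a + b \<in> T \<longleftrightarrow> (\<forall>y. y + a \<in> x0 \<longleftrightarrow> y + b \<in> x0)" for a b
  proof
    assume "a + b \<in> T"
    then have "y + a \<in> x0 \<longleftrightarrow> (y + a) + (a + b) \<in> x0" for y unfolding T_def by blast
    then show "\<forall>y. y + a \<in> x0 \<longleftrightarrow> y + b \<in> x0" by (simp add: nf)
  next
    assume r: "\<forall>y. y + a \<in> x0 \<longleftrightarrow> y + b \<in> x0"
    show "a + b \<in> T" unfolding T_def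
    proof (intro CollectI allI)
      fix u show "u \<in> x0 \<longleftrightarrow> u + (a + b) \<in> x0" using r[rule_format, of "u + a"] by (simp add: nf)
    qed
  qed
  have "sg T" unfolding sg_def T_def
  proof (intro conjI ballI)
    fix a b assume a: "a \<in> {t. \<forall>u. (u \<in> x0) = (u + t \<in> x0)}" and b: "b \<in> {t. \<forall>u. (u \<in> x0) = (u + t \<in> x0)}"
    show "a + b \<in> {t. \<forall>u. (u \<in> x0) = (u + t \<in> x0)}"
    proof (intro CollectI allI)
      fix u
      have "(u \<in> x0) = (u + a \<in> x0)" "(u + a \<in> x0) = ((u + a) + b \<in> x0)" using a b by blast+
      then show "(u \<in> x0) = (u + (a + b) \<in> x0)" by (simp add: add.assoc)
    qed
  qed simp
  moreover have "q a + q b \<in> T" if q: "q \<in> Q" and ab: "a + b \<in> T" for q a b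
  proof -
    have "y + q a \<in> x0 \<longleftrightarrow> y + q b \<in> x0" for y
    proof -
      have "q (finv q y) = y" using Q_inv(3)[OF q] .
      then have "(y + q a \<in> x0) = (finv q y + a \<in> x0)" "(y + q b \<in> x0) = (finv q y + b \<in> x0)"
        using X_pair_iff[OF K q, of "finv q y"] by metis+
      then show ?thesis using ab mem by blast
    qed
    then show ?thesis using mem by blast
  qed
  ultimately have T: "blk T" unfolding blk_def by blast
  have KT: "K \<subseteq> T"
  proof
    fix k assume k: "k \<in> K"
    have "u \<in> x0 \<longleftrightarrow> u + k \<in> x0" for u
      using X_sat[OF K _ k, of u v] X_sat[OF K _ k, of "u + k" v] by (auto simp: nf)
    then show "k \<in> T" unfolding T_def by blast
  qed
  have "T = K"
  proof (rule ccontr)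
    assume "T \<noteq> K"
    then obtain s where s: "s \<in> T" "s \<notin> K" "s \<in> Z K" using Z_meets[OF K T] KT by blast
    have "v + s \<in> x0" using s(1) X_self[OF K, of v] unfolding T_def by blast
    then show False using shift_TZ[OF X_self[OF K]] s by blast
  qed
  then show ?thesis using t unfolding T_def by blast
qed

text \<open>Counting leaves only a trivial \<open>K\<close> and a suborbit \<open>x0\<close> of four
  points that spans, with one central element, a subgroup \<open>Y\<close> of order 16. As
  \<open>x0\<close> has no additive coincidences, the stabiliser of 0 acts additively on
  \<open>Y\<close>, and comparing \<open>ep a1\<close> with \<open>ep a2\<close> for two points of
  \<open>x0\<close> forces both to be translations on \<open>Y\<close>.\<close>

lemma case_one: "\<exists>Y. AB Y"
proof -
  obtain e where e: "e \<in> Z (Z K)" "e \<notin> Z K" using exists_e by blast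
  note sgK = blk_sg[OF K] and ZB = Z_blk(1)[OF K] and sgZ = blk_sg[OF Z_blk(1)[OF K]]
  \<comment> \<open>The periods of the deviation of an element \<open>e\<close> of the second centre
    that is not central.\<close>
  define Y where "Y = {y. \<forall>w. zeta e (w + y) + zeta e w \<in> K}"
  have sgY: "sg Y" unfolding sg_def
  proof (intro conjI ballI)
    show "0 \<in> Y" unfolding Y_def using sgD(1)[OF sgK] by simp
    fix a b assume a: "a \<in> Y" and b: "b \<in> Y"
    have "zeta e (w + (a + b)) + zeta e w \<in> K" for w
    proof -
      have "zeta e ((w + a) + b) + zeta e (w + a) \<in> K" "zeta e (w + a) + zeta e w \<in> K"
        using a b unfolding Y_def by blast+
      then show ?thesis using sg_trans[OF sgK] by (metis add.assoc)
    qed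
    then show "a + b \<in> Y" unfolding Y_def by blast
  qed
  \<comment> \<open>A difference of two values of \<open>zeta e\<close> is central and, by
    \<open>zeta_X\<close>, moves \<open>u\<close> inside \<open>x0\<close>; by assumption it then
    lies in \<open>K\<close>.\<close>
  have xY: "x0 \<subseteq> Y"
  proof
    fix u assume u: "u \<in> x0"
    have "zeta e (w + u) + zeta e w \<in> K" for w
    proof -
      have "zeta e (w + u) + zeta e w \<in> Z K" using zeta_mem[OF e(1)] sgD(2)[OF sgZ] by blast
      moreover have "u + (zeta e (w + u) + zeta e w) \<in> x0" using zeta_X[OF K, of u e w] X_eq[OF K u] by simp
      ultimately show ?thesis using shift_TZ[OF u] by blast
    qed
    then show "u \<in> Y" unfolding Y_def by blast
  qed
  have ZY: "Z K \<subseteq> Y" unfolding Y_def using zeta_Z by blast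
  have eY: "e \<in> Y" unfolding Y_def using zeta_self[OF K e(1)] by blast
  obtain a where a: "zeta e a \<notin> K" using zeta_nonconst[OF K e(2)] by blast
  have "a \<notin> Y"
  proof
    assume "a \<in> Y"
    then have "zeta e (0 + a) + zeta e 0 \<in> K" unfolding Y_def by blast
    then show False using a by simp
  qed
  then have "card Y < 32" using card_V by (metis UNIV_I finite psubset_card_mono top.not_eq_extremum)
  then have cY: "card Y \<le> 16" using sg_card_cases[OF sgY] by auto
  have vY: "v \<in> Y" using xY X_self[OF K] by blast
  define Y0 where "Y0 = Y \<inter> E0"
  have sgY0: "sg Y0" using sgY E0_sg unfolding Y0_def sg_def by blast
  have "Y0 \<subset> Y" using v vY unfolding Y0_def by blast
  from sg_psubset_card(1)[OF sgY0 sgY this] have cY0: "2 * card Y0 \<le> card Y" .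
  have xY0: "u + v \<in> Y0" if "u \<in> x0" for u
    using that xY vY sgD(2)[OF sgY] E0_index X_E0 v unfolding Y0_def by blast
  have x_sub: "x0 \<subseteq> (\<lambda>y. y + v) ` Y0"
  proof
    fix u assume "u \<in> x0"
    then have "u + v \<in> Y0" by (rule xY0)
    moreover have "u = (u + v) + v" by (simp add: nf)
    ultimately show "u \<in> (\<lambda>y. y + v) ` Y0" by blast
  qed
  have cimg: "card ((\<lambda>y. y + v) ` Y0) = card Y0" by (rule card_image) (auto intro: inj_onI)
  have c1: "card x0 \<le> card Y0" using card_mono[OF _ x_sub] cimg by simp
  have vZ: "v \<notin> Z K" using v ZE by blast
  obtain i j where ij: "card K = 2 ^ i" "card x0 = 2 ^ j" using sg_card_pow[OF sgK] card_X[OF K] by metis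
  have d2: "2 * card K dvd card x0" using card_X_ge(2)[OF K vZ] .
  \<comment> \<open>Two cosets of \<open>K\<close> are interchanged by their difference, against
    \<open>stab_trivial\<close>.\<close>
  have ne2: "card x0 \<noteq> 2 * card K"
  proof
    assume c: "card x0 = 2 * card K"
    obtain u where u: "u \<in> x0" "u + v \<notin> K" using Z_iff_X[OF K] vZ by blast
    let ?A = "(\<lambda>k. k + v) ` K" and ?B = "(\<lambda>k. k + u) ` K"
    have sub: "?A \<union> ?B \<subseteq> x0"
      using X_sat[OF K X_self[OF K, of v]] X_sat[OF K u(1)] by (auto simp: add.commute)
    have "?A \<inter> ?B = {}"
    proof (rule ccontr)
      assume "?A \<inter> ?B \<noteq> {}"
      then obtain k l where kl: "k \<in> K" "l \<in> K" "k + v = l + u" by auto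
      then have "u + v = k + l" by (metis add.commute add.left_commute char2_left)
      then show False using u(2) kl sgD(2)[OF sgK] by simp
    qed
    moreover have "card ?A = card K" "card ?B = card K" by (auto intro!: card_image inj_onI)
    ultimately have "card (?A \<union> ?B) = 2 * card K" by (simp add: card_Un_disjoint)
    then have eq: "?A \<union> ?B = x0" using sub c by (intro card_subset_eq) auto
    have iff: "y \<in> x0 \<longleftrightarrow> y + v \<in> K \<or> y + u \<in> K" for y
    proof
      assume "y \<in> x0" then show "y + v \<in> K \<or> y + u \<in> K" unfolding eq[symmetric] by (auto simp: nf)
    next
      assume "y + v \<in> K \<or> y + u \<in> K"
      moreover have "y = (y + v) + v" "y = (y + u) + u" by (simp_all add: nf)
      ultimately show "y \<in> x0" unfolding eq[symmetric] by blast
    qed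
    have "y \<in> x0 \<longleftrightarrow> y + (u + v) \<in> x0" for y
      unfolding iff by (auto simp: nf)
    then have "u + v \<in> K" by (rule stab_trivial)
    then show False using u(2) by blast
  qed
  have c4: "4 * card K \<le> card x0"
  proof -
    obtain m where m: "card x0 = 2 * card K * m" using d2 by (rule dvdE)
    have "card x0 > 0" using X_self[OF K, of v] by (auto simp: card_gt_0_iff)
    then have "m > 0" using m by (cases m) auto
    moreover have "m \<noteq> 1" using ne2 m by auto
    ultimately have "m \<ge> 2" by simp
    then show ?thesis using m mult_le_mono2[of 2 m "2 * card K"] by simp
  qed
  \<comment> \<open>If \<open>x0\<close> filled the coset \<open>v + Y0\<close>, it would be
    preserved by all of \<open>Y0\<close>.\<close>
  have lt: "card x0 < card Y0"
  proof (rule ccontr)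
    assume "\<not> ?thesis"
    then have "x0 = (\<lambda>y. y + v) ` Y0" using c1 cimg x_sub by (intro card_subset_eq) auto
    then have iff: "y \<in> x0 \<longleftrightarrow> y + v \<in> Y0" for y
      using xY0 image_eqI[of y "\<lambda>y. y + v" "y + v" Y0] by (auto simp: add.assoc)
    have "Y0 \<subseteq> K"
    proof
      fix t assume t: "t \<in> Y0"
      have "y \<in> x0 \<longleftrightarrow> y + t \<in> x0" for y
        unfolding iff using sg_cancel[OF sgY0 t, of "y + v"] by (simp add: nf)
      then show "t \<in> K" by (rule stab_trivial)
    qed
    then have "card Y0 \<le> card K" by (simp add: card_mono)
    then show False using c4 c1 sg_card_pos[OF sgK] by simp
  qed
  have "card K = 1" using c4 lt cY0 cY sg_card_pos[OF sgK] by linarith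
  then have K0: "K = {0}" using sgD(1)[OF sgK] by (metis card_1_singletonE singletonD)
  have cY0': "card Y0 = 8" using sg_card_cases[OF sgY0] lt c4 cY0 cY \<open>card K = 1\<close> by linarith
  have cY': "card Y = 16" using cY0 cY cY0' by simp
  have "card x0 < 8" "4 \<le> card x0" using lt cY0' c4 \<open>card K = 1\<close> by auto
  then have cx: "card x0 = 4"
  proof -
    have "(2::nat) ^ j < 2 ^ 3" "(2::nat) ^ 2 \<le> 2 ^ j" using \<open>card x0 < 8\<close> \<open>4 \<le> card x0\<close> ij by auto
    then have "j < 3" "2 \<le> j"
      using power_less_imp_less_exp[of "2::nat" j 3] power_le_imp_le_exp[of "2::nat" 2 j] by linarith+
    then have "j = 2" by simp
    then show ?thesis using ij by simp
  qed
  have "K \<noteq> UNIV" using KZ ZnU by blast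
  then have Kz: "{0} \<subset> Z K" using Z_grows[OF K] K0 by simp
  then obtain z where z: "z \<in> Z K" "z \<noteq> 0" by blast
  have Zq: "q (u + s) = q u + s" if "s \<in> Z K" "q \<in> Q" for q u s
  proof -
    have "q (u + s) + q u + s = 0" using Z_D[OF that] K0 by blast
    then have "q (u + s) + (q u + s) = 0" by (simp add: nf)
    then show ?thesis using add_eq_0_iff2 by blast
  qed
  have notx: "u + s \<notin> x0" if "u \<in> x0" "s \<in> Z K" "s \<noteq> 0" for u s
    using shift_TZ that K0 by blast
  have zY: "z \<in> Y" "z \<in> E0" using z ZY ZE by auto
  \<comment> \<open>The sets \<open>x0\<close> and \<open>x0 + z\<close> are disjoint with four
    points each, so they fill the eight elements of \<open>Y\<close> outside \<open>E0\<close>. In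
    particular \<open>x0\<close> and \<open>z\<close> generate \<open>Y\<close>.\<close>
  have odd: "u \<in> x0 \<or> u + z \<in> x0" if u: "u \<in> Y" "u \<notin> E0" for u
  proof -
    let ?B = "(\<lambda>u. u + z) ` x0"
    have "x0 \<inter> ?B = {}" using notx z by auto
    moreover have "card ?B = 4" using cx by (subst card_image) (auto intro: inj_onI)
    ultimately have c8: "card (x0 \<union> ?B) = 8" using cx by (simp add: card_Un_disjoint)
    have "x0 \<union> ?B \<subseteq> (\<lambda>y. y + v) ` Y0"
    proof
      fix t assume "t \<in> x0 \<union> ?B"
      then consider "t \<in> x0" | s where "s \<in> x0" "t = s + z" by blast
      then show "t \<in> (\<lambda>y. y + v) ` Y0"
      proof cases
        case 1 then show ?thesis using x_sub by blast
      next
        case 2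
        then have "s + v + z \<in> Y0" using xY0 sgD(2)[OF sgY0] zY unfolding Y0_def by blast
        moreover have "t = (s + v + z) + v" using 2 by (simp add: nf)
        ultimately show ?thesis by blast
      qed
    qed
    then have eq: "x0 \<union> ?B = (\<lambda>y. y + v) ` Y0" using c8 cimg cY0' by (intro card_subset_eq) auto
    have "u + v \<in> Y0" using u vY sgD(2)[OF sgY] E0_index v unfolding Y0_def by blast
    moreover have "u = (u + v) + v" by (simp add: nf)
    ultimately have "u \<in> x0 \<union> ?B" unfolding eq by blast
    then show ?thesis by (auto simp: nf)
  qed
  have xE: "u \<notin> E0" if "u \<in> x0" for u using X_E0 that v by blast
  have even: "u + a \<in> x0 \<or> u + a + z \<in> x0" if u: "u \<in> Y" "u \<in> E0" and a: "a \<in> x0" for u a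
    using odd[of "u + a"] sgD(2)[OF sgY] u a xY xE E0_mix by blast
  \<comment> \<open>Otherwise \<open>x0\<close> would be a coset of a subgroup of order four,
    preserved by the translation by \<open>a + b\<close>.\<close>
  have sidon: "c = a \<or> c = b"
    if m: "a \<in> x0" "b \<in> x0" "c \<in> x0" "d \<in> x0" and s: "a + b = c + d" and ne: "a \<noteq> b" for a b c d
  proof (rule ccontr)
    assume n: "\<not> ?thesis"
    have d: "d = a + b + c" using s by (simp add: nf)
    have dd: "d \<noteq> a" "d \<noteq> b" "d \<noteq> c" using n s ne by (auto simp: add.commute add_eq_0_iff2)
    have "card {a, b, c, d} = 4" using n ne dd by auto
    then have x4: "{a, b, c, d} = x0" using m cx by (intro card_subset_eq) auto
    have "u \<in> x0 \<longleftrightarrow> u + (a + b) \<in> x0" for u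
    proof -
      have st: "u + (a + b) \<in> {a, b, c, d}" if "u \<in> {a, b, c, d}" for u
        using that unfolding d by (auto simp: nf)
      show ?thesis using st[of u] st[of "u + (a + b)"] unfolding x4 by (auto simp: nf)
    qed
    then have "a + b \<in> K" by (rule stab_trivial)
    then show False using ne K0 add_eq_0_iff2 by blast
  qed
  have qx: "q u \<in> x0" if "q \<in> Q" "q 0 = 0" "u \<in> x0" for q u
    using X_step[OF K that(3,1)] that(2) K0 by simp
  have qinj: "q u = q t \<longleftrightarrow> u = t" if "q \<in> Q" for q u t
    using Q_inv(2)[OF that] by metis
  \<comment> \<open>The points \<open>q (a + b) + q a\<close> and \<open>q (a + b) + q b\<close> lie
    in \<open>x0\<close> and have the same sum as \<open>q a\<close> and \<open>q b\<close>; absence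
    of coincidences identifies them.\<close>
  have pair: "q (a + b) = q a + q b" if q: "q \<in> Q" "q 0 = 0" and ab: "a \<in> x0" "b \<in> x0" for q a b
  proof (cases "a = b")
    case True then show ?thesis using q(2) by simp
  next
    case False
    define c where "c = q (a + b) + q a"
    define d where "d = q (a + b) + q b"
    have "(a + b) + a \<in> x0" "(a + b) + b \<in> x0" using ab by (simp_all add: nf)
    then have cd: "c \<in> x0" "d \<in> x0" unfolding c_def d_def using X_pair[OF K q(1)] by blast+
    have "q a + q b = c + d" unfolding c_def d_def by (simp add: nf)
    from sidon[OF qx[OF q ab(1)] qx[OF q ab(2)] cd this] False qinj[OF q(1)]
    consider "c = q a" | "c = q b" by blast
    then show ?thesis
    proof cases
      case 1
      then have "q (a + b) = q 0" unfolding c_def q(2) by simp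
      then have "a + b = 0" using qinj[OF q(1)] by blast
      then show ?thesis using False add_eq_0_iff2 by simp
    next
      case 2
      have "q (a + b) = c + q a" unfolding c_def by (simp add: nf)
      then show ?thesis using 2 by (simp add: add.commute)
    qed
  qed
  have addv: "q (u + a) = q u + q a" if q: "q \<in> Q" "q 0 = 0" and u: "u \<in> Y" and a: "a \<in> x0" for q u a
  proof -
    have red: "q (u + a) = q u + q a" if "q ((u + z) + a) = q (u + z) + q a"
    proof -
      have "q ((u + a) + z) = q (u + z) + q a" using that by (simp add: nf)
      then show ?thesis unfolding Zq[OF z(1) q(1)] by (simp add: nf)
    qed
    show ?thesis
    proof (cases "u \<in> E0")
      case False
      from odd[OF u this] show ?thesis
      proof
        assume "u \<in> x0" then show ?thesis using pair[OF q _ a] by blast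
      next
        assume "u + z \<in> x0" then show ?thesis using pair[OF q _ a] red by blast
      qed
    next
      case True
      from even[OF u True a] show ?thesis
      proof
        assume 1: "u + a \<in> x0"
        have "q ((u + a) + a) = q (u + a) + q a" using pair[OF q 1 a] .
        then have "q u = q (u + a) + q a" by (simp add: nf)
        then show ?thesis by (simp add: nf)
      next
        assume 1: "u + a + z \<in> x0"
        have "q ((u + a + z) + a) = q (u + a + z) + q a" using pair[OF q 1 a] .
        then have "q (u + z) = q ((u + z) + a) + q a" by (simp add: nf)
        then show ?thesis using red by (simp add: nf)
      qed
    qed
  qed
  have fixY: "q u = u" if q: "q \<in> Q" "q 0 = 0" and f: "\<And>a. a \<in> x0 \<Longrightarrow> q a = a" and u: "u \<in> Y" for q u
  proof (cases "u \<in> E0")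
    case False
    from odd[OF u this] show ?thesis
    proof
      assume "u + z \<in> x0" then have "q (u + z) = u + z" by (rule f)
      then show ?thesis unfolding Zq[OF z(1) q(1)] by simp
    qed (rule f)
  next
    case True
    have v0: "v \<in> x0" using X_self[OF K] .
    have qv: "q (u + v) = q u + v" using addv[OF q u v0] f[OF v0] by simp
    from even[OF u True v0] show ?thesis
    proof
      assume "u + v \<in> x0" then have "q (u + v) = u + v" by (rule f)
      then show ?thesis using qv by simp
    next
      assume "u + v + z \<in> x0" then have "q (u + v + z) = u + v + z" by (rule f)
      then show ?thesis unfolding Zq[OF z(1) q(1)] qv by simp
    qed
  qed
  \<comment> \<open>The labels whose element of \<open>E'\<close> is a translation on
    \<open>Y\<close>; the goal is to put \<open>x0\<close> into this subgroup.\<close>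
  define M where "M = {y\<in>Y. \<forall>u\<in>Y. ep y u = u + y}"
  have ep_ep: "ep (ep y y') u = ep y (ep y' u)" for y y' u
    by (metis ep_comm ep_swap)
  have Madd: "y + y' \<in> M" if "y \<in> M" "y' \<in> M" for y y'
  proof -
    have m: "y \<in> Y" "y' \<in> Y" "\<And>u. u \<in> Y \<Longrightarrow> ep y u = u + y" "\<And>u. u \<in> Y \<Longrightarrow> ep y' u = u + y'"
      using that unfolding M_def by auto
    have yy: "ep y y' = y + y'" using m by (simp add: add.commute)
    have "ep (y + y') u = u + (y + y')" if "u \<in> Y" for u
    proof -
      have "ep (y + y') u = ep y (ep y' u)" using ep_ep[of y y' u] yy by simp
      also have "\<dots> = u + y' + y" using m that sgD(2)[OF sgY] by simp
      finally show ?thesis by (simp add: nf)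
    qed
    then show ?thesis unfolding M_def using sgD(2)[OF sgY] m by blast
  qed
  have eM: "e \<in> M"
  proof -
    have "ep e u = u + e" if "u \<in> Y" for u
    proof -
      have "zeta e (0 + u) + zeta e 0 \<in> K" using that unfolding Y_def by blast
      then have "zeta e u = 0" using K0 by simp
      then show ?thesis using ep_zeta[of e u] by simp
    qed
    then show ?thesis unfolding M_def using eY by blast
  qed
  have zM: "z \<in> M"
  proof -
    have "ep z u = u + z" for u
    proof -
      have "ep u (0 + z) = ep u 0 + z" using Zq[OF z(1) ep_mem] .
      then show ?thesis using ep_swap[of z u] by simp
    qed
    then show ?thesis unfolding M_def using zY by blast
  qed
  have v0: "v \<in> x0" using X_self[OF K] .
  \<comment> \<open>If \<open>e\<close> were outside \<open>E0\<close>, a point \<open>p\<close> of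
    \<open>x0\<close> would lie in its coset of \<open>Z K\<close>. The suborbit of a second-centre
    element stays in such a coset, so any other point of \<open>x0\<close> would differ from
    \<open>p\<close> by a central element.\<close>
  have eE: "e \<in> E0"
  proof (rule ccontr)
    assume "e \<notin> E0"
    then obtain p where p: "p \<in> x0" "p + e \<in> Z K"
    proof -
      from odd[OF eY \<open>e \<notin> E0\<close>] consider "e \<in> x0" | "e + z \<in> x0" by blast
      then show thesis
        by (cases; rule that) (auto simp: nf intro: sgD(1)[OF sgZ] z)
    qed
    obtain u where u: "u \<in> x0" "u \<noteq> p"
    proof -
      have "\<not> x0 \<subseteq> {p}" using cx card_mono[of "{p}" x0] by auto
      then show thesis using that by blast
    qed
    have "X K p = x0" using X_eq[OF K p(1)] .
    then have "u + (p + e) \<in> X K (p + (p + e))" using X_add_Z[OF K p(2)] u by blast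
    then have 1: "u + (p + e) \<in> X K e" by simp
    obtain q where q: "q \<in> Q" "q 0 \<in> K" "q e = u + (p + e)" using X_elim[OF 1] .
    have "q (0 + e) + q 0 + e \<in> Z K" using Z_D[OF e(1) q(1)] .
    then have "u + p \<in> Z K" using q K0 by (simp add: nf)
    moreover have "p + (u + p) \<in> x0" using u by (simp add: nf)
    ultimately have "u + p \<in> K" using shift_TZ[OF p(1)] by blast
    then show False using u K0 add_eq_0_iff2 by blast
  qed
  obtain f1 where f1: "f1 \<in> M" "f1 \<notin> Z K" "v + f1 \<in> x0"
  proof -
    from even[OF eY eE v0] consider "e + v \<in> x0" | "e + v + z \<in> x0" by blast
    then show thesis
    proof cases
      case 1 then show ?thesis using that[of e] eM e by (simp add: nf)
    next
      case 2
      have "e + z \<notin> Z K" using e(2) z(1) sg_cancel_right[OF sgZ] by blast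
      then show ?thesis using that[of "e + z"] Madd[OF eM zM] 2 by (simp add: nf)
    qed
  qed
  \<comment> \<open>\<open>x0\<close> splits into the pairs \<open>a1\<close>, \<open>a3\<close> and
    \<open>a2\<close>, \<open>a4\<close>, whose sums \<open>f1\<close> and \<open>f1 + z\<close> are
    already known to be in \<open>M\<close>.\<close>
  define a1 where "a1 = v"
  define a3 where "a3 = v + f1"
  have f10: "f1 \<noteq> 0" using f1(2) sgD(1)[OF sgZ] by blast
  have a13: "a1 \<in> x0" "a3 \<in> x0" "a1 \<noteq> a3" "a1 + a3 = f1"
    using v0 f1 f10 unfolding a1_def a3_def by auto
  have "\<not> x0 \<subseteq> {a1, a3}" using cx card_mono[of "{a1,a3}" x0] a13(3) by auto
  then obtain a2 where a2: "a2 \<in> x0" "a2 \<noteq> a1" "a2 \<noteq> a3" by blast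
  have f1Y: "f1 \<in> Y" "f1 \<in> E0"
  proof -
    show "f1 \<in> Y" using f1(1) unfolding M_def by blast
    show "f1 \<in> E0" using a13(4) E0_index xE a13 by blast
  qed
  have nf2: "f1 + a2 \<notin> x0"
  proof
    assume "f1 + a2 \<in> x0"
    moreover have "a1 + a3 = a2 + (f1 + a2)" using a13(4) by (simp add: nf)
    ultimately show False using sidon[OF a13(1,2) a2(1) _ _ a13(3)] a2 by blast
  qed
  define a4 where "a4 = f1 + a2 + z"
  have a4: "a4 \<in> x0" using even[OF f1Y a2(1)] nf2 unfolding a4_def by blast
  have f2M: "f1 + z \<in> M" using Madd[OF f1(1) zM] .
  have a24: "a2 + a4 = f1 + z" unfolding a4_def by (simp add: nf)
  have f2Z: "f1 + z \<noteq> 0" using f1(2) z(1) unfolding add_eq_0_iff2 by auto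
  have a4ne: "a4 \<noteq> a2" "a4 \<noteq> a1" "a4 \<noteq> a3"
  proof -
    show "a4 \<noteq> a2" using a24 f2Z by auto
    have "a2 + z = a4 + f1" unfolding a4_def by (simp add: nf)
    then have "a4 + f1 \<notin> x0" using notx[OF a2(1) z] by simp
    moreover have "a1 + f1 \<in> x0" "a3 + f1 \<in> x0" using a13(1,2) unfolding a13(4)[symmetric] by (simp_all add: nf)
    ultimately show "a4 \<noteq> a1" "a4 \<noteq> a3" by blast+
  qed
  have "card {a1, a2, a3, a4} = 4" using a13(3) a2 a4ne by auto
  then have x4: "x0 = {a1, a2, a3, a4}" using a13 a2 a4 cx by (intro card_subset_eq[symmetric]) auto
  \<comment> \<open>\<open>ep a\<close> corrected so as to fix 0. It also fixes \<open>a\<close>,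
    because \<open>ep a a = 0\<close>, and permutes \<open>x0\<close>.\<close>
  define \<pi> where "\<pi> a u = ep a u + a" for a u
  have \<pi>Q: "\<pi> a \<in> Q" "\<pi> a 0 = 0" for a unfolding \<pi>_def using Q_add[OF ep_mem] by auto
  have ep\<pi>: "ep a u = \<pi> a u + a" for a u unfolding \<pi>_def by (simp add: nf)
  have \<pi>self: "\<pi> a a = a" for a unfolding \<pi>_def using ep_invol[of a 0] by simp
  have \<pi>partner: "\<pi> a b = b" if ab: "a \<in> x0" "b \<in> x0" "a + b \<in> M" for a b
  proof -
    have "\<pi> a (a + b) = a + b"
      unfolding \<pi>_def ep_swap[of a "a + b"] using ab xY unfolding M_def by (auto simp: nf)
    moreover have "\<pi> a (a + b) = \<pi> a a + \<pi> a b" using pair[OF \<pi>Q ab(1,2)] .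
    ultimately show ?thesis using \<pi>self[of a] by simp
  qed
  have p1: "\<pi> a1 a1 = a1" "\<pi> a1 a3 = a3" using \<pi>self \<pi>partner a13 f1 by auto
  have p2: "\<pi> a2 a2 = a2" "\<pi> a2 a4 = a4" using \<pi>self \<pi>partner[OF a2(1) a4] a24 f2M by auto
  have "\<pi> a1 a2 \<in> x0" "\<pi> a1 a2 \<noteq> \<pi> a1 a1" "\<pi> a1 a2 \<noteq> \<pi> a1 a3"
    using qx[OF \<pi>Q a2(1)] qinj[OF \<pi>Q(1)] a2 by auto
  then have b: "\<pi> a1 a2 = a2 \<or> \<pi> a1 a2 = a4" using p1 x4 by auto
  have "\<pi> a2 a1 \<in> x0" "\<pi> a2 a1 \<noteq> \<pi> a2 a2" "\<pi> a2 a1 \<noteq> \<pi> a2 a4"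
    using qx[OF \<pi>Q a13(1)] qinj[OF \<pi>Q(1)] a2 a4ne by auto
  then have c: "\<pi> a2 a1 = a1 \<or> \<pi> a2 a1 = a3" using p2 x4 by auto
  \<comment> \<open>Both sides equal \<open>ep a1 a2\<close>. Read as a coincidence of sums in
    \<open>x0\<close>, the equation forces \<open>\<pi> a1\<close> to fix \<open>a2\<close> and
    \<open>\<pi> a2\<close> to fix \<open>a1\<close>.\<close>
  have com: "\<pi> a1 a2 + a1 = \<pi> a2 a1 + a2"
    unfolding \<pi>_def ep_swap[of a2 a1] by (simp add: nf)
  have "\<pi> a1 a2 \<noteq> a1" using b a2 a4ne by auto
  from sidon[OF qx[OF \<pi>Q a2(1)] a13(1) qx[OF \<pi>Q a13(1)] a2(1) com this]
  have c': "\<pi> a2 a1 = a1" using b c a2 a4ne by auto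
  have b': "\<pi> a1 a2 = a2" using com unfolding c' by (simp add: add.commute)
  have "\<pi> a1 a4 \<in> x0" "\<pi> a1 a4 \<noteq> \<pi> a1 a1" "\<pi> a1 a4 \<noteq> \<pi> a1 a3" "\<pi> a1 a4 \<noteq> \<pi> a1 a2"
    using qx[OF \<pi>Q a4] qinj[OF \<pi>Q(1)] a4ne by auto
  then have "\<pi> a1 a4 = a4" using p1 b' x4 by auto
  then have fx1: "\<pi> a1 a = a" if "a \<in> x0" for a using that p1 b' x4 by auto
  have "\<pi> a1 u = u" if "u \<in> Y" for u using fixY[OF \<pi>Q fx1 that] by simp
  then have "ep a1 u = u + a1" if "u \<in> Y" for u using that ep\<pi>[of a1 u] by simp
  then have M1: "a1 \<in> M" unfolding M_def using a13 xY by blast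
  have "\<pi> a2 a3 \<in> x0" "\<pi> a2 a3 \<noteq> \<pi> a2 a1" "\<pi> a2 a3 \<noteq> \<pi> a2 a2" "\<pi> a2 a3 \<noteq> \<pi> a2 a4"
    using qx[OF \<pi>Q a13(2)] qinj[OF \<pi>Q(1)] a4ne a2 a13 by auto
  then have "\<pi> a2 a3 = a3" using p2 c' x4 by auto
  then have fx2: "\<pi> a2 a = a" if "a \<in> x0" for a using that p2 c' x4 by auto
  have "\<pi> a2 u = u" if "u \<in> Y" for u using fixY[OF \<pi>Q fx2 that] by simp
  then have "ep a2 u = u + a2" if "u \<in> Y" for u using that ep\<pi>[of a2 u] by simp
  then have M2: "a2 \<in> M" unfolding M_def using a2 xY by blast
  have "a3 = a1 + f1" "a4 = a2 + (f1 + z)" unfolding a1_def a3_def a4_def by (simp_all add: nf)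
  then have "a3 \<in> M" "a4 \<in> M" using Madd M1 M2 f1 f2M by auto
  then have "{a1, a2, a3, a4} \<subseteq> M" using M1 M2 by blast
  then have xM: "x0 \<subseteq> M" unfolding x4[symmetric] .
  have gen: "u \<in> N" if add: "\<And>s t. s \<in> N \<Longrightarrow> t \<in> N \<Longrightarrow> s + t \<in> N" and N: "x0 \<subseteq> N" "z \<in> N" and u: "u \<in> Y" for N u
  proof -
    have oddN: "t \<in> N" if "t \<in> Y" "t \<notin> E0" for t
      using odd[OF that]
    proof
      assume "t + z \<in> x0" then have "(t + z) + z \<in> N" using add N by blast
      then show ?thesis by (simp add: nf)
    qed (use N in blast)
    show ?thesis
    proof (cases "u \<in> E0")
      case True
      then have "u + v \<in> N" using oddN u vY sgD(2)[OF sgY] E0_mix v by blast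
      then have "(u + v) + v \<in> N" using add N v0 by blast
      then show ?thesis by (simp add: nf)
    qed (use oddN u in blast)
  qed
  have YM: "u \<in> M" if "u \<in> Y" for u
    by (rule gen[OF _ xM zM that]) (rule Madd)
  have blkY: "blk Y"
  proof -
    \<comment> \<open>Admissible differences are closed under addition, so the block property of
      \<open>Y\<close> needs to be seen only for \<open>x0\<close> and \<open>z\<close>.\<close>
    define N where "N = {s. \<forall>q\<in>Q. \<forall>t. q (t + s) + q t \<in> Y}"
    have "s + t \<in> N" if s: "s \<in> N" and t: "t \<in> N" for s t
    proof -
      have "q (w + (s + t)) + q w \<in> Y" if q: "q \<in> Q" for q w
      proof -
        have "q ((w + s) + t) + q (w + s) \<in> Y" "q (w + s) + q w \<in> Y" using s t q unfolding N_def by blast+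
        from sg_trans[OF sgY this] show ?thesis by (simp add: nf)
      qed
      then show ?thesis unfolding N_def by blast
    qed
    moreover have "x0 \<subseteq> N"
    proof
      fix s assume "s \<in> x0"
      then have "q (t + s) + q t \<in> x0" if "q \<in> Q" for q t
        using X_pair[OF K that, of "t + s" t v] by (simp add: nf)
      then show "s \<in> N" unfolding N_def using xY by blast
    qed
    moreover have "q (t + z) + q t = z" if "q \<in> Q" for q t
      using Zq[OF z(1) that, of t] add.commute[of "q t" z] by (simp add: add.assoc)
    then have "z \<in> N" unfolding N_def using zY by simp
    ultimately have YN: "u \<in> N" if "u \<in> Y" for u using gen[of N u] that by blast
    show ?thesis unfolding blk_def
    proof (intro conjI sgY ballI allI impI)
      fix q s t assume q: "q \<in> Q" and "s + t \<in> Y"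
      then have "q (t + (s + t)) + q t \<in> Y" using YN unfolding N_def by blast
      then show "q s + q t \<in> Y" by (simp add: nf)
    qed
  qed
  have ixY: "s + t \<in> Y" if "s \<notin> Y" "t \<notin> Y" for s t
    using index2[OF sgY sg_UNIV, of t s] that cY' card_V by simp
  obtain w where w: "w \<notin> Y" using \<open>a \<notin> Y\<close> by blast
  define N where "N = {y\<in>Y. \<exists>c\<in>Y. \<forall>t. t \<notin> Y \<longrightarrow> ep y t = t + c}"
  have YN: "u \<in> N" if "u \<in> Y" for u
  proof (rule gen[OF _ _ _ that])
    fix s t assume s: "s \<in> N" and t: "t \<in> N"
    obtain c d where cd: "c \<in> Y" "d \<in> Y" "\<And>x. x \<notin> Y \<Longrightarrow> ep s x = x + c" "\<And>x. x \<notin> Y \<Longrightarrow> ep t x = x + d"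
      using s t unfolding N_def by blast
    have st: "s \<in> Y" "t \<in> Y" using s t unfolding N_def by auto
    have "ep s t = s + t" using YM[OF st(1)] st unfolding M_def by (auto simp: add.commute)
    then have "ep (s + t) x = x + (d + c)" if "x \<notin> Y" for x
    proof -
      have "x + d \<notin> Y" using that cd(2) sg_cancel_right[OF sgY] by blast
      then show ?thesis using ep_ep[of s t x] \<open>ep s t = s + t\<close> cd that by (simp add: nf)
    qed
    then show "s + t \<in> N" unfolding N_def using sgD(2)[OF sgY] st cd by blast
  next
    show "z \<in> N"
    proof -
      have "ep z t = t + z" for t using Zq[OF z(1) ep_mem, of t 0] ep_swap[of z t] by simp
      then show ?thesis unfolding N_def using zY by blast
    qed
    show "x0 \<subseteq> N"
    proof
      fix a assume a: "a \<in> x0"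
      \<comment> \<open>\<open>ep w\<close> maps the complement of \<open>Y\<close> into
        \<open>Y\<close> and commutes with \<open>ep a\<close>; this carries the behaviour of
        \<open>ep a\<close> over to the complement.\<close>
      have "ep a t = t + \<pi> w a" if t: "t \<notin> Y" for t
      proof -
        have "ep w t + ep w w \<in> Y" using blkD[OF blkY ep_mem, of t w w] ixY[OF t w] by blast
        then have u: "ep w t \<in> Y" using ep_invol[of w 0] by simp
        have "ep a t = ep w (ep a (ep w t))" using ep_comm[of a w "ep w t"] by simp
        also have "ep a (ep w t) = ep w t + a" using u a xM unfolding M_def by blast
        finally have "ep a t + w = \<pi> w (ep w t + a)" unfolding \<pi>_def by simp
        also have "\<dots> = \<pi> w (ep w t) + \<pi> w a" by (rule addv[OF \<pi>Q u a])
        also have "\<pi> w (ep w t) = t + w" unfolding \<pi>_def by simp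
        finally show ?thesis by (simp add: nf)
      qed
      moreover have "\<pi> w a \<in> Y" using qx[OF \<pi>Q a] xY by blast
      ultimately show "a \<in> N" unfolding N_def using a xY by blast
    qed
  qed
  have "AB Y" unfolding AB_def
  proof (intro conjI)
    show "Y \<noteq> E0" using v vY by blast
    show "\<forall>y\<in>Y. (\<forall>x\<in>Y. ep y x = x + y) \<and> (\<exists>c\<in>Y. \<forall>x. x \<notin> Y \<longrightarrow> ep y x = x + c)"
    proof
      fix y assume y: "y \<in> Y"
      have "\<forall>x\<in>Y. ep y x = x + y" using YM[OF y] unfolding M_def by blast
      moreover have "\<exists>c\<in>Y. \<forall>x. x \<notin> Y \<longrightarrow> ep y x = x + c" using YN[OF y] unfolding N_def by blast
      ultimately show "(\<forall>x\<in>Y. ep y x = x + y) \<and> (\<exists>c\<in>Y. \<forall>x. x \<notin> Y \<longrightarrow> ep y x = x + c)" ..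
    qed
  qed (use blkY cY' in auto)
  then show ?thesis by blast
qed

end

lemma sg_periods: "sg {y. \<forall>w. zeta e (w + y) + zeta e w \<in> K}"
  unfolding sg_def
proof (intro conjI ballI)
  show "0 \<in> {y. \<forall>w. zeta e (w + y) + zeta e w \<in> K}" using sgD(1)[OF blk_sg[OF K]] by simp
  fix a b assume a: "a \<in> {y. \<forall>w. zeta e (w + y) + zeta e w \<in> K}"
    and b: "b \<in> {y. \<forall>w. zeta e (w + y) + zeta e w \<in> K}"
  show "a + b \<in> {y. \<forall>w. zeta e (w + y) + zeta e w \<in> K}"
  proof (intro CollectI allI)
    fix w
    have "zeta e ((w + a) + b) + zeta e (w + a) \<in> K" "zeta e (w + a) + zeta e w \<in> K" using a b by blast+
    from sg_trans[OF blk_sg[OF K] this] show "zeta e (w + (a + b)) + zeta e w \<in> K" by (simp add: add.assoc)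
  qed
qed

lemma translation_set_add:
  assumes Y: "sg Y"
    and s: "s \<in> Y" "\<forall>x\<in>Y. ep s x = x + s" "\<exists>c\<in>Y. \<forall>x. x \<notin> Y \<longrightarrow> ep s x = x + c"
    and t: "t \<in> Y" "\<forall>x\<in>Y. ep t x = x + t" "\<exists>c\<in>Y. \<forall>x. x \<notin> Y \<longrightarrow> ep t x = x + c"
  shows "(\<forall>x\<in>Y. ep (s + t) x = x + (s + t)) \<and> (\<exists>c\<in>Y. \<forall>x. x \<notin> Y \<longrightarrow> ep (s + t) x = x + c)"
proof -
  have "ep s t = s + t" using s t by (simp add: add.commute)
  then have c: "ep (s + t) x = ep s (ep t x)" for x by (metis ep_comm ep_swap)
  obtain c d where cd: "c \<in> Y" "d \<in> Y" "\<And>x. x \<notin> Y \<Longrightarrow> ep s x = x + c" "\<And>x. x \<notin> Y \<Longrightarrow> ep t x = x + d"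
    using s t by blast
  have "ep (s + t) x = x + (d + c)" if "x \<notin> Y" for x
  proof -
    have "x + d \<notin> Y" using that cd(2) sg_cancel_right[OF Y] by blast
    then show ?thesis using c cd that by (simp add: add.assoc)
  qed
  moreover have "ep (s + t) x = x + (s + t)" if "x \<in> Y" for x
  proof -
    have "x + t \<in> Y" using that t sgD(2)[OF Y] by blast
    then show ?thesis using c s t that by (simp add: nf)
  qed
  moreover have "d + c \<in> Y" using cd sgD(2)[OF Y] by blast
  ultimately show ?thesis by blast
qed

text \<open>Every suborbit off \<open>E0\<close> is preserved by some central translation outside
  \<open>K\<close>, but no such translation preserves all of them. A proper second centre
  contradicts this. If the second centre is everything, differences of \<open>zeta\<close> are
  central and symmetric in the two labels, so they preserve two suborbits at once; either this
  yields a translation preserving all, or the differences vanish and \<open>Y\<close>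
  appears.\<close>

lemma case_two:
  assumes big: "\<And>v. v \<notin> E0 \<Longrightarrow> \<exists>z\<in>TZ K v. z \<notin> K"
    and fail: "\<And>z. z \<in> Z K \<Longrightarrow> z \<notin> K \<Longrightarrow> \<exists>v. v \<notin> E0 \<and> v + z \<notin> X K v"
  shows "\<exists>Y. AB Y"
proof -
  note sgK = blk_sg[OF K] and ZB = Z_blk(1)[OF K] and sgZ = blk_sg[OF Z_blk(1)[OF K]]
  note B2 = Z_blk[OF ZB]
  have TZZ: "TZ K v \<subseteq> Z K" for v unfolding TZ_def by blast
  have "K \<noteq> Z K"
  proof
    assume "K = Z K"
    moreover obtain v where "v \<notin> E0" using E0_proper by blast
    ultimately show False using big[of v] TZZ by blast
  qed
  then have KZ': "K \<subset> Z K" using KZ by blast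
  \<comment> \<open>With a single coset of central elements outside \<open>K\<close>, the
    translation given by \<open>big\<close> would be the one refuted by \<open>fail\<close>.\<close>
  have ne2: "card (Z K) \<noteq> 2 * card K"
  proof
    assume c: "card (Z K) = 2 * card K"
    obtain z where z: "z \<in> Z K" "z \<notin> K" using KZ' by blast
    obtain v where v: "v \<notin> E0" "v + z \<notin> X K v" using fail[OF z] by blast
    obtain z' where z': "z' \<in> TZ K v" "z' \<notin> K" using big[OF v(1)] by blast
    then have z'2: "z' \<in> Z K" "v + z' \<in> X K v" unfolding TZ_def by auto
    have "z + z' \<in> K" using index2[OF sgK sgZ KZ _ z'2(1) z'(2) z] c by simp
    from X_sat[OF K z'2(2) this] have "v + z \<in> X K v" by (simp add: nf)
    then show False using v by blast
  qed
  have c4: "4 * card K \<le> card (Z K)"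
  proof -
    obtain m where m: "card (Z K) = 2 * card K * m" using sg_psubset_card(2)[OF sgK sgZ KZ'] by (rule dvdE)
    have "m \<noteq> 0" using m sg_card_pos[OF sgZ] by auto
    moreover have "m \<noteq> 1" using ne2 m by auto
    ultimately have "m \<ge> 2" by simp
    then show ?thesis using m mult_le_mono2[of 2 m "2 * card K"] by simp
  qed
  have c8: "card (Z K) \<le> 8" using card_Z_small[OF K ZnU] .
  \<comment> \<open>The group of central translations preserving a suborbit depends only on the
    coset of \<open>Z K\<close>.\<close>
  have shiftX: "v + z \<in> X K v" if "v + c \<in> Z K" "c + z \<in> X K c" for v c z
  proof -
    have "(c + z) + (v + c) \<in> X K (c + (v + c))" using X_add_Z[OF K that] .
    then show ?thesis by (simp add: nf)
  qed
  show ?thesis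
  proof (cases "Z (Z K) = UNIV")
    case False
    let ?Z2 = "Z (Z K)"
    note sgZ2 = blk_sg[OF B2(1)]
    have "card ?Z2 \<le> 8" using card_Z_small[OF ZB False] .
    have ZZ2: "Z K \<subset> ?Z2" using Z_grows[OF ZB ZnU] .
    then have cc: "2 * card (Z K) \<le> card ?Z2" using sg_psubset_card(1)[OF sgZ sgZ2] by blast
    then have "card K = 1" using \<open>card ?Z2 \<le> 8\<close> c4 sg_card_pos[OF sgK] by linarith
    then have K0: "K = {0}" using sgD(1)[OF sgK] by (metis card_1_singletonE singletonD)
    have cZ: "card (Z K) = 4" "card ?Z2 = 8" using \<open>card ?Z2 \<le> 8\<close> c4 cc \<open>card K = 1\<close> by linarith+
    have Z3: "Z ?Z2 = UNIV"
    proof (rule ccontr)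
      assume n: "Z ?Z2 \<noteq> UNIV"
      have "?Z2 \<subset> Z ?Z2" using Z_grows[OF B2(1) False] .
      then have "2 * card ?Z2 \<le> card (Z ?Z2)" using sg_psubset_card(1)[OF sgZ2 blk_sg[OF Z_blk(1)[OF B2(1)]]] by blast
      then show False using card_Z_small[OF B2(1) n] cZ by linarith
    qed
    have idx: "s + t \<in> Z K" if "s \<in> ?Z2" "s \<notin> Z K" "t \<in> ?Z2" "t \<notin> Z K" for s t
      using index2[OF sgZ sgZ2 B2(2) _ that(3,4) that(1,2)] cZ by simp
    obtain s where s: "s \<in> ?Z2" "s \<notin> Z K" using ZZ2 by blast
    \<comment> \<open>A second-centre element \<open>s\<close> that is not central yields a central
      \<open>z\<close> outside \<open>K\<close> preserving its suborbit. The rest of this case shows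
      that \<open>z\<close> preserves every suborbit off \<open>E0\<close>.\<close>
    obtain u where u: "u \<in> X K s" "u + s \<notin> K" using s(2) Z_iff_X[OF K] by blast
    define z where "z = u + s"
    have z: "z \<in> Z K" "z \<notin> K" "s + z \<in> X K s"
    proof -
      obtain q where q: "q \<in> Q" "q 0 \<in> K" "q s = u" using X_elim[OF u(1)] .
      have "q (0 + s) + q 0 + s \<in> Z K" using Z_D[OF s(1) q(1)] .
      then show "z \<in> Z K" using q K0 unfolding z_def by (simp add: nf)
      show "z \<notin> K" "s + z \<in> X K s" using u unfolding z_def by (simp_all add: nf)
    qed
    obtain v where v: "v \<notin> E0" "v + z \<notin> X K v" using fail[OF z(1,2)] by blast
    have vZ: "v \<notin> Z K" using v ZE by blast
    show ?thesis
    proof (cases "v \<in> ?Z2")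
      case True
      then have "v + s \<in> Z K" using idx vZ s by blast
      then show ?thesis using shiftX z(3) v(2) by blast
    next
      case False
      then obtain q x where q: "q \<in> Q" "q (x + v) + q x + v \<notin> Z K" unfolding Z_def[of "Z K"] by blast
      define c where "c = q (x + v) + q x"
      have cX: "c \<in> X K v" unfolding c_def
        using X_pair[OF K q(1), of "x + v" x v] X_self[OF K] by (simp add: nf)
      have inZ2: "t + v \<in> ?Z2" if "t \<in> X K v" for t
      proof -
        obtain r where r: "r \<in> Q" "r 0 \<in> K" "r v = t" using X_elim[OF \<open>t \<in> X K v\<close>] .
        have "r (0 + v) + r 0 + v \<in> ?Z2" using Z_D[of v ?Z2 r 0] Z3 r(1) by blast
        then show ?thesis using r K0 by simp
      qed
      define s1 where "s1 = c + v"
      have s1: "s1 \<in> ?Z2" "s1 \<notin> Z K" using inZ2[OF cX] q(2) unfolding s1_def c_def by auto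
      have "s1 + s \<in> Z K" using idx s1 s by blast
      from shiftX[OF this z(3)] have s1z: "s1 + z \<in> X K s1" .
      obtain r where r: "r \<in> Q" "r 0 \<in> K" "r s1 = s1 + z" using X_elim[OF s1z] .
      have r0: "r 0 = 0" using r(2) K0 by simp
      have "c + s1 \<in> X K v" unfolding s1_def using X_self[OF K, of v] by (simp add: nf)
      from X_pair[OF K r(1) this] have x2: "r c + (s1 + z) \<in> X K v" using r(3) by simp
      have "c + 0 \<in> X K v" using cX by simp
      from X_pair[OF K r(1) this] have x1: "r c \<in> X K v" using r0 by simp
      have vx: "v \<in> X K v" using X_self[OF K] .
      have cvs: "v + s1 = c" unfolding s1_def by (simp add: nf)
      have both: "c1 \<in> TZ K v \<and> c1 + z \<in> TZ K v \<Longrightarrow> z \<in> TZ K v" for c1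
        using sg_cancel[OF TZ_sg(1)[OF K]] by blast
      \<comment> \<open>Both \<open>r c\<close> and \<open>r c + (s1 + z)\<close> lie in the
        suborbit. Since \<open>c\<close> and \<open>v\<close> differ by \<open>s1\<close>, one of
        the two points is compared with \<open>v\<close> and the other with \<open>c\<close>; which
        one depends on the coset of \<open>r c\<close> modulo \<open>Z K\<close>.\<close>
      have "\<exists>c1. c1 \<in> TZ K v \<and> c1 + z \<in> TZ K v"
      proof (cases "r c + v \<in> Z K")
        case True
        define c1 where "c1 = r c + v"
        have c1: "c1 \<in> Z K" "c1 + z \<in> Z K" using True z(1) sgD(2)[OF sgZ] unfolding c1_def by auto
        have "v + c1 \<in> X K v" unfolding c1_def using x1 by (simp add: nf)
        moreover have "c + (c1 + z) = r c + (s1 + z)" unfolding c1_def s1_def by (simp add: nf)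
        ultimately show ?thesis using TZ_eq[OF K c1(1) vx] TZ_eq[OF K c1(2) cX] x2 by metis
      next
        case False
        define c1 where "c1 = (r c + v) + s1"
        have "c1 \<in> Z K" unfolding c1_def using idx[OF inZ2[OF x1] False s1] .
        then have c1: "c1 \<in> Z K" "c1 + z \<in> Z K" using z(1) sgD(2)[OF sgZ] by auto
        have "c + c1 = r c" unfolding c1_def s1_def by (simp add: nf)
        moreover have "v + (c1 + z) = r c + (s1 + z)" unfolding c1_def by (simp add: nf)
        ultimately show ?thesis using TZ_eq[OF K c1(1) cX] TZ_eq[OF K c1(2) vx] x1 x2 by metis
      qed
      then have "z \<in> TZ K v" using both by blast
      then show ?thesis using v(2) unfolding TZ_def by blast
    qed
  next
    case Z2: True
    have all: "v \<in> Z (Z K)" for v using Z2 by blast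
    have zZ: "zeta a x \<in> Z K" for a x using zeta_mem[OF all] .
    \<comment> \<open>The commutation of \<open>ep a\<close> and \<open>ep b\<close>, read modulo
      \<open>K\<close>: the mixed second difference is symmetric in the two labels.\<close>
    have com: "(zeta a (x + b) + zeta a x) + (zeta b (x + a) + zeta b x) \<in> K" for a b x
    proof -
      have 1: "ep a ((x + b) + zeta b x) + ep a (x + b) + zeta b x \<in> K" using Z_D[OF zZ ep_mem] .
      have 2: "ep b ((x + a) + zeta a x) + ep b (x + a) + zeta a x \<in> K" using Z_D[OF zZ ep_mem] .
      have "ep a ((x + b) + zeta b x) = ep b ((x + a) + zeta a x)"
        using ep_comm[of a b x] unfolding ep_zeta[of b x] ep_zeta[of a x] .
      then have "(ep a (x + b) + zeta b x) + (ep b (x + a) + zeta a x) \<in> K"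
        using sgD(2)[OF sgK 1 2] by (simp add: nf)
      then show ?thesis unfolding ep_zeta[of a "x + b"] ep_zeta[of b "x + a"] by (simp add: nf)
    qed
    have dTb: "zeta a (x + b) + zeta a x \<in> TZ K b" for a b x
      using zeta_X[OF K, of b a x] sgD(2)[OF sgZ zZ zZ] unfolding TZ_def by blast
    \<comment> \<open>\<open>dTb\<close> gives this for the label by which the argument is shifted;
      symmetry transfers it to the other label.\<close>
    have dTa: "zeta a (x + b) + zeta a x \<in> TZ K a" for a b x
    proof -
      have "(zeta a (x + b) + zeta a x) + (zeta b (x + a) + zeta b x) \<in> TZ K a"
        using com TZ_sg(2)[OF K] by blast
      then show ?thesis using sg_cancel_right[OF TZ_sg(1)[OF K] dTb] by blast
    qed
    show ?thesis
    proof (cases "card (Z K) = 8")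
      case True
      obtain v1 where v1: "v1 \<notin> E0" using E0_proper by blast
      have "\<not> E0 \<subseteq> Z K" using True card_E0 card_mono[of "Z K" E0] by auto
      then obtain t where t: "t \<in> E0" "t \<notin> Z K" by blast
      define v2 where "v2 = t + v1"
      have v2: "v2 \<notin> E0" unfolding v2_def using E0_mix t v1 by blast
      have v12: "v1 + v2 = t" unfolding v2_def by (simp add: nf)
      define P where "P = {y. \<forall>w. zeta v1 (w + y) + zeta v1 w \<in> K}"
      have sgP: "sg P" unfolding P_def by (rule sg_periods)
      have "v2 \<notin> P"
      proof
        assume v2P: "v2 \<in> P"
        have v1P: "v1 \<in> P" unfolding P_def using zeta_self[OF K all] by blast
        have ZP: "Z K \<subseteq> P" unfolding P_def using zeta_Z by blast
        have "v1 \<notin> Z K" using v1 ZE by blast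
        have "v2 \<notin> Z K \<union> (\<lambda>k. k + v1) ` Z K"
        proof
          assume "v2 \<in> Z K \<union> (\<lambda>k. k + v1) ` Z K"
          then have "v2 + v1 \<in> Z K" using v2 ZE by (auto simp: nf)
          then show False using v12 t by (simp add: nf)
        qed
        moreover have sub: "Z K \<union> (\<lambda>k. k + v1) ` Z K \<subseteq> P" using ZP v1P sgD(2)[OF sgP] by auto
        ultimately have "Z K \<union> (\<lambda>k. k + v1) ` Z K \<subset> P" using v2P by blast
        from sg_psubset_card(1)[OF sg_double(1)[OF sgZ \<open>v1 \<notin> Z K\<close>] sgP this]
        have "32 \<le> card P" using sg_double(2)[OF sgZ \<open>v1 \<notin> Z K\<close>] True by simp
        then have "P = UNIV" using card_V by (intro card_seteq) auto
        then have "zeta v1 (0 + x) + zeta v1 0 \<in> K" for x unfolding P_def by blast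
        then have "zeta v1 x \<in> K" for x by simp
        then show False using zeta_nonconst[OF K \<open>v1 \<notin> Z K\<close>] by blast
      qed
      then obtain x where x: "zeta v1 (x + v2) + zeta v1 x \<notin> K" unfolding P_def by blast
      \<comment> \<open>\<open>b\<close> preserves the suborbits of \<open>v1\<close> and
        \<open>v2\<close>. As \<open>Z K\<close> has index 2 in \<open>E0\<close>, every
        \<open>v\<close> off \<open>E0\<close> is congruent to one of them, so \<open>b\<close>
        preserves all suborbits off \<open>E0\<close>, against \<open>fail\<close>.\<close>
      define b where "b = zeta v1 (x + v2) + zeta v1 x"
      have b: "b \<in> TZ K v1" "b \<in> TZ K v2" "b \<notin> K" unfolding b_def using dTa dTb x by auto
      obtain v where v: "v \<notin> E0" "v + b \<notin> X K v" using fail[of b] b TZZ by blast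
      have "v + v1 \<in> Z K \<or> v + v2 \<in> Z K"
      proof (rule disjCI)
        assume n: "v + v2 \<notin> Z K"
        show "v + v1 \<in> Z K"
        proof (rule ccontr)
          assume "v + v1 \<notin> Z K"
          then have "(v + v1) + t \<in> Z K"
            using index2[OF sgZ E0_sg ZE _ t] E0_index[OF v(1) v1] True card_E0 by simp
          then show False using n unfolding v12[symmetric] by (simp add: nf)
        qed
      qed
      then show ?thesis using shiftX[of v v1 b] shiftX[of v v2 b] b v(2) unfolding TZ_def by blast
    next
      case False
      have "card (Z K) \<le> 4" using sg_card_cases[OF sgZ] c8 False by linarith
      then have "card K = 1" using c4 sg_card_pos[OF sgK] by linarith
      then have K0: "K = {0}" using sgD(1)[OF sgK] by (metis card_1_singletonE singletonD)
      have cZ: "card (Z K) = 4" using c4 \<open>card (Z K) \<le> 4\<close> \<open>card K = 1\<close> by simp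
      have small: "\<exists>t. t \<noteq> 0 \<and> TZ K v = {0, t}" if v: "v \<notin> E0" and z: "z \<in> Z K" "z \<notin> TZ K v" for v z
      proof -
        have "TZ K v \<subset> Z K" using TZZ z by blast
        then have "card (TZ K v) \<le> 2" using sg_psubset_card(1)[OF TZ_sg(1)[OF K] sgZ] cZ by fastforce
        obtain t where t: "t \<in> TZ K v" "t \<noteq> 0" using big[OF v] K0 by blast
        have "{0, t} \<subseteq> TZ K v" using t sgD(1)[OF TZ_sg(1)[OF K]] by blast
        moreover have "card {0, t} = 2" using t by simp
        ultimately have "{0, t} = TZ K v" using \<open>card (TZ K v) \<le> 2\<close> by (intro card_seteq) auto
        then show ?thesis using t by blast
      qed
      obtain z1 where z1: "z1 \<in> Z K" "z1 \<notin> K" using KZ' by blast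
      obtain v1 where v1: "v1 \<notin> E0" "v1 + z1 \<notin> X K v1" using fail[OF z1] by blast
      then have "z1 \<notin> TZ K v1" unfolding TZ_def by blast
      from small[OF v1(1) z1(1) this] obtain t1 where t1: "t1 \<noteq> 0" "TZ K v1 = {0, t1}" by blast
      have t1Z: "t1 \<in> Z K" "t1 \<notin> K" using t1 TZZ[of v1] K0 by auto
      obtain v2 where v2: "v2 \<notin> E0" "v2 + t1 \<notin> X K v2" using fail[OF t1Z] by blast
      then have t1v2: "t1 \<notin> TZ K v2" unfolding TZ_def by blast
      \<comment> \<open>The mixed differences of \<open>v1\<close> and \<open>v2\<close> lie in this
        trivial intersection, so both labels are periods of both deviations; this is why
        \<open>Y\<close> is spanned by \<open>Z K\<close>, \<open>v1\<close> and
        \<open>v2\<close>.\<close>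
      have int0: "TZ K v1 \<inter> TZ K v2 \<subseteq> K" using t1(2) t1v2 K0 by auto
      have v12: "v1 + v2 \<notin> Z K"
      proof
        assume "v1 + v2 \<in> Z K"
        then have "v2 + v1 \<in> Z K" by (simp add: add.commute)
        moreover have "v1 + t1 \<in> X K v1" using t1(2) unfolding TZ_def by blast
        ultimately show False using shiftX v2(2) by blast
      qed
      have vZ: "v1 \<notin> Z K" "v2 \<notin> Z K" using v1 v2 ZE by auto
      define Y1 where "Y1 = Z K \<union> (\<lambda>k. k + v1) ` Z K"
      define Y where "Y = Y1 \<union> (\<lambda>k. k + v2) ` Y1"
      have sgY1: "sg Y1" "card Y1 = 8" using sg_double[OF sgZ vZ(1)] cZ unfolding Y1_def by auto
      have "v2 \<notin> Y1"
      proof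
        assume "v2 \<in> Y1"
        then have "v1 + v2 \<in> Z K" using vZ unfolding Y1_def by (auto simp: nf)
        then show False using v12 by blast
      qed
      then have sgY: "sg Y" "card Y = 16" using sg_double[OF sgY1(1)] sgY1(2) unfolding Y_def by auto
      have ZY: "Z K \<subseteq> Y" and v1Y: "v1 \<in> Y" and v2Y: "v2 \<in> Y"
      proof -
        show "Z K \<subseteq> Y" unfolding Y_def Y1_def by blast
        have "v1 = 0 + v1" "v2 = 0 + v2" by auto
        then show "v1 \<in> Y" "v2 \<in> Y" unfolding Y_def Y1_def using sgD(1)[OF sgZ] by blast+
      qed
      have blkY: "blk Y" unfolding blk_def
      proof (intro conjI sgY ballI allI impI)
        fix q x y assume q: "q \<in> Q" and xy: "x + y \<in> Y"
        have "q (y + (x + y)) + q y + (x + y) \<in> Z K" using Z_D[OF all q] .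
        then have "(q x + q y) + (x + y) \<in> Y" using ZY by (auto simp: nf)
        then show "q x + q y \<in> Y" using sg_cancel_right[OF sgY(1) xy] by blast
      qed
      have ixY: "s + t \<in> Y" if "s \<notin> Y" "t \<notin> Y" for s t
        using index2[OF sgY(1) sg_UNIV, of t s] that sgY(2) card_V by simp
      define N where "N = {y\<in>Y. (\<forall>x\<in>Y. ep y x = x + y) \<and> (\<exists>c\<in>Y. \<forall>x. x \<notin> Y \<longrightarrow> ep y x = x + c)}"
      have Nadd: "s + t \<in> N" if "s \<in> N" "t \<in> N" for s t
        using translation_set_add[OF sgY(1), of s t] that sgD(2)[OF sgY(1)] unfolding N_def by blast
      have ZN: "z \<in> N" if "z \<in> Z K" for z
      proof -
        have "ep z x = x + z" for x
        proof -
          have "ep z x + x + z = 0" using Z_ep[OF that] K0 by blast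
          then have "ep z x + (x + z) = 0" by (simp add: add.assoc)
          then show ?thesis using add_eq_0_iff2 by blast
        qed
        then show ?thesis unfolding N_def using that ZY by blast
      qed
      have vN: "v \<in> N" if vY: "v \<in> Y" and d1: "\<And>x. zeta v (x + v1) + zeta v x \<in> K" and d2: "\<And>x. zeta v (x + v2) + zeta v x \<in> K" for v
      proof -
        define P where "P = {y. \<forall>w. zeta v (w + y) + zeta v w \<in> K}"
        have sgP: "sg P" unfolding P_def by (rule sg_periods)
        have mem: "Z K \<subseteq> P" "v1 \<in> P" "v2 \<in> P" unfolding P_def using zeta_Z d1 d2 by blast+
        have "Y1 \<subseteq> P" unfolding Y1_def using mem sgD(2)[OF sgP] by auto
        then have "Y \<subseteq> P" unfolding Y_def using mem sgD(2)[OF sgP] by auto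
        then have per: "zeta v (w + y) = zeta v w" if "y \<in> Y" for w y
          using that K0 add_eq_0_iff2[of "zeta v (w + y)" "zeta v w"] unfolding P_def by blast
        have on: "ep v x = x + v" if "x \<in> Y" for x using per[OF that, of 0] ep_zeta[of v x] by simp
        have "Y \<noteq> UNIV" using sgY(2) card_V by auto
        then obtain w where w: "w \<notin> Y" by blast
        have off: "ep v x = x + (v + zeta v w)" if "x \<notin> Y" for x
          using per[OF ixY[OF that w], of w] ep_zeta[of v x] by (simp add: nf)
        have "v + zeta v w \<in> Y" using vY zZ ZY sgD(2)[OF sgY(1)] by blast
        then show ?thesis unfolding N_def using on off vY by blast
      qed
      have "v1 \<in> N"
      proof (rule vN[OF v1Y])
        fix x show "zeta v1 (x + v1) + zeta v1 x \<in> K" using zeta_self[OF K all] .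
        show "zeta v1 (x + v2) + zeta v1 x \<in> K" using dTa[of v1 x v2] dTb[of v1 x v2] int0 by blast
      qed
      moreover have "v2 \<in> N"
      proof (rule vN[OF v2Y])
        fix x show "zeta v2 (x + v2) + zeta v2 x \<in> K" using zeta_self[OF K all] .
        show "zeta v2 (x + v1) + zeta v2 x \<in> K" using dTa[of v2 x v1] dTb[of v2 x v1] int0 by blast
      qed
      ultimately have "Y1 \<subseteq> N" "\<forall>y\<in>Y1. y + v2 \<in> N" unfolding Y1_def using ZN Nadd by auto
      then have YN: "Y \<subseteq> N" unfolding Y_def by auto
      have "AB Y" unfolding AB_def
      proof (intro conjI)
        show "Y \<noteq> E0" using v1 v1Y by blast
        show "\<forall>y\<in>Y. (\<forall>x\<in>Y. ep y x = x + y) \<and> (\<exists>c\<in>Y. \<forall>x. x \<notin> Y \<longrightarrow> ep y x = x + c)"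
          using YN unfolding N_def by blast
      qed (use blkY sgY in auto)
      then show ?thesis by blast
    qed
  qed
qed

end

lemma blk_double:
  assumes K: "blk K" and z: "z \<in> Z K" "z \<notin> K" shows "blk (K \<union> (\<lambda>k. k + z) ` K)"
  unfolding blk_def
proof (intro conjI ballI allI impI)
  note sgK = blk_sg[OF K]
  show "sg (K \<union> (\<lambda>k. k + z) ` K)" using sg_double(1)[OF sgK z(2)] .
  fix q x y assume q: "q \<in> Q" and xy: "x + y \<in> K \<union> (\<lambda>k. k + z) ` K"
  show "q x + q y \<in> K \<union> (\<lambda>k. k + z) ` K"
  proof (cases "x + y \<in> K")
    case True then show ?thesis using blkD[OF K q] by blast
  next
    case False
    then obtain k where k: "k \<in> K" "x + y = k + z" using xy by blast
    have x: "x = (y + k) + z" using k(2) by (metis add.assoc add.commute char2_left)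
    have 1: "q x + q (y + k) + z \<in> K" using Z_D[OF z(1) q, of "y + k"] unfolding x .
    have 2: "q (y + k) + q y \<in> K" using blkD[OF K q, of "y + k" y] k(1) by (simp add: nf)
    have "(q x + q y) + z \<in> K" using sgD(2)[OF sgK 1 2] by (simp add: nf)
    moreover have "q x + q y = ((q x + q y) + z) + z" by (simp add: nf)
    ultimately show ?thesis by blast
  qed
qed

text \<open>Induction upwards in \<open>K\<close>: a central translation that preserves all
  suborbits off \<open>E0\<close> is adjoined to \<open>K\<close>, and \<open>star_lift\<close>
  brings the result back. Where there is none, \<open>case_one\<close> or \<open>case_two\<close>
  applies.\<close>

lemma star_or_AB: "blk K \<Longrightarrow> K \<subseteq> E0 \<Longrightarrow> star K \<or> (\<exists>Y. AB Y)"
proof (induction "32 - card K" arbitrary: K rule: less_induct)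
  case less
  note K = less.prems(1)
  show ?case
  proof (cases "Z K \<subseteq> E0")
    case False
    then show ?thesis using star_Z[OF K] by blast
  next
    case ZE: True
    show ?thesis
    proof (cases "\<exists>z\<in>Z K. z \<notin> K \<and> (\<forall>v. v \<notin> E0 \<longrightarrow> v + z \<in> X K v)")
      case True
      then obtain z where z: "z \<in> Z K" "z \<notin> K" "\<And>v. v \<notin> E0 \<Longrightarrow> v + z \<in> X K v" by blast
      let ?L = "K \<union> (\<lambda>k. k + z) ` K"
      have L: "blk ?L" using blk_double[OF K z(1,2)] .
      have sub: "?L \<subseteq> E0" using less.prems(2) z(1) ZE sgD(2)[OF E0_sg] by auto
      have "card ?L = 2 * card K" using sg_double(2)[OF blk_sg[OF K] z(2)] .
      moreover have "card K \<le> 16" using card_mono[OF _ less.prems(2)] card_E0 by simp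
      moreover have "card K > 0" using sg_card_pos[OF blk_sg[OF K]] .
      ultimately have "32 - card ?L < 32 - card K" by simp
      from less.hyps[OF this L sub] show ?thesis using star_lift[OF K z(1,3)] by blast
    next
      case nz: False
      show ?thesis
      proof (cases "\<exists>v. v \<notin> E0 \<and> TZ K v \<subseteq> K")
        case True
        then show ?thesis using case_one[OF K ZE] by blast
      next
        case False
        then show ?thesis using case_two[OF K ZE] nz by blast
      qed
    qed
  qed
qed

theorem dichotomy: "star {0} \<or> (\<exists>Y. AB Y)"
  using star_or_AB[OF blk_zero] sgD(1)[OF E0_sg] by simp

end

section \<open>Sylow conjugation and cyclic counting\<close>

text \<open>Words in the generators without inverses; this is the generated group when the
  generators are closed under inverse, as \<open>mgen_group\<close> assumes.\<close>

inductive_set mgen :: "('a \<Rightarrow> 'a) set \<Rightarrow> ('a \<Rightarrow> 'a) set" for B where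
  mgen_id: "id \<in> mgen B"
| mgen_step: "f \<in> B \<Longrightarrow> g \<in> mgen B \<Longrightarrow> f \<circ> g \<in> mgen B"

lemma mgen_base: assumes "f \<in> B" shows "f \<in> mgen B"
  using mgen_step[OF assms mgen_id] by simp

lemma mgen_comp: assumes "f \<in> mgen B" "g \<in> mgen B" shows "f \<circ> g \<in> mgen B"
  using assms(1)
proof induction
  case mgen_id then show ?case using assms(2) by simp
next
  case (mgen_step f h)
  show ?case unfolding comp_assoc using mgen.mgen_step[OF mgen_step(1,3)] .
qed

lemma mgen_group:
  assumes perm: "\<And>f. f \<in> B \<Longrightarrow> f permutes S" and inv: "\<And>f. f \<in> B \<Longrightarrow> finv f \<in> B"
  shows "perm_group S (mgen B)"
proof (rule perm_groupI)
  show p: "f permutes S" if "f \<in> mgen B" for f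
    using that by induction (blast intro: permutes_compose perm permutes_id)+
  show "finv f \<in> mgen B" if "f \<in> mgen B" for f
    using that
  proof induction
    case mgen_id show ?case unfolding inv_id using mgen.mgen_id .
  next
    case (mgen_step f g)
    have "finv (f \<circ> g) = finv g \<circ> finv f"
      using permutes_inv_o[OF perm[OF mgen_step(1)]] permutes_bij[OF perm[OF mgen_step(1)]] permutes_bij[OF p[OF mgen_step(2)]]
      by (intro o_inv_distrib)
    then show ?case using mgen_comp[OF mgen_step(3) mgen_base[OF inv[OF mgen_step(1)]]] by (simp only:)
  qed
qed (use mgen_comp mgen.mgen_id in auto)

lemma mgen_subset:
  assumes "B \<subseteq> G" "perm_group S G" shows "mgen B \<subseteq> G"
proof
  fix f assume "f \<in> mgen B"
  then show "f \<in> G" using assms perm_groupD[OF assms(2)] by induction auto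
qed

text \<open>Orbit and stabiliser for a map \<open>\<phi>\<close> that obeys the laws of an action
  only at \<open>c\<close> and on its orbit. This permits \<open>\<phi>\<close> to be an action on
  representatives of blocks.\<close>

lemma action_orbit_card:
  assumes G: "perm_group S G" and fin: "finite S"
    and act_id: "\<phi> id c = c" and act_comp: "\<And>f g. f \<in> G \<Longrightarrow> g \<in> G \<Longrightarrow> \<phi> (f \<circ> g) c = \<phi> f (\<phi> g c)"
    and act_inj: "\<And>f d e. f \<in> G \<Longrightarrow> d \<in> (\<lambda>g. \<phi> g c) ` G \<Longrightarrow> e \<in> (\<lambda>g. \<phi> g c) ` G \<Longrightarrow> \<phi> f d = \<phi> f e \<Longrightarrow> d = e"
  shows "card G = card ((\<lambda>g. \<phi> g c) ` G) * card {g\<in>G. \<phi> g c = c}"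
proof -
  have fG: "finite G" using perm_group_finite G fin by blast
  let ?O = "(\<lambda>g. \<phi> g c) ` G"
  have cO: "c \<in> ?O" using act_id perm_groupD(2)[OF G] by (metis image_eqI)
  have "card G = (\<Sum>y\<in>?O. card {f\<in>G. \<phi> f c = y})"
  proof -
    have "G = (\<Union>y\<in>?O. {f\<in>G. \<phi> f c = y})" by auto
    moreover have "card (\<Union>y\<in>?O. {f\<in>G. \<phi> f c = y}) = (\<Sum>y\<in>?O. card {f\<in>G. \<phi> f c = y})"
      by (rule card_UN_disjoint) (use fG in auto)
    ultimately show ?thesis by simp
  qed
  also have "\<dots> = (\<Sum>y\<in>?O. card {f\<in>G. \<phi> f c = c})"
  proof (rule sum.cong[OF refl])
    fix y assume "y \<in> ?O"
    then obtain g where g: "g \<in> G" "\<phi> g c = y" by auto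
    have cc: "finv g \<circ> (g \<circ> f) = f" "g \<circ> (finv g \<circ> f) = f" for f
      using perm_group_inv_apply[OF G g(1)] by (simp_all add: comp_def)
    have "bij_betw (\<lambda>f. g \<circ> f) {f\<in>G. \<phi> f c = c} {f\<in>G. \<phi> f c = y}"
    proof (rule bij_betwI[where g="\<lambda>f. finv g \<circ> f"])
      show "(\<lambda>f. g \<circ> f) \<in> {f \<in> G. \<phi> f c = c} \<rightarrow> {f \<in> G. \<phi> f c = y}"
        using g perm_groupD(3)[OF G g(1)] act_comp[OF g(1)] by simp
      show "(\<lambda>f. finv g \<circ> f) \<in> {f \<in> G. \<phi> f c = y} \<rightarrow> {f \<in> G. \<phi> f c = c}"
      proof
        fix f assume f: "f \<in> {f \<in> G. \<phi> f c = y}"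
        have m: "finv g \<circ> f \<in> G" using f perm_groupD(3)[OF G perm_groupD(4)[OF G g(1)]] by simp
        have "\<phi> g (\<phi> (finv g \<circ> f) c) = \<phi> (g \<circ> (finv g \<circ> f)) c" using act_comp[OF g(1) m] by simp
        also have "\<dots> = \<phi> g c" unfolding cc(2) using f g(2) by simp
        finally have "\<phi> (finv g \<circ> f) c = c" using act_inj[OF g(1) _ cO] m by blast
        then show "finv g \<circ> f \<in> {f \<in> G. \<phi> f c = c}" using m by simp
      qed
    qed (use cc in auto)
    from bij_betw_same_card[OF this] show "card {f\<in>G. \<phi> f c = y} = card {f\<in>G. \<phi> f c = c}" by simp
  qed
  finally show ?thesis by simp
qed

lemma action_fixed_point:
  fixes p :: nat
  assumes G: "perm_group S G" and fin: "finite S" and card: "card G = p ^ k" and p: "prime p"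
    and C: "finite C" "\<not> p dvd card C"
    and act_mem: "\<And>f c. f \<in> G \<Longrightarrow> c \<in> C \<Longrightarrow> \<phi> f c \<in> C"
    and act_id: "\<And>c. c \<in> C \<Longrightarrow> \<phi> id c = c"
    and act_comp: "\<And>f g c. f \<in> G \<Longrightarrow> g \<in> G \<Longrightarrow> c \<in> C \<Longrightarrow> \<phi> (f \<circ> g) c = \<phi> f (\<phi> g c)"
  shows "\<exists>c\<in>C. \<forall>f\<in>G. \<phi> f c = c"
proof (rule ccontr)
  assume no: "\<not> ?thesis"
  let ?O = "\<lambda>c. (\<lambda>g. \<phi> g c) ` G"
  have inv: "\<phi> (finv f) (\<phi> f c) = c" if "f \<in> G" "c \<in> C" for f c
  proof -
    have "finv f \<circ> f = id" using perm_group_inv_apply(1)[OF G that(1)] by (simp add: fun_eq_iff)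
    then show ?thesis using act_comp[OF perm_groupD(4)[OF G that(1)] that(1) that(2)] act_id[OF that(2)] by simp
  qed
  have sub: "?O c \<subseteq> C" if "c \<in> C" for c using act_mem that by auto
  have self: "c \<in> ?O c" if "c \<in> C" for c
    using image_eqI[of c "\<lambda>g. \<phi> g c" id G] act_id[OF that] perm_groupD(2)[OF G] by simp
  have eq: "?O d = ?O c" if c: "c \<in> C" and d: "d \<in> ?O c" for c d
  proof -
    have half: "?O d \<subseteq> ?O c" if c: "c \<in> C" and d: "d \<in> ?O c" for c d
    proof
      fix y assume "y \<in> ?O d"
      then obtain g where g: "g \<in> G" "y = \<phi> g d" by auto
      obtain h where h: "h \<in> G" "d = \<phi> h c" using d by auto
      have "y = \<phi> (g \<circ> h) c" using g h act_comp[OF g(1) h(1) c] by simp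
      then show "y \<in> ?O c" using perm_groupD(3)[OF G g(1) h(1)] by blast
    qed
    obtain h where h: "h \<in> G" "d = \<phi> h c" using d by auto
    have "c = \<phi> (finv h) d" using inv[OF h(1) c] h(2) by simp
    then have "c \<in> ?O d" using perm_groupD(4)[OF G h(1)] by blast
    then show ?thesis using half[OF c d] half[of d c] sub[OF c] d by blast
  qed
  have orbp: "p dvd card (?O c)" if c: "c \<in> C" for c
  proof -
    have i: "d = e" if f: "f \<in> G" and d: "d \<in> ?O c" and e: "e \<in> ?O c" and de: "\<phi> f d = \<phi> f e" for f d e
    proof -
      have dC: "d \<in> C" by (rule subsetD[OF sub[OF c] d])
      have eC: "e \<in> C" by (rule subsetD[OF sub[OF c] e])
      have "d = \<phi> (finv f) (\<phi> f d)" by (rule inv[OF f dC, symmetric])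
      also have "\<dots> = \<phi> (finv f) (\<phi> f e)" unfolding de ..
      also have "\<dots> = e" by (rule inv[OF f eC])
      finally show ?thesis .
    qed
    have "card G = card (?O c) * card {g\<in>G. \<phi> g c = c}"
    proof (rule action_orbit_card[OF G fin])
      show "\<phi> id c = c" by (rule act_id[OF c])
      fix f g assume "f \<in> G" "g \<in> G"
      then show "\<phi> (f \<circ> g) c = \<phi> f (\<phi> g c)" by (rule act_comp[OF _ _ c])
    next
      fix f d e assume "f \<in> G" "d \<in> ?O c" "e \<in> ?O c" "\<phi> f d = \<phi> f e"
      then show "d = e" by (rule i)
    qed
    then have "card (?O c) dvd p ^ k" unfolding card by (rule dvdI)
    then obtain i where i: "card (?O c) = p ^ i" using divides_primepow_nat[OF p] by blast
    have "i \<noteq> 0"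
    proof
      assume "i = 0"
      then have "card (?O c) = 1" using i by simp
      then obtain d where d: "?O c = {d}" by (rule card_1_singletonE)
      have "c = d" using self[OF c] unfolding d by simp
      moreover have "\<phi> f c = d" if "f \<in> G" for f using imageI[OF that, of "\<lambda>g. \<phi> g c"] unfolding d by simp
      ultimately have "\<forall>f\<in>G. \<phi> f c = c" by simp
      then show False using no c by blast
    qed
    then show ?thesis using i by simp
  qed
  have U: "\<Union> (?O ` C) = C"
  proof
    show "C \<subseteq> \<Union> (?O ` C)" using self by blast
  qed (use sub in blast)
  have "p dvd card (\<Union> (?O ` C))"
  proof (rule dvd_partition)
    show "finite (\<Union> (?O ` C))" unfolding U by (rule C(1))
    show "\<forall>c1\<in>?O ` C. \<forall>c2\<in>?O ` C. c1 \<noteq> c2 \<longrightarrow> c1 \<inter> c2 = {}"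
    proof (intro ballI impI)
      fix c1 c2 assume "c1 \<in> ?O ` C" "c2 \<in> ?O ` C" and ne: "c1 \<noteq> c2"
      then obtain a b where ab: "a \<in> C" "b \<in> C" "c1 = ?O a" "c2 = ?O b" by blast
      show "c1 \<inter> c2 = {}"
      proof (rule ccontr)
        assume "c1 \<inter> c2 \<noteq> {}"
        then obtain d where d: "d \<in> ?O a" "d \<in> ?O b" unfolding ab by blast
        show False using eq[OF ab(1) d(1)] eq[OF ab(2) d(2)] ne unfolding ab by simp
      qed
    qed
  qed (use orbp in blast)
  then show False unfolding U using C(2) by simp
qed

lemma perm_group_is_group:
  assumes G: "perm_group S G" shows "group \<lparr>carrier = G, monoid.mult = (\<circ>), one = id\<rparr>" (is "group ?M")
proof (rule groupI)
  fix f assume "f \<in> carrier ?M"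
  then have f: "f \<in> G" by simp
  have "finv f \<circ> f = id" using perm_group_inv_apply(1)[OF G f] by (simp add: fun_eq_iff)
  then show "\<exists>y\<in>carrier ?M. y \<otimes>\<^bsub>?M\<^esub> f = \<one>\<^bsub>?M\<^esub>" using perm_groupD(4)[OF G f] by auto
qed (use perm_groupD[OF G] in \<open>auto simp: comp_assoc\<close>)

text \<open>The number of cosets of a Sylow subgroup \<open>H\<close> is prime to \<open>p\<close>,
  so a \<open>p\<close>-group acting on them fixes a coset \<open>H g\<close>, which means that
  \<open>g\<close> conjugates it into \<open>H\<close>. The result is normalised such that the first
  group is not moved.\<close>

lemma sylow_conj:
  fixes p :: nat and S :: "'a set"
  assumes G: "perm_group S G" and fin: "finite S" and p: "prime p"
    and A: "perm_group S A" "A \<subseteq> G" "card A = p ^ a" and B: "perm_group S B" "B \<subseteq> G" "card B = p ^ b"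
  shows "\<exists>g\<in>G. \<exists>T k. perm_group S T \<and> T \<subseteq> G \<and> card T = p ^ k \<and> A \<subseteq> T \<and> (\<forall>f\<in>B. g \<circ> f \<circ> finv g \<in> T)"
proof -
  define M :: "('a \<Rightarrow> 'a) monoid" where "M = \<lparr>carrier = G, monoid.mult = (\<circ>), one = id\<rparr>"
  have grp: "group M" unfolding M_def using perm_group_is_group[OF G] .
  interpret group M by (rule grp)
  have fG: "finite G" using perm_group_finite G fin by blast
  have cG: "card G > 0" using perm_groupD(2)[OF G] fG by (auto simp: card_gt_0_iff)
  obtain m where m: "card G = p ^ multiplicity p (card G) * m" "\<not> p dvd m"
    using cG p by (elim multiplicity_decompose'[rotated 2]) (auto simp: prime_nat_iff)
  define i where "i = multiplicity p (card G)"
  note m = m[folded i_def]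
  have "\<exists>H. subgroup H M \<and> card H = p ^ i"
    by (rule sylow_thm[OF p grp]) (use m fG in \<open>auto simp: order_def M_def\<close>)
  then obtain H where H: "subgroup H M" "card H = p ^ i" by blast
  have lag: "card (rcosets\<^bsub>M\<^esub> H) * card H = card G"
    using lagrange_finite[OF _ H(1)] fG by (simp add: order_def M_def)
  have "p > 0" using p prime_gt_0_nat by blast
  then have cC: "card (rcosets\<^bsub>M\<^esub> H) = m" using lag m H(2) by simp
  have HG: "H \<subseteq> G" using subgroup.subset[OF H(1)] by (simp add: M_def)
  have invM: "inv\<^bsub>M\<^esub> f = finv f" if "f \<in> G" for f
  proof (rule inv_equality)
    have "finv f \<circ> f = id" using perm_group_inv_apply(1)[OF G that] by (simp add: fun_eq_iff)
    then show "finv f \<otimes>\<^bsub>M\<^esub> f = \<one>\<^bsub>M\<^esub>" by (simp add: M_def)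
  qed (use that perm_groupD(4)[OF G] in \<open>auto simp: M_def\<close>)
  have Hpg: "perm_group S H"
  proof (rule perm_groupI)
    show "f permutes S" if "f \<in> H" for f using that HG perm_groupD(1)[OF G] by blast
    show "id \<in> H" using subgroup.one_closed[OF H(1)] by (simp add: M_def)
    show "f \<circ> g \<in> H" if "f \<in> H" "g \<in> H" for f g using subgroup.m_closed[OF H(1) that] by (simp add: M_def)
    show "finv f \<in> H" if "f \<in> H" for f using subgroup.m_inv_closed[OF H(1) that] invM that HG by auto
  qed
  have rc: "c \<in> rcosets\<^bsub>M\<^esub> H \<longleftrightarrow> (\<exists>g\<in>G. c = (\<lambda>h. h \<circ> g) ` H)" for c
    by (auto simp: RCOSETS_def r_coset_def M_def)
  have key: "\<exists>g\<in>G. \<forall>f\<in>A. g \<circ> f \<circ> finv g \<in> H" if A: "perm_group S A" "A \<subseteq> G" "card A = p ^ a" for A a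
  proof -
    have "\<exists>c\<in>rcosets\<^bsub>M\<^esub> H. \<forall>f\<in>A. (\<lambda>x. x \<circ> finv f) ` c = c"
    proof (rule action_fixed_point[OF A(1) fin A(3) p])
      show "finite (rcosets\<^bsub>M\<^esub> H)" using cC m(2) by (metis card.infinite dvd_0_right)
      show "\<not> p dvd card (rcosets\<^bsub>M\<^esub> H)" using cC m by simp
      show "(\<lambda>x. x \<circ> finv f) ` c \<in> rcosets\<^bsub>M\<^esub> H" if f: "f \<in> A" and c: "c \<in> rcosets\<^bsub>M\<^esub> H" for f c
      proof -
        obtain g where g: "g \<in> G" "c = (\<lambda>h. h \<circ> g) ` H" using c rc by blast
        have "g \<circ> finv f \<in> G" using g f A(2) perm_groupD(3,4)[OF G] by blast
        moreover have "(\<lambda>x. x \<circ> finv f) ` c = (\<lambda>h. h \<circ> (g \<circ> finv f)) ` H" unfolding g(2) by (simp add: image_image comp_assoc)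
        ultimately show ?thesis using rc by blast
      qed
      show "(\<lambda>x. x \<circ> finv id) ` c = c" for c :: "('a \<Rightarrow> 'a) set" by simp
      show "(\<lambda>x. x \<circ> finv (f \<circ> g)) ` c = (\<lambda>x. x \<circ> finv f) ` (\<lambda>x. x \<circ> finv g) ` c" if "f \<in> A" "g \<in> A" for f g c
      proof -
        have "finv (f \<circ> g) = finv g \<circ> finv f"
          using perm_group_bij[OF A(1) that(1)] perm_group_bij[OF A(1) that(2)] by (simp add: o_inv_distrib)
        then show ?thesis by (simp add: image_image comp_assoc)
      qed
    qed
    then obtain g where g: "g \<in> G" and fix1: "\<And>f. f \<in> A \<Longrightarrow> (\<lambda>x. x \<circ> finv f) ` ((\<lambda>h. h \<circ> g) ` H) = (\<lambda>h. h \<circ> g) ` H"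
      using rc by auto
    have "g \<circ> f \<circ> finv g \<in> H" if f: "f \<in> A" for f
    proof -
      have fi: "finv f \<in> A" "finv (finv f) = f" using perm_groupD(4)[OF A(1) f] perm_group_bij[OF A(1) f] inv_inv_eq by blast+
      have "id \<circ> g \<in> (\<lambda>h. h \<circ> g) ` H" using perm_groupD(2)[OF Hpg] by blast
      then have "(\<lambda>x. x \<circ> f) (id \<circ> g) \<in> (\<lambda>x. x \<circ> finv (finv f)) ` ((\<lambda>h. h \<circ> g) ` H)" unfolding fi(2) by (rule imageI)
      then have "g \<circ> f \<in> (\<lambda>h. h \<circ> g) ` H" unfolding fix1[OF fi(1)] by simp
      then obtain h where h: "h \<in> H" "g \<circ> f = h \<circ> g" by auto
      have "g \<circ> f \<circ> finv g = h \<circ> (g \<circ> finv g)" unfolding h(2) by (simp only: comp_assoc)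
      also have "g \<circ> finv g = id" using perm_group_inv_apply(2)[OF G g] by (simp add: fun_eq_iff)
      finally have "g \<circ> f \<circ> finv g = h" by (simp only: comp_id)
      then show ?thesis using h(1) by (simp only:)
    qed
    then show ?thesis using g by blast
  qed
  obtain g where g: "g \<in> G" "\<And>f. f \<in> A \<Longrightarrow> g \<circ> f \<circ> finv g \<in> H" using key[OF A] by blast
  obtain h where h: "h \<in> G" "\<And>f. f \<in> B \<Longrightarrow> h \<circ> f \<circ> finv h \<in> H" using key[OF B] by blast
  have gg: "finv g \<circ> g = id" "g \<circ> finv g = id" using perm_group_inv_apply[OF G g(1)] by (simp_all add: fun_eq_iff)
  \<comment> \<open>Conjugating \<open>H\<close> back by \<open>g\<close> puts \<open>A\<close>
    itself into \<open>T\<close>; the second group is then moved by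
    \<open>finv g \<circ> h\<close>.\<close>
  define T where "T = (\<lambda>f. finv g \<circ> f \<circ> g) ` H"
  have gm: "finv g \<in> G" using perm_groupD(4)[OF G g(1)] .
  have comp_T: "(finv g \<circ> a \<circ> g) \<circ> (finv g \<circ> b \<circ> g) = finv g \<circ> (a \<circ> b) \<circ> g" for a b
  proof -
    have "(finv g \<circ> a \<circ> g) \<circ> (finv g \<circ> b \<circ> g) = finv g \<circ> a \<circ> (g \<circ> finv g) \<circ> b \<circ> g" by (simp only: comp_assoc)
    then show ?thesis unfolding gg by (simp only: comp_assoc comp_id)
  qed
  have TG: "T \<subseteq> G" unfolding T_def using HG g(1) gm perm_groupD(3)[OF G] by blast
  have "perm_group S T"
  proof (rule perm_groupI)
    show "f permutes S" if "f \<in> T" for f using that TG perm_groupD(1)[OF G] by blast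
    have "id = finv g \<circ> id \<circ> g" unfolding comp_id gg ..
    then show "id \<in> T" unfolding T_def using perm_groupD(2)[OF Hpg] by (rule image_eqI)
    show "f1 \<circ> f2 \<in> T" if t: "f1 \<in> T" "f2 \<in> T" for f1 f2
    proof -
      obtain a b where "a \<in> H" "b \<in> H" "f1 = finv g \<circ> a \<circ> g" "f2 = finv g \<circ> b \<circ> g" using t unfolding T_def by auto
      then have "f1 \<circ> f2 = finv g \<circ> (a \<circ> b) \<circ> g" "a \<circ> b \<in> H" using comp_T perm_groupD(3)[OF Hpg] by (simp_all only:)
      then show ?thesis unfolding T_def by (rule image_eqI)
    qed
    show "finv f1 \<in> T" if t: "f1 \<in> T" for f1
    proof -
      obtain a where a: "a \<in> H" "f1 = finv g \<circ> a \<circ> g" using t unfolding T_def by auto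
      have ai: "finv a \<circ> a = id" "a \<circ> finv a = id" using perm_group_inv_apply[OF Hpg a(1)] by (simp_all add: fun_eq_iff)
      have "(finv g \<circ> a \<circ> g) \<circ> (finv g \<circ> finv a \<circ> g) = id" "(finv g \<circ> finv a \<circ> g) \<circ> (finv g \<circ> a \<circ> g) = id"
        unfolding comp_T ai comp_id gg by (rule refl)+
      then have "finv f1 = finv g \<circ> finv a \<circ> g" unfolding a(2) by (rule inv_unique_comp)
      then show ?thesis unfolding T_def using perm_groupD(4)[OF Hpg a(1)] by blast
    qed
  qed
  moreover have "card T = p ^ i"
  proof -
    have "inj_on (\<lambda>f. finv g \<circ> f \<circ> g) H"
    proof (rule inj_onI)
      fix a b assume "finv g \<circ> a \<circ> g = finv g \<circ> b \<circ> g"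
      then have "g \<circ> (finv g \<circ> a \<circ> g) \<circ> finv g = g \<circ> (finv g \<circ> b \<circ> g) \<circ> finv g" by (simp only:)
      then have "(g \<circ> finv g) \<circ> a \<circ> (g \<circ> finv g) = (g \<circ> finv g) \<circ> b \<circ> (g \<circ> finv g)" by (simp only: comp_assoc)
      then show "a = b" unfolding gg by (simp only: comp_id id_comp)
    qed
    from card_image[OF this] show ?thesis unfolding T_def H(2) .
  qed
  moreover have "A \<subseteq> T"
  proof
    fix f assume "f \<in> A"
    have "f = (finv g \<circ> g) \<circ> f \<circ> (finv g \<circ> g)" unfolding gg by (simp only: comp_id id_comp)
    also have "\<dots> = finv g \<circ> (g \<circ> f \<circ> finv g) \<circ> g" by (simp only: comp_assoc)
    finally show "f \<in> T" unfolding T_def using g(2)[OF \<open>f \<in> A\<close>] by blast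
  qed
  moreover have "(finv g \<circ> h) \<circ> f \<circ> finv (finv g \<circ> h) \<in> T" if "f \<in> B" for f
  proof -
    have "finv (finv g \<circ> h) = finv h \<circ> g"
      unfolding o_inv_distrib[OF perm_group_bij[OF G gm] perm_group_bij[OF G h(1)]] inv_inv_eq[OF perm_group_bij[OF G g(1)]] ..
    then have "(finv g \<circ> h) \<circ> f \<circ> finv (finv g \<circ> h) = finv g \<circ> (h \<circ> f \<circ> finv h) \<circ> g" by (simp only: comp_assoc)
    then show ?thesis unfolding T_def using h(2)[OF that] by blast
  qed
  moreover have "finv g \<circ> h \<in> G" using gm h(1) perm_groupD(3)[OF G] by blast
  ultimately show ?thesis using TG by blast
qed

text \<open>The cycles of \<open>f\<close> on \<open>S\<close> have length 1 or
  \<open>p\<close>.\<close>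

lemma card_cyclic_fixed:
  fixes p :: nat
  assumes fin: "finite S" and p: "prime p" and f: "\<And>x. x \<in> S \<Longrightarrow> f x \<in> S"
    and fp: "\<And>x. x \<in> S \<Longrightarrow> (f ^^ p) x = x"
  shows "p dvd card (S - {x\<in>S. f x = x})"
proof -
  let ?N = "S - {x\<in>S. f x = x}"
  let ?O = "\<lambda>x. (\<lambda>i. (f ^^ i) x) ` {..<p}"
  have p0: "p > 0" "p > 1" using p prime_gt_0_nat prime_gt_1_nat by auto
  have fS: "(f ^^ i) x \<in> S" if "x \<in> S" for i x using that by (induction i) (auto intro: f)
  have modp: "(f ^^ (m mod p)) x = (f ^^ m) x" if "x \<in> S" for m x
    using funpow_mod_eq[OF fp[OF that]] .
  have inj: "inj_on (\<lambda>i. (f ^^ i) x) {..<p}" if x: "x \<in> ?N" for x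
  proof -
    have xS: "x \<in> S" "f x \<noteq> x" using x by auto
    have nop: "(f ^^ d) x \<noteq> x" if d: "0 < d" "d < p" for d
    proof
      assume "(f ^^ d) x = x"
      then have ex: "\<exists>d. 0 < d \<and> (f ^^ d) x = x" using d by blast
      define e where "e = (LEAST d. 0 < d \<and> (f ^^ d) x = x)"
      have e: "0 < e" "(f ^^ e) x = x" using LeastI_ex[OF ex] unfolding e_def by auto
      have le: "e \<le> d" unfolding e_def by (rule Least_le) (use d \<open>(f ^^ d) x = x\<close> in auto)
      have "(f ^^ (p mod e)) x = x" using funpow_mod_eq[OF e(2), of p] fp[OF xS(1)] by simp
      then have "p mod e = 0" using not_less_Least[of "p mod e" "\<lambda>d. 0 < d \<and> (f ^^ d) x = x"] e(1) unfolding e_def[symmetric] by fastforce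
      then have "e dvd p" by auto
      then have "e = 1 \<or> e = p" using p prime_nat_iff by blast
      then show False using e(2) xS(2) le d by auto
    qed
    show ?thesis
    proof (rule linorder_inj_onI')
      fix i j assume ij: "i \<in> {..<p}" "j \<in> {..<p}" "i < j"
      show "(f ^^ i) x \<noteq> (f ^^ j) x"
      proof
        assume eq: "(f ^^ i) x = (f ^^ j) x"
        have fa: "(f ^^ a) ((f ^^ b) x) = (f ^^ (a + b)) x" for a b by (simp add: funpow_add)
        have "(p - i) + i = p" "(p - i) + j = (j - i) + p" using ij by auto
        then have "(f ^^ (p - i)) ((f ^^ i) x) = (f ^^ p) x"
          "(f ^^ (p - i)) ((f ^^ j) x) = (f ^^ (j - i)) ((f ^^ p) x)" unfolding fa by simp_all
        moreover note this
        ultimately have "(f ^^ (j - i)) x = x" using eq fp[OF xS(1)] by simp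
        moreover have "0 < j - i" "j - i < p" using ij by auto
        ultimately show False using nop by blast
      qed
    qed
  qed
  have sub: "?O x \<subseteq> ?N" if x: "x \<in> ?N" for x
  proof
    fix y assume "y \<in> ?O x"
    then obtain i where i: "i < p" "y = (f ^^ i) x" by auto
    have xS: "x \<in> S" "f x \<noteq> x" using x by auto
    have "f y \<noteq> y"
    proof
      assume "f y = y"
      then have "(f ^^ k) y = y" for k by (induction k) auto
      then have "(f ^^ (p - i)) y = y" "(f ^^ (Suc (p - i))) y = y" by blast+
      moreover have "(f ^^ (p - i)) y = (f ^^ ((p - i) + i)) x" unfolding i(2) by (simp add: funpow_add)
      then have "(f ^^ (p - i)) y = x" "(f ^^ (Suc (p - i))) y = f x" using i(1) fp[OF xS(1)] by simp_all
      ultimately show False using xS by simp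
    qed
    then show "y \<in> ?N" using fS[OF xS(1)] i by auto
  qed
  have self: "x \<in> ?O x" for x using p0 by (force intro: image_eqI[of _ _ 0])
  have eq: "?O y = ?O x" if x: "x \<in> S" and y: "y \<in> ?O x" for x y
  proof -
    have half: "?O y \<subseteq> ?O x" if x: "x \<in> S" and y: "y \<in> ?O x" for x y
    proof
      fix u assume "u \<in> ?O y"
      then obtain i j where ij: "u = (f ^^ i) y" "y = (f ^^ j) x" using y by auto
      then have "u = (f ^^ (i + j)) x" by (simp add: funpow_add)
      also have "\<dots> = (f ^^ ((i + j) mod p)) x" using modp[OF x] by simp
      finally show "u \<in> ?O x" using p0 by auto
    qed
    obtain i where i: "i < p" "y = (f ^^ i) x" using y by auto
    have yS: "y \<in> S" using fS[OF x] i by simp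
    have "(f ^^ (p - i)) y = (f ^^ ((p - i) + i)) x" unfolding i(2) by (simp add: funpow_add)
    then have "x = (f ^^ (p - i)) y" using i(1) fp[OF x] by simp
    also have "\<dots> = (f ^^ ((p - i) mod p)) y" using modp[OF yS] by simp
    finally have "x \<in> ?O y" using p0 by auto
    then show ?thesis using half[OF x y] half[OF yS] by blast
  qed
  have "p dvd card (\<Union> (?O ` ?N))"
  proof (rule dvd_partition)
    have "\<Union> (?O ` ?N) \<subseteq> S" using sub by blast
    then show "finite (\<Union> (?O ` ?N))" using fin finite_subset by blast
    show "\<forall>c\<in>?O ` ?N. p dvd card c" using card_image[OF inj] by fastforce
    show "\<forall>c1\<in>?O ` ?N. \<forall>c2\<in>?O ` ?N. c1 \<noteq> c2 \<longrightarrow> c1 \<inter> c2 = {}"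
    proof (intro ballI impI)
      fix c1 c2 assume "c1 \<in> ?O ` ?N" "c2 \<in> ?O ` ?N" "c1 \<noteq> c2"
      then obtain a b where ab: "a \<in> S" "b \<in> S" "c1 = ?O a" "c2 = ?O b" by auto
      show "c1 \<inter> c2 = {}"
      proof (rule ccontr)
        assume "c1 \<inter> c2 \<noteq> {}"
        then obtain y where "y \<in> ?O a" "y \<in> ?O b" using ab by blast
        then show False using eq[OF ab(1)] eq[OF ab(2)] ab \<open>c1 \<noteq> c2\<close> by metis
      qed
    qed
  qed
  moreover have "\<Union> (?O ` ?N) = ?N"
  proof
    show "\<Union> (?O ` ?N) \<subseteq> ?N" using sub by blast
    show "?N \<subseteq> \<Union> (?O ` ?N)" using self by blast
  qed
  ultimately show ?thesis by simp
qed

section \<open>Regular representations in a 2-closed group\<close>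

text \<open>A regular group \<open>E \<times> P\<close> given by its generators. Regularity is
  expressed by transitivity together with the number of points; \<open>rep_free\<close> recovers
  freeness by counting.\<close>

definition rep :: "'a set \<Rightarrow> ('a \<Rightarrow> 'a) set \<Rightarrow> nat \<Rightarrow> ('v::{ab_group_add,finite} \<Rightarrow> 'a \<Rightarrow> 'a) \<Rightarrow> ('a \<Rightarrow> 'a) \<Rightarrow> bool" where
  "rep \<Omega> A p eps z \<longleftrightarrow> (\<forall>v. eps v \<in> A) \<and> z \<in> A \<and> (\<forall>u v x. eps (u + v) x = eps u (eps v x)) \<and>
     (\<forall>v x. eps v (z x) = z (eps v x)) \<and> (\<forall>x. (z ^^ p) x = x) \<and>
     (\<forall>x\<in>\<Omega>. \<forall>y\<in>\<Omega>. \<exists>v t. y = (z ^^ t) (eps v x)) \<and> card \<Omega> = 32 * p"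

text \<open>The argument \<open>tv\<close> only fixes the type of labels, which occurs neither in
  \<open>\<Omega>\<close> nor in \<open>A\<close>.\<close>

locale closed_group =
  fixes \<Omega> :: "'a set" and A :: "('a \<Rightarrow> 'a) set" and p :: nat and tv :: "'v::{ab_group_add,finite} itself"
  assumes fin: "finite \<Omega>" and pgA: "perm_group \<Omega> A"
    and closed2: "\<And>\<delta>. \<delta> permutes \<Omega> \<Longrightarrow> (\<And>x y. x \<in> \<Omega> \<Longrightarrow> y \<in> \<Omega> \<Longrightarrow> \<exists>a\<in>A. a x = \<delta> x \<and> a y = \<delta> y) \<Longrightarrow> \<delta> \<in> A"
    and prime_p: "prime p" and odd_p: "odd p"
    and V2: "\<And>x::'v. x + x = 0" and V32: "card (UNIV :: 'v set) = 32"
begin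

lemma p_pos: "p > 0" using prime_p prime_gt_0_nat by blast
lemma p_gt1: "p > 1" using prime_p prime_gt_1_nat by blast

lemma A_perm: "a \<in> A \<Longrightarrow> a permutes \<Omega>" using perm_groupD(1)[OF pgA] .
lemma A_mem: "a \<in> A \<Longrightarrow> x \<in> \<Omega> \<Longrightarrow> a x \<in> \<Omega>" using permutes_in_image[OF A_perm] by blast
lemma A_out: "a \<in> A \<Longrightarrow> x \<notin> \<Omega> \<Longrightarrow> a x = x" using permutes_not_in[OF A_perm] by blast
lemma A_inj: "a \<in> A \<Longrightarrow> a x = a y \<Longrightarrow> x = y" using permutes_inj[OF A_perm] injD by metis
lemma A_id: "(\<lambda>x. x) \<in> A" using perm_groupD(2)[OF pgA] by (simp add: id_def)
lemma A_comp: "a \<in> A \<Longrightarrow> b \<in> A \<Longrightarrow> (\<lambda>x. a (b x)) \<in> A" using perm_group_mult_mem[OF pgA] .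
lemma A_inv: "a \<in> A \<Longrightarrow> finv a \<in> A" "a \<in> A \<Longrightarrow> finv a (a x) = x" "a \<in> A \<Longrightarrow> a (finv a x) = x"
  using perm_groupD(4)[OF pgA] perm_group_inv_apply[OF pgA] by blast+
lemma A_pow: "a \<in> A \<Longrightarrow> (\<lambda>x. (a ^^ n) x) \<in> A"
proof (induction n)
  case (Suc n)
  from A_comp[OF Suc.prems Suc.IH[OF Suc.prems]] show ?case by simp
qed (use perm_groupD(2)[OF pgA] in simp)

lemma vv [simp]: "(x::'v) + x = 0" "(x::'v) + (x + y) = y"
proof -
  show "x + x = 0" by (rule V2)
  have "x + (x + y) = (x + x) + y" by (simp only: add.assoc)
  then show "x + (x + y) = y" unfolding V2 by simp
qed

lemma v_eq: "(x::'v) + y = 0 \<longleftrightarrow> x = y"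
proof
  assume "x + y = 0"
  then have "x + (x + y) = x" by simp
  then show "x = y" by simp
qed simp

lemmas nf = add.assoc add.commute add.left_commute

abbreviation "Rep (eps :: 'v \<Rightarrow> 'a \<Rightarrow> 'a) z \<equiv> rep \<Omega> A p eps z"

context
  fixes eps :: "'v \<Rightarrow> 'a \<Rightarrow> 'a" and z :: "'a \<Rightarrow> 'a"
  assumes R: "Rep eps z"
begin

lemma rep_mem: "eps v \<in> A" "z \<in> A" and rep_add: "eps (u + v) x = eps u (eps v x)"
  and rep_z: "eps v (z x) = z (eps v x)" and rep_zp: "(z ^^ p) x = x" and rep_card: "card \<Omega> = 32 * p"
  using R unfolding rep_def by auto

lemma rep_trans: "x \<in> \<Omega> \<Longrightarrow> y \<in> \<Omega> \<Longrightarrow> \<exists>v t. y = (z ^^ t) (eps v x)"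
  using R unfolding rep_def by blast

lemma rep_zpow_mem: "x \<in> \<Omega> \<Longrightarrow> (z ^^ t) x \<in> \<Omega>"
  using A_mem[OF A_pow[OF rep_mem(2), of t]] .

lemma rep_eps_mem: "x \<in> \<Omega> \<Longrightarrow> eps v x \<in> \<Omega>"
  using A_mem[OF rep_mem(1)] .

lemma rep_0: "eps 0 x = x"
proof -
  have "eps 0 (eps 0 x) = eps 0 x" using rep_add[of 0 0 x] by simp
  then show ?thesis using A_inj[OF rep_mem(1)] by blast
qed

lemma rep_invol: "eps v (eps v x) = x"
  using rep_add[of v v x] rep_0 by simp

lemma rep_comm: "eps u (eps v x) = eps v (eps u x)"
  using rep_add[of u v x] rep_add[of v u x] by (simp add: add.commute)

lemma rep_zpow: "eps v ((z ^^ t) x) = (z ^^ t) (eps v x)"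
  by (induction t) (simp_all add: rep_z)

lemma rep_zmod: "(z ^^ (t mod p)) x = (z ^^ t) x"
  using funpow_mod_eq[OF rep_zp] .

lemma zadd: "(z ^^ s) ((z ^^ t) x) = (z ^^ (s + t)) x"
  by (simp add: funpow_add)

lemma rep_free:
  assumes x: "x \<in> \<Omega>" and eq: "(z ^^ t) (eps v x) = (z ^^ s) (eps u x)"
  shows "v = u" "t mod p = s mod p"
proof -
  let ?f = "\<lambda>(v, t). (z ^^ t) (eps v x)"
  let ?D = "(UNIV :: 'v set) \<times> {..<p}"
  have img: "?f ` ?D = \<Omega>"
  proof
    show "?f ` ?D \<subseteq> \<Omega>" using rep_zpow_mem rep_eps_mem x by auto
    show "\<Omega> \<subseteq> ?f ` ?D"
    proof
      fix y assume "y \<in> \<Omega>"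
      then obtain v t where "y = (z ^^ t) (eps v x)" using rep_trans[OF x] by blast
      then have "y = ?f (v, t mod p)" using rep_zmod by simp
      moreover have "(v, t mod p) \<in> ?D" using p_pos by simp
      ultimately show "y \<in> ?f ` ?D" by (rule image_eqI)
    qed
  qed
  have "card ?D = card (?f ` ?D)" unfolding img rep_card using V32 by (simp add: card_cartesian_product)
  then have inj: "inj_on ?f ?D" by (intro eq_card_imp_inj_on) auto
  have "?f (v, t mod p) = ?f (u, s mod p)" using eq rep_zmod by simp
  then have "(v, t mod p) = (u, s mod p)" by (rule inj_onD[OF inj]) (use p_pos in auto)
  then show "v = u" "t mod p = s mod p" by auto
qed

lemma rep_z_ne: assumes x: "x \<in> \<Omega>" shows "(z ^^ t) x = x \<longleftrightarrow> p dvd t"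
proof
  assume "(z ^^ t) x = x"
  then have "(z ^^ t) (eps 0 x) = (z ^^ 0) (eps 0 x)" by (simp add: rep_0)
  from rep_free(2)[OF x this] show "p dvd t" by auto
next
  assume "p dvd t"
  then have "t mod p = 0" by auto
  then show "(z ^^ t) x = x" using rep_zmod[of t x] by simp
qed

end

lemma rep_conj:
  assumes R: "Rep eps z" and g: "g \<in> A"
  shows "Rep (\<lambda>v x. g (eps v (finv g x))) (\<lambda>x. g (z (finv g x)))"
proof -
  have pow: "((\<lambda>x. g (z (finv g x))) ^^ t) y = g ((z ^^ t) (finv g y))" for t y
    by (induction t) (simp_all add: A_inv[OF g])
  show ?thesis unfolding rep_def
  proof (intro conjI allI ballI)
    fix v show "(\<lambda>x. g (eps v (finv g x))) \<in> A" using A_comp[OF g A_comp[OF rep_mem(1)[OF R] A_inv(1)[OF g]]] .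
  next
    show "(\<lambda>x. g (z (finv g x))) \<in> A" using A_comp[OF g A_comp[OF rep_mem(2)[OF R] A_inv(1)[OF g]]] .
  next
    fix x y assume x: "x \<in> \<Omega>" and y: "y \<in> \<Omega>"
    have "finv g x \<in> \<Omega>" "finv g y \<in> \<Omega>" using x y A_mem[OF A_inv(1)[OF g]] by auto
    then obtain v t where "finv g y = (z ^^ t) (eps v (finv g x))" using rep_trans[OF R] by blast
    then have "y = g ((z ^^ t) (eps v (finv g x)))" using A_inv(3)[OF g, of y] by simp
    then have "y = ((\<lambda>x. g (z (finv g x))) ^^ t) (g (eps v (finv g x)))" unfolding pow A_inv(2)[OF g] .
    then show "\<exists>v t. y = ((\<lambda>x. g (z (finv g x))) ^^ t) (g (eps v (finv g x)))" by blast
  qed (simp_all add: A_inv[OF g] pow rep_add[OF R] rep_z[OF R] rep_zp[OF R] rep_card[OF R])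
qed

lemma inverse_mod_p: assumes "\<not> p dvd k" shows "\<exists>i. (k * i) mod p = 1"
proof -
  have "coprime k p" using prime_imp_coprime[OF prime_p assms] by (simp only: coprime_commute)
  moreover have "k \<noteq> 0" using assms by (rule contrapos_nn) simp
  ultimately obtain i y where "k * i = p * y + 1" using bezout_nat[of k p] by auto
  then have "(k * i) mod p = (p * y + 1) mod p" by (simp only:)
  also have "\<dots> = 1 mod p" using mod_mult_self2[of 1 p y] by (simp only: add.commute)
  also have "\<dots> = 1" by (rule mod_less[OF p_gt1])
  finally show ?thesis by blast
qed

text \<open>Only the groups matter, not their labelling: the label \<open>u\<close> may depend on
  \<open>v\<close> in any way, and \<open>z'\<close> may go to any power of
  \<open>z\<close>.\<close>

definition Conj :: "('v \<Rightarrow> 'a \<Rightarrow> 'a) \<Rightarrow> ('a \<Rightarrow> 'a) \<Rightarrow> ('v \<Rightarrow> 'a \<Rightarrow> 'a) \<Rightarrow> ('a \<Rightarrow> 'a) \<Rightarrow> bool" where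
  "Conj eps z ep z' \<longleftrightarrow> (\<exists>\<delta>\<in>A. (\<forall>v. \<exists>u. \<forall>x\<in>\<Omega>. \<delta> (ep v x) = eps u (\<delta> x)) \<and> (\<exists>k. \<forall>x\<in>\<Omega>. \<delta> (z' x) = (z ^^ k) (\<delta> x)))"

lemma Conj_conj:
  assumes g: "g \<in> A" and C: "Conj eps z (\<lambda>v x. g (ep v (finv g x))) (\<lambda>x. g (z' (finv g x)))"
  shows "Conj eps z ep z'"
proof -
  obtain \<delta> k where \<delta>: "\<delta> \<in> A" "\<And>v. \<exists>u. \<forall>x\<in>\<Omega>. \<delta> (g (ep v (finv g x))) = eps u (\<delta> x)"
    "\<And>x. x \<in> \<Omega> \<Longrightarrow> \<delta> (g (z' (finv g x))) = (z ^^ k) (\<delta> x)" using C unfolding Conj_def by blast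
  have 1: "\<exists>u. \<forall>x\<in>\<Omega>. \<delta> (g (ep v x)) = eps u (\<delta> (g x))" for v
  proof -
    obtain u where u: "\<And>x. x \<in> \<Omega> \<Longrightarrow> \<delta> (g (ep v (finv g x))) = eps u (\<delta> x)" using \<delta>(2) by blast
    have "\<delta> (g (ep v x)) = eps u (\<delta> (g x))" if "x \<in> \<Omega>" for x using u[OF A_mem[OF g that]] A_inv(2)[OF g] by simp
    then show ?thesis by blast
  qed
  have 2: "\<delta> (g (z' x)) = (z ^^ k) (\<delta> (g x))" if "x \<in> \<Omega>" for x using \<delta>(3)[OF A_mem[OF g that]] A_inv(2)[OF g] by simp
  show ?thesis unfolding Conj_def
    by (rule bexI[OF _ A_comp[OF \<delta>(1) g]]) (use 1 2 in blast)
qed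

definition sgv :: "'v set \<Rightarrow> bool" where
  "sgv L \<longleftrightarrow> 0 \<in> L \<and> (\<forall>x\<in>L. \<forall>y\<in>L. x + y \<in> L)"

end

locale base_rep = closed_group \<Omega> A p tv for \<Omega> :: "'a set" and A p and tv :: "'v::{ab_group_add,finite} itself" +
  fixes eps :: "'v \<Rightarrow> 'a \<Rightarrow> 'a" and z :: "'a \<Rightarrow> 'a"
  assumes R: "Rep eps z"
begin

definition cl :: "'v set \<Rightarrow> 'a \<Rightarrow> 'a \<Rightarrow> bool" where
  "cl L x y \<longleftrightarrow> (\<exists>l\<in>L. \<exists>t. y = (z ^^ t) (eps l x))"

definition Dhyp :: "'v set \<Rightarrow> bool" where
  "Dhyp L \<longleftrightarrow> (\<forall>a. (\<forall>x\<in>\<Omega>. \<forall>y. cl L x y \<longrightarrow> a x = a y) \<longrightarrow> (\<lambda>x. if x \<in> \<Omega> then (z ^^ (a x)) x else x) \<in> A)"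

text \<open>The state after alignment: \<open>z'\<close> is a power of \<open>z\<close> on each
  orbit of \<open>L \<times> P\<close>, with an exponent that depends on the orbit, and
  \<open>E'\<close> permutes these orbits. The bound \<open>\<kappa> x < p\<close> makes the
  exponent unique.\<close>

definition adm :: "'v set \<Rightarrow> ('v \<Rightarrow> 'a \<Rightarrow> 'a) \<Rightarrow> ('a \<Rightarrow> 'a) \<Rightarrow> ('a \<Rightarrow> nat) \<Rightarrow> bool" where
  "adm L ep z' \<kappa> \<longleftrightarrow> Rep ep z' \<and> (\<forall>x\<in>\<Omega>. \<kappa> x < p \<and> z' x = (z ^^ (\<kappa> x)) x) \<and>
     (\<forall>x\<in>\<Omega>. \<forall>y. cl L x y \<longrightarrow> \<kappa> x = \<kappa> y) \<and> (\<forall>v. \<forall>x\<in>\<Omega>. \<forall>y. cl L x y \<longrightarrow> cl L (ep v x) (ep v y))"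

text \<open>The labels of \<open>E \<inter> E'\<close>, whose number measures progress.\<close>

definition commons :: "('v \<Rightarrow> 'a \<Rightarrow> 'a) \<Rightarrow> 'v set" where
  "commons ep = {v. eps v \<in> range ep}"

lemma cl_z: assumes "sgv L" shows "cl L x ((z ^^ t) x)"
  unfolding cl_def using assms rep_0[OF R] unfolding sgv_def by metis

lemma cl_refl: "sgv L \<Longrightarrow> cl L x x" using cl_z[of L x 0] by simp

lemma cl_eps: assumes "cl L x y" shows "cl L (eps v x) (eps v y)"
proof -
  obtain l t where l: "l \<in> L" "y = (z ^^ t) (eps l x)" using assms unfolding cl_def by blast
  have "eps v y = (z ^^ t) (eps l (eps v x))" unfolding l(2) rep_zpow[OF R] rep_comm[OF R, of v l] ..
  then show ?thesis unfolding cl_def using l by blast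
qed

lemma cl_mem: "x \<in> \<Omega> \<Longrightarrow> cl L x y \<Longrightarrow> y \<in> \<Omega>"
  unfolding cl_def using rep_zpow_mem[OF R] rep_eps_mem[OF R] by blast

context
  fixes L ep z' \<kappa>
  assumes adm: "adm L ep z' \<kappa>" and L: "sgv L"
begin

lemma R': "Rep ep z'" using adm unfolding adm_def by blast
lemma kap: "x \<in> \<Omega> \<Longrightarrow> \<kappa> x < p" "x \<in> \<Omega> \<Longrightarrow> z' x = (z ^^ (\<kappa> x)) x" using adm unfolding adm_def by auto
lemma kap_cl: "x \<in> \<Omega> \<Longrightarrow> cl L x y \<Longrightarrow> \<kappa> x = \<kappa> y" using adm unfolding adm_def by blast
lemma ep_cl: "x \<in> \<Omega> \<Longrightarrow> cl L x y \<Longrightarrow> cl L (ep v x) (ep v y)" using adm unfolding adm_def by blast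

lemma kap_z: "x \<in> \<Omega> \<Longrightarrow> \<kappa> ((z ^^ t) x) = \<kappa> x"
  using kap_cl[OF _ cl_z[OF L]] by simp

lemma z'_pow: "x \<in> \<Omega> \<Longrightarrow> (z' ^^ n) x = (z ^^ (n * \<kappa> x)) x"
proof (induction n)
  case (Suc n)
  have "(z' ^^ Suc n) x = z' ((z ^^ (n * \<kappa> x)) x)" using Suc by simp
  also have "\<dots> = (z ^^ (\<kappa> x)) ((z ^^ (n * \<kappa> x)) x)"
    using kap(2)[OF rep_zpow_mem[OF R Suc.prems]] kap_z[OF Suc.prems] by simp
  also have "\<dots> = (z ^^ (Suc n * \<kappa> x)) x" unfolding zadd[OF R] by simp
  finally show ?case .
qed simp

lemma kap_ndvd: assumes x: "x \<in> \<Omega>" shows "\<not> p dvd \<kappa> x"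
proof
  assume "p dvd \<kappa> x"
  then have "(z' ^^ 1) x = x" using z'_pow[OF x, of 1] rep_z_ne[OF R x, of "\<kappa> x"] by simp
  then show False using rep_z_ne[OF R' x, of 1] p_gt1 by auto
qed

lemma z_pow': assumes x: "x \<in> \<Omega>" shows "\<exists>n. (z ^^ t) x = (z' ^^ n) x"
proof -
  obtain i where i: "(\<kappa> x * i) mod p = 1" using inverse_mod_p[OF kap_ndvd[OF x]] by blast
  have "(t * i * \<kappa> x) mod p = (t * ((\<kappa> x * i) mod p)) mod p" by (simp add: mult.commute mult.left_commute mod_mult_right_eq)
  then have "(t * i * \<kappa> x) mod p = t mod p" unfolding i by simp
  then have "(z ^^ (t * i * \<kappa> x)) x = (z ^^ t) x" using rep_zmod[OF R] by metis
  then show ?thesis using z'_pow[OF x, of "t * i"] by metis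
qed

lemma ep_fib: assumes x: "x \<in> \<Omega>" shows "\<exists>s. ep v ((z ^^ t) x) = (z ^^ s) (ep v x)"
proof -
  obtain n where n: "(z ^^ t) x = (z' ^^ n) x" using z_pow'[OF x] by blast
  have "ep v ((z ^^ t) x) = (z' ^^ n) (ep v x)" unfolding n by (rule rep_zpow[OF R'])
  also have "\<dots> = (z ^^ (n * \<kappa> (ep v x))) (ep v x)" by (rule z'_pow[OF rep_eps_mem[OF R' x]])
  finally show ?thesis by blast
qed

definition Qg :: "('a \<Rightarrow> 'a) set" where "Qg = mgen (range eps \<union> range ep)"

lemma Qg_induct [consumes 1, case_names id eps ep]:
  assumes "q \<in> Qg" "P (\<lambda>x. x)" "\<And>v q. q \<in> Qg \<Longrightarrow> P q \<Longrightarrow> P (\<lambda>x. eps v (q x))" "\<And>v q. q \<in> Qg \<Longrightarrow> P q \<Longrightarrow> P (\<lambda>x. ep v (q x))"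
  shows "P q"
  using assms(1) unfolding Qg_def
proof induction
  case mgen_id then show ?case using assms(2) by (simp add: id_def)
next
  case (mgen_step f g)
  then consider v where "f = eps v" | v where "f = ep v" by blast
  then show ?case
  proof cases
    case 1 then show ?thesis using assms(3)[of g v] mgen_step unfolding Qg_def comp_def by simp
  next
    case 2 then show ?thesis using assms(4)[of g v] mgen_step unfolding Qg_def comp_def by simp
  qed
qed

lemma finv_invol: assumes "\<And>x. f (f x) = x" shows "finv f = f"
proof
  fix x
  have "inj f" using assms by (metis injI)
  then have "finv f (f (f x)) = f x" by (rule inv_f_f)
  then show "finv f x = f x" unfolding assms .
qed

lemma Qg_group: "perm_group \<Omega> Qg" unfolding Qg_def
proof (rule mgen_group)
  show "f permutes \<Omega>" if "f \<in> range eps \<union> range ep" for f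
    using that A_perm[OF rep_mem(1)[OF R]] A_perm[OF rep_mem(1)[OF R']] by blast
  show "finv f \<in> range eps \<union> range ep" if "f \<in> range eps \<union> range ep" for f
  proof -
    from that consider v where "f = eps v" | v where "f = ep v" by blast
    then have "finv f = f"
    proof cases
      case 1 show ?thesis unfolding 1 by (rule finv_invol) (rule rep_invol[OF R])
    next
      case 2 show ?thesis unfolding 2 by (rule finv_invol) (rule rep_invol[OF R'])
    qed
    then show ?thesis using that by simp
  qed
qed

lemma Qg_A: "Qg \<subseteq> A" unfolding Qg_def
  by (rule mgen_subset[OF _ pgA]) (use rep_mem(1)[OF R] rep_mem(1)[OF R'] in auto)

lemma Qg_base: "eps v \<in> Qg" "ep v \<in> Qg" unfolding Qg_def by (rule mgen_base, simp)+

lemma Qg_mem: "q \<in> Qg \<Longrightarrow> x \<in> \<Omega> \<Longrightarrow> q x \<in> \<Omega>" using Qg_A A_mem by blast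

text \<open>The orbits of \<open>P\<close> are permuted by the group generated by \<open>E\<close>
  and \<open>E'\<close>, although its elements need not commute with \<open>z\<close>.\<close>

lemma Qg_fib: assumes q: "q \<in> Qg" and x: "x \<in> \<Omega>" shows "\<exists>s. q ((z ^^ t) x) = (z ^^ s) (q x)"
  using q
proof (induction rule: Qg_induct)
  case id show ?case by blast
next
  case (eps v q)
  then obtain s where "q ((z ^^ t) x) = (z ^^ s) (q x)" by blast
  then have "eps v (q ((z ^^ t) x)) = (z ^^ s) (eps v (q x))" by (simp add: rep_zpow[OF R])
  then show ?case by blast
next
  case (ep v q)
  then obtain s where s: "q ((z ^^ t) x) = (z ^^ s) (q x)" by blast
  show ?case unfolding s using ep_fib[OF Qg_mem[OF ep(1) x]] .
qed

lemma Qg_cl: assumes q: "q \<in> Qg" and x: "x \<in> \<Omega>" and c: "cl L x y" shows "cl L (q x) (q y)"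
  using q
proof (induction rule: Qg_induct)
  case id show ?case using c .
next
  case (eps v q) then show ?case using cl_eps by blast
next
  case (ep v q) then show ?case using ep_cl[OF Qg_mem[OF ep(1) x]] by blast
qed

lemma commons_central: assumes v: "v \<in> commons ep" and q: "q \<in> Qg" shows "q (eps v x) = eps v (q x)"
  using q
proof (induction rule: Qg_induct)
  case (eps u q) then show ?case using rep_comm[OF R] by simp
next
  case (ep u q)
  obtain w where w: "eps v = ep w" using v unfolding commons_def by blast
  show ?case using ep(2) rep_comm[OF R', of u w] w by simp
qed simp

lemma commons_kap: assumes v: "v \<in> commons ep" and x: "x \<in> \<Omega>" shows "\<kappa> (eps v x) = \<kappa> x"
proof -
  obtain w where w: "eps v = ep w" using v unfolding commons_def by blast
  have vx: "eps v x \<in> \<Omega>" using rep_eps_mem[OF R x] .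
  have "(z ^^ \<kappa> (eps v x)) (eps v x) = z' (eps v x)" using kap(2)[OF vx] by simp
  also have "\<dots> = eps v (z' x)" unfolding w using rep_z[OF R'] by simp
  also have "\<dots> = (z ^^ \<kappa> x) (eps v x)" unfolding kap(2)[OF x] rep_zpow[OF R] ..
  finally have "(z ^^ \<kappa> (eps v x)) (eps v x) = (z ^^ \<kappa> x) (eps v x)" .
  from rep_free(2)[OF R x this] show ?thesis using kap(1)[OF x] kap(1)[OF vx] by simp
qed

end

end

section \<open>Reduction to a 2-group\<close>

context boolean_pair
begin

text \<open>A block of order at most 8 can be doubled by adjoining an element that is central modulo
  it.\<close>

lemma exists_half: "blk B \<Longrightarrow> B \<noteq> UNIV \<Longrightarrow> \<exists>E. blk E \<and> card E = 16 \<and> B \<subseteq> E"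
proof (induction "32 - card B" arbitrary: B rule: less_induct)
  case less
  note sg = blk_sg[OF less.prems(1)]
  have "card B < 32" using less.prems(2) card_V by (metis finite psubset_card_mono top.not_eq_extremum)
  show ?case
  proof (cases "card B = 16")
    case True then show ?thesis using less.prems by blast
  next
    case False
    then have "card B \<le> 8" using sg_card_cases[OF sg] \<open>card B < 32\<close> by linarith
    obtain v where v: "v \<in> Z B" "v \<notin> B" using Z_grows[OF less.prems] by blast
    have b: "blk (B \<union> (\<lambda>k. k + v) ` B)" unfolding blk_def
    proof (intro conjI ballI allI impI)
      show "sg (B \<union> (\<lambda>k. k + v) ` B)" using sg_double(1)[OF sg v(2)] .
      fix q x y assume q: "q \<in> Q" and xy: "x + y \<in> B \<union> (\<lambda>k. k + v) ` B"
      show "q x + q y \<in> B \<union> (\<lambda>k. k + v) ` B"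
      proof (cases "x + y \<in> B")
        case True then show ?thesis using blkD[OF less.prems(1) q] by blast
      next
        case False
        then obtain k where k: "k \<in> B" "x + y = k + v" using xy by blast
        have "(y + k) + v = y + (x + y)" using k(2) by (simp add: add.assoc)
        also have "\<dots> = x" by (simp add: nf)
        finally have x: "x = (y + k) + v" ..
        have 1: "q x + q (y + k) + v \<in> B" using Z_D[OF v(1) q, of "y + k"] unfolding x .
        have 2: "q (y + k) + q y \<in> B" using blkD[OF less.prems(1) q, of "y + k" y] k(1) by (simp add: nf)
        have "(q x + q y) + v \<in> B" using sgD(2)[OF sg 1 2] by (simp add: nf)
        moreover have "q x + q y = ((q x + q y) + v) + v" by (simp add: nf)
        ultimately show ?thesis by blast
      qed
    qed
    have c: "card (B \<union> (\<lambda>k. k + v) ` B) = 2 * card B" using sg_double(2)[OF sg v(2)] .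
    have "B \<union> (\<lambda>k. k + v) ` B \<noteq> UNIV" using c \<open>card B \<le> 8\<close> card_V by fastforce
    moreover have "32 - card (B \<union> (\<lambda>k. k + v) ` B) < 32 - card B" using c \<open>card B \<le> 8\<close> sg_card_pos[OF sg] by simp
    ultimately show ?thesis using less.hyps[OF _ b] by blast
  qed
qed

end

context base_rep
begin

lemma Dhyp_UNIV: "Dhyp UNIV" unfolding Dhyp_def
proof (intro allI impI)
  fix a :: "'a \<Rightarrow> nat" assume a: "\<forall>x\<in>\<Omega>. \<forall>y. cl UNIV x y \<longrightarrow> a x = a y"
  show "(\<lambda>x. if x \<in> \<Omega> then (z ^^ (a x)) x else x) \<in> A"
  proof (cases "\<Omega> = {}")
    case True then show ?thesis using A_id by simp
  next
    case False
    then obtain o' where o': "o' \<in> \<Omega>" by blast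
    have eq: "a x = a o'" if "x \<in> \<Omega>" for x
      using a o' rep_trans[OF R o' that] unfolding cl_def by (metis UNIV_I)
    have "(\<lambda>x. if x \<in> \<Omega> then (z ^^ (a x)) x else x) = (\<lambda>x. (z ^^ (a o')) x)"
    proof
      fix x show "(if x \<in> \<Omega> then (z ^^ (a x)) x else x) = (z ^^ (a o')) x"
        using eq[of x] A_out[OF A_pow[OF rep_mem(2)[OF R]], of x] by simp
    qed
    then show ?thesis using A_pow[OF rep_mem(2)[OF R]] by simp
  qed
qed

end

text \<open>The base point \<open>b\<close> is such that its orbit under the group generated by
  \<open>E\<close> and \<open>E'\<close> is no larger than its orbit under \<open>E\<close>; so this
  group acts on the 32 labels.\<close>

locale core = base_rep \<Omega> A p tv eps z
  for \<Omega> :: "'a set" and A p and tv :: "'v::{ab_group_add,finite} itself" and eps :: "'v \<Rightarrow> 'a \<Rightarrow> 'a" and z +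
  fixes L :: "'v set" and ep :: "'v \<Rightarrow> 'a \<Rightarrow> 'a" and z' :: "'a \<Rightarrow> 'a" and \<kappa> :: "'a \<Rightarrow> nat" and b :: 'a
  assumes adm: "adm L ep z' \<kappa>" and L: "sgv L" and D: "Dhyp L"
    and b: "b \<in> \<Omega>" and orbb: "orb (Qg ep) b = range (\<lambda>v. eps v b)"
    and Q2: "\<exists>k. card (Qg ep) = 2 ^ k"
begin

lemmas R'' = R'[OF adm L]
lemmas Qgp = Qg_group[OF adm L]

lemma eps_inj: "eps v b = eps u b \<longleftrightarrow> v = u"
  using rep_free(1)[OF R b, of 0 v 0 u] by auto

definition h :: "('a \<Rightarrow> 'a) \<Rightarrow> 'v \<Rightarrow> 'v" where
  "h q v = (THE u. q (eps v b) = eps u b)"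

lemma h_eq: "q (eps v b) = eps u b \<Longrightarrow> h q v = u"
  unfolding h_def using eps_inj by auto

lemma h_spec: assumes q: "q \<in> Qg ep" shows "q (eps v b) = eps (h q v) b"
proof -
  have "(\<lambda>x. q (eps v x)) \<in> Qg ep" using perm_group_mult_mem[OF Qgp q Qg_base(1)[OF adm L]] .
  from orbI[OF this, of b] have "q (eps v b) \<in> range (\<lambda>v. eps v b)" unfolding orbb by simp
  then obtain u where "q (eps v b) = eps u b" by blast
  then show ?thesis using h_eq by metis
qed

lemma h_comp: assumes "q \<in> Qg ep" "r \<in> Qg ep" shows "h (\<lambda>x. q (r x)) v = h q (h r v)"
  by (rule h_eq) (simp add: h_spec[OF assms(2)] h_spec[OF assms(1)])

lemma h_id: "h (\<lambda>x. x) v = v" by (rule h_eq) simp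

lemma h_eps: "h (eps u) v = v + u"
  by (rule h_eq) (simp add: rep_add[OF R, symmetric] add.commute)

lemma h_inj: assumes q: "q \<in> Qg ep" shows "h q v = h q u \<longleftrightarrow> v = u"
proof
  assume "h q v = h q u"
  then have "q (eps v b) = q (eps u b)" using h_spec[OF q] by simp
  then have "eps v b = eps u b" using A_inj[of q] Qg_A[OF adm L] q by blast
  then show "v = u" using eps_inj by blast
qed simp

text \<open>Relabels \<open>E'\<close> by the image of the base point, to match the normalisation
  \<open>ep v 0 = v\<close> of \<open>boolean_pair\<close>.\<close>

definition j :: "'v \<Rightarrow> 'v" where "j v = (SOME u. ep u b = eps v b)"

lemma j_spec: "ep (j v) b = eps v b"
proof -
  let ?f = "\<lambda>u. h (ep u) 0"
  have s: "ep u b = eps (?f u) b" for u using h_spec[OF Qg_base(2)[OF adm L], of u 0] rep_0[OF R] by simp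
  have "inj ?f"
  proof (rule injI)
    fix u v assume "?f u = ?f v"
    then have "(z' ^^ 0) (ep u b) = (z' ^^ 0) (ep v b)" using s by simp
    then show "u = v" by (rule rep_free(1)[OF R'' b])
  qed
  then have "surj ?f" by (rule finite_UNIV_inj_surj[OF finite])
  from surjD[OF this, of v] obtain u where "?f u = v" by (elim exE) simp
  then have "ep u b = eps v b" using s by metis
  then show ?thesis unfolding j_def by (rule someI)
qed

lemma j_surj: "\<exists>y. ep u = ep (j y)"
proof -
  have "ep u b = eps (h (ep u) 0) b" using h_spec[OF Qg_base(2)[OF adm L], of u 0] rep_0[OF R] by simp
  then have "(z' ^^ 0) (ep u b) = (z' ^^ 0) (ep (j (h (ep u) 0)) b)" using j_spec by simp
  from rep_free(1)[OF R'' b this] show ?thesis by metis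
qed

definition eh :: "'v \<Rightarrow> 'v \<Rightarrow> 'v" where "eh v = h (ep (j v))"

abbreviation "Qh \<equiv> h ` Qg ep"

lemma epj: "ep (j v) \<in> Qg ep" using Qg_base(2)[OF adm L] .

lemma eh_spec: "ep (j c) (eps v b) = eps (eh c v) b" unfolding eh_def using h_spec[OF epj] .

lemma eh_0: "eh v 0 = v" unfolding eh_def by (rule h_eq) (simp add: rep_0[OF R] j_spec)

lemma eh_comm: "eh u (eh v x) = eh v (eh u x)"
proof -
  have "eps (eh u (eh v x)) b = eps (eh v (eh u x)) b"
    unfolding eh_spec[symmetric] by (rule rep_comm[OF R''])
  then show ?thesis using eps_inj by blast
qed

lemma eh_invol: "eh v (eh v x) = x"
proof -
  have "eps (eh v (eh v x)) b = eps x b" unfolding eh_spec[symmetric] by (rule rep_invol[OF R''])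
  then show ?thesis using eps_inj by blast
qed

lemma bp: "boolean_pair Qh eh"
proof
  show "(x::'v) + x = 0" for x by simp
  show "card (UNIV :: 'v set) = 32" by (rule V32)
  show "perm_group UNIV Qh"
  proof (rule perm_groupI)
    have inv: "h (finv q) (h q v) = v" "h q (h (finv q) v) = v" if q: "q \<in> Qg ep" for q v
    proof -
      note qi = perm_groupD(4)[OF Qgp q]
      have "h (\<lambda>x. finv q (q x)) v = v" "h (\<lambda>x. q (finv q x)) v = v"
        unfolding perm_group_inv_apply[OF Qgp q] by (rule h_id)+
      then show "h (finv q) (h q v) = v" "h q (h (finv q) v) = v" using h_comp[OF qi q] h_comp[OF q qi] by simp_all
    qed
    fix f assume "f \<in> Qh"
    then obtain q where q: "q \<in> Qg ep" "f = h q" by blast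
    have bij: "bij (h q)" by (rule o_bij[of "h (finv q)"]) (simp_all add: fun_eq_iff inv[OF q(1)])
    then show "f permutes UNIV" using bij_imp_permutes[OF bij] q(2) by simp
    have "finv (h q) = h (finv q)" by (rule inv_unique_comp) (simp_all add: fun_eq_iff inv[OF q(1)])
    then show "finv f \<in> Qh" using q perm_groupD(4)[OF Qgp q(1)] by blast
    fix g assume "g \<in> Qh"
    then obtain r where r: "r \<in> Qg ep" "g = h r" by blast
    have "f \<circ> g = h (\<lambda>x. q (r x))" using h_comp[OF q(1) r(1)] q r by (simp add: fun_eq_iff)
    then show "f \<circ> g \<in> Qh" using perm_group_mult_mem[OF Qgp q(1) r(1)] by blast
  next
    have "id = h (\<lambda>x. x)" using h_id by (simp add: fun_eq_iff)
    moreover have "(\<lambda>x. x) \<in> Qg ep" using perm_groupD(2)[OF Qgp] by (simp add: id_def)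
    ultimately show "id \<in> Qh" by (rule image_eqI)
  qed
  obtain k where k: "card (Qg ep) = 2 ^ k" using Q2 by blast
  \<comment> \<open>The order of the group induced on labels divides that of \<open>Qg ep\<close>:
    under composition on maps of labels, the orbit of the identity is the induced group.\<close>
  have "card (Qg ep) = card ((\<lambda>g. (\<lambda>v. h g (id v))) ` Qg ep) * card {g\<in>Qg ep. (\<lambda>v. h g (id v)) = id}"
  proof (rule action_orbit_card[OF Qgp fin, where \<phi>="\<lambda>g c v. h g (c v)"])
    show "(\<lambda>v. h id (id v)) = (id :: 'v \<Rightarrow> 'v)" using h_id by (simp add: fun_eq_iff id_def)
    show "(\<lambda>v. h (f \<circ> g) (id v)) = (\<lambda>v. h f (h g (id v)))" if "f \<in> Qg ep" "g \<in> Qg ep" for f g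
      using h_comp[OF that] by (simp add: comp_def fun_eq_iff)
    show "d = e" if "f \<in> Qg ep" "(\<lambda>v. h f (d v)) = (\<lambda>v. h f (e v))" for f and d e :: "'v \<Rightarrow> 'v"
      using that(2) h_inj[OF that(1)] by (simp add: fun_eq_iff)
  qed
  then have "card Qh dvd 2 ^ k" unfolding k id_apply by (rule dvdI)
  then show "\<exists>k. card Qh = 2 ^ k" using divides_primepow_nat[OF two_is_prime_nat] by blast
  show "(\<lambda>x. x + v) \<in> Qh" for v
  proof -
    have "(\<lambda>x. x + v) = h (eps v)" using h_eps by (simp add: fun_eq_iff)
    then show ?thesis using Qg_base(1)[OF adm L] by blast
  qed
  show "eh v \<in> Qh" for v unfolding eh_def using epj by blast
  show "eh v 0 = v" for v by (rule eh_0)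
  show "eh u (eh v x) = eh v (eh u x)" for u v x by (rule eh_comm)
  show "eh v (eh v x) = x" for v x by (rule eh_invol)
  show "P q" if q: "q \<in> Qh" and P: "P id" "\<And>v r. P r \<Longrightarrow> P (\<lambda>x. r x + v)" "\<And>v r. P r \<Longrightarrow> P (\<lambda>x. eh v (r x))" for P q
  proof -
    obtain r where r: "r \<in> Qg ep" "q = h r" using q by blast
    have "P (h r)" using r(1)
    proof (induction rule: Qg_induct[OF adm L, consumes 1, case_names id eps ep])
      case id
      have "h (\<lambda>x. x) = id" using h_id by (simp add: fun_eq_iff)
      then show ?case using P(1) by (simp only:)
    next
      case (eps v q)
      have "h (\<lambda>x. eps v (q x)) = (\<lambda>x. h q x + v)"
        using h_comp[OF Qg_base(1)[OF adm L] eps(1)] h_eps by (simp add: fun_eq_iff)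
      then show ?case using P(2)[OF eps(2)] by simp
    next
      case (ep v q)
      obtain y where y: "ep v = ep (j y)" using j_surj by blast
      have "h (\<lambda>x. ep v (q x)) = (\<lambda>x. eh y (h q x))"
        unfolding y eh_def using h_comp[OF epj ep(1)] by (simp add: fun_eq_iff)
      then show ?case using P(3)[OF ep(2)] by simp
    qed
    then show ?thesis using r(2) by simp
  qed
qed

end

sublocale core \<subseteq> B: boolean_pair Qh eh by (rule bp)

context core
begin

section \<open>Points over a label, and the two moves inside \<open>A\<close>\<close>

definition vp :: "'a \<Rightarrow> 'v" where "vp x = (THE v. \<exists>t. x = (z ^^ t) (eps v b))"

lemma vpI: "vp ((z ^^ t) (eps v b)) = v"
  unfolding vp_def
proof (rule the_equality)
  show "\<exists>s. (z ^^ t) (eps v b) = (z ^^ s) (eps v b)" by blast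
  fix u assume "\<exists>s. (z ^^ t) (eps v b) = (z ^^ s) (eps u b)"
  then show "u = v" using rep_free(1)[OF R b] by blast
qed

lemma vp_ex: assumes "x \<in> \<Omega>" shows "\<exists>t. x = (z ^^ t) (eps (vp x) b)"
proof -
  obtain v t where "x = (z ^^ t) (eps v b)" using rep_trans[OF R b assms] by blast
  then show ?thesis using vpI by metis
qed

lemma eb: "eps v b \<in> \<Omega>" using rep_eps_mem[OF R b] .

lemma vp_z: assumes "x \<in> \<Omega>" shows "vp ((z ^^ t) x) = vp x"
proof -
  obtain s where "x = (z ^^ s) (eps (vp x) b)" using vp_ex[OF assms] by blast
  then have "(z ^^ t) x = (z ^^ (t + s)) (eps (vp x) b)" using zadd[OF R] by metis
  then show ?thesis using vpI by metis
qed

lemma vp_q: assumes q: "q \<in> Qg ep" and x: "x \<in> \<Omega>" shows "vp (q x) = h q (vp x)"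
proof -
  obtain t where t: "x = (z ^^ t) (eps (vp x) b)" using vp_ex[OF x] by blast
  obtain s where s: "q ((z ^^ t) (eps (vp x) b)) = (z ^^ s) (q (eps (vp x) b))"
    using Qg_fib[OF adm L q eb] by blast
  have "q x = (z ^^ s) (eps (h q (vp x)) b)" using s t h_spec[OF q] by metis
  then show ?thesis using vpI by metis
qed

lemma vp_eps: "x \<in> \<Omega> \<Longrightarrow> vp (eps v x) = vp x + v"
  using vp_q[OF Qg_base(1)[OF adm L]] h_eps by simp

lemma vp_epj: "x \<in> \<Omega> \<Longrightarrow> vp (ep (j v) x) = eh v (vp x)"
  using vp_q[OF epj] unfolding eh_def by simp

lemma fiber: assumes x: "x \<in> \<Omega>" and y: "y \<in> \<Omega>" and eq: "vp x = vp y" shows "\<exists>s. y = (z ^^ s) x"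
proof -
  obtain t where t: "x = (z ^^ t) (eps (vp x) b)" using vp_ex[OF x] by blast
  obtain s where s: "y = (z ^^ s) (eps (vp x) b)" using vp_ex[OF y] eq by metis
  obtain n where n: "(n + t) mod p = s mod p"
  proof
    show "((s + (p - t mod p)) + t) mod p = s mod p"
    proof -
      have "((s + (p - t mod p)) + t) mod p = ((s + (p - t mod p)) + t mod p) mod p" by (rule mod_add_right_eq[symmetric])
      also have "(s + (p - t mod p)) + t mod p = s + p" using mod_less_divisor[OF p_pos, of t] by linarith
      finally show ?thesis by simp
    qed
  qed
  have "(z ^^ n) x = (z ^^ (n + t)) (eps (vp x) b)" using t zadd[OF R] by metis
  also have "\<dots> = (z ^^ s) (eps (vp x) b)" using rep_zmod[OF R] n by metis
  finally show ?thesis using s by metis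
qed

lemma cl_vp: assumes x: "x \<in> \<Omega>" and y: "y \<in> \<Omega>" shows "cl L x y \<longleftrightarrow> vp x + vp y \<in> L"
proof
  assume "cl L x y"
  then obtain l t where l: "l \<in> L" "y = (z ^^ t) (eps l x)" unfolding cl_def by blast
  have "vp y = vp x + l" unfolding l(2) using vp_z[OF rep_eps_mem[OF R x]] vp_eps[OF x] by simp
  then show "vp x + vp y \<in> L" using l(1) by simp
next
  assume a: "vp x + vp y \<in> L"
  have "vp (eps (vp x + vp y) x) = vp y" using vp_eps[OF x] by simp
  from fiber[OF rep_eps_mem[OF R x] y this] show "cl L x y" unfolding cl_def using a by blast
qed

lemma blk_L: "B.blk L" unfolding B.blk_def
proof (intro conjI ballI allI impI)
  show "B.sg L" using L unfolding sgv_def B.sg_def .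
  fix q x y assume "q \<in> Qh" and xy: "x + y \<in> L"
  then obtain r where r: "r \<in> Qg ep" "q = h r" by blast
  have v: "vp (eps u b) = u" for u using vpI[of 0 u] by simp
  have "cl L (eps x b) (eps y b)" using cl_vp[OF eb eb] v xy by simp
  then have "cl L (r (eps x b)) (r (eps y b))" using Qg_cl[OF adm L r(1) eb] by blast
  then show "q x + q y \<in> L" unfolding h_spec[OF r(1)] r(2) using cl_vp[OF eb eb] v by simp
qed

lemma blk_commons: "B.blk (commons ep)" unfolding B.blk_def B.sg_def
proof (intro conjI ballI allI impI)
  have "eps 0 = ep 0" using rep_0[OF R] rep_0[OF R''] by (simp add: fun_eq_iff)
  then show "0 \<in> commons ep" unfolding commons_def by blast
  fix u v assume "u \<in> commons ep" "v \<in> commons ep"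
  then obtain u' v' where "eps u = ep u'" "eps v = ep v'" unfolding commons_def by blast
  then have "eps (u + v) = ep (u' + v')" using rep_add[OF R] rep_add[OF R''] by (simp add: fun_eq_iff)
  then show "u + v \<in> commons ep" unfolding commons_def by blast
next
  fix q x y assume "q \<in> Qh" and xy: "x + y \<in> commons ep"
  then obtain r where r: "r \<in> Qg ep" "q = h r" by blast
  have "r (eps (x + y) (eps x b)) = eps (x + y) (r (eps x b))" by (rule commons_central[OF adm L xy r(1)])
  moreover have "eps (x + y) (eps x b) = eps y b" using rep_add[OF R, of "x + y" x b] by (simp add: nf)
  ultimately have "r (eps y b) = eps (x + y) (r (eps x b))" by (simp only:)
  then have "eps (h r y) b = eps (x + y) (eps (h r x) b)" unfolding h_spec[OF r(1)] .
  then have "eps (h r y) b = eps ((x + y) + h r x) b" unfolding rep_add[OF R, of "x + y" "h r x" b] .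
  then have "h r y = (x + y) + h r x" using eps_inj by blast
  then show "q x + q y \<in> commons ep" using xy r(2) by (simp add: nf)
qed

text \<open>Points whose labels differ modulo \<open>L\<close> lie in different orbits of
  \<open>L \<times> P\<close>, on which \<open>P\<close> rotates independently. For such pairs it is
  enough to match labels.\<close>

lemma adjust:
  assumes x: "x \<in> \<Omega>" "x' \<in> \<Omega>" "vp x = vp x'" and y: "y \<in> \<Omega>" "y' \<in> \<Omega>" "vp y = vp y'" and n: "vp x + vp y \<notin> L"
  shows "\<exists>d\<in>A. d x = x' \<and> d y = y'"
proof -
  obtain s where s: "x' = (z ^^ s) x" using fiber[OF x(1,2,3)] by blast
  obtain t where t: "y' = (z ^^ t) y" using fiber[OF y(1,2,3)] by blast
  define a where "a u = (if vp u + vp x \<in> L then s else t)" for u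
  have "a u = a w" if "u \<in> \<Omega>" "cl L u w" for u w
  proof -
    have "vp u + vp w \<in> L" using cl_vp[OF that(1) cl_mem[OF that]] that(2) by blast
    then have "vp u + vp x \<in> L \<longleftrightarrow> vp w + vp x \<in> L"
      using B.sg_cancel[OF B.blk_sg[OF blk_L], of "vp u + vp w" "vp w + vp x"] by (simp add: nf)
    then show ?thesis unfolding a_def by simp
  qed
  then have "(\<lambda>x. if x \<in> \<Omega> then (z ^^ (a x)) x else x) \<in> A" using D unfolding Dhyp_def by blast
  moreover have "a x = s" "a y = t" unfolding a_def using n L by (auto simp: sgv_def nf)
  ultimately show ?thesis using s t x y by (intro bexI[of _ "\<lambda>x. if x \<in> \<Omega> then (z ^^ (a x)) x else x"]) auto
qed

end

context core
begin

lemma cl_UNIV: assumes "L = UNIV" "x \<in> \<Omega>" "y \<in> \<Omega>" shows "\<kappa> x = \<kappa> y"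
  using kap_cl[OF adm L assms(2)] cl_vp[OF assms(2,3)] assms(1) by blast

text \<open>With a single class there is a single exponent, so \<open>z\<close> is a power of
  \<open>z'\<close> and \<open>E'\<close> centralises \<open>P\<close>.\<close>

lemma q_z:
  assumes LU: "L = UNIV" and q: "q \<in> Qg ep" and x: "x \<in> \<Omega>"
  shows "q ((z ^^ t) x) = (z ^^ t) (q x)"
  using q
proof (induction rule: Qg_induct[OF adm L, consumes 1, case_names id eps ep])
  case (eps v q) then show ?case using rep_zpow[OF R] by simp
next
  case (ep v q)
  note qx = Qg_mem[OF adm L ep(1) x]
  obtain n where n: "(z ^^ t) (q x) = (z' ^^ n) (q x)" using z_pow'[OF adm L qx] by blast
  have "(z ^^ t) (eps 0 (q x)) = (z ^^ (n * \<kappa> (q x))) (eps 0 (q x))"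
    unfolding rep_0[OF R] n z'_pow[OF adm L qx] ..
  from rep_free(2)[OF R qx this] have m: "t mod p = (n * \<kappa> (q x)) mod p" .
  have epx: "ep v (q x) \<in> \<Omega>" using rep_eps_mem[OF R'' qx] .
  have "ep v ((z ^^ t) (q x)) = (z' ^^ n) (ep v (q x))" unfolding n by (rule rep_zpow[OF R''])
  also have "\<dots> = (z ^^ (n * \<kappa> (ep v (q x)))) (ep v (q x))" by (rule z'_pow[OF adm L epx])
  also have "\<kappa> (ep v (q x)) = \<kappa> (q x)" by (rule cl_UNIV[OF LU epx qx])
  also have "(z ^^ (n * \<kappa> (q x))) (ep v (q x)) = (z ^^ t) (ep v (q x))" using m rep_zmod[OF R] by metis
  finally show ?case using ep(2) by simp
qed simp

text \<open>Let \<open>\<delta>\<close> be the identity over \<open>U\<close> and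
  \<open>eps e \<circ> ep (j w)\<close> elsewhere. Pairs over one half are clear. Across the halves
  \<open>cross\<close> matches the labels; the fibres are then corrected by \<open>adjust\<close> if
  \<open>L \<subseteq> U\<close>, while for \<open>L = UNIV\<close> everything commutes with
  \<open>z\<close> and the fibres already match.\<close>

lemma half_move:
  assumes U: "B.blk U" "card U = 16" and C: "commons ep \<subseteq> U" and LU: "L \<subseteq> U \<or> L = UNIV" and e: "e \<notin> U" and w: "w \<notin> U"
    and cross: "\<And>x y. x \<in> U \<Longrightarrow> y \<notin> U \<Longrightarrow> \<exists>q\<in>Qh. q x = x \<and> q y = eh w y + e"
  shows "\<exists>\<delta>\<in>A. \<exists>\<kappa>2. adm L (\<lambda>v x. \<delta> (ep v (finv \<delta> x))) (\<lambda>x. \<delta> (z' (finv \<delta> x))) \<kappa>2 \<and>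
    commons ep \<subset> commons (\<lambda>v x. \<delta> (ep v (finv \<delta> x)))"
proof -
  note sgU = B.blk_sg[OF U(1)]
  have ixU: "u + v \<in> U" if "u \<notin> U" "v \<notin> U" for u v
    using B.index2[OF sgU B.sg_UNIV, of v u] that U(2) V32 by simp
  have mixU: "u + v \<notin> U" "v + u \<notin> U" if "u \<in> U" "v \<notin> U" for u v
    using B.sg_cancel[OF sgU that(1)] B.sg_cancel_right[OF sgU that(1)] that(2) by auto
  have ehw: "eh w w = 0" using eh_invol[of w 0] eh_0 by simp
  have hw1: "eh w v \<in> U" if "v \<notin> U" for v
  proof -
    have "eh w v + eh w w \<in> U" using B.blkD[OF U(1) B.ep_mem, of v w w] ixU[OF that w] by blast
    then show ?thesis using ehw by simp
  qed
  have hw2: "eh w v \<notin> U" if "v \<in> U" for v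
  proof
    assume "eh w v \<in> U"
    moreover have "eh w v + eh w 0 \<in> U" using B.blkD[OF U(1) B.ep_mem, of v 0 w] that by simp
    ultimately have "w \<in> U" using B.sg_cancel[OF sgU] eh_0 by simp
    then show False using w by blast
  qed
  define f where "f x = eps e (ep (j w) x)" for x
  have fQ: "f \<in> Qg ep" unfolding f_def using perm_group_mult_mem[OF Qgp Qg_base(1)[OF adm L] epj] .
  have fA: "f \<in> A" using fQ Qg_A[OF adm L] by blast
  have fvp: "vp (f x) = eh w (vp x) + e" if "x \<in> \<Omega>" for x
    unfolding f_def using vp_eps[OF rep_eps_mem[OF R'' that]] vp_epj[OF that] by simp
  have fm: "f x \<in> \<Omega>" if "x \<in> \<Omega>" for x using A_mem[OF fA that] .
  define \<delta> where "\<delta> x = (if x \<in> \<Omega> \<and> vp x \<notin> U then f x else x)" for x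
  define g where "g x = (if x \<in> \<Omega> \<and> vp x \<notin> U then ep (j w) (eps e x) else x)" for x
  have gm: "ep (j w) (eps e x) \<in> \<Omega>" "vp (ep (j w) (eps e x)) \<notin> U" if "x \<in> \<Omega>" "vp x \<notin> U" for x
  proof -
    show "ep (j w) (eps e x) \<in> \<Omega>" using rep_eps_mem[OF R'' rep_eps_mem[OF R that(1)]] .
    have "vp (ep (j w) (eps e x)) = eh w (vp x + e)" using vp_epj[OF rep_eps_mem[OF R that(1)]] vp_eps[OF that(1)] by simp
    then show "vp (ep (j w) (eps e x)) \<notin> U" using hw2 ixU[OF that(2) e] by simp
  qed
  have fU: "vp (f x) \<notin> U" if "x \<in> \<Omega>" "vp x \<notin> U" for x using fvp[OF that(1)] mixU(1)[OF hw1[OF that(2)] e] by simp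
  have d1: "\<delta> x = f x" "g x = ep (j w) (eps e x)" if "x \<in> \<Omega>" "vp x \<notin> U" for x
    unfolding \<delta>_def g_def using that by simp_all
  have d2: "\<delta> x = x" "g x = x" if "\<not> (x \<in> \<Omega> \<and> vp x \<notin> U)" for x
    unfolding \<delta>_def g_def by (simp_all only: that if_False)
  have dg: "\<delta> (g x) = x" "g (\<delta> x) = x" for x
  proof -
    show "\<delta> (g x) = x"
    proof (cases "x \<in> \<Omega> \<and> vp x \<notin> U")
      case True
      then have "\<delta> (g x) = f (ep (j w) (eps e x))" using d1(2)[of x] d1(1)[OF gm[of x]] by simp
      then show ?thesis unfolding f_def rep_invol[OF R''] rep_invol[OF R] .
    next
      case False show ?thesis unfolding d2(2)[OF False] by (rule d2(1)[OF False])
    qed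
    show "g (\<delta> x) = x"
    proof (cases "x \<in> \<Omega> \<and> vp x \<notin> U")
      case True
      then have "g (\<delta> x) = ep (j w) (eps e (f x))" using d1(1)[of x] d1(2)[OF fm[of x] fU[of x]] by simp
      then show ?thesis unfolding f_def rep_invol[OF R] rep_invol[OF R''] .
    next
      case False show ?thesis unfolding d2(1)[OF False] by (rule d2(2)[OF False])
    qed
  qed
  have perm: "\<delta> permutes \<Omega>" unfolding permutes_def
  proof (intro conjI allI impI)
    fix x assume "x \<notin> \<Omega>" then show "\<delta> x = x" by (simp add: \<delta>_def)
  next
    fix y show "\<exists>!x. \<delta> x = y" by (rule ex1I[of _ "g y"]) (use dg in auto)
  qed
  have fing: "finv \<delta> = g" by (rule inv_unique_comp) (simp_all add: fun_eq_iff dg)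
  have pair: "\<exists>a\<in>A. a x = x \<and> a y = f y" if x: "x \<in> \<Omega>" "vp x \<in> U" and y: "y \<in> \<Omega>" "vp y \<notin> U" for x y
  proof -
    obtain q where q: "q \<in> Qg ep" "h q (vp x) = vp x" "h q (vp y) = eh w (vp y) + e" using cross[OF x(2) y(2)] by blast
    have qA: "q \<in> A" using q(1) Qg_A[OF adm L] by blast
    note qx = A_mem[OF qA x(1)] and qy = A_mem[OF qA y(1)]
    have vq: "vp (q x) = vp x" "vp (q y) = vp (f y)" using vp_q[OF q(1)] q x y fvp by auto
    from LU show ?thesis
    proof
      assume "L \<subseteq> U"
      then have "vp (q x) + vp (q y) \<notin> L" using vq mixU(1)[OF x(2) fU[OF y]] by auto
      from adjust[OF qx x(1) vq(1) qy fm[OF y(1)] vq(2) this]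
      obtain d where d: "d \<in> A" "d (q x) = x" "d (q y) = f y" by blast
      show ?thesis by (rule bexI[OF _ A_comp[OF d(1) qA]]) (use d in simp)
    next
      assume LU: "L = UNIV"
      obtain t where t: "x = (z ^^ t) (eps (vp x) b)" using vp_ex[OF x(1)] by blast
      obtain s where s: "y = (z ^^ s) (eps (vp y) b)" using vp_ex[OF y(1)] by blast
      have "q ((z ^^ t) (eps (vp x) b)) = (z ^^ t) (eps (vp x) b)"
        unfolding q_z[OF LU q(1) eb] h_spec[OF q(1)] q(2) ..
      then have 1: "q x = x" using t by simp
      have "f (eps (vp y) b) = eps (eh w (vp y) + e) b"
        unfolding f_def eh_spec rep_add[OF R, symmetric] by (simp add: add.commute)
      then have "q ((z ^^ s) (eps (vp y) b)) = f ((z ^^ s) (eps (vp y) b))"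
        unfolding q_z[OF LU q(1) eb] q_z[OF LU fQ eb] h_spec[OF q(1)] q(3) by simp
      then have "q y = f y" using s by simp
      then show ?thesis using 1 qA by blast
    qed
  qed
  have \<delta>A: "\<delta> \<in> A"
  proof (rule closed2[OF perm])
    fix x y assume x: "x \<in> \<Omega>" and y: "y \<in> \<Omega>"
    show "\<exists>a\<in>A. a x = \<delta> x \<and> a y = \<delta> y"
    proof (cases "vp x \<in> U"; cases "vp y \<in> U")
      assume "vp x \<in> U" "vp y \<in> U"
      then show ?thesis using A_id unfolding \<delta>_def by (intro bexI[of _ "\<lambda>x. x"]) auto
    next
      assume "vp x \<in> U" "vp y \<notin> U"
      then show ?thesis using pair[OF x _ y] x y unfolding \<delta>_def by simp
    next
      assume "vp x \<notin> U" "vp y \<in> U"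
      then obtain a where "a \<in> A" "a y = y" "a x = f x" using pair[OF y _ x] by blast
      then show ?thesis using \<open>vp x \<notin> U\<close> \<open>vp y \<in> U\<close> x y unfolding \<delta>_def by auto
    next
      assume "vp x \<notin> U" "vp y \<notin> U"
      then show ?thesis using fA x y unfolding \<delta>_def by auto
    qed
  qed
  \<comment> \<open>On the moved half the conjugate of \<open>z'\<close> acts at \<open>x\<close>
    with the exponent found at \<open>eps e x\<close>.\<close>
  define \<kappa>2 where "\<kappa>2 x = (if x \<in> \<Omega> \<and> vp x \<notin> U then \<kappa> (eps e x) else \<kappa> x)" for x
  have z'm: "z' x \<in> \<Omega>" "vp (z' x) = vp x" if "x \<in> \<Omega>" for x
    using A_mem[OF rep_mem(2)[OF R''] that] vp_z[OF that] kap(2)[OF adm L that] by auto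
  have z2: "\<delta> (z' (g x)) = (z ^^ \<kappa>2 x) x" if x: "x \<in> \<Omega>" for x
  proof (cases "vp x \<in> U")
    case True
    then show ?thesis using x z'm[OF x] kap(2)[OF adm L x] unfolding \<delta>_def g_def \<kappa>2_def by simp
  next
    case False
    note y = gm[OF x False]
    let ?y = "ep (j w) (eps e x)"
    have "\<delta> (z' (g x)) = f (z' ?y)" using x False z'm[OF y(1)] y unfolding g_def \<delta>_def by simp
    also have "\<dots> = eps e (z' (ep (j w) ?y))" unfolding f_def rep_z[OF R''] ..
    also have "\<dots> = eps e (z' (eps e x))" unfolding rep_invol[OF R''] ..
    also have "\<dots> = (z ^^ \<kappa> (eps e x)) x"
      unfolding kap(2)[OF adm L rep_eps_mem[OF R x]] rep_zpow[OF R] rep_invol[OF R] ..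
    finally show ?thesis using x False unfolding \<kappa>2_def by simp
  qed
  have same: "vp x \<in> U \<longleftrightarrow> vp y \<in> U" if "L \<subseteq> U" "x \<in> \<Omega>" "cl L x y" for x y
  proof -
    have "vp x + vp y \<in> U" using cl_vp[OF that(2) cl_mem[OF that(2,3)]] that by blast
    then show ?thesis using B.sg_cancel[OF sgU, of "vp x + vp y" "vp y"] by (simp add: nf)
  qed
  have clL: "cl L x y" if "L = UNIV" "x \<in> \<Omega>" "y \<in> \<Omega>" for x y using cl_vp[OF that(2,3)] that(1) by simp
  have a1: "\<kappa>2 x = \<kappa>2 y" if x: "x \<in> \<Omega>" and c: "cl L x y" for x y
  proof -
    note y = cl_mem[OF x c]
    from LU show ?thesis
    proof
      assume LU: "L \<subseteq> U"
      have "\<kappa> x = \<kappa> y" "\<kappa> (eps e x) = \<kappa> (eps e y)"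
        using kap_cl[OF adm L x c] kap_cl[OF adm L rep_eps_mem[OF R x] cl_eps[OF c]] by auto
      then show ?thesis unfolding \<kappa>2_def by (simp only: same[OF LU x c] x y)
    next
      assume LU: "L = UNIV"
      have c: "\<kappa>2 u = \<kappa> b" if "u \<in> \<Omega>" for u
        unfolding \<kappa>2_def using cl_UNIV[OF LU that b] cl_UNIV[OF LU rep_eps_mem[OF R that] b] by simp
      show ?thesis unfolding c[OF x] c[OF y] ..
    qed
  qed
  have dcl: "cl L (\<delta> x) (\<delta> y)" and gcl: "cl L (g x) (g y)" if LU: "L \<subseteq> U" and x: "x \<in> \<Omega>" and c: "cl L x y" for x y
  proof -
    note y = cl_mem[OF x c]
    have "cl L (f x) (f y)" using Qg_cl[OF adm L fQ x c] .
    then show "cl L (\<delta> x) (\<delta> y)" using c unfolding \<delta>_def by (cases "vp y \<in> U") (simp_all only: same[OF LU x c] x y simp_thms if_True if_False)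
    have "cl L (ep (j w) (eps e x)) (ep (j w) (eps e y))" using ep_cl[OF adm L rep_eps_mem[OF R x] cl_eps[OF c]] .
    then show "cl L (g x) (g y)" using c unfolding g_def by (cases "vp y \<in> U") (simp_all only: same[OF LU x c] x y simp_thms if_True if_False)
  qed
  have dm: "\<delta> x \<in> \<Omega>" "g x \<in> \<Omega>" if "x \<in> \<Omega>" for x
    using A_mem[OF \<delta>A that] gm[OF that] that unfolding g_def by auto
  have a2: "cl L (\<delta> (ep v (g x))) (\<delta> (ep v (g y)))" if x: "x \<in> \<Omega>" and c: "cl L x y" for v x y
    using LU
  proof
    assume LU: "L \<subseteq> U"
    have "cl L (ep v (g x)) (ep v (g y))" using ep_cl[OF adm L dm(2)[OF x] gcl[OF LU x c]] .
    then show ?thesis using dcl[OF LU rep_eps_mem[OF R'' dm(2)[OF x]]] by blast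
  next
    assume "L = UNIV"
    then show ?thesis
      by (rule clL) (rule dm(1)[OF rep_eps_mem[OF R'' dm(2)[OF x]]] dm(1)[OF rep_eps_mem[OF R'' dm(2)[OF cl_mem[OF x c]]]])+
  qed
  have adm2: "adm L (\<lambda>v x. \<delta> (ep v (finv \<delta> x))) (\<lambda>x. \<delta> (z' (finv \<delta> x))) \<kappa>2"
    unfolding adm_def
  proof (intro conjI ballI allI impI)
    show "Rep (\<lambda>v x. \<delta> (ep v (finv \<delta> x))) (\<lambda>x. \<delta> (z' (finv \<delta> x)))" by (rule rep_conj[OF R'' \<delta>A])
    fix x assume x: "x \<in> \<Omega>"
    show "\<kappa>2 x < p" unfolding \<kappa>2_def using kap(1)[OF adm L] x rep_eps_mem[OF R x] by simp
    show "\<delta> (z' (finv \<delta> x)) = (z ^^ \<kappa>2 x) x" unfolding fing by (rule z2[OF x])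
    fix y assume c: "cl L x y"
    show "\<kappa>2 x = \<kappa>2 y" by (rule a1[OF x c])
    show "cl L (\<delta> (ep v (finv \<delta> x))) (\<delta> (ep v (finv \<delta> y)))" for v unfolding fing by (rule a2[OF x c])
  qed
  have sub: "commons ep \<subseteq> commons (\<lambda>v x. \<delta> (ep v (finv \<delta> x)))"
  proof
    fix v assume v: "v \<in> commons ep"
    then obtain u where u: "eps v = ep u" unfolding commons_def by blast
    have vU: "v \<in> U" using v C by blast
    have "\<delta> (eps v y) = eps v (\<delta> y)" for y
    proof (cases "y \<in> \<Omega>")
      case True
      have "vp (eps v y) \<in> U \<longleftrightarrow> vp y \<in> U" unfolding vp_eps[OF True] using B.sg_cancel_right[OF sgU vU] .
      then show ?thesis using True rep_eps_mem[OF R True] commons_central[OF adm L v fQ] unfolding \<delta>_def by simp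
    next
      case False
      then show ?thesis using A_out[OF rep_mem(1)[OF R]] A_out[OF \<delta>A] by simp
    qed
    then have "eps v = (\<lambda>x. \<delta> (ep u (finv \<delta> x)))" unfolding u[symmetric] fing using dg by (simp add: fun_eq_iff)
    then show "v \<in> commons (\<lambda>v x. \<delta> (ep v (finv \<delta> x)))" unfolding commons_def by blast
  qed
  \<comment> \<open>\<open>\<delta>\<close> conjugates \<open>ep (j w)\<close> into
    \<open>eps e\<close>. The label \<open>e\<close> is new, since the old common labels lie in
    \<open>U\<close>.\<close>
  have "eps e x = \<delta> (ep (j w) (g x))" for x
  proof (cases "x \<in> \<Omega>")
    case x: True
    show ?thesis
    proof (cases "vp x \<in> U")
      case True
      have "vp (ep (j w) x) \<notin> U" using vp_epj[OF x] hw2[OF True] by simp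
      then show ?thesis using x True rep_eps_mem[OF R'' x] rep_invol[OF R''] unfolding g_def \<delta>_def f_def by simp
    next
      case False
      have "vp (eps e x) \<in> U" using vp_eps[OF x] ixU[OF False e] by simp
      then show ?thesis using x False rep_invol[OF R''] unfolding g_def \<delta>_def by simp
    qed
  next
    case False
    then show ?thesis using A_out[OF rep_mem(1)[OF R]] A_out[OF rep_mem(1)[OF R'']] unfolding \<delta>_def g_def by simp
  qed
  then have "eps e = (\<lambda>x. \<delta> (ep (j w) (finv \<delta> x)))" unfolding fing by (simp add: fun_eq_iff)
  then have "e \<in> commons (\<lambda>v x. \<delta> (ep v (finv \<delta> x)))" unfolding commons_def by blast
  then show ?thesis using \<delta>A adm2 sub e C by blast
qed

lemma ep_pow: "ep (j c) ((z' ^^ s) (eps v b)) = (z' ^^ s) (eps (eh c v) b)"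
  unfolding rep_zpow[OF R''] eh_spec ..

lemma eps_pow: "eps c ((z' ^^ s) (eps v b)) = (z ^^ (s * \<kappa> (eps v b))) (eps (v + c) b)"
  unfolding z'_pow[OF adm L eb] rep_zpow[OF R] rep_add[OF R, symmetric] by (simp add: add.commute)

lemma z'_form: assumes "x \<in> \<Omega>" shows "\<exists>s. x = (z' ^^ s) (eps (vp x) b)"
  using vp_ex[OF assms] z_pow'[OF adm L eb] by metis

text \<open>The conjugating permutation is written down directly: on labels it turns
  \<open>eh\<close> into addition, and on every fibre it turns \<open>z'\<close> into the fixed
  power \<open>k0\<close> of \<open>z\<close>. For pairs in different classes, matching labels
  suffices. For pairs in one class, elements of \<open>E'\<close> with labels in \<open>Y\<close>
  carry the points into the class of the base point, where the exponent is \<open>k0\<close>; the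
  element \<open>w\<close> of \<open>L\<close> outside \<open>Y\<close> links the two
  halves.\<close>

lemma final_move:
  assumes Y: "B.blk Y" "card Y = 16" and on: "\<And>y x. y \<in> Y \<Longrightarrow> x \<in> Y \<Longrightarrow> eh y x = x + y"
    and w: "w \<in> L" "w \<notin> Y"
  shows "Conj eps z ep z'"
proof -
  note sgY = B.blk_sg[OF Y(1)] and sgL = B.blk_sg[OF blk_L]
  have ixY: "u + v \<in> Y" if "u \<notin> Y" "v \<notin> Y" for u v
    using B.index2[OF sgY B.sg_UNIV, of v u] that Y(2) V32 by simp
  have ehw: "eh w w = 0" using eh_invol[of w 0] eh_0 by simp
  have hw1: "eh w v \<in> Y" if "v \<notin> Y" for v
  proof -
    have "eh w v + eh w w \<in> Y" using B.blkD[OF Y(1) B.ep_mem, of v w w] ixY[OF that w(2)] by blast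
    then show ?thesis using ehw by simp
  qed
  have hw2: "eh w v \<notin> Y" if "v \<in> Y" for v
  proof
    assume "eh w v \<in> Y"
    moreover have "eh w v + eh w 0 \<in> Y" using B.blkD[OF Y(1) B.ep_mem, of v 0 w] that by simp
    ultimately have "w \<in> Y" using B.sg_cancel[OF sgY] eh_0 by simp
    then show False using w by blast
  qed
  have wY: "u + w \<notin> Y" if "u \<in> Y" for u using B.sg_cancel[OF sgY that] w(2) by blast
  have ehL: "eh w u + u \<in> L" for u
  proof -
    have "eh u w + eh u 0 \<in> L" using B.blkD[OF blk_L B.ep_mem, of w 0 u] w(1) by simp
    then show ?thesis unfolding eh_0 B.ep_swap[of u w] .
  qed
  define k0 where "k0 = \<kappa> b"
  have kL: "\<kappa> (eps u b) = k0" if "u \<in> L" for u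
  proof -
    have "vp (eps u b) = u" "vp b = 0" using vpI[of 0 u] vpI[of 0 0] rep_0[OF R] by auto
    then have "cl L b (eps u b)" using cl_vp[OF b eb] that by simp
    from kap_cl[OF adm L b this] show ?thesis unfolding k0_def by simp
  qed
  \<comment> \<open>An isomorphism from the group law \<open>eh\<close> to addition, see
    \<open>\<gamma>eh\<close>; it changes labels only by elements of \<open>L\<close>.\<close>
  define \<gamma> where "\<gamma> v = (if v \<in> Y then v else eh w v + w)" for v
  have \<gamma>Y: "\<gamma> v \<in> Y \<longleftrightarrow> v \<in> Y" for v unfolding \<gamma>_def using wY hw1 by simp
  have \<gamma>inj: "\<gamma> u = \<gamma> v \<Longrightarrow> u = v" for u v
  proof -
    assume eq: "\<gamma> u = \<gamma> v"
    then have "u \<in> Y \<longleftrightarrow> v \<in> Y" using \<gamma>Y by metis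
    then have "u = v \<or> eh w u = eh w v" using eq unfolding \<gamma>_def by (auto split: if_splits)
    then show "u = v" using eh_invol by metis
  qed
  have \<gamma>L: "\<gamma> v + v \<in> L" for v
  proof (cases "v \<in> Y")
    case True then show ?thesis unfolding \<gamma>_def using B.sgD(1)[OF sgL] by simp
  next
    case False
    have "(eh w v + v) + w \<in> L" using B.sgD(2)[OF sgL ehL w(1)] .
    then show ?thesis unfolding \<gamma>_def using False by (simp add: nf)
  qed
  define si where "si x = (SOME s. x = (z' ^^ s) (eps (vp x) b))" for x
  have si: "x = (z' ^^ si x) (eps (vp x) b)" if "x \<in> \<Omega>" for x unfolding si_def using someI_ex[OF z'_form[OF that]] .
  define \<delta> where "\<delta> x = (if x \<in> \<Omega> then (z ^^ (si x * k0)) (eps (\<gamma> (vp x)) b) else x)" for x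
  have vz': "vp ((z' ^^ s) (eps v b)) = v" for s v unfolding z'_pow[OF adm L eb] vpI ..
  have zm': "(z' ^^ s) (eps v b) \<in> \<Omega>" for s v using rep_zpow_mem[OF R'' eb] .
  have \<delta>eq: "\<delta> ((z' ^^ s) (eps v b)) = (z ^^ (s * k0)) (eps (\<gamma> v) b)" for s v
  proof -
    let ?x = "(z' ^^ s) (eps v b)"
    have "(z' ^^ s) (ep 0 (eps v b)) = (z' ^^ si ?x) (ep 0 (eps v b))" unfolding rep_0[OF R''] using si[OF zm', of s v] vz' by simp
    from rep_free(2)[OF R'' eb this] have "s mod p = si ?x mod p" .
    then have "(si ?x * k0) mod p = (s * k0) mod p" by (metis mod_mult_left_eq)
    then have "(z ^^ (si ?x * k0)) (eps (\<gamma> v) b) = (z ^^ (s * k0)) (eps (\<gamma> v) b)" using rep_zmod[OF R] by metis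
    then show ?thesis unfolding \<delta>_def using zm' vz' by simp
  qed
  have \<delta>m: "\<delta> x \<in> \<Omega>" if "x \<in> \<Omega>" for x unfolding \<delta>_def using that rep_zpow_mem[OF R eb] by simp
  have \<delta>inj: "inj_on \<delta> \<Omega>"
  proof (rule inj_onI)
    fix x y assume x: "x \<in> \<Omega>" and y: "y \<in> \<Omega>" and eq: "\<delta> x = \<delta> y"
    have e: "(z ^^ (si x * k0)) (eps (\<gamma> (vp x)) b) = (z ^^ (si y * k0)) (eps (\<gamma> (vp y)) b)" using eq x y unfolding \<delta>_def by simp
    have v: "vp x = vp y" using \<gamma>inj[OF rep_free(1)[OF R b e]] .
    have m: "(si x * k0) mod p = (si y * k0) mod p" using rep_free(2)[OF R b e] .
    obtain i where i: "(k0 * i) mod p = 1" using inverse_mod_p[OF kap_ndvd[OF adm L b]] unfolding k0_def by blast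
    have c: "s mod p = (((s * k0) mod p) * i) mod p" for s
    proof -
      have "(((s * k0) mod p) * i) mod p = (s * k0 * i) mod p" by (rule mod_mult_left_eq)
      also have "\<dots> = (s * ((k0 * i) mod p)) mod p" by (simp only: mod_mult_right_eq mult.assoc)
      finally show ?thesis unfolding i by simp
    qed
    have "si x mod p = si y mod p" using c[of "si x"] c[of "si y"] m by simp
    then have "(z' ^^ si x) (eps (vp y) b) = (z' ^^ si y) (eps (vp y) b)" using rep_zmod[OF R''] by metis
    then show "x = y" using si[OF x] si[OF y] v by simp
  qed
  have "\<delta> ` \<Omega> = \<Omega>" by (rule endo_inj_surj[OF fin _ \<delta>inj]) (use \<delta>m in blast)
  then have bij: "bij_betw \<delta> \<Omega> \<Omega>" using \<delta>inj unfolding bij_betw_def by blast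
  have perm: "\<delta> permutes \<Omega>" by (rule bij_imp_permutes[OF bij]) (simp add: \<delta>_def)
  \<comment> \<open>The factor from \<open>E'\<close> moves the label \<open>v\<close> to
    \<open>eh c v\<close>. When this lies in \<open>L\<close>, the power of \<open>z'\<close> is
    read with the exponent \<open>k0\<close> before the translation by \<open>c\<close> is
    applied.\<close>
  define G where "G c x = eps c (ep (j c) x)" for c x
  have GA: "G c \<in> A" "G c \<in> Qg ep" for c
  proof -
    show q: "G c \<in> Qg ep" unfolding G_def using perm_group_mult_mem[OF Qgp Qg_base(1)[OF adm L] epj] .
    then show "G c \<in> A" using Qg_A[OF adm L] by blast
  qed
  have Gon: "G c ((z' ^^ s) (eps v b)) = (z ^^ (s * k0)) (eps v b)" if "c \<in> Y" "v \<in> Y" "v + c \<in> L" for c v s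
    unfolding G_def ep_pow on[OF that(1,2)] eps_pow kL[OF that(3)] by (simp add: nf)
  have Goff: "G (eh w u) ((z' ^^ s) (eps u b)) = (z ^^ (s * k0)) (eps (eh w u + w) b)" for u s
  proof -
    have "eh u (eh w u) = eh w (eh u u)" by (rule eh_comm)
    also have "eh u u = 0" using eh_invol[of u 0] eh_0 by simp
    finally have "eh (eh w u) u = w" unfolding eh_0 B.ep_swap[of "eh w u" u] .
    then show ?thesis unfolding G_def ep_pow eps_pow using kL[OF w(1)] by (simp add: add.commute)
  qed
  have vv': "vp (\<delta> x) = \<gamma> (vp x)" if "x \<in> \<Omega>" for x unfolding \<delta>_def using that vpI by simp
  have \<delta>x: "\<delta> x = (z ^^ (si x * k0)) (eps (\<gamma> (vp x)) b)" if "x \<in> \<Omega>" for x unfolding \<delta>_def using that by simp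
  have far: "\<exists>a\<in>A. a x = \<delta> x \<and> a y = \<delta> y"
    if x: "x \<in> \<Omega>" and y: "y \<in> \<Omega>" and n: "vp x + vp y \<notin> L" and q: "q \<in> Qg ep" "vp (q x) = \<gamma> (vp x)" "vp (q y) = \<gamma> (vp y)" for x y q
  proof -
    have qA: "q \<in> A" using q(1) Qg_A[OF adm L] by blast
    have "\<gamma> (vp x) + \<gamma> (vp y) \<notin> L"
    proof
      assume "\<gamma> (vp x) + \<gamma> (vp y) \<in> L"
      then have "(\<gamma> (vp x) + \<gamma> (vp y)) + ((\<gamma> (vp x) + vp x) + (\<gamma> (vp y) + vp y)) \<in> L" using \<gamma>L B.sgD(2)[OF sgL] by blast
      then show False using n by (simp add: nf)
    qed
    then obtain d where d: "d \<in> A" "d (q x) = \<delta> x" "d (q y) = \<delta> y"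
      using adjust[OF A_mem[OF qA x] \<delta>m[OF x] _ A_mem[OF qA y] \<delta>m[OF y]] vv' x y q(2,3) by auto
    then show ?thesis by (intro bexI[OF _ A_comp[OF d(1) qA]] conjI)
  qed
  have cross: "\<exists>a\<in>A. a x = \<delta> x \<and> a y = \<delta> y" if x: "x \<in> \<Omega>" "vp x \<in> Y" and y: "y \<in> \<Omega>" "vp y \<notin> Y" for x y
  proof -
    define c where "c = eh w (vp y)"
    have cY: "c \<in> Y" unfolding c_def using hw1[OF y(2)] .
    have Gy: "G c y = \<delta> y" unfolding \<delta>x[OF y(1)] c_def \<gamma>_def using Goff[of "vp y" "si y", folded si[OF y(1)]] y(2) by simp
    show ?thesis
    proof (cases "vp x + vp y \<in> L")
      case True
      have "(vp x + vp y) + (c + vp y) \<in> L" unfolding c_def using B.sgD(2)[OF sgL True ehL] .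
      then have "vp x + c \<in> L" by (simp add: nf)
      from Gon[OF cY x(2) this, of "si x", folded si[OF x(1)]] have "G c x = \<delta> x" unfolding \<delta>x[OF x(1)] \<gamma>_def using x(2) by simp
      then show ?thesis using Gy GA by blast
    next
      case False
      have "vp (G c x) = vp x" unfolding G_def
        using vp_eps[OF rep_eps_mem[OF R'' x(1)]] vp_epj[OF x(1)] on[OF cY x(2)] by (simp add: nf)
      then have "vp (G c x) = \<gamma> (vp x)" unfolding \<gamma>_def using x(2) by simp
      moreover have "vp (G c y) = \<gamma> (vp y)" unfolding Gy by (rule vv'[OF y(1)])
      ultimately show ?thesis by (rule far[OF x(1) y(1) False GA(2)])
    qed
  qed
  have \<delta>A: "\<delta> \<in> A"
  proof (rule closed2[OF perm])
    fix x y assume x: "x \<in> \<Omega>" and y: "y \<in> \<Omega>"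
    show "\<exists>a\<in>A. a x = \<delta> x \<and> a y = \<delta> y"
    proof (cases "vp x \<in> Y"; cases "vp y \<in> Y")
      assume vx: "vp x \<in> Y" and vy: "vp y \<in> Y"
      show ?thesis
      proof (cases "vp x + vp y \<in> L")
        case True
        have "G (vp x) x = \<delta> x" unfolding \<delta>x[OF x] \<gamma>_def
          using Gon[OF vx vx, of "si x", folded si[OF x]] vx B.sgD(1)[OF sgL] by simp
        moreover have "G (vp x) y = \<delta> y" unfolding \<delta>x[OF y] \<gamma>_def
          using Gon[OF vx vy, of "si y", folded si[OF y]] vy True by (simp add: add.commute)
        ultimately show ?thesis using GA by blast
      next
        case False
        have "(\<lambda>x. x) \<in> Qg ep" using perm_groupD(2)[OF Qgp] by (simp add: id_def)
        from far[OF x y False this] show ?thesis using vx vy unfolding \<gamma>_def by simp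
      qed
    next
      assume vx: "vp x \<in> Y" and vy: "vp y \<notin> Y"
      then show ?thesis using cross[OF x _ y] by blast
    next
      assume vx: "vp x \<notin> Y" and vy: "vp y \<in> Y"
      then show ?thesis using cross[OF y _ x] by blast
    next
      assume vx: "vp x \<notin> Y" and vy: "vp y \<notin> Y"
      define c where "c = eh w (vp x)"
      have cY: "c \<in> Y" unfolding c_def using hw1[OF vx] .
      have uY: "eh w (vp y) \<in> Y" using hw1[OF vy] .
      show ?thesis
      proof (cases "vp x + vp y \<in> L")
        case True
        \<comment> \<open>\<open>ep (j w)\<close> first brings both labels into \<open>Y\<close>,
          where \<open>G c\<close> handles them; the translation by \<open>w\<close> then leads off
          \<open>Y\<close> again.\<close>
        define a where "a u = eps w (G c (ep (j w) u))" for u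
        have aA: "a \<in> A" unfolding a_def using A_comp[OF rep_mem(1)[OF R] A_comp[OF GA(1) rep_mem(1)[OF R'']]] .
        have key: "a ((z' ^^ s) (eps u b)) = (z ^^ (s * k0)) (eps (eh w u + w) b)" if "eh w u \<in> Y" "eh w u + c \<in> L" for s u
          unfolding a_def ep_pow Gon[OF cY that] rep_zpow[OF R] rep_add[OF R, symmetric] by (simp add: add.commute)
        have "eh w (vp y) + c \<in> L" unfolding c_def using B.blkD[OF blk_L B.ep_mem, of "vp y" "vp x" w] True by (simp add: add.commute)
        from key[OF uY this, of "si y", folded si[OF y]] have 1: "a y = \<delta> y" unfolding \<delta>x[OF y] \<gamma>_def using vy by simp
        have "eh w (vp x) + c \<in> L" unfolding c_def using B.sgD(1)[OF sgL] by simp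
        from key[OF hw1[OF vx] this, of "si x", folded si[OF x]] have "a x = \<delta> x" unfolding \<delta>x[OF x] \<gamma>_def using vx by simp
        then show ?thesis using 1 aA by blast
      next
        case False
        have q: "(\<lambda>u. eps w (ep (j w) u)) \<in> Qg ep" using perm_group_mult_mem[OF Qgp Qg_base(1)[OF adm L] epj] .
        have "vp (eps w (ep (j w) u)) = eh w (vp u) + w" if "u \<in> \<Omega>" for u
          using vp_eps[OF rep_eps_mem[OF R'' that]] vp_epj[OF that] by simp
        then show ?thesis using far[OF x y False q] x y vx vy unfolding \<gamma>_def by simp
      qed
    qed
  qed
  have \<gamma>eh: "\<gamma> (eh c v) = \<gamma> v + \<gamma> c" for c v
  proof -
    have yon: "\<gamma> (eh c v) = \<gamma> v + c" if c: "c \<in> Y" for c v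
    proof (cases "v \<in> Y")
      case True
      then show ?thesis unfolding \<gamma>_def using on[OF c True] B.sgD(2)[OF sgY True c] by simp
    next
      case False
      have "eh c v + eh c 0 \<in> Y \<longleftrightarrow> v + 0 \<in> Y" by (rule B.blk_iff[OF Y(1) B.ep_mem])
      then have "eh c v \<notin> Y" using False c B.sg_cancel_right[OF sgY c] eh_0 by simp
      moreover have "eh w (eh c v) = eh w v + c" using eh_comm[of w c v] on[OF c hw1[OF False]] by simp
      ultimately show ?thesis unfolding \<gamma>_def using False by (simp add: nf)
    qed
    have won: "\<gamma> (eh w v) = \<gamma> v + w" for v
      unfolding \<gamma>_def using hw1 hw2 eh_invol by (simp add: nf)
    show ?thesis
    proof (cases "c \<in> Y")
      case True then show ?thesis using yon unfolding \<gamma>_def[of c] by simp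
    next
      case False
      define d where "d = eh w c"
      have d: "d \<in> Y" "c = eh w d" unfolding d_def using hw1[OF False] eh_invol by auto
      have "eh c v = eh w (eh d v)"
        unfolding d(2) by (metis B.ep_comm B.ep_swap)
      then have "\<gamma> (eh c v) = \<gamma> v + d + w" using won yon[OF d(1)] by simp
      then show ?thesis unfolding \<gamma>_def[of c] using False d_def by (simp add: nf)
    qed
  qed
  have "\<exists>u. \<forall>x\<in>\<Omega>. \<delta> (ep v x) = eps u (\<delta> x)" for v
  proof -
    obtain y where y: "ep v = ep (j y)" using j_surj by blast
    have "\<delta> (ep v x) = eps (\<gamma> y) (\<delta> x)" if x: "x \<in> \<Omega>" for x
    proof -
      have "\<delta> (ep v x) = \<delta> ((z' ^^ si x) (eps (eh y (vp x)) b))" using arg_cong[OF si[OF x], of "\<lambda>u. \<delta> (ep (j y) u)"] unfolding y ep_pow .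
      also have "\<dots> = (z ^^ (si x * k0)) (eps (\<gamma> y + \<gamma> (vp x)) b)" unfolding \<delta>eq \<gamma>eh by (simp add: add.commute)
      also have "\<dots> = eps (\<gamma> y) (\<delta> x)" unfolding \<delta>x[OF x] rep_zpow[OF R] rep_add[OF R] ..
      finally show ?thesis .
    qed
    then show ?thesis by blast
  qed
  moreover have "\<delta> (z' x) = (z ^^ k0) (\<delta> x)" if x: "x \<in> \<Omega>" for x
  proof -
    have "z' x = (z' ^^ Suc (si x)) (eps (vp x) b)" using arg_cong[OF si[OF x], of z'] unfolding funpow.simps(2) comp_apply .
    then have "\<delta> (z' x) = (z ^^ (Suc (si x) * k0)) (eps (\<gamma> (vp x)) b)" unfolding \<delta>eq[symmetric] by (simp only:)
    then show ?thesis unfolding \<delta>x[OF x] zadd[OF R] by simp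
  qed
  ultimately show ?thesis unfolding Conj_def using \<delta>A by blast
qed

end

context core
begin

text \<open>The dichotomy is applied to a half \<open>E0\<close> containing the common labels, and
  also \<open>L\<close> unless \<open>L\<close> is everything. The case \<open>star\<close> is a
  \<open>half_move\<close>. In the case \<open>AB\<close>, either \<open>L\<close> leaves
  \<open>Y\<close> and \<open>final_move\<close> finishes, or \<open>L\<close> lies in
  \<open>Y\<close> and a \<open>half_move\<close> is still possible.\<close>

lemma two_group_step:
  assumes LU: "L = UNIV \<or> (\<exists>x\<in>\<Omega>. \<exists>y\<in>\<Omega>. \<kappa> x \<noteq> \<kappa> y)" and CU: "commons ep \<noteq> UNIV"
  shows "Conj eps z ep z' \<or> (\<exists>\<delta>\<in>A. \<exists>\<kappa>2. adm L (\<lambda>v x. \<delta> (ep v (finv \<delta> x))) (\<lambda>x. \<delta> (z' (finv \<delta> x))) \<kappa>2 \<and>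
    commons ep \<subset> commons (\<lambda>v x. \<delta> (ep v (finv \<delta> x))))" (is "_ \<or> ?move")
proof -
  have "\<exists>E0. B.blk E0 \<and> card E0 = 16 \<and> commons ep \<subseteq> E0 \<and> (L \<subseteq> E0 \<or> L = UNIV)"
  proof (cases "L = UNIV")
    case True
    then show ?thesis using B.exists_half[OF blk_commons CU] by blast
  next
    case False
    then obtain x0 y0 where xy0: "x0 \<in> \<Omega>" "y0 \<in> \<Omega>" "\<kappa> x0 \<noteq> \<kappa> y0" using LU by blast
    define S where "S = {l + c | l c. l \<in> L \<and> c \<in> commons ep}"
    note sgL = B.blk_sg[OF blk_L] and sgC = B.blk_sg[OF blk_commons]
    have SI: "l + c \<in> S" if "l \<in> L" "c \<in> commons ep" for l c unfolding S_def using that by blast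
    have sg: "B.sg S" unfolding B.sg_def
    proof (intro conjI ballI)
      show "0 \<in> S" using SI[OF B.sgD(1)[OF sgL] B.sgD(1)[OF sgC]] by simp
      fix u v assume "u \<in> S" "v \<in> S"
      then obtain l c l' c' where *: "u = l + c" "v = l' + c'" "l \<in> L" "l' \<in> L" "c \<in> commons ep" "c' \<in> commons ep"
        unfolding S_def by blast
      have "u + v = (l + l') + (c + c')" unfolding * by (simp only: nf)
      then show "u + v \<in> S" using SI[OF B.sgD(2)[OF sgL *(3,4)] B.sgD(2)[OF sgC *(5,6)]] by simp
    qed
    have blk: "B.blk S" unfolding B.blk_def
    proof (intro conjI ballI allI impI)
      show "B.sg S" by (rule sg)
      fix q x y assume q: "q \<in> Qh" and "x + y \<in> S"
      then obtain l c where lc: "x + y = l + c" "l \<in> L" "c \<in> commons ep" unfolding S_def by blast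
      have "q x + q (x + c) \<in> commons ep" using B.blkD[OF blk_commons q, of x "x + c"] lc(3) by simp
      moreover have "(x + c) + y = l" using lc(1) by (metis B.char2_left add.assoc add.commute)
      then have "q (x + c) + q y \<in> L" using B.blkD[OF blk_L q, of "x + c" y] lc(2) by simp
      ultimately have "(q (x + c) + q y) + (q x + q (x + c)) \<in> S" by (intro SI)
      then show "q x + q y \<in> S" by (simp add: nf)
    qed
    \<comment> \<open>The exponent is constant along \<open>L\<close> and along common elements, so
      a non-constant \<open>\<kappa>\<close> keeps their sum proper.\<close>
    have "S \<noteq> UNIV"
    proof
      assume "S = UNIV"
      then obtain l c where lc: "vp x0 + vp y0 = l + c" "l \<in> L" "c \<in> commons ep" unfolding S_def by blast
      have "vp (eps c x0) + vp y0 = l" using lc(1) vp_eps[OF xy0(1)] by (metis B.char2_left add.assoc add.commute)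
      then have "cl L (eps c x0) y0" using cl_vp[OF rep_eps_mem[OF R xy0(1)] xy0(2)] lc(2) by simp
      from kap_cl[OF adm L rep_eps_mem[OF R xy0(1)] this] have "\<kappa> x0 = \<kappa> y0"
        using commons_kap[OF adm L lc(3) xy0(1)] by simp
      then show False using xy0(3) by blast
    qed
    from B.exists_half[OF blk this] obtain E0 where E0: "B.blk E0" "card E0 = 16" "S \<subseteq> E0" by blast
    have "L \<subseteq> S" "commons ep \<subseteq> S" using SI[OF _ B.sgD(1)[OF sgC]] SI[OF B.sgD(1)[OF sgL]] by auto
    then show ?thesis using E0 by blast
  qed
  then obtain E0 where E0: "B.blk E0" "card E0 = 16" "commons ep \<subseteq> E0" "L \<subseteq> E0 \<or> L = UNIV" by blast
  interpret H: boolean_pair_half Qh eh E0 by unfold_locales (use E0 in auto)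
  have diag: "eh u u = 0" for u using eh_invol[of u 0] eh_0 by simp
  show ?thesis
  proof (cases "H.star {0}")
    case True
    then obtain e w where ew: "e \<notin> E0" "w \<notin> E0"
      "\<And>x y. x \<in> E0 \<Longrightarrow> y \<notin> E0 \<Longrightarrow> \<exists>q\<in>Qh. q x + x \<in> {0} \<and> q y + (eh w y + e) \<in> {0}" unfolding H.star_def by blast
    have "\<exists>q\<in>Qh. q x = x \<and> q y = eh w y + e" if xy: "x \<in> E0" "y \<notin> E0" for x y
    proof -
      obtain q where q: "q \<in> Qh" "q x + x = 0" "q y + (eh w y + e) = 0" using ew(3)[OF xy] by blast
      show ?thesis by (rule bexI[OF _ q(1)]) (use q(2,3) v_eq in auto)
    qed
    from half_move[OF E0(1-4) ew(1,2) this] show ?thesis by (rule disjI2)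
  next
    case False
    then obtain Y where "H.AB Y" using H.dichotomy by blast
    then have Y: "B.blk Y" "card Y = 16" "\<And>y x. y \<in> Y \<Longrightarrow> x \<in> Y \<Longrightarrow> eh y x = x + y" unfolding H.AB_def by blast+
    note sgY = B.blk_sg[OF Y(1)]
    show ?thesis
    proof (cases "L \<subseteq> Y")
      case False
      then obtain w where "w \<in> L" "w \<notin> Y" by blast
      from final_move[OF Y this] show ?thesis by (rule disjI1)
    next
      case LY: True
      show ?thesis
      proof (cases "commons ep \<subseteq> Y")
        case True
        have "Y \<noteq> UNIV" using Y(2) V32 by auto
        then obtain w where w: "w \<notin> Y" by blast
        have ixY: "u + v \<in> Y" if "u \<notin> Y" "v \<notin> Y" for u v
          using B.index2[OF sgY B.sg_UNIV, of v u] that Y(2) V32 by simp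
        \<comment> \<open>Here \<open>Y\<close> itself is the half. For \<open>u = eh w y\<close>
          the element \<open>ep u\<close> followed by the translation by \<open>u\<close> fixes
          \<open>Y\<close> pointwise and sends \<open>y\<close> to the required image.\<close>
        have "\<exists>q\<in>Qh. q x = x \<and> q y = eh w y + w" if xy: "x \<in> Y" "y \<notin> Y" for x y
        proof -
          define u where "u = eh w y"
          have "eh w y + eh w w \<in> Y" using B.blkD[OF Y(1) B.ep_mem, of y w w] ixY[OF xy(2) w] by blast
          then have u: "u \<in> Y" unfolding u_def diag by simp
          have "eh u y = eh y (eh w y)" unfolding u_def by (rule B.ep_swap)
          also have "\<dots> = w" unfolding eh_comm[of y w y] diag eh_0 ..
          finally have 1: "eh u y + u = eh w y + w" unfolding u_def by (simp add: add.commute)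
          have 2: "eh u x + u = x" using Y(3)[OF u xy(1)] by (simp add: nf)
          show ?thesis by (rule bexI[OF _ B.Q_add[OF B.ep_mem, of u u]]) (use 1 2 in simp)
        qed
        from half_move[OF Y(1,2) True disjI1[OF LY] w w this] show ?thesis by (rule disjI2)
      next
        case False
        then obtain c where c: "c \<in> commons ep" "c \<notin> Y" by blast
        \<comment> \<open>A common element outside \<open>Y\<close> spreads the translation
          behaviour from \<open>Y\<close> to all labels. Then both groups agree on labels and
          \<open>q\<close> can be the identity.\<close>
        have ehc: "eh c x = x + c" for x
        proof -
          obtain u where u: "eps c = ep u" using c(1) unfolding commons_def by blast
          obtain y where "ep u = ep (j y)" using j_surj by blast
          then have y: "eps c = ep (j y)" using u by (simp only:)
          have "eps y b = eps c b" unfolding y by (rule j_spec[symmetric])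
          then have "y = c" using eps_inj by blast
          then have "eps (eh c x) b = eps (x + c) b"
            unfolding eh_spec[symmetric] using y rep_add[OF R, of c x b] by (simp add: add.commute)
          then show ?thesis using eps_inj by blast
        qed
        have ixY: "u + c \<in> Y" if "u \<notin> Y" for u
          using B.index2[OF sgY B.sg_UNIV, of c u] that c(2) Y(2) V32 by simp
        have tY: "eh y x = x + y" if y: "y \<in> Y" for x y
        proof (cases "x \<in> Y")
          case True then show ?thesis using Y(3)[OF y] by blast
        next
          case False
          have "eh y (eh c (x + c)) = eh c (x + c + y)" unfolding eh_comm[of y c] Y(3)[OF y ixY[OF False]] ..
          then show ?thesis unfolding ehc by (simp add: nf)
        qed
        have tr: "eh y x = x + y" for x y
        proof (cases "y \<in> Y")
          case True then show ?thesis using tY by blast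
        next
          case yn: False
          show ?thesis
          proof (cases "x \<in> Y")
            case True then show ?thesis using tY[OF True, of y] B.ep_swap[of y x] by (simp add: add.commute)
          next
            case False
            have "eh y x = eh y (eh c (x + c))" unfolding ehc by (simp add: nf)
            also have "\<dots> = eh c (eh (x + c) y)" unfolding eh_comm[of y c] B.ep_swap[of y "x + c"] ..
            also have "\<dots> = x + y" unfolding tY[OF ixY[OF False]] ehc by (simp add: nf)
            finally show ?thesis .
          qed
        qed
        obtain w where w: "w \<notin> E0" using H.E0_proper by blast
        have "\<exists>q\<in>Qh. q x = x \<and> q y = eh w y + w" for x y
          by (rule bexI[OF _ H.id_Q]) (simp add: tr nf)
        from half_move[OF E0(1-4) w w this] show ?thesis by (rule disjI2)
      qed
    qed
  qed
qed

end

section \<open>Induction on the common part of \<open>E\<close> and \<open>E'\<close>\<close>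

context base_rep
begin

text \<open>When all exponents agree, the division into classes can be forgotten; this is the case
  \<open>L = UNIV\<close> of the moves.\<close>

lemma adm_UNIV:
  assumes a: "adm L ep z' \<kappa>" and c: "\<And>x y. x \<in> \<Omega> \<Longrightarrow> y \<in> \<Omega> \<Longrightarrow> \<kappa> x = \<kappa> y" shows "adm UNIV ep z' \<kappa>"
proof -
  have R': "Rep ep z'" using a unfolding adm_def by blast
  have k: "\<kappa> x < p" "z' x = (z ^^ (\<kappa> x)) x" if "x \<in> \<Omega>" for x using a that unfolding adm_def by auto
  have U: "cl UNIV x y" if "x \<in> \<Omega>" "y \<in> \<Omega>" for x y
    using rep_trans[OF R that] unfolding cl_def by blast
  show ?thesis unfolding adm_def
  proof (intro conjI ballI allI impI)
    show "Rep ep z'" by (rule R')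
    fix x assume x: "x \<in> \<Omega>"
    show "\<kappa> x < p" "z' x = (z ^^ (\<kappa> x)) x" using k[OF x] .
    fix y assume "cl UNIV x y"
    note y = cl_mem[OF x this]
    show "\<kappa> x = \<kappa> y" using c[OF x y] .
    show "cl UNIV (ep v x) (ep v y)" for v using U[OF rep_eps_mem[OF R' x] rep_eps_mem[OF R' y]] .
  qed
qed

lemma sgv_UNIV: "sgv UNIV" unfolding sgv_def by simp

context
  fixes L ep z' \<kappa>
  assumes adm: "adm L ep z' \<kappa>" and L: "sgv L"
begin

lemmas R1 = R'[OF adm L]

lemma conj_commons_UNIV:
  assumes U: "commons ep = UNIV" shows "Conj eps z ep z'"
proof (cases "\<Omega> = {}")
  case True
  then show ?thesis unfolding Conj_def using A_id by blast
next
  case False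
  then obtain o' where o': "o' \<in> \<Omega>" by blast
  have "inj eps" "inj ep"
  proof -
    show "inj eps" using rep_free(1)[OF R o', of 0 _ 0] by (metis injI)
    show "inj ep" using rep_free(1)[OF R1 o', of 0 _ 0] by (metis injI)
  qed
  then have "card (range eps) = card (range ep)" by (simp add: card_image)
  moreover have "range eps \<subseteq> range ep" using U unfolding commons_def by blast
  ultimately have eq: "range eps = range ep" by (simp add: card_subset_eq)
  have kc: "\<kappa> x = \<kappa> o'" if x: "x \<in> \<Omega>" for x
  proof -
    obtain v t where vt: "x = (z ^^ t) (eps v o')" using rep_trans[OF R o' x] by blast
    have "\<kappa> x = \<kappa> (eps v o')" unfolding vt by (rule kap_z[OF adm L rep_eps_mem[OF R o']])
    also have "\<dots> = \<kappa> o'" using commons_kap[OF adm L _ o', of v] U by simp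
    finally show ?thesis .
  qed
  have "\<exists>u. \<forall>x\<in>\<Omega>. ep v x = eps u x" for v using eq by (metis rangeE rangeI)
  moreover have "\<forall>x\<in>\<Omega>. z' x = (z ^^ \<kappa> o') x" using kap(2)[OF adm L] kc by simp
  ultimately show ?thesis unfolding Conj_def by (intro bexI[OF _ A_id]) blast
qed

text \<open>Elements of \<open>E\<close> commute with \<open>z\<close>. For \<open>ep v\<close>, a
  power of \<open>z\<close> is rewritten as a power of \<open>z'\<close>, with \<open>i\<close>
  inverting the old exponent, and read back with the new exponent \<open>k\<close>; both exponents
  are constant on a class.\<close>

lemma multiplier:
  assumes q: "q \<in> Qg ep" and x: "x \<in> \<Omega>"
  shows "\<exists>m. \<forall>y. cl L x y \<longrightarrow> (\<forall>t. q ((z ^^ t) y) = (z ^^ (t * m)) (q y))"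
  using q
proof (induction rule: Qg_induct[OF adm L, consumes 1, case_names id eps ep])
  case id show ?case by (rule exI[of _ 1]) simp
next
  case (eps v q)
  then obtain m where m: "\<And>y t. cl L x y \<Longrightarrow> q ((z ^^ t) y) = (z ^^ (t * m)) (q y)" by blast
  show ?case by (rule exI[of _ m]) (simp add: m rep_zpow[OF R])
next
  case (ep v q)
  then obtain m where m: "\<And>y t. cl L x y \<Longrightarrow> q ((z ^^ t) y) = (z ^^ (t * m)) (q y)" by blast
  note qx = Qg_mem[OF adm L ep(1) x]
  obtain i where i: "(\<kappa> (q x) * i) mod p = 1" using inverse_mod_p[OF kap_ndvd[OF adm L qx]] by blast
  define k where "k = \<kappa> (ep v (q x))"
  show ?case
  proof (intro exI[of _ "m * i * k"] allI impI)
    fix y t assume c: "cl L x y"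
    have c2: "cl L (q x) (q y)" by (rule Qg_cl[OF adm L ep(1) x c])
    note qy = cl_mem[OF qx c2]
    have k1: "\<kappa> (q y) = \<kappa> (q x)" using kap_cl[OF adm L qx c2] by simp
    have k2: "\<kappa> (ep v (q y)) = k" unfolding k_def using kap_cl[OF adm L rep_eps_mem[OF R1 qx] ep_cl[OF adm L qx c2]] by simp
    have e: "(t * m * i * \<kappa> (q y)) mod p = (t * m) mod p"
    proof -
      have "(t * m * i * \<kappa> (q y)) mod p = (t * m * (\<kappa> (q x) * i)) mod p"
        unfolding k1 by (simp only: ac_simps)
      also have "\<dots> = (t * m * ((\<kappa> (q x) * i) mod p)) mod p" by (rule mod_mult_right_eq[symmetric])
      finally show ?thesis unfolding i by simp
    qed
    have "(z ^^ (t * m)) (q y) = (z ^^ (t * m * i * \<kappa> (q y))) (q y)" using e rep_zmod[OF R] by metis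
    also have "\<dots> = (z' ^^ (t * m * i)) (q y)" by (rule z'_pow[OF adm L qy, symmetric])
    finally have "ep v (q ((z ^^ t) y)) = (z' ^^ (t * m * i)) (ep v (q y))" unfolding m[OF c] by (simp add: rep_zpow[OF R1])
    also have "\<dots> = (z ^^ (t * m * i * k)) (ep v (q y))"
      unfolding z'_pow[OF adm L rep_eps_mem[OF R1 qy]] k2 ..
    also have "t * m * i * k = t * (m * i * k)" by (simp add: ac_simps)
    finally show "ep v (q ((z ^^ t) y)) = (z ^^ (t * (m * i * k))) (ep v (q y))" .
  qed
qed

text \<open>By \<open>multiplier\<close>, the conjugate of \<open>z'\<close> still acts on each
  class as one power of \<open>z\<close>; and common elements are central in \<open>Qg ep\<close>,
  so they stay common.\<close>

lemma conj_Qg: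
  assumes g: "g \<in> Qg ep"
  shows "\<exists>\<kappa>2. adm L (\<lambda>v x. g (ep v (finv g x))) (\<lambda>x. g (z' (finv g x))) \<kappa>2"
    "commons ep \<subseteq> commons (\<lambda>v x. g (ep v (finv g x)))"
proof -
  note gA = subsetD[OF Qg_A[OF adm L] g]
  have gi: "finv g \<in> Qg ep" using perm_groupD(4)[OF Qg_group[OF adm L] g] .
  note giA = subsetD[OF Qg_A[OF adm L] gi]
  define P where "P x s \<longleftrightarrow> s < p \<and> g (z' (finv g x)) = (z ^^ s) x" for x s
  have uniq: "s = t" if "x \<in> \<Omega>" "P x s" "P x t" for x s t
  proof -
    have "(z ^^ s) (eps 0 x) = (z ^^ t) (eps 0 x)" using that(2,3) unfolding P_def rep_0[OF R] by metis
    from rep_free(2)[OF R that(1) this] show ?thesis using that(2,3) unfolding P_def by simp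
  qed
  have ex: "\<exists>s. \<forall>x'. cl L x x' \<longrightarrow> P x' s" if x: "x \<in> \<Omega>" for x
  proof -
    define y where "y = finv g x"
    have y: "y \<in> \<Omega>" unfolding y_def by (rule A_mem[OF giA x])
    obtain m where m: "\<And>y' t. cl L y y' \<Longrightarrow> g ((z ^^ t) y') = (z ^^ (t * m)) (g y')" using multiplier[OF g y] by blast
    show ?thesis
    proof (intro exI[of _ "(\<kappa> y * m) mod p"] allI impI)
      fix x' assume c: "cl L x x'"
      have c2: "cl L y (finv g x')" unfolding y_def by (rule Qg_cl[OF adm L gi x c])
      note y' = cl_mem[OF y c2]
      have "g (z' (finv g x')) = g ((z ^^ \<kappa> y) (finv g x'))" using kap(2)[OF adm L y'] kap_cl[OF adm L y c2] by simp
      also have "\<dots> = (z ^^ (\<kappa> y * m)) x'" unfolding m[OF c2] A_inv(3)[OF gA] ..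
      also have "\<dots> = (z ^^ ((\<kappa> y * m) mod p)) x'" by (rule rep_zmod[OF R, symmetric])
      finally show "P x' ((\<kappa> y * m) mod p)" unfolding P_def using p_pos by simp
    qed
  qed
  define \<kappa>2 where "\<kappa>2 x = (SOME s. P x s)" for x
  have \<kappa>2: "P x (\<kappa>2 x)" if x: "x \<in> \<Omega>" for x
  proof -
    have "\<exists>s. P x s" using ex[OF x] cl_refl[OF L, of x] by blast
    then show ?thesis unfolding \<kappa>2_def by (rule someI_ex)
  qed
  have "adm L (\<lambda>v x. g (ep v (finv g x))) (\<lambda>x. g (z' (finv g x))) \<kappa>2" unfolding adm_def
  proof (intro conjI ballI allI impI)
    show "Rep (\<lambda>v x. g (ep v (finv g x))) (\<lambda>x. g (z' (finv g x)))" by (rule rep_conj[OF R1 gA])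
    fix x assume x: "x \<in> \<Omega>"
    show "\<kappa>2 x < p" "g (z' (finv g x)) = (z ^^ \<kappa>2 x) x" using \<kappa>2[OF x] unfolding P_def by auto
    fix y assume c: "cl L x y"
    obtain s where s: "\<And>x'. cl L x x' \<Longrightarrow> P x' s" using ex[OF x] by blast
    have "\<kappa>2 x = s" "\<kappa>2 y = s"
      using uniq[OF x \<kappa>2[OF x] s[OF cl_refl[OF L]]] uniq[OF cl_mem[OF x c] \<kappa>2[OF cl_mem[OF x c]] s[OF c]] by auto
    then show "\<kappa>2 x = \<kappa>2 y" by simp
    show "cl L (g (ep v (finv g x))) (g (ep v (finv g y)))" for v
      by (rule Qg_cl[OF adm L g rep_eps_mem[OF R1 A_mem[OF giA x]] ep_cl[OF adm L A_mem[OF giA x] Qg_cl[OF adm L gi x c]]])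
  qed
  then show "\<exists>\<kappa>2. adm L (\<lambda>v x. g (ep v (finv g x))) (\<lambda>x. g (z' (finv g x))) \<kappa>2" by blast
  show "commons ep \<subseteq> commons (\<lambda>v x. g (ep v (finv g x)))"
  proof
    fix v assume v: "v \<in> commons ep"
    then obtain u where u: "eps v = ep u" unfolding commons_def by blast
    have "eps v = (\<lambda>x. g (ep u (finv g x)))"
      unfolding u[symmetric] commons_central[OF adm L v g] A_inv(3)[OF gA] ..
    then show "v \<in> commons (\<lambda>v x. g (ep v (finv g x)))" unfolding commons_def by blast
  qed
qed

lemma eps_group: assumes "\<Omega> \<noteq> {}" and R2: "Rep ep2 z2" shows "perm_group \<Omega> (range ep2)" "card (range ep2) = 2 ^ 5"
proof -
  obtain o' where o': "o' \<in> \<Omega>" using assms by blast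
  have "inj ep2" using rep_free(1)[OF R2 o', of 0 _ 0] by (metis injI)
  then show "card (range ep2) = 2 ^ 5" using V32 by (simp add: card_image)
  show "perm_group \<Omega> (range ep2)"
  proof (rule perm_groupI)
    fix f assume "f \<in> range ep2"
    then obtain v where v: "f = ep2 v" by blast
    show "f permutes \<Omega>" unfolding v by (rule A_perm[OF rep_mem(1)[OF R2]])
    have "finv (ep2 v) = ep2 v" by (rule finv_invol[OF adm L]) (rule rep_invol[OF R2])
    then show "finv f \<in> range ep2" unfolding v by simp
    fix g assume "g \<in> range ep2"
    then obtain u where u: "g = ep2 u" by blast
    have "f \<circ> g = ep2 (v + u)" unfolding u v using rep_add[OF R2] by (simp add: fun_eq_iff)
    then show "f \<circ> g \<in> range ep2" by blast
  next
    have "id = ep2 0" using rep_0[OF R2] by (simp add: fun_eq_iff)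
    then show "id \<in> range ep2" by blast
  qed
qed

lemma sylow_wlog:
  assumes ne: "\<Omega> \<noteq> {}"
  shows "\<exists>g\<in>Qg ep. \<exists>k. card (Qg (\<lambda>v x. g (ep v (finv g x)))) = 2 ^ k"
proof -
  have sub: "range eps \<subseteq> Qg ep" "range ep \<subseteq> Qg ep" using Qg_base[OF adm L] by auto
  obtain g T k where gT: "g \<in> Qg ep" "perm_group \<Omega> T" "card T = 2 ^ k" "range eps \<subseteq> T" "\<forall>f\<in>range ep. g \<circ> f \<circ> finv g \<in> T"
    using sylow_conj[OF Qg_group[OF adm L] fin two_is_prime_nat eps_group(1)[OF ne R] sub(1) eps_group(2)[OF ne R]
      eps_group(1)[OF ne R1] sub(2) eps_group(2)[OF ne R1]] by blast
  define ep2 where "ep2 v x = g (ep v (finv g x))" for v x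
  obtain \<kappa>2 where a2: "adm L ep2 (\<lambda>x. g (z' (finv g x))) \<kappa>2" using conj_Qg(1)[OF gT(1)] unfolding ep2_def by blast
  have "ep2 v \<in> T" for v
  proof -
    have "ep2 v = g \<circ> ep v \<circ> finv g" unfolding ep2_def by (simp add: fun_eq_iff)
    then show ?thesis using gT(5) by simp
  qed
  then have "range eps \<union> range ep2 \<subseteq> T" using gT(4) by blast
  then have "Qg ep2 \<subseteq> T" unfolding Qg_def[OF a2 L] by (rule mgen_subset[OF _ gT(2)])
  then have "card (Qg ep2) dvd 2 ^ k" using perm_group_card_dvd[OF gT(2) Qg_group[OF a2 L] _ fin] gT(3) by simp
  then have "\<exists>k. card (Qg ep2) = 2 ^ k" using divides_primepow_nat[OF two_is_prime_nat] by blast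
  then show ?thesis using gT(1) unfolding ep2_def by blast
qed

text \<open>The orbits have 2-power length and contain orbits of \<open>E\<close>. If all were
  longer than 32, then 64 would divide the number \<open>32 * p\<close> of points.\<close>

lemma base_point:
  assumes ne: "\<Omega> \<noteq> {}" and k: "card (Qg ep) = 2 ^ k"
  shows "\<exists>b\<in>\<Omega>. orb (Qg ep) b = range (\<lambda>v. eps v b)"
proof (rule ccontr)
  assume no: "\<not> ?thesis"
  note Q = Qg_group[OF adm L]
  have "64 dvd card (orb (Qg ep) x)" if x: "x \<in> \<Omega>" for x
  proof -
    obtain i where i: "card (orb (Qg ep) x) = 2 ^ i" using card_orb_prime_power[OF Q fin k two_is_prime_nat] by blast
    have sub: "range (\<lambda>v. eps v x) \<subset> orb (Qg ep) x" using no x orbI[OF Qg_base(1)[OF adm L], of _ x] by blast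
    have "finite (orb (Qg ep) x)" using orb_subset[OF Q x] fin finite_subset by blast
    from psubset_card_mono[OF this sub] have "card (range (\<lambda>v. eps v x)) < 2 ^ i" using i by simp
    moreover have "inj (\<lambda>v. eps v x)" using rep_free(1)[OF R x, of 0 _ 0] by (intro injI) simp
    then have "card (range (\<lambda>v. eps v x)) = 2 ^ 5" using V32 by (simp add: card_image)
    ultimately have "(2::nat) ^ 5 < 2 ^ i" by simp
    then have "5 < i" by (rule power_less_imp_less_exp[rotated]) simp
    then have "(2::nat) ^ 6 dvd 2 ^ i" by (intro le_imp_power_dvd) simp
    then show ?thesis unfolding i by simp
  qed
  moreover have "\<Union> (orb (Qg ep) ` \<Omega>) = \<Omega>" using orb_subset[OF Q] orb_self[OF Q] by blast
  moreover have "c1 \<inter> c2 = {}" if "c1 \<in> orb (Qg ep) ` \<Omega>" "c2 \<in> orb (Qg ep) ` \<Omega>" "c1 \<noteq> c2" for c1 c2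
    using that orb_eq[OF Q] by blast
  ultimately have "64 dvd card \<Omega>" using dvd_partition[of "orb (Qg ep) ` \<Omega>" 64] fin by auto
  then show False unfolding rep_card[OF R] using odd_p by presburger
qed

end

text \<open>Each round starts with a new Sylow conjugation, since after a move the two groups need
  not generate a 2-group any more. \<open>L\<close> is replaced by everything as soon as the
  exponent is constant, so that \<open>two_group_step\<close> applies.\<close>

lemma claim:
  assumes "adm L ep z' \<kappa>" "sgv L" "Dhyp L" shows "Conj eps z ep z'"
  using assms
proof (induction "32 - card (commons ep)" arbitrary: L ep z' \<kappa> rule: less_induct)
  case less
  show ?case
  proof (cases "\<Omega> = {}")
    case True
    then show ?thesis unfolding Conj_def using A_id by blast
  next
    case ne: False
    have "\<exists>L1. adm L1 ep z' \<kappa> \<and> sgv L1 \<and> Dhyp L1 \<and> (L1 = UNIV \<or> (\<exists>x\<in>\<Omega>. \<exists>y\<in>\<Omega>. \<kappa> x \<noteq> \<kappa> y))"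
    proof (cases "\<exists>x\<in>\<Omega>. \<exists>y\<in>\<Omega>. \<kappa> x \<noteq> \<kappa> y")
      case True then show ?thesis using less.prems by blast
    next
      case False
      then have "adm UNIV ep z' \<kappa>" using adm_UNIV[OF less.prems(1)] by blast
      then show ?thesis using sgv_UNIV Dhyp_UNIV by blast
    qed
    then obtain L1 where L1: "adm L1 ep z' \<kappa>" "sgv L1" "Dhyp L1" by blast
    obtain g k where g: "g \<in> Qg ep" and k: "card (Qg (\<lambda>v x. g (ep v (finv g x)))) = 2 ^ k"
      using sylow_wlog[OF L1(1,2) ne] by blast
    define ep2 where "ep2 = (\<lambda>v x. g (ep v (finv g x)))"
    define z2 where "z2 = (\<lambda>x. g (z' (finv g x)))"
    note gA = subsetD[OF Qg_A[OF L1(1,2)] g]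
    have sub1: "commons ep \<subseteq> commons ep2" unfolding ep2_def by (rule conj_Qg(2)[OF L1(1,2) g])
    obtain \<kappa>1 where a1: "adm L1 ep2 z2 \<kappa>1" using conj_Qg(1)[OF L1(1,2) g] unfolding ep2_def z2_def by blast
    have "\<exists>L2. adm L2 ep2 z2 \<kappa>1 \<and> sgv L2 \<and> Dhyp L2 \<and> (L2 = UNIV \<or> (\<exists>x\<in>\<Omega>. \<exists>y\<in>\<Omega>. \<kappa>1 x \<noteq> \<kappa>1 y))"
    proof (cases "\<exists>x\<in>\<Omega>. \<exists>y\<in>\<Omega>. \<kappa>1 x \<noteq> \<kappa>1 y")
      case True then show ?thesis using L1 a1 by blast
    next
      case False
      then have "adm UNIV ep2 z2 \<kappa>1" using adm_UNIV[OF a1] by blast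
      then show ?thesis using sgv_UNIV Dhyp_UNIV by blast
    qed
    then obtain L2 where L2: "adm L2 ep2 z2 \<kappa>1" "sgv L2" "Dhyp L2" "L2 = UNIV \<or> (\<exists>x\<in>\<Omega>. \<exists>y\<in>\<Omega>. \<kappa>1 x \<noteq> \<kappa>1 y)" by blast
    have k2: "\<exists>k. card (Qg ep2) = 2 ^ k" using k unfolding ep2_def by blast
    have "Conj eps z ep2 z2"
    proof (cases "commons ep2 = UNIV")
      case True then show ?thesis by (rule conj_commons_UNIV[OF L2(1,2)])
    next
      case CU: False
      obtain b where b: "b \<in> \<Omega>" "orb (Qg ep2) b = range (\<lambda>v. eps v b)" using base_point[OF L2(1,2) ne] k2 by blast
      interpret C: core \<Omega> A p tv eps z L2 ep2 z2 \<kappa>1 b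
        by unfold_locales (use L2 b k2 in auto)
      from C.two_group_step[OF L2(4) CU] show ?thesis
      proof
        assume "\<exists>\<delta>\<in>A. \<exists>\<kappa>2. adm L2 (\<lambda>v x. \<delta> (ep2 v (finv \<delta> x))) (\<lambda>x. \<delta> (z2 (finv \<delta> x))) \<kappa>2 \<and>
          commons ep2 \<subset> commons (\<lambda>v x. \<delta> (ep2 v (finv \<delta> x)))"
        then obtain \<delta> \<kappa>2 where d: "\<delta> \<in> A" and a: "adm L2 (\<lambda>v x. \<delta> (ep2 v (finv \<delta> x))) (\<lambda>x. \<delta> (z2 (finv \<delta> x))) \<kappa>2"
          and c: "commons ep2 \<subset> commons (\<lambda>v x. \<delta> (ep2 v (finv \<delta> x)))" by blast
        have "card (commons ep2) < card (commons (\<lambda>v x. \<delta> (ep2 v (finv \<delta> x))))"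
          by (rule psubset_card_mono[OF finite c])
        moreover have "card (commons ep) \<le> card (commons ep2)" by (rule card_mono[OF finite sub1])
        moreover have "card (commons (\<lambda>v x. \<delta> (ep2 v (finv \<delta> x)))) \<le> 32" using V32 card_mono[OF finite subset_UNIV] by metis
        ultimately have "32 - card (commons (\<lambda>v x. \<delta> (ep2 v (finv \<delta> x)))) < 32 - card (commons ep)" by linarith
        from less.hyps[OF this a L2(2,3)] show ?thesis by (rule Conj_conj[OF d])
      qed
    qed
    then show ?thesis unfolding ep2_def z2_def by (rule Conj_conj[OF gA])
  qed
qed

end

section \<open>Counting walks of prime length\<close>

lemma rotate1_fixed:
  assumes "rotate1 xs = xs" shows "xs = replicate (length xs) (hd xs)"
proof -
  have rot: "rotate n xs = xs" for n by (induction n) (simp_all add: assms rotate_def)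
  show ?thesis
  proof (rule nth_equalityI)
    fix i assume i: "i < length xs"
    then have "xs \<noteq> []" by auto
    from hd_rotate_conv_nth[OF this, of i] show "xs ! i = replicate (length xs) (hd xs) ! i" using i rot by simp
  qed simp
qed

lemma sum_list_map_rotate1: fixes f :: "'a \<Rightarrow> 'b::comm_monoid_add" shows "sum_list (map f (rotate1 xs)) = sum_list (map f xs)"
  by (cases xs) (simp_all add: add.commute)

context base_rep
begin

definition tr :: "'v \<Rightarrow> nat \<Rightarrow> 'a \<Rightarrow> 'a" where "tr v t x = (z ^^ t) (eps v x)"

lemma tr_A: "tr v t \<in> A"
proof -
  have "tr v t = (\<lambda>x. (z ^^ t) (eps v x))" by (simp add: tr_def fun_eq_iff)
  then show ?thesis using A_comp[OF A_pow[OF rep_mem(2)[OF R], of t] rep_mem(1)[OF R, of v]] by simp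
qed

lemma tr_tr: "tr v t (tr u s x) = tr (v + u) (t + s) x"
  unfolding tr_def rep_zpow[OF R] zadd[OF R] rep_add[OF R] ..

lemma tr_comm: "tr v t (tr u s x) = tr u s (tr v t x)"
  unfolding tr_tr by (simp add: add.commute)

lemma tr_eps: "tr v 0 x = eps v x" and tr_z: "tr 0 t x = (z ^^ t) x" and tr_00: "tr 0 0 x = x"
  unfolding tr_def using rep_0[OF R] by simp_all

lemma tr_ex: "x \<in> \<Omega> \<Longrightarrow> y \<in> \<Omega> \<Longrightarrow> \<exists>v t. t < p \<and> y = tr v t x"
proof -
  assume x: "x \<in> \<Omega>" and y: "y \<in> \<Omega>"
  obtain v t where "y = (z ^^ t) (eps v x)" using rep_trans[OF R x y] by blast
  then have "y = tr v (t mod p) x" unfolding tr_def rep_zmod[OF R] .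
  then show ?thesis using mod_less_divisor[OF p_pos, of t] by blast
qed

lemma tr_mem: "x \<in> \<Omega> \<Longrightarrow> tr v t x \<in> \<Omega>" using A_mem[OF tr_A] .

lemma tr_eqD: "x \<in> \<Omega> \<Longrightarrow> tr v t x = tr u s x \<Longrightarrow> v = u \<and> t mod p = s mod p"
  unfolding tr_def using rep_free[OF R] by blast

definition act :: "('v \<times> nat) list \<Rightarrow> 'a \<Rightarrow> 'a" where
  "act xs = tr (sum_list (map fst xs)) (sum_list (map snd xs))"

lemma act_Cons: "act (c # xs) y = tr (fst c) (snd c) (act xs y)"
  unfolding act_def tr_tr by simp

lemma act_Nil: "act [] y = y" unfolding act_def using tr_00 by simp

lemma act_rotate1: "act (rotate1 xs) = act xs"
  unfolding act_def sum_list_map_rotate1 ..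

lemma act_replicate: "act (replicate p c) y = eps (fst c) y"
proof -
  have s: "sum_list (replicate n u) = (if even n then 0 else u)" for n and u :: 'v by (induction n) auto
  have "act (replicate p c) y = tr (fst c) (p * snd c) y" unfolding act_def using odd_p by (simp add: s sum_list_replicate)
  also have "\<dots> = tr (fst c) ((p * snd c) mod p) y" unfolding tr_def rep_zmod[OF R] ..
  finally show ?thesis using tr_eps by simp
qed

text \<open>The number of walks of length \<open>p\<close> from \<open>b\<close> to a point, in the orbital digraph of the pair
  \<open>(b, x0)\<close>, is constant on orbits of the stabiliser of \<open>b\<close>; modulo \<open>p\<close> only the constant walks
  survive the cyclic rotation of the steps, and these end in \<open>{eps v b | v. True}\<close>.\<close>

lemma stabilizer_orbit_fibre:
  assumes b: "b \<in> \<Omega>" and x0: "x0 = tr v s b"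
    and out: "a0 \<in> A" "a0 b = b" "\<And>u. a0 (eps v b) \<noteq> eps u b"
  shows "\<exists>a\<in>A. a b = b \<and> a x0 = tr v t b"
proof -
  \<comment> \<open>\<open>X\<close> is the orbit of \<open>x0\<close> under the stabiliser of
    \<open>b\<close>, and \<open>Xc\<close> the same set in coordinates; \<open>S k w\<close>
    collects the walks of length \<open>k\<close> from \<open>b\<close> to \<open>w\<close> with
    steps in \<open>Xc\<close>.\<close>
  define X where "X = {a x0 | a. a \<in> A \<and> a b = b}"
  define Xc where "Xc = {c \<in> UNIV \<times> {..<p}. tr (fst c) (snd c) b \<in> X}"
  define S where "S k w = {xs. length xs = k \<and> set xs \<subseteq> Xc \<and> act xs b = w}" for k w
  define \<Gamma> where "\<Gamma> y w \<longleftrightarrow> (\<exists>a\<in>A. a b = y \<and> a x0 = w)" for y w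
  have x0m: "x0 \<in> \<Omega>" unfolding x0 by (rule tr_mem[OF b])
  have finXc: "finite Xc" unfolding Xc_def by (rule finite_subset[of _ "UNIV \<times> {..<p}"]) auto
  have finS: "finite (S k w)" for k w
    by (rule finite_subset[OF _ finite_lists_length_eq[OF finXc, of k]]) (auto simp: S_def)
  \<comment> \<open>The orbital digraph of \<open>(b, x0)\<close> is the Cayley digraph with
    connection set \<open>Xc\<close>, because the regular group lies in \<open>A\<close> and is
    commutative.\<close>
  have gam: "\<Gamma> y w \<longleftrightarrow> (\<exists>c\<in>Xc. w = tr (fst c) (snd c) y)" if y: "y \<in> \<Omega>" for y w
  proof -
    obtain u r where g: "y = tr u r b" using tr_ex[OF b y] by blast
    show ?thesis
    proof
      assume "\<Gamma> y w"
      then obtain a where a: "a \<in> A" "a b = y" "a x0 = w" unfolding \<Gamma>_def by blast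
      define a' where "a' x = finv (tr u r) (a x)" for x
      have a': "a' \<in> A" unfolding a'_def using A_comp[OF A_inv(1)[OF tr_A] a(1)] .
      have "a' b = b" unfolding a'_def a(2) g using A_inv(2)[OF tr_A] .
      then have aX: "a' x0 \<in> X" unfolding X_def using a' by blast
      obtain m r' where m: "r' < p" "a' x0 = tr m r' b" using tr_ex[OF b A_mem[OF a' x0m]] by blast
      have c: "(m, r') \<in> Xc" unfolding Xc_def using m aX by simp
      have "w = tr u r (a' x0)" unfolding a'_def A_inv(3)[OF tr_A] using a(3) by simp
      also have "\<dots> = tr m r' y" unfolding m(2) g by (rule tr_comm)
      finally show "\<exists>c\<in>Xc. w = tr (fst c) (snd c) y" using c by force
    next
      assume "\<exists>c\<in>Xc. w = tr (fst c) (snd c) y"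
      then obtain c where c: "c \<in> Xc" "w = tr (fst c) (snd c) y" by blast
      then obtain a where a: "a \<in> A" "a b = b" "tr (fst c) (snd c) b = a x0" unfolding Xc_def X_def by blast
      have "w = tr u r (a x0)" unfolding c(2) g a(3)[symmetric] by (rule tr_comm)
      moreover have "tr u r (a b) = y" unfolding a(2) g ..
      ultimately show "\<Gamma> y w" unfolding \<Gamma>_def by (intro bexI[OF _ A_comp[OF tr_A a(1), of u r]]) simp
    qed
  qed
  have gamA: "\<Gamma> (a y) (a w)" if a: "a \<in> A" and G: "\<Gamma> y w" for a y w
  proof -
    obtain c where c: "c \<in> A" "c b = y" "c x0 = w" using G unfolding \<Gamma>_def by blast
    show ?thesis unfolding \<Gamma>_def by (rule bexI[OF _ A_comp[OF a c(1)]]) (use c in simp)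
  qed
  have gamA': "\<Gamma> (a y) (a w) \<longleftrightarrow> \<Gamma> y w" if a: "a \<in> A" for a y w
    using gamA[OF a, of y w] gamA[OF A_inv(1)[OF a], of "a y" "a w"] unfolding A_inv(2)[OF a] by blast
  have step: "card (S (Suc k) w) = (\<Sum>y\<in>{y\<in>\<Omega>. \<Gamma> y w}. card (S k y))" for k w
  proof -
    define cc where "cc y = (SOME c. c \<in> Xc \<and> w = tr (fst c) (snd c) y)" for y
    have cc: "cc y \<in> Xc" "w = tr (fst (cc y)) (snd (cc y)) y" if y: "y \<in> \<Omega>" "\<Gamma> y w" for y
    proof -
      have "\<exists>c. c \<in> Xc \<and> w = tr (fst c) (snd c) y" using gam[OF y(1), of w] y(2) by blast
      from someI_ex[OF this] show "cc y \<in> Xc" "w = tr (fst (cc y)) (snd (cc y)) y" unfolding cc_def by auto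
    qed
    have uq: "c = cc y" if y: "y \<in> \<Omega>" "\<Gamma> y w" and c: "c \<in> Xc" "w = tr (fst c) (snd c) y" for c y
    proof -
      have "fst c = fst (cc y) \<and> snd c mod p = snd (cc y) mod p" using tr_eqD[OF y(1)] cc(2)[OF y] c(2) by metis
      moreover have "snd c < p" "snd (cc y) < p" using c(1) cc(1)[OF y] unfolding Xc_def by auto
      ultimately show ?thesis by (simp add: prod_eq_iff)
    qed
    have "S (Suc k) w = (\<Union>y\<in>{y\<in>\<Omega>. \<Gamma> y w}. (#) (cc y) ` S k y)"
    proof (intro equalityI subsetI)
      fix xs assume "xs \<in> S (Suc k) w"
      then obtain c ys where xs: "xs = c # ys" "length ys = k" "set ys \<subseteq> Xc" "c \<in> Xc" "w = tr (fst c) (snd c) (act ys b)"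
        unfolding S_def by (auto simp: length_Suc_conv act_Cons)
      have y: "act ys b \<in> \<Omega>" unfolding act_def by (rule tr_mem[OF b])
      have G: "\<Gamma> (act ys b) w" using gam[OF y] xs(4,5) by blast
      have "c = cc (act ys b)" by (rule uq[OF y G xs(4,5)])
      moreover have "ys \<in> S k (act ys b)" unfolding S_def using xs by simp
      ultimately show "xs \<in> (\<Union>y\<in>{y\<in>\<Omega>. \<Gamma> y w}. (#) (cc y) ` S k y)" using y G xs(1) by blast
    next
      fix xs assume "xs \<in> (\<Union>y\<in>{y\<in>\<Omega>. \<Gamma> y w}. (#) (cc y) ` S k y)"
      then obtain y ys where y: "y \<in> \<Omega>" "\<Gamma> y w" "xs = cc y # ys" "ys \<in> S k y" by blast
      have "act ys b = y" "length ys = k" "set ys \<subseteq> Xc" using y(4) unfolding S_def by auto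
      then show "xs \<in> S (Suc k) w" unfolding S_def using y(3) cc[OF y(1,2)] by (simp add: act_Cons)
    qed
    moreover have "card (\<Union>y\<in>{y\<in>\<Omega>. \<Gamma> y w}. (#) (cc y) ` S k y) = (\<Sum>y\<in>{y\<in>\<Omega>. \<Gamma> y w}. card ((#) (cc y) ` S k y))"
    proof (rule card_UN_disjoint)
      show "finite {y\<in>\<Omega>. \<Gamma> y w}" using fin by simp
      show "\<forall>i\<in>{y\<in>\<Omega>. \<Gamma> y w}. finite ((#) (cc i) ` S k i)" using finS by simp
      show "\<forall>i\<in>{y\<in>\<Omega>. \<Gamma> y w}. \<forall>j\<in>{y\<in>\<Omega>. \<Gamma> y w}. i \<noteq> j \<longrightarrow> (#) (cc i) ` S k i \<inter> (#) (cc j) ` S k j = {}"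
        unfolding S_def by auto
    qed
    moreover have "card ((#) (cc y) ` S k y) = card (S k y)" for y by (rule card_image) (simp add: inj_on_def)
    ultimately show ?thesis by simp
  qed
  have inv: "card (S k (a w)) = card (S k w)" if a: "a \<in> A" "a b = b" for a k w
  proof (induction k arbitrary: w)
    case 0
    have "a w = b \<longleftrightarrow> w = b" using A_inj[OF a(1)] a(2) by metis
    then have "b = a w \<longleftrightarrow> b = w" by metis
    then have "S 0 (a w) = S 0 w" unfolding S_def by (auto simp: act_Nil)
    then show ?case by simp
  next
    case (Suc k)
    have "bij_betw a {y\<in>\<Omega>. \<Gamma> y w} {y\<in>\<Omega>. \<Gamma> y (a w)}"
    proof (rule bij_betwI[where g="finv a"])
      show "a \<in> {y\<in>\<Omega>. \<Gamma> y w} \<rightarrow> {y\<in>\<Omega>. \<Gamma> y (a w)}" using A_mem[OF a(1)] gamA[OF a(1)] by simp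
      show "finv a \<in> {y\<in>\<Omega>. \<Gamma> y (a w)} \<rightarrow> {y\<in>\<Omega>. \<Gamma> y w}"
      proof (rule Pi_I, rule CollectI, rule conjI)
        fix y assume y: "y \<in> {y\<in>\<Omega>. \<Gamma> y (a w)}"
        then show "finv a y \<in> \<Omega>" using A_mem[OF A_inv(1)[OF a(1)]] by simp
        show "\<Gamma> (finv a y) w" using y gamA'[OF a(1), of "finv a y" w] unfolding A_inv(3)[OF a(1)] by simp
      qed
    qed (simp_all add: A_inv[OF a(1)])
    from sum.reindex_bij_betw[OF this, of "\<lambda>y. card (S k y)"] show ?case unfolding step Suc by simp
  qed
  \<comment> \<open>Rotating the steps cyclically does not change the end point; a walk fixed by the
    rotation repeats a single step.\<close>
  have rot: "p dvd card (S p w - {xs\<in>S p w. rotate1 xs = xs})" for w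
  proof (rule card_cyclic_fixed[OF finS prime_p])
    fix xs assume xs: "xs \<in> S p w"
    then show "rotate1 xs \<in> S p w" unfolding S_def by (simp add: act_rotate1)
    show "(rotate1 ^^ p) xs = xs" using xs rotate_id[of p xs] unfolding S_def rotate_def by simp
  qed
  have fx: "xs = replicate p (hd xs)" "hd xs \<in> Xc" "w = eps (fst (hd xs)) b" if "xs \<in> S p w" "rotate1 xs = xs" for xs w
  proof -
    have len: "length xs = p" and sub: "set xs \<subseteq> Xc" and ac: "act xs b = w" using that(1) unfolding S_def by auto
    show x: "xs = replicate p (hd xs)" using rotate1_fixed[OF that(2)] len by simp
    have "xs \<noteq> []" using len p_pos by auto
    then show "hd xs \<in> Xc" using sub by auto
    show "w = eps (fst (hd xs)) b" using ac act_replicate[of "hd xs" b] x by simp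
  qed
  \<comment> \<open>No constant walk ends at this point, so the number of walks to it is divisible
    by \<open>p\<close>, and by invariance the same holds at \<open>eps v b\<close>. Constant walks
    ending there use steps with label \<open>v\<close>, as \<open>p\<close> is odd.\<close>
  let ?w = "a0 (eps v b)"
  have "{xs\<in>S p ?w. rotate1 xs = xs} = {}" using fx(3)[of _ ?w] out(3) by blast
  from rot[of ?w, unfolded this] have "p dvd card (S p ?w)" by simp
  then have d1: "p dvd card (S p (eps v b))" unfolding inv[OF out(1,2)] .
  let ?F = "{xs\<in>S p (eps v b). rotate1 xs = xs}"
  let ?C = "{c\<in>Xc. fst c = v}"
  have F: "?F = replicate p ` ?C"
  proof (intro equalityI subsetI)
    fix xs assume "xs \<in> ?F"
    then have xs: "xs \<in> S p (eps v b)" "rotate1 xs = xs" by auto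
    have "eps v b = eps (fst (hd xs)) b" by (rule fx(3)[OF xs])
    then have "tr v 0 b = tr (fst (hd xs)) 0 b" unfolding tr_eps .
    from tr_eqD[OF b this] have "hd xs \<in> ?C" using fx(2)[OF xs] by simp
    then show "xs \<in> replicate p ` ?C" using fx(1)[OF xs] by blast
  next
    fix xs assume "xs \<in> replicate p ` ?C"
    then obtain c where c: "c \<in> Xc" "fst c = v" "xs = replicate p c" by blast
    have r: "rotate1 (replicate n c) = replicate n c" for n
      by (cases n) (simp_all add: replicate_append_same)
    show "xs \<in> ?F" unfolding S_def c(3) using c(1) act_replicate[of c b] c(2) r by auto
  qed
  have "card (S p (eps v b)) = card (S p (eps v b) - ?F) + card ?F"
    using card_Diff_subset[of ?F "S p (eps v b)"] card_mono[of "S p (eps v b)" ?F] finS[of p "eps v b"] finite_subset[of ?F "S p (eps v b)"] by auto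
  with d1 have "p dvd card (S p (eps v b) - ?F) + card ?F" by (simp only:)
  then have "p dvd card ?F" using dvd_add_right_iff[OF rot[of "eps v b"], THEN iffD1] by blast
  moreover have "card ?F = card ?C" unfolding F using p_pos by (intro card_image inj_onI) (simp add: replicate_eq_replicate)
  moreover have "card ?C = card (snd ` ?C)" by (rule card_image[symmetric]) (auto simp: inj_on_def)
  ultimately have dv: "p dvd card (snd ` ?C)" by simp
  have sub: "snd ` ?C \<subseteq> {..<p}" unfolding Xc_def by auto
  have "x0 \<in> X" unfolding X_def by (rule CollectI, rule exI[of _ "\<lambda>x. x"]) (simp add: A_id)
  then have "tr v (s mod p) b \<in> X" unfolding x0 tr_def rep_zmod[OF R] .
  then have "(v, s mod p) \<in> ?C" unfolding Xc_def using p_pos by simp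
  then have "snd ` ?C \<noteq> {}" by blast
  moreover have finC: "finite (snd ` ?C)" using finXc by simp
  ultimately have "0 < card (snd ` ?C)" by (simp add: card_gt_0_iff)
  \<comment> \<open>The number of exponents \<open>t < p\<close> with \<open>(v, t)\<close> in
    \<open>Xc\<close> is positive and divisible by \<open>p\<close>, so all of them occur.\<close>
  then have "p \<le> card (snd ` ?C)" using dv by (rule dvd_imp_le[rotated])
  then have "snd ` ?C = {..<p}" using card_seteq[OF _ sub] by simp
  then have "t mod p \<in> snd ` ?C" using p_pos by simp
  then have "tr v (t mod p) b \<in> X" unfolding Xc_def by auto
  then have "tr v t b \<in> X" unfolding tr_def rep_zmod[OF R] .
  then obtain a where a: "tr v t b = a x0" "a \<in> A" "a b = b" unfolding X_def by (elim CollectE exE conjE)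
  show ?thesis by (rule bexI[OF _ a(2)]) (simp add: a)
qed

text \<open>The subgroup \<open>L\<close> of the overview. Its definition refers to
  \<open>E\<close>; that its orbits depend on \<open>A\<close> alone is
  \<open>sim_eq\<close>.\<close>

definition LV :: "'v set" where
  "LV = {v. \<forall>x\<in>\<Omega>. \<forall>a\<in>A. a x = x \<longrightarrow> (\<exists>u. a (eps v x) = eps u x)}"

lemma LV_D: "v \<in> LV \<Longrightarrow> x \<in> \<Omega> \<Longrightarrow> a \<in> A \<Longrightarrow> a x = x \<Longrightarrow> \<exists>u. a (eps v x) = eps u x"
  unfolding LV_def by blast

lemma LV_at:
  assumes x: "x \<in> \<Omega>" and at: "\<And>a. a \<in> A \<Longrightarrow> a x = x \<Longrightarrow> \<exists>u. a (eps v x) = eps u x"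
  shows "v \<in> LV" unfolding LV_def
proof (intro CollectI ballI impI)
  fix y a assume y: "y \<in> \<Omega>" and a: "a \<in> A" "a y = y"
  obtain u t where g: "y = tr u t x" using tr_ex[OF x y] by blast
  note gA = tr_A[of u t]
  define a' where "a' w = finv (tr u t) (a (tr u t w))" for w
  have a': "a' \<in> A" unfolding a'_def using A_comp[OF A_inv(1)[OF gA] A_comp[OF a(1) gA]] .
  have "a' x = x" unfolding a'_def g[symmetric] a(2) unfolding g using A_inv(2)[OF gA] .
  from at[OF a' this] obtain w where w: "a' (eps v x) = eps w x" by blast
  have c: "eps v y = tr u t (eps v x)" for v unfolding g by (rule tr_comm[of v 0 u t x, unfolded tr_eps])
  have "tr u t (a' (eps v x)) = a (eps v y)" unfolding a'_def A_inv(3)[OF gA] c ..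
  then have "a (eps v y) = eps w y" unfolding w c by (rule sym)
  then show "\<exists>u. a (eps v y) = eps u y" by (rule exI)
qed

text \<open>Makes the orbits of \<open>LV\<close> blocks of \<open>A\<close>. After composition with
  an element of the regular group, \<open>a\<close> fixes \<open>x\<close> and defines
  \<open>l'\<close>; the stabiliser condition for \<open>l'\<close> follows from that for
  \<open>l\<close>, applied to products with \<open>a'\<close>.\<close>

lemma LV_inv:
  assumes a: "a \<in> A" and l: "l \<in> LV" and x: "x \<in> \<Omega>"
  shows "\<exists>l'\<in>LV. a (eps l x) = eps l' (a x)"
proof -
  obtain u t where g: "a x = tr u t x" using tr_ex[OF x A_mem[OF a x]] by blast
  note gA = tr_A[of u t]
  define a' where "a' w = finv (tr u t) (a w)" for w
  have a': "a' \<in> A" unfolding a'_def using A_comp[OF A_inv(1)[OF gA] a] .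
  have a'x: "a' x = x" unfolding a'_def g using A_inv(2)[OF gA] .
  from LV_D[OF l x a' this] obtain l' where l': "a' (eps l x) = eps l' x" by blast
  have "a (eps l x) = tr u t (eps l' x)" unfolding l'[symmetric] a'_def A_inv(3)[OF gA] ..
  then have 1: "a (eps l x) = eps l' (a x)" unfolding g by (rule trans[OF _ tr_comm[of u t l' 0 x, unfolded tr_eps]])
  have "l' \<in> LV"
  proof (rule LV_at[OF x])
    fix c assume c: "c \<in> A" "c x = x"
    have "c (a' x) = x" using c(2) a'x by simp
    from LV_D[OF l x A_comp[OF c(1) a'] this] show "\<exists>u. c (eps l' x) = eps u x" unfolding l' .
  qed
  then show ?thesis using 1 by blast
qed

lemma LV_sgv: "sgv LV" unfolding sgv_def
proof (intro conjI ballI)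
  have "\<exists>u. x = eps u x" for x using rep_0[OF R, of x] by metis
  then show "0 \<in> LV" unfolding LV_def by (simp add: rep_0[OF R])
  fix u v assume u: "u \<in> LV" and v: "v \<in> LV"
  show "u + v \<in> LV" unfolding LV_def
  proof (intro CollectI ballI impI)
    fix x a assume x: "x \<in> \<Omega>" and a: "a \<in> A" "a x = x"
    obtain v' where v': "a (eps v x) = eps v' x" using LV_D[OF v x a] by blast
    obtain u' where u': "a (eps u (eps v x)) = eps u' (a (eps v x))" using LV_inv[OF a(1) u rep_eps_mem[OF R x]] by blast
    have "a (eps (u + v) x) = eps (u' + v') x" unfolding rep_add[OF R] u' v' ..
    then show "\<exists>w. a (eps (u + v) x) = eps w x" by blast
  qed
qed

lemma rotate_off_LV:
  assumes v: "v \<notin> LV" and b: "b \<in> \<Omega>" shows "\<exists>a\<in>A. a b = b \<and> a (tr v s b) = tr v t b"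
proof -
  obtain a0 where "a0 \<in> A" "a0 b = b" "\<And>u. a0 (eps v b) \<noteq> eps u b" using v LV_at[OF b, of v] by blast
  from stabilizer_orbit_fibre[OF b refl this] show ?thesis .
qed

definition Dmap :: "('a \<Rightarrow> nat) \<Rightarrow> 'a \<Rightarrow> 'a" where
  "Dmap a x = (if x \<in> \<Omega> then (z ^^ (a x)) x else x)"

lemma cl_sym: assumes L: "sgv L" and c: "cl L x y" shows "cl L y x"
proof -
  obtain l t where l: "l \<in> L" "y = tr l t x" using c unfolding cl_def tr_def by blast
  have "tr l (p * t - t) y = tr 0 (p * t) x" unfolding l(2) tr_tr using p_pos by simp
  also have "\<dots> = tr 0 ((p * t) mod p) x" unfolding tr_def rep_zmod[OF R] ..
  finally have "x = tr l (p * t - t) y" using tr_00 by simp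
  then show ?thesis unfolding cl_def tr_def using l(1) by blast
qed

lemma cl_trans: assumes L: "sgv L" and c: "cl L x y" "cl L y w" shows "cl L x w"
proof -
  obtain l t where l: "l \<in> L" "y = tr l t x" using c unfolding cl_def tr_def by blast
  obtain m s where m: "m \<in> L" "w = tr m s y" using c unfolding cl_def tr_def by blast
  have "w = tr (m + l) (s + t) x" unfolding m(2) l(2) tr_tr ..
  moreover have "m + l \<in> L" using L l(1) m(1) unfolding sgv_def by blast
  ultimately show ?thesis unfolding cl_def tr_def by blast
qed

lemma Dmap_z:
  assumes "x \<in> \<Omega>" "sgv L" "\<And>x y. x \<in> \<Omega> \<Longrightarrow> cl L x y \<Longrightarrow> (a x :: nat) = a y" shows "a ((z ^^ t) x) = a x"
  using assms(3)[OF assms(1) cl_z[OF assms(2)]] by simp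

lemma Dmap_comp:
  assumes L: "sgv L" and a: "\<And>x y. x \<in> \<Omega> \<Longrightarrow> cl L x y \<Longrightarrow> a x = a y"
  shows "Dmap a (Dmap c x) = Dmap (\<lambda>x. a x + c x) x"
proof (cases "x \<in> \<Omega>")
  case True
  have "a ((z ^^ c x) x) = a x" by (rule Dmap_z[OF True L a])
  then show ?thesis unfolding Dmap_def using True rep_zpow_mem[OF R True] by (simp add: zadd[OF R])
qed (simp add: Dmap_def)

text \<open>By 2-closedness only pairs count. Inside a class the rotation is a power of
  \<open>z\<close>; for points in different classes the label difference is outside
  \<open>LV\<close>, and \<open>rotate_off_LV\<close> moves the second point alone along its
  fibre.\<close>

lemma Dhyp_LV: "Dhyp LV" unfolding Dhyp_def
proof (intro allI impI)
  fix a :: "'a \<Rightarrow> nat" assume "\<forall>x\<in>\<Omega>. \<forall>y. cl LV x y \<longrightarrow> a x = a y"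
  then have a: "a x = a y" if "x \<in> \<Omega>" "cl LV x y" for x y using that by blast
  have "Dmap a \<in> A"
  proof (rule closed2)
    show "Dmap a permutes \<Omega>"
    proof (rule bij_imp_permutes)
      have inj: "inj_on (Dmap a) \<Omega>"
      proof (rule inj_onI)
        fix x y assume x: "x \<in> \<Omega>" and y: "y \<in> \<Omega>" and "Dmap a x = Dmap a y"
        then have e: "(z ^^ a x) x = (z ^^ a y) y" unfolding Dmap_def by simp
        then have "a x = a y" using a[OF x cl_z[OF LV_sgv, where t="a x"]] a[OF y cl_z[OF LV_sgv, where t="a y"]] by simp
        then show "x = y" using e A_inj[OF A_pow[OF rep_mem(2)[OF R], of "a y"]] by simp
      qed
      moreover have "Dmap a ` \<Omega> \<subseteq> \<Omega>" using rep_zpow_mem[OF R] unfolding Dmap_def by auto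
      ultimately show "bij_betw (Dmap a) \<Omega> \<Omega>" unfolding bij_betw_def using endo_inj_surj[OF fin] by blast
    qed (simp add: Dmap_def)
    fix x y assume x: "x \<in> \<Omega>" and y: "y \<in> \<Omega>"
    show "\<exists>f\<in>A. f x = Dmap a x \<and> f y = Dmap a y"
    proof (cases "cl LV x y")
      case True
      then show ?thesis unfolding Dmap_def using a[OF x] x y A_pow[OF rep_mem(2)[OF R], of "a x"] by (intro bexI) auto
    next
      case False
      obtain v s where v: "y = tr v s x" using tr_ex[OF x y] by blast
      have nv: "v \<notin> LV" using False v unfolding cl_def tr_def by blast
      \<comment> \<open>The term \<open>p * a x - a x\<close> stands for minus \<open>a x\<close>
        modulo \<open>p\<close>; it compensates the rotation by \<open>a x\<close> applied
        afterwards to both points.\<close>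
      obtain f where f: "f \<in> A" "f x = x" "f (tr v s x) = tr v (s + a y + (p * a x - a x)) x"
        using rotate_off_LV[OF nv x] by blast
      define h where "h u = (z ^^ a x) (f u)" for u
      have hA: "h \<in> A" unfolding h_def using A_comp[OF A_pow[OF rep_mem(2)[OF R]] f(1)] .
      have "h y = tr 0 (a x) (tr v (s + a y + (p * a x - a x)) x)" unfolding h_def v f(3) tr_z ..
      also have "\<dots> = tr v (s + a y + p * a x) x" 
      proof -
        have "a x \<le> p * a x" using p_pos by simp
        then have "a x + (s + a y + (p * a x - a x)) = s + a y + p * a x" by linarith
        then show ?thesis unfolding tr_tr add_0 by (simp only:)
      qed
      also have "\<dots> = tr v (s + a y) x" unfolding tr_def using rep_zmod[OF R, of "s + a y + p * a x"] rep_zmod[OF R, of "s + a y"] by simp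
      also have "\<dots> = tr 0 (a y) y" unfolding v tr_tr by (simp add: ac_simps)
      finally have "h y = Dmap a y" unfolding Dmap_def tr_z using y by simp
      moreover have "h x = Dmap a x" unfolding h_def f(2) Dmap_def using x by simp
      ultimately show ?thesis using hA by blast
    qed
  qed
  then show "(\<lambda>x. if x \<in> \<Omega> then (z ^^ a x) x else x) \<in> A" unfolding Dmap_def .
qed

definition sim :: "'a \<Rightarrow> 'a \<Rightarrow> bool" where "sim x y \<longleftrightarrow> (\<exists>l\<in>LV. y = eps l x)"

lemma simI: "l \<in> LV \<Longrightarrow> y = eps l x \<Longrightarrow> sim x y" unfolding sim_def by (rule bexI)

lemma simE: assumes "sim x y" obtains l where "l \<in> LV" "y = eps l x" using assms unfolding sim_def by (elim bexE)

lemma sim_refl: "sim x x"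
proof (rule simI)
  show "0 \<in> LV" using LV_sgv unfolding sgv_def by (rule conjunct1)
qed (rule rep_0[OF R, symmetric])

lemma sim_sym: assumes "sim x y" shows "sim y x"
proof -
  obtain l where l: "l \<in> LV" "y = eps l x" using assms by (rule simE)
  show ?thesis by (rule simI[OF l(1)]) (rule rep_invol[OF R, of l x, symmetric, folded l(2)])
qed

lemma sim_trans: assumes "sim x y" "sim y w" shows "sim x w"
proof -
  obtain l where l: "l \<in> LV" "y = eps l x" using assms(1) by (rule simE)
  obtain m where m: "m \<in> LV" "w = eps m y" using assms(2) by (rule simE)
  have "m + l \<in> LV" using LV_sgv m(1) l(1) unfolding sgv_def by blast
  then show ?thesis by (rule simI) (rule trans[OF m(2)[unfolded l(2)] rep_add[OF R, symmetric]])
qed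

lemma sim_A: assumes "a \<in> A" "x \<in> \<Omega>" "sim x y" shows "sim (a x) (a y)"
proof -
  obtain l where l: "l \<in> LV" "y = eps l x" using assms(3) by (rule simE)
  obtain m where m: "m \<in> LV" "a (eps l x) = eps m (a x)" using LV_inv[OF assms(1) l(1) assms(2)] by (elim bexE)
  show ?thesis unfolding l(2) by (rule simI[OF m])
qed

lemma sim_cl: assumes "sim x y" shows "cl LV x y"
proof -
  obtain l where l: "l \<in> LV" "y = eps l x" using assms by (rule simE)
  show ?thesis unfolding cl_def by (rule bexI[OF _ l(1)], rule exI[of _ 0]) (simp add: l(2))
qed

lemma cl_sim: "cl LV x y \<Longrightarrow> \<exists>t<p. sim ((z ^^ t) x) y"
proof -
  assume "cl LV x y"
  then obtain l t where l: "l \<in> LV" "y = (z ^^ t) (eps l x)" unfolding cl_def by blast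
  have "y = eps l ((z ^^ (t mod p)) x)" unfolding l(2) rep_zpow[OF R] rep_zmod[OF R] ..
  then show "\<exists>t<p. sim ((z ^^ t) x) y"
    by (intro exI[of _ "t mod p"] conjI) (use p_pos simI[OF l(1)] in simp_all)
qed

lemma sim_z: assumes x: "x \<in> \<Omega>" shows "sim ((z ^^ s) x) ((z ^^ t) x) \<longleftrightarrow> s mod p = t mod p"
proof
  assume "sim ((z ^^ s) x) ((z ^^ t) x)"
  then obtain l where l: "l \<in> LV" "(z ^^ t) x = eps l ((z ^^ s) x)" by (rule simE)
  have "(z ^^ t) x = tr l s x" unfolding tr_def by (rule trans[OF l(2) rep_zpow[OF R, of l s x]])
  then have "tr 0 t x = tr l s x" by (rule trans[OF tr_z[of t x]])
  from tr_eqD[OF x this] show "s mod p = t mod p" by simp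
next
  assume "s mod p = t mod p"
  then have "(z ^^ s) x = (z ^^ t) x" using rep_zmod[OF R, of s x] rep_zmod[OF R, of t x] by simp
  then show "sim ((z ^^ s) x) ((z ^^ t) x)" using sim_refl by simp
qed

lemma sgv_card: assumes "sgv K" shows "card K dvd 32"
proof -
  have pg: "perm_group UNIV ((\<lambda>v x. x + v) ` K)" if K: "sgv K" for K :: "'v set"
  proof (rule perm_groupI)
    fix f assume "f \<in> (\<lambda>v x. x + v) ` K"
    then obtain v where v: "f = (\<lambda>x. x + v)" "v \<in> K" by blast
    have ff: "f (f x) = x" for x unfolding v(1) by (simp add: add.assoc)
    have "bij f" by (rule o_bij[of f]) (simp_all add: fun_eq_iff ff)
    then show "f permutes UNIV" by (rule bij_imp_permutes) simp
    have "finv f = f" by (rule inv_unique_comp) (simp_all add: fun_eq_iff ff)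
    then show "finv f \<in> (\<lambda>v x. x + v) ` K" using v by simp
    fix g assume "g \<in> (\<lambda>v x. x + v) ` K"
    then obtain u where u: "g = (\<lambda>x. x + u)" "u \<in> K" by blast
    have "f \<circ> g = (\<lambda>x. x + (u + v))" unfolding u v by (simp add: fun_eq_iff add.assoc)
    then show "f \<circ> g \<in> (\<lambda>v x. x + v) ` K" using u v K unfolding sgv_def by blast
  next
    have "id = (\<lambda>x. x + (0::'v))" by (simp add: fun_eq_iff)
    then show "id \<in> (\<lambda>v x. x + v) ` K" using K unfolding sgv_def by blast
  qed
  have c: "card ((\<lambda>v x. x + v) ` K) = card K" for K :: "'v set"
    by (rule card_image) (auto simp: inj_on_def fun_eq_iff)
  have "sgv UNIV" unfolding sgv_def by simp
  from perm_group_card_dvd[OF pg[OF this] pg[OF assms]] show ?thesis unfolding c V32 by auto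
qed

lemma sgv_card_p: assumes "sgv K" shows "\<not> p dvd card K"
proof
  assume "p dvd card K"
  then have "p dvd 2 ^ 5" using dvd_trans[OF _ sgv_card[OF assms], of p] by simp
  then have "p dvd 2" using prime_p prime_dvd_power by blast
  then have "p = 2" using p_gt1 by (auto dest: dvd_imp_le)
  then show False using odd_p by simp
qed

end

section \<open>Correlations modulo p and characters\<close>

definition fdiff :: "(nat \<Rightarrow> int) \<Rightarrow> nat \<Rightarrow> int" where "fdiff f t = f (Suc t) - f t"

lemma fdiff_iterate:
  "(fdiff ^^ k) f t = (\<Sum>i\<le>k. (- 1) ^ (k + i) * int (k choose i) * f (t + i))"
proof (induction k arbitrary: t)
  case (Suc k)
  let ?g = "\<lambda>i. (- 1) ^ (k + i) * int (k choose i) * f (Suc t + i)"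
  let ?h = "\<lambda>i. (- 1) ^ (Suc k + i) * int (k choose i) * f (t + i)"
  have "(fdiff ^^ Suc k) f t = (\<Sum>i\<le>k. ?g i) - (\<Sum>i\<le>k. (- 1) ^ (k + i) * int (k choose i) * f (t + i))"
    by (simp add: fdiff_def Suc)
  also have "\<dots> = (\<Sum>i\<le>k. ?g i) + (\<Sum>i\<le>k. ?h i)" by (simp add: sum_negf)
  also have "(\<Sum>i\<le>k. ?h i) = (\<Sum>i\<le>Suc k. ?h i)" by simp
  also have "\<dots> = ?h 0 + (\<Sum>i\<le>k. ?h (Suc i))" by (rule sum.atMost_Suc_shift)
  also have "(\<Sum>i\<le>k. ?g i) + (?h 0 + (\<Sum>i\<le>k. ?h (Suc i))) = ?h 0 + (\<Sum>i\<le>k. ?g i + ?h (Suc i))"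
    by (simp add: sum.distrib)
  also have "\<dots> = (- 1) ^ (Suc k + 0) * int (Suc k choose 0) * f (t + 0) +
      (\<Sum>i\<le>k. (- 1) ^ (Suc k + Suc i) * int (Suc k choose Suc i) * f (t + Suc i))"
    by (simp add: algebra_simps)
  also have "\<dots> = (\<Sum>i\<le>Suc k. (- 1) ^ (Suc k + i) * int (Suc k choose i) * f (t + i))"
    by (rule sum.atMost_Suc_shift[symmetric])
  finally show ?case .
qed simp

text \<open>Modulo \<open>p\<close> only the two extreme binomial terms remain, and they cancel by
  periodicity because \<open>p\<close> is odd.\<close>

lemma fdiff_iterate_prime:
  fixes p :: nat
  assumes p: "prime p" "odd p" and per: "\<And>t. f (t + p) = f t"
  shows "int p dvd (fdiff ^^ p) f t"
proof -
  let ?g = "\<lambda>i. (- 1) ^ (p + i) * int (p choose i) * f (t + i)"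
  have p0: "p > 0" using p prime_gt_0_nat by blast
  then have "{..p} = insert 0 (insert p {1..<p})" by auto
  moreover have "sum ?g (insert 0 (insert p {1..<p})) = ?g 0 + (?g p + sum ?g {1..<p})"
    using p0 by (subst sum.insert) auto
  moreover have "?g 0 + ?g p = 0" using per[of t] p(2) by simp
  moreover have "int p dvd sum ?g {1..<p}"
  proof (rule dvd_sum)
    fix i assume "i \<in> {1..<p}"
    then have "p dvd (p choose i)" using p by (intro dvd_choose_prime) auto
    then show "int p dvd ?g i" by (intro dvd_mult2 dvd_mult) simp
  qed
  ultimately have "sum ?g {..p} = sum ?g {1..<p}" "int p dvd sum ?g {1..<p}" by (simp_all only:)
  then show ?thesis unfolding fdiff_iterate by (simp only:)
qed

context
  fixes p :: nat and n :: "nat \<Rightarrow> int"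
  assumes p: "prime p" "odd p" and pern: "\<And>t. n (t + p) = n t" and N: "\<not> int p dvd (\<Sum>s<p. n s)"
begin

private definition kills :: "(nat \<Rightarrow> int) \<Rightarrow> bool" where
  "kills d \<longleftrightarrow> (\<forall>t. d (t + p) = d t) \<and> (\<forall>t. (\<Sum>s<p. d s * n (t + s)) = 0)"

private lemma kills_fdiff: assumes k: "kills d" shows "kills (fdiff d)"
proof -
  have per: "d (t + p) = d t" for t using k unfolding kills_def by blast
  have rel: "(\<Sum>s<p. d s * n (t + s)) = 0" for t using k unfolding kills_def by blast
  have "(\<Sum>s<p. d (Suc s) * n (t + s)) = 0" for t
  proof -
    let ?h = "\<lambda>s. d s * n (t + (p - 1) + s)"
    have p0: "p > 0" using p prime_gt_0_nat by blast
    have "n (t + s) = n (t + (p - 1) + Suc s)" for s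
    proof -
      have "t + (p - 1) + Suc s = (t + s) + p" using p0 by simp
      then show ?thesis using pern[of "t + s"] by (simp only:)
    qed
    then have "(\<Sum>s<p. d (Suc s) * n (t + s)) = (\<Sum>s<p. ?h (Suc s))" by simp
    moreover have "?h 0 + (\<Sum>s<p. ?h (Suc s)) = (\<Sum>s<p. ?h s) + ?h p"
      using sum.lessThan_Suc_shift[of ?h p] sum.lessThan_Suc[of ?h p] by simp
    moreover have "?h p = ?h 0" using per[of 0] pern[of "t + (p - 1)"] by simp
    ultimately show ?thesis using rel[of "t + (p - 1)"] by simp
  qed
  then have "(\<Sum>s<p. fdiff d s * n (t + s)) = 0" for t
    using rel[of t] unfolding fdiff_def by (simp add: left_diff_distrib sum_subtractf)
  moreover have "fdiff d (t + p) = fdiff d t" for t using per[of t] per[of "Suc t"] unfolding fdiff_def by simp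
  ultimately show ?thesis unfolding kills_def by blast
qed

text \<open>The property \<open>kills\<close> passes to differences, and the \<open>p\<close>-th
  difference vanishes modulo \<open>p\<close>. The last difference that does not vanish is constant
  modulo \<open>p\<close>, so the constant times the sum of \<open>n\<close> is zero modulo
  \<open>p\<close>, against \<open>N\<close>.\<close>

private lemma kills_dvd: assumes k: "kills d" shows "int p dvd d s"
proof (rule ccontr)
  assume s: "\<not> int p dvd d s"
  define P where "P k \<longleftrightarrow> (\<forall>t. int p dvd (fdiff ^^ k) d t)" for k
  have per: "d (t + p) = d t" for t using k unfolding kills_def by blast
  have "P p" unfolding P_def using fdiff_iterate_prime[where f=d, OF p per] by blast
  then have l: "P (LEAST k. P k)" by (rule LeastI)
  have "\<not> P 0" unfolding P_def using s by auto
  then obtain m where m: "(LEAST k. P k) = Suc m" using l by (metis not0_implies_Suc)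
  then have Pm: "P (Suc m)" "\<not> P m" using l not_less_Least[of m P] by auto
  define e where "e = (fdiff ^^ m) d"
  have ke: "kills e" unfolding e_def by (induction m) (simp_all add: k kills_fdiff)
  have st: "int p dvd e (Suc t) - e t" for t using Pm(1) unfolding P_def e_def by (simp add: fdiff_def)
  have c: "int p dvd e t - e 0" for t
  proof (induction t)
    case (Suc t)
    from dvd_add[OF st[of t] Suc] show ?case by simp
  qed simp
  have "(\<Sum>s<p. e s * n (0 + s)) = 0" using ke unfolding kills_def by blast
  then have "(\<Sum>s<p. e s * n s) = 0" by simp
  moreover have "int p dvd (\<Sum>s<p. (e s - e 0) * n s)" by (rule dvd_sum) (use c in auto)
  moreover have "(\<Sum>s<p. (e s - e 0) * n s) = (\<Sum>s<p. e s * n s) - e 0 * (\<Sum>s<p. n s)"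
    by (simp add: left_diff_distrib sum_subtractf sum_distrib_left)
  ultimately have "int p dvd e 0 * (\<Sum>s<p. n s)" by simp
  then have "int p dvd e 0" using N p by (simp add: prime_dvd_mult_iff)
  then have "int p dvd e t" for t using dvd_add[OF c[of t]] by force
  then show False using Pm(2) unfolding P_def e_def by blast
qed

text \<open>\<open>n\<close> is a unit of the localisation at \<open>p\<close> of the group ring of a cyclic group of order \<open>p\<close>.\<close>

lemma cyclic_correlation_zero:
  assumes per: "\<And>t. d (t + p) = d t" and rel: "\<And>t. (\<Sum>s<p. d s * n (t + s)) = 0"
  shows "d s = 0"
proof (rule ccontr)
  assume ne: "d s \<noteq> 0"
  have p1: "p > 1" using p prime_gt_1_nat by blast
  \<comment> \<open>Dividing by \<open>p\<close> preserves the relation, so every power of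
    \<open>p\<close> divides \<open>d s\<close>.\<close>
  have all: "kills d \<Longrightarrow> int p ^ k dvd d s" for k d
  proof (induction k arbitrary: d)
    case (Suc k)
    define e where "e s = d s div int p" for s
    have de: "d s = int p * e s" for s unfolding e_def using kills_dvd[OF Suc.prems, of s] by simp
    have "int p * (\<Sum>s<p. e s * n (t + s)) = 0" for t
      using Suc.prems unfolding kills_def by (simp add: sum_distrib_left de mult.assoc)
    then have "kills e" using Suc.prems p1 unfolding kills_def by (auto simp: e_def)
    from Suc.IH[OF this] show ?case unfolding de by simp
  qed simp
  have "kills d" unfolding kills_def using per rel by blast
  from dvd_imp_le_int[OF ne all[OF this, of "nat \<bar>d s\<bar>"]] have "int p ^ nat \<bar>d s\<bar> \<le> \<bar>d s\<bar>" by simp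
  moreover have "nat \<bar>d s\<bar> < p ^ nat \<bar>d s\<bar>" using p1 by (intro power_gt_expt) simp
  then have "\<bar>d s\<bar> < int (p ^ nat \<bar>d s\<bar>)" by linarith
  ultimately show False by simp
qed

end

section \<open>Integer-valued characters of the label group\<close>

context closed_group
begin

definition chars :: "('v \<Rightarrow> int) set" where
  "chars = {h. (\<forall>v. h v = 1 \<or> h v = - 1) \<and> (\<forall>u v. h (u + v) = h u * h v)}"

lemma charsD: "h \<in> chars \<Longrightarrow> h v = 1 \<or> h v = - 1" "h \<in> chars \<Longrightarrow> h (u + v) = h u * h v"
  unfolding chars_def by auto

lemma chars_0: "h \<in> chars \<Longrightarrow> h 0 = 1" using charsD(1)[of h 0] charsD(2)[of h 0 0] by auto

lemma chars_sq: "h \<in> chars \<Longrightarrow> h v * h v = 1" using charsD(1)[of h v] by auto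

lemma chars_mult: "h \<in> chars \<Longrightarrow> g \<in> chars \<Longrightarrow> (\<lambda>v. h v * g v) \<in> chars"
proof -
  assume h: "h \<in> chars" and g: "g \<in> chars"
  show ?thesis unfolding chars_def
  proof (intro CollectI conjI allI)
    fix v show "h v * g v = 1 \<or> h v * g v = - 1" using charsD(1)[OF h, of v] charsD(1)[OF g, of v] by auto
    fix u show "h (v + u) * g (v + u) = h v * g v * (h u * g u)" unfolding charsD(2)[OF h] charsD(2)[OF g] by simp
  qed
qed

lemma finite_chars: "finite chars"
  by (rule finite_subset[OF _ finite_PiE[of UNIV "\<lambda>_. {1, - 1}"]]) (auto simp: chars_def PiE_def)

text \<open>A subgroup of largest order among those avoiding \<open>v\<close> has index 2, and its
  sign character is the one wanted.\<close>

lemma chars_separate: assumes v: "v \<noteq> 0" shows "\<exists>h\<in>chars. h v = - 1"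
proof -
  define P where "P M \<longleftrightarrow> sgv M \<and> v \<notin> M" for M
  have "P {0}" unfolding P_def sgv_def using v by simp
  moreover have "\<forall>K. P K \<longrightarrow> card K \<le> 32" using V32 card_mono[OF finite_UNIV subset_UNIV] by metis
  ultimately have "\<exists>M. P M \<and> (\<forall>K. P K \<longrightarrow> card K \<le> card M)"
    by (intro ex_has_greatest_nat[where k="{0}" and b=33]) (auto simp: less_Suc_eq_le)
  then obtain M where M: "P M" "\<And>K. P K \<Longrightarrow> card K \<le> card M" by blast
  have sg: "0 \<in> M" "\<And>x y. x \<in> M \<Longrightarrow> y \<in> M \<Longrightarrow> x + y \<in> M" "v \<notin> M" using M(1) unfolding P_def sgv_def by auto
  have canc: "x + y \<in> M \<longleftrightarrow> y \<in> M" if "x \<in> M" for x y using sg(2)[OF that, of y] sg(2)[OF that, of "x + y"] by auto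
  have uv: "u + v \<in> M" if u: "u \<notin> M" for u
  proof (rule ccontr)
    assume uv: "u + v \<notin> M"
    let ?K = "M \<union> (\<lambda>m. m + u) ` M"
    have "P ?K" unfolding P_def sgv_def
    proof (intro conjI ballI)
      show "0 \<in> ?K" using sg(1) by blast
      show "v \<notin> ?K"
      proof
        assume "v \<in> ?K"
        then obtain m where "m \<in> M" "v = m + u" using sg(3) by blast
        then have "u + v = m" "m \<in> M" by (simp_all add: nf)
        then show False using uv by simp
      qed
      fix x y assume "x \<in> ?K" "y \<in> ?K"
      then obtain a b i j where ab: "a \<in> M" "b \<in> M" "x = a + i" "y = b + j" "i = 0 \<or> i = u" "j = 0 \<or> j = u" by (elim UnE imageE) (metis add_0_right)+
      have "x + y = (a + b) + (i + j)" unfolding ab by (simp only: nf)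
      moreover have "i + j = 0 \<or> i + j = u" using ab(5,6) by auto
      ultimately show "x + y \<in> ?K" using sg(2)[OF ab(1,2)] by auto
    qed
    from M(2)[OF this] have "card ?K \<le> card M" .
    moreover have "M \<subset> ?K" using u sg(1) by force
    then have "card M < card ?K" by (rule psubset_card_mono[OF finite])
    ultimately show False by simp
  qed
  define h where "h w = (if w \<in> M then 1 else - 1 :: int)" for w
  have "h \<in> chars" unfolding chars_def
  proof (intro CollectI conjI allI)
    fix u w
    show "h u = 1 \<or> h u = - 1" unfolding h_def by simp
    have "u + w \<in> M" if "u \<notin> M" "w \<notin> M" using sg(2)[OF uv[OF that(1)] uv[OF that(2)]] by (simp add: nf)
    moreover have "u + w \<in> M \<longleftrightarrow> w \<in> M" if "u \<in> M" using canc[OF that] .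
    moreover have "u + w \<in> M \<longleftrightarrow> u \<in> M" if "w \<in> M" using canc[OF that, of u] by (simp add: add.commute)
    ultimately show "h (u + w) = h u * h w" unfolding h_def by auto
  qed
  moreover have "h v = - 1" unfolding h_def using sg(3) by simp
  ultimately show ?thesis by blast
qed

lemma chars_orth: assumes v: "v \<noteq> 0" shows "(\<Sum>h\<in>chars. h v) = 0"
proof -
  obtain g where g: "g \<in> chars" "g v = - 1" using chars_separate[OF v] by blast
  have "bij_betw (\<lambda>h v. g v * h v) chars chars"
  proof (rule bij_betwI[where g="\<lambda>h v. g v * h v"])
    show "(\<lambda>h v. g v * h v) \<in> chars \<rightarrow> chars" "(\<lambda>h v. g v * h v) \<in> chars \<rightarrow> chars" using chars_mult[OF g(1)] by auto
  qed (simp_all add: fun_eq_iff mult.assoc[symmetric] chars_sq[OF g(1)])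
  from sum.reindex_bij_betw[OF this, of "\<lambda>h. h v"] have "(\<Sum>h\<in>chars. g v * h v) = (\<Sum>h\<in>chars. h v)" .
  then show ?thesis using g(2) by (simp add: sum_negf)
qed

lemma card_chars: "card chars = 32"
proof -
  have 1: "(\<Sum>h\<in>chars. h v) = (if v = 0 then int (card chars) else 0)" for v
    using chars_orth[of v] by (simp add: chars_0)
  have one: "(\<lambda>_. 1) \<in> chars" unfolding chars_def by simp
  have 2: "(\<Sum>v\<in>UNIV. h v) = (if h = (\<lambda>_. 1) then 32 else 0)" if h: "h \<in> chars" for h
  proof (cases "h = (\<lambda>_. 1)")
    case False
    then obtain w where "h w \<noteq> 1" by blast
    then have w: "h w = - 1" using charsD(1)[OF h] by blast
    have "bij_betw (\<lambda>v. v + w) UNIV UNIV" by (rule bij_betwI[where g="\<lambda>v. v + w"]) (simp_all add: add.assoc)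
    from sum.reindex_bij_betw[OF this, of h] show ?thesis using False w by (simp add: charsD(2)[OF h] sum_negf)
  qed (simp add: V32)
  have "(\<Sum>v\<in>UNIV. \<Sum>h\<in>chars. h v) = int (card chars)" unfolding 1 by simp
  moreover have "(\<Sum>h\<in>chars. \<Sum>v\<in>UNIV. h v) = 32" using 2 one finite_chars by (simp add: sum.delta)
  moreover have "(\<Sum>v\<in>UNIV. \<Sum>h\<in>chars. h v) = (\<Sum>h\<in>chars. \<Sum>v\<in>UNIV. h v)" by (rule sum.swap)
  ultimately show ?thesis by simp
qed

lemma fourier_inversion: "(\<Sum>h\<in>chars. h m * (\<Sum>l\<in>UNIV. S l * h l)) = 32 * (S m :: int)"
proof -
  have "(\<Sum>h\<in>chars. h m * (\<Sum>l\<in>UNIV. S l * h l)) = (\<Sum>h\<in>chars. \<Sum>l\<in>UNIV. S l * h (m + l))"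
    by (rule sum.cong[OF refl]) (simp add: charsD(2) sum_distrib_left mult.left_commute)
  also have "\<dots> = (\<Sum>l\<in>UNIV. S l * (\<Sum>h\<in>chars. h (m + l)))" by (subst sum.swap) (simp add: sum_distrib_left)
  also have "\<dots> = (\<Sum>l\<in>UNIV. if l = m then S l * 32 else 0)"
  proof (rule sum.cong[OF refl])
    fix l show "S l * (\<Sum>h\<in>chars. h (m + l)) = (if l = m then S l * 32 else 0)"
      using chars_orth[of "m + l"] v_eq[of m l] by (auto simp: chars_0 card_chars)
  qed
  finally show ?thesis by simp
qed

end

section \<open>Aligning the classes\<close>

locale two_reps = base_rep \<Omega> A p tv eps z + H: base_rep \<Omega> A p tv ep z'
  for \<Omega> :: "'a set" and A p and tv :: "'v::{ab_group_add,finite} itself" and eps :: "'v \<Rightarrow> 'a \<Rightarrow> 'a" and z ep z'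
begin

lemma sim_mem: "x \<in> \<Omega> \<Longrightarrow> sim x y \<Longrightarrow> y \<in> \<Omega>"
  using cl_mem[OF _ sim_cl] .

text \<open>If the element of \<open>E' \<times> P'\<close> from \<open>x\<close> to
  \<open>y\<close> had a nontrivial part in \<open>P'\<close>, its square, a power of
  \<open>z'\<close>, would act without fixed points on the \<open>LV\<close>-orbit of
  \<open>x\<close>, and \<open>p\<close> would divide the order of \<open>LV\<close>, which divides
  32.\<close>

lemma sim_ep: assumes x: "x \<in> \<Omega>" and s: "sim x y" shows "\<exists>u. y = ep u x"
proof -
  note y = sim_mem[OF x s]
  obtain u t where ut: "t < p" "y = H.tr u t x" using H.tr_ex[OF x y] by blast
  have "t = 0"
  proof (rule ccontr)
    assume "t \<noteq> 0"
    then have nt: "\<not> p dvd t" using ut(1) by (auto dest: dvd_imp_le)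
    have np: "\<not> p dvd 2 * t"
    proof
      assume "p dvd 2 * t"
      then have "p dvd 2" using nt prime_dvd_mult_iff[OF prime_p] by blast
      then have "p \<le> 2" by (rule dvd_imp_le) simp
      then have "p = 2" using p_gt1 by simp
      then show False using odd_p by simp
    qed
    let ?c = "\<lambda>x. (z' ^^ (2 * t)) x"
    have cA: "?c \<in> A" by (rule A_pow[OF rep_mem(2)[OF H.R]])
    have "sim y (H.tr u t y)" using sim_A[OF H.tr_A x s, of u t] unfolding ut(2)[symmetric] .
    then have "sim x (H.tr u t (H.tr u t x))" unfolding ut(2)[symmetric] by (rule sim_trans[OF s])
    moreover have "H.tr u t (H.tr u t x) = ?c x" unfolding H.tr_tr by (simp add: H.tr_z mult_2)
    ultimately have c1: "sim x (?c x)" by simp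
    have fS: "finite {y. sim x y}" by (rule finite_subset[OF _ fin]) (use sim_mem[OF x] in blast)
    have d: "p dvd card ({y. sim x y} - {y\<in>{y. sim x y}. ?c y = y})"
    proof (rule card_cyclic_fixed[OF fS prime_p])
      fix y assume "y \<in> {y. sim x y}"
      then have "sim (?c x) (?c y)" using sim_A[OF cA x] by simp
      then show "?c y \<in> {y. sim x y}" using sim_trans[OF c1] by simp
      have "(?c ^^ p) y = (z' ^^ (p * (2 * t))) y" using fun_cong[OF funpow_mult[where f=z' and m="2 * t" and n=p], of y] unfolding mult.commute[of p] .
      also have "\<dots> = (z' ^^ ((p * (2 * t)) mod p)) y" by (rule rep_zmod[OF H.R, symmetric])
      finally show "(?c ^^ p) y = y" by simp
    qed
    have "{y\<in>{y. sim x y}. ?c y = y} = {}"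
      using rep_z_ne[OF H.R sim_mem[OF x]] np by blast
    from d[unfolded this] have "p dvd card {y. sim x y}" by simp
    moreover have "{y. sim x y} = (\<lambda>l. eps l x) ` LV" unfolding sim_def by blast
    moreover have "card ((\<lambda>l. eps l x) ` LV) = card LV"
      by (rule card_image, rule inj_onI) (use rep_free(1)[OF R x, of 0 _ 0] in simp)
    ultimately show False using sgv_card_p[OF LV_sgv] by simp
  qed
  then have "y = ep u x" using ut(2) H.tr_eps by simp
  then show ?thesis by blast
qed

lemma sim_sub: assumes x: "x \<in> \<Omega>" and s: "sim x y" shows "H.sim x y"
proof -
  obtain u where u: "y = ep u x" using sim_ep[OF x s] by blast
  have "u \<in> H.LV"
  proof (rule H.LV_at[OF x])
    fix a assume a: "a \<in> A" "a x = x"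
    from sim_A[OF a(1) x s] have "sim x (a y)" unfolding a(2) .
    from sim_ep[OF x this] show "\<exists>w. a (ep u x) = ep w x" unfolding u .
  qed
  then show ?thesis using u by (rule H.simI)
qed

text \<open>By symmetry of the two groups; so the block system depends on \<open>A\<close>
  only.\<close>

lemma sim_eq: assumes x: "x \<in> \<Omega>" shows "sim x y \<longleftrightarrow> H.sim x y"
proof -
  interpret S: two_reps \<Omega> A p tv ep z' eps z by unfold_locales
  show ?thesis using sim_sub[OF x] S.sim_sub[OF x] by blast
qed

definition br :: "'a \<Rightarrow> 'a" where "br x = (SOME y. sim x y)"

lemma br_sim: "sim x (br x)" unfolding br_def using sim_refl by (rule someI)

lemma br_eq: "br x = br y \<longleftrightarrow> sim x y"
proof
  assume "br x = br y"
  then show "sim x y" using br_sim[of x] br_sim[of y] sim_sym sim_trans by metis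
next
  assume s: "sim x y"
  have "sim x w \<longleftrightarrow> sim y w" for w using sim_trans[OF s] sim_trans[OF sim_sym[OF s]] by blast
  then have "sim x = sim y" by (simp add: fun_eq_iff)
  then show "br x = br y" unfolding br_def by (simp only:)
qed

lemma br_mem: "x \<in> \<Omega> \<Longrightarrow> br x \<in> \<Omega>" using sim_mem[OF _ br_sim] .

text \<open>The action on blocks is realised on their representatives by
  \<open>\<lambda>g c. br (g c)\<close>.\<close>

lemma block_orbit:
  assumes M: "perm_group \<Omega> M" "M \<subseteq> A" "card M dvd p ^ j" and x: "x \<in> \<Omega>"
  shows "\<exists>i. card ((\<lambda>g. br (g x)) ` M) = p ^ i"
proof -
  have key: "br (f (br u)) = br (f u)" if "f \<in> M" "u \<in> \<Omega>" for f u
    using sim_A[OF subsetD[OF M(2) that(1)] that(2) br_sim] br_eq sim_sym by metis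
  have mem: "f u \<in> \<Omega>" if "f \<in> M" "u \<in> \<Omega>" for f u using A_mem[OF subsetD[OF M(2) that(1)] that(2)] .
  have "card M = card ((\<lambda>g. br (g (br x))) ` M) * card {g\<in>M. br (g (br x)) = br x}"
  proof (rule action_orbit_card[OF M(1) fin, where \<phi>="\<lambda>g c. br (g c)"])
    show "br (id (br x)) = br x" using br_eq[of "br x" x] sim_sym[OF br_sim[of x]] by simp
    show "br ((f \<circ> g) (br x)) = br (f (br (g (br x))))" if "f \<in> M" "g \<in> M" for f g
      using key[OF that(1) mem[OF that(2) br_mem[OF x]]] by simp
    show "d = e" if f: "f \<in> M" and d: "d \<in> (\<lambda>g. br (g (br x))) ` M" and e: "e \<in> (\<lambda>g. br (g (br x))) ` M" and eq: "br (f d) = br (f e)" for f d e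
    proof -
      obtain g where g: "g \<in> M" "d = br (g (br x))" using d by blast
      obtain h where h: "h \<in> M" "e = br (h (br x))" using e by blast
      note dm = br_mem[OF mem[OF g(1) br_mem[OF x]], folded g(2)]
      have "sim (f d) (f e)" using eq br_eq by blast
      from sim_A[OF subsetD[OF M(2) perm_groupD(4)[OF M(1) f]] mem[OF f dm] this]
      have "sim d e" unfolding perm_group_inv_apply[OF M(1) f] .
      then have "br d = br e" using br_eq by blast
      moreover have "br d = d" "br e = e" unfolding g(2) h(2) using br_eq sim_sym[OF br_sim] by metis+
      ultimately show ?thesis by simp
    qed
  qed
  moreover have "(\<lambda>g. br (g (br x))) ` M = (\<lambda>g. br (g x)) ` M" by (rule image_cong[OF refl]) (rule key[OF _ x])
  ultimately have "card M = card ((\<lambda>g. br (g x)) ` M) * card {g\<in>M. br (g (br x)) = br x}" by (simp only:)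
  then have "card ((\<lambda>g. br (g x)) ` M) dvd card M" by (rule dvdI)
  then have "card ((\<lambda>g. br (g x)) ` M) dvd p ^ j" using M(3) by (rule dvd_trans)
  then show ?thesis using divides_primepow_nat[OF prime_p] by blast
qed

end

section \<open>Comparing the orbits of \<open>L \<times> P\<close> and
  \<open>L' \<times> P'\<close>\<close>

locale common_sylow = two_reps \<Omega> A p tv eps z ep z'
  for \<Omega> :: "'a set" and A p and tv :: "'v::{ab_group_add,finite} itself" and eps :: "'v \<Rightarrow> 'a \<Rightarrow> 'a" and z ep z' +
  fixes T :: "('a \<Rightarrow> 'a) set" and kT :: nat
  assumes T: "perm_group \<Omega> T" "T \<subseteq> A" "card T = p ^ kT"
    and DT: "\<And>a. (\<And>x y. x \<in> \<Omega> \<Longrightarrow> cl LV x y \<Longrightarrow> a x = a y) \<Longrightarrow> Dmap a \<in> T"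
    and DT': "\<And>a. (\<And>x y. x \<in> \<Omega> \<Longrightarrow> H.cl H.LV x y \<Longrightarrow> a x = a y) \<Longrightarrow> H.Dmap a \<in> T"
begin

abbreviation "C \<equiv> cl LV"
abbreviation "C' \<equiv> H.cl H.LV"

lemmas C_refl = cl_refl[OF LV_sgv] and C_sym = cl_sym[OF LV_sgv] and C_trans = cl_trans[OF LV_sgv] and C_z = cl_z[OF LV_sgv]
lemmas C'_refl = H.cl_refl[OF H.LV_sgv] and C'_sym = H.cl_sym[OF H.LV_sgv] and C'_trans = H.cl_trans[OF H.LV_sgv] and C'_z = H.cl_z[OF H.LV_sgv]

definition dx :: "'a \<Rightarrow> nat \<Rightarrow> 'a \<Rightarrow> 'a" where "dx x n = Dmap (\<lambda>y. if C x y then n else 0)"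
definition dx' :: "'a \<Rightarrow> nat \<Rightarrow> 'a \<Rightarrow> 'a" where "dx' x n = H.Dmap (\<lambda>y. if C' x y then n else 0)"

lemma dx: "dx x n \<in> T" "y \<in> \<Omega> \<Longrightarrow> C x y \<Longrightarrow> dx x n y = (z ^^ n) y" "\<not> C x y \<Longrightarrow> dx x n y = y"
proof -
  show "dx x n \<in> T" unfolding dx_def
  proof (rule DT)
    fix u w assume c: "C u w"
    have "C x u \<longleftrightarrow> C x w" using C_trans[OF _ c] C_trans[OF _ C_sym[OF c]] by blast
    then show "(if C x u then n else 0) = (if C x w then n else 0)" by simp
  qed
qed (simp_all add: dx_def Dmap_def)

lemma dx': "dx' x n \<in> T" "y \<in> \<Omega> \<Longrightarrow> C' x y \<Longrightarrow> dx' x n y = (z' ^^ n) y" "\<not> C' x y \<Longrightarrow> dx' x n y = y"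
proof -
  show "dx' x n \<in> T" unfolding dx'_def
  proof (rule DT')
    fix u w assume c: "C' u w"
    have "C' x u \<longleftrightarrow> C' x w" using C'_trans[OF _ c] C'_trans[OF _ C'_sym[OF c]] by blast
    then show "(if C' x u then n else 0) = (if C' x w then n else 0)" by simp
  qed
qed (simp_all add: dx'_def H.Dmap_def)

lemma T_A: "f \<in> T \<Longrightarrow> f \<in> A" using T(2) by blast

lemma T_inv: assumes "f \<in> T" shows "finv f \<in> T" "finv f (f x) = x" "f (finv f x) = x"
  using perm_groupD(4)[OF T(1) assms] perm_group_inv_apply[OF T(1) assms] by auto

lemma fixing_subgroup:
  assumes sub: "\<And>f g. f \<in> T \<Longrightarrow> g \<in> T \<Longrightarrow> P f \<Longrightarrow> P g \<Longrightarrow> P (f \<circ> g)" "\<And>f. f \<in> T \<Longrightarrow> P f \<Longrightarrow> P (finv f)" "P id"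
  shows "perm_group \<Omega> {f\<in>T. P f}" "card {f\<in>T. P f} dvd p ^ kT"
proof -
  show pg: "perm_group \<Omega> {f\<in>T. P f}"
    by (rule perm_groupI) (use perm_groupD[OF T(1)] sub in auto)
  show "card {f\<in>T. P f} dvd p ^ kT" using perm_group_card_dvd[OF T(1) pg _ fin] T(3) by auto
qed

text \<open>Each of the two classes of \<open>x\<close> consists of \<open>p\<close> blocks. The
  subgroup of \<open>T\<close> supported on their union moves the block of \<open>x\<close> through
  all of them; as they share a block, this orbit has fewer than \<open>2 * p\<close> blocks, and
  being of \<open>p\<close>-power size it has exactly \<open>p\<close>. For the exponent,
  \<open>k\<close> is chosen at \<open>x\<close> and then shown to fit the whole class.\<close>

lemma classes:
  assumes x: "x \<in> \<Omega>"
  shows "C x y \<longleftrightarrow> C' x y" "\<exists>k<p. \<forall>y. C x y \<longrightarrow> sim ((z ^^ k) y) (z' y)"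
proof -
  define P1 where "P1 = (\<lambda>n. br ((z ^^ n) x)) ` {..<p}"
  define P2 where "P2 = (\<lambda>n. br ((z' ^^ n) x)) ` {..<p}"
  have zx: "(z ^^ n) x \<in> \<Omega>" "(z' ^^ n) x \<in> \<Omega>" for n using rep_zpow_mem[OF R x] rep_zpow_mem[OF H.R x] by auto
  have c1: "card P1 = p" unfolding P1_def
    by (subst card_image) (auto simp: inj_on_def br_eq sim_z[OF x])
  have c2: "card P2 = p" unfolding P2_def
    by (subst card_image) (auto simp: inj_on_def br_eq sim_eq[OF zx(2)] H.sim_z[OF x])
  have inP1: "br y \<in> P1" if c: "C x y" for y
  proof -
    obtain t where "t < p" "sim ((z ^^ t) x) y" using cl_sim[OF c] by blast
    then show ?thesis unfolding P1_def by (intro image_eqI[of _ _ t]) (auto simp: br_eq intro: sim_sym)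
  qed
  have inP2: "br y \<in> P2" if c: "C' x y" for y
  proof -
    obtain t where "t < p" "H.sim ((z' ^^ t) x) y" using H.cl_sim[OF c] by blast
    then have "t < p" "sim ((z' ^^ t) x) y" using sim_eq[OF zx(2)] by auto
    then show ?thesis unfolding P2_def by (intro image_eqI[of _ _ t]) (auto simp: br_eq intro: sim_sym)
  qed
  define Q where "Q f \<longleftrightarrow> (\<forall>y. \<not> C x y \<and> \<not> C' x y \<longrightarrow> f y = y)" for f :: "'a \<Rightarrow> 'a"
  let ?M = "{f\<in>T. Q f}"
  have M: "perm_group \<Omega> ?M" "card ?M dvd p ^ kT"
  proof (rule_tac [!] fixing_subgroup)
    fix f assume f: "f \<in> T" "Q f"
    have "finv f y = y" if "\<not> C x y \<and> \<not> C' x y" for y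
      using T_inv(2)[OF f(1), of y] f(2) that unfolding Q_def by simp
    then show "Q (finv f)" "Q (finv f)" unfolding Q_def by blast+
  qed (simp_all add: Q_def)
  define O' where "O' = (\<lambda>g. br (g x)) ` ?M"
  obtain i where i: "card O' = p ^ i" unfolding O'_def using block_orbit[OF M(1) _ M(2) x] T(2) by blast
  have "P1 \<subseteq> O'"
  proof
    fix u assume "u \<in> P1"
    then obtain n where u: "u = br ((z ^^ n) x)" unfolding P1_def by blast
    have m: "dx x n \<in> ?M" using dx(1,3) unfolding Q_def by simp
    have e: "u = br (dx x n x)" unfolding u dx(2)[OF x C_refl] ..
    show "u \<in> O'" unfolding O'_def by (rule image_eqI[where f="\<lambda>g. br (g x)", OF e m])
  qed
  have "P2 \<subseteq> O'"
  proof
    fix u assume "u \<in> P2"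
    then obtain n where u: "u = br ((z' ^^ n) x)" unfolding P2_def by blast
    have m: "dx' x n \<in> ?M" using dx'(1,3) unfolding Q_def by simp
    have e: "u = br (dx' x n x)" unfolding u dx'(2)[OF x C'_refl] ..
    show "u \<in> O'" unfolding O'_def by (rule image_eqI[where f="\<lambda>g. br (g x)", OF e m])
  qed
  have "O' \<subseteq> P1 \<union> P2"
  proof
    fix u assume "u \<in> O'"
    then obtain g where g: "g \<in> T" "Q g" "u = br (g x)" unfolding O'_def by blast
    have "C x (g x) \<or> C' x (g x)"
    proof (rule ccontr)
      assume n: "\<not> ?thesis"
      then have "g (g x) = g x" using g(2) unfolding Q_def by blast
      then have "g x = x" using A_inj[OF T_A[OF g(1)]] by blast
      then show False using n C_refl by simp
    qed
    then show "u \<in> P1 \<union> P2" using g(3) inP1 inP2 by blast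
  qed
  have finP: "finite P1" "finite P2" unfolding P1_def P2_def by auto
  have "br x \<in> P1 \<inter> P2" using inP1[OF C_refl] inP2[OF C'_refl] by blast
  then have "card (P1 \<inter> P2) > 0" using finP by (auto simp: card_gt_0_iff)
  then have u: "card (P1 \<union> P2) < 2 * p" using card_Un_Int[OF finP] c1 c2 by linarith
  have finO: "finite O'" using finite_subset[OF \<open>O' \<subseteq> P1 \<union> P2\<close>] finP by simp
  have "card O' \<le> card (P1 \<union> P2)" using card_mono[OF _ \<open>O' \<subseteq> P1 \<union> P2\<close>] finP by simp
  then have lt: "p ^ i < 2 * p" using u i by simp
  have "p \<le> p ^ i" using card_mono[OF finO \<open>P1 \<subseteq> O'\<close>] c1 i by simp
  have "i = 1"
  proof (rule ccontr)
    assume "i \<noteq> 1"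
    then consider "i = 0" | "2 \<le> i" by linarith
    then show False
    proof cases
      case 1 then show False using \<open>p \<le> p ^ i\<close> p_gt1 by simp
    next
      case 2
      have "p ^ 2 \<le> p ^ i" using 2 p_pos by (intro power_increasing) auto
      then have "p * p < 2 * p" using lt unfolding power2_eq_square by (rule le_less_trans)
      then have "p < 2" by simp
      then show False using p_gt1 by simp
    qed
  qed
  then have "card O' = p" using i by simp
  then have PP: "P1 = O'" "P2 = O'" using card_subset_eq[OF finO] \<open>P1 \<subseteq> O'\<close> \<open>P2 \<subseteq> O'\<close> c1 c2 by auto
  have C1: "C x y" if "C' x y" for y
  proof -
    have "br y \<in> P1" using inP2[OF that] PP by simp
    then obtain t where "br y = br ((z ^^ t) x)" unfolding P1_def by blast
    then have "sim ((z ^^ t) x) y" by (intro br_eq[THEN iffD1]) (rule sym)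
    from C_trans[OF C_z sim_cl[OF this]] show ?thesis .
  qed
  have C2: "C' x y" if "C x y" for y
  proof -
    have "br y \<in> P2" using inP1[OF that] PP by simp
    then obtain t where "br y = br ((z' ^^ t) x)" unfolding P2_def by blast
    then have "sim ((z' ^^ t) x) y" by (intro br_eq[THEN iffD1]) (rule sym)
    then have "H.sim ((z' ^^ t) x) y" using sim_eq[OF zx(2)] by blast
    from C'_trans[OF C'_z H.sim_cl[OF this]] show ?thesis .
  qed
  show "C x y \<longleftrightarrow> C' x y" using C1 C2 by blast
  have "br (z' x) \<in> P1" using inP1[OF C1, of "z' x"] C'_z[of x 1] by simp
  then obtain k where k: "k < p" "br (z' x) = br ((z ^^ k) x)" unfolding P1_def by blast
  have kx: "sim ((z ^^ k) x) (z' x)" by (rule br_eq[THEN iffD1, OF k(2)[symmetric]])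
  define Q0 where "Q0 f \<longleftrightarrow> (\<forall>y. \<not> C x y \<longrightarrow> f y = y) \<and> sim x (f x)" for f :: "'a \<Rightarrow> 'a"
  let ?M0 = "{f\<in>T. Q0 f}"
  have M0: "perm_group \<Omega> ?M0" "card ?M0 dvd p ^ kT"
  proof (rule_tac [!] fixing_subgroup)
    fix f assume f: "f \<in> T" "Q0 f"
    have "finv f y = y" if "\<not> C x y" for y using T_inv(2)[OF f(1), of y] f(2) that unfolding Q0_def by simp
    moreover have "sim (finv f x) (finv f (f x))" using sim_A[OF T_A[OF T_inv(1)[OF f(1)]] x] f(2) unfolding Q0_def by blast
    then have "sim x (finv f x)" unfolding T_inv(2)[OF f(1)] by (rule sim_sym)
    ultimately show "Q0 (finv f)" "Q0 (finv f)" unfolding Q0_def by blast+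
  next
    fix f g assume f: "f \<in> T" "g \<in> T" "Q0 f" "Q0 g"
    have "sim (f x) (f (g x))" using sim_A[OF T_A[OF f(1)] x] f(4) unfolding Q0_def by blast
    then have "sim x (f (g x))" using sim_trans f(3) unfolding Q0_def by blast
    then show "Q0 (f \<circ> g)" "Q0 (f \<circ> g)" using f(3,4) unfolding Q0_def by simp_all
  qed (use sim_refl in \<open>simp_all add: Q0_def\<close>)
  \<comment> \<open>A \<open>p\<close>-group that fixes one of the \<open>p\<close> blocks moves any
    other one through at most \<open>p - 1\<close> blocks, hence fixes it.\<close>
  have triv: "sim y (g y)" if g: "g \<in> ?M0" and y: "C x y" for g y
  proof (cases "sim x y")
    case True
    have "sim x (g x)" "sim (g x) (g y)" using g sim_A[OF T_A _ True] x unfolding Q0_def by auto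
    then show ?thesis using True sim_sym sim_trans by blast
  next
    case False
    note yO = cl_mem[OF x y]
    let ?O = "(\<lambda>g. br (g y)) ` ?M0"
    obtain i' where i': "card ?O = p ^ i'" using block_orbit[OF M0(1) _ M0(2) yO] T(2) by blast
    have sub: "?O \<subseteq> P1 - {br x}"
    proof
      fix u assume "u \<in> ?O"
      then obtain h where h: "h \<in> T" "Q0 h" "u = br (h y)" by blast
      have "C x (h y)"
      proof (rule ccontr)
        assume n: "\<not> C x (h y)"
        then have "h (h y) = h y" using h(2) unfolding Q0_def by blast
        then have "h y = y" using A_inj[OF T_A[OF h(1)]] by blast
        then show False using n y by simp
      qed
      then have 1: "u \<in> P1" using h(3) inP1 by simp
      have "u \<noteq> br x"
      proof
        assume "u = br x"
        then have "sim x (h y)" using h(3) by (intro br_eq[THEN iffD1]) simp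
        then have "sim (h x) (h y)" using h(2) sim_sym sim_trans unfolding Q0_def by blast
        from sim_A[OF T_A[OF T_inv(1)[OF h(1)]] A_mem[OF T_A[OF h(1)] x] this] have "sim x y" unfolding T_inv(2)[OF h(1)] .
        then show False using False by blast
      qed
      then show "u \<in> P1 - {br x}" using 1 by blast
    qed
    have "card ?O \<le> p - 1" using card_mono[OF _ sub] finP(1) inP1[OF C_refl] c1 by simp
    then have "p ^ i' < p" using i' p_pos by simp
    then have "i' = 0" using power_increasing[of 1 i' p] p_pos by (cases i') auto
    then have "card ?O = 1" using i' by simp
    then obtain w where w: "?O = {w}" using card_1_singletonE by blast
    have "id \<in> ?M0" using perm_groupD(2)[OF M0(1)] .
    then have "br (id y) \<in> ?O" by blast
    moreover have "br (g y) \<in> ?O" using g by blast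
    ultimately have "br y = br (g y)" unfolding w by simp
    then show ?thesis using br_eq by blast
  qed
  have pk: "(z ^^ (p * k - k)) ((z ^^ k) y) = y" "(z ^^ k) ((z ^^ (p * k - k)) y) = y" for y
  proof -
    have k1: "(p * k - k) + k = p * k" "k + (p * k - k) = p * k" using p_pos by auto
    have k2: "(z ^^ (p * k)) y = y" using rep_zmod[OF R, of "p * k" y] by simp
    show "(z ^^ (p * k - k)) ((z ^^ k) y) = y" unfolding zadd[OF R] k1 by (rule k2)
    show "(z ^^ k) ((z ^^ (p * k - k)) y) = y" unfolding zadd[OF R] k1 by (rule k2)
  qed
  have zA: "(\<lambda>x. (z ^^ n) x) \<in> A" for n by (rule A_pow[OF rep_mem(2)[OF R]])
  \<comment> \<open>\<open>z'\<close> followed by the inverse of \<open>z ^^ k\<close>, restricted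
    to the class of \<open>x\<close>; \<open>p * k - k\<close> stands for minus \<open>k\<close>. It
    fixes the block of \<open>x\<close>, so all blocks of the class.\<close>
  let ?g = "dx x (p * k - k) \<circ> dx' x 1"
  have gy: "?g y = (z ^^ (p * k - k)) (z' y)" if "C x y" for y
  proof -
    note y = cl_mem[OF x that]
    have "dx' x 1 y = z' y" using dx'(2)[OF y C2[OF that], of 1] by simp
    moreover have "C x (z' y)" using C1[OF C'_trans[OF C2[OF that] C'_z[of y 1]]] by simp
    ultimately show ?thesis using dx(2)[OF A_mem[OF rep_mem(2)[OF H.R] y]] by (simp only: comp_apply)
  qed
  have "?g \<in> ?M0"
  proof (rule CollectI, rule conjI)
    show "?g \<in> T" by (rule perm_groupD(3)[OF T(1) dx(1) dx'(1)])
    have "?g y = y" if "\<not> C x y" for y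
    proof -
      have "\<not> C' x y" using that C1 by blast
      then show ?thesis using dx'(3) dx(3) that by simp
    qed
    moreover have "sim x (?g x)" unfolding gy[OF C_refl] using sim_A[OF zA zx(1) kx, of "p * k - k"] unfolding pk .
    ultimately show "Q0 ?g" unfolding Q0_def by blast
  qed
  have "sim ((z ^^ k) y) (z' y)" if "C x y" for y
  proof -
    from triv[OF \<open>?g \<in> ?M0\<close> that] have "sim y ((z ^^ (p * k - k)) (z' y))" unfolding gy[OF that] .
    from sim_A[OF zA cl_mem[OF x that] this, of k] show ?thesis unfolding pk .
  qed
  then show "\<exists>k<p. \<forall>y. C x y \<longrightarrow> sim ((z ^^ k) y) (z' y)" using k(1) by blast
qed

end

text \<open>The sum is twice the number of values 1 minus \<open>p\<close>, so this number is
  divisible by \<open>p\<close> and must be 0 or \<open>p\<close>.\<close>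

lemma pm_one_sum:
  fixes g :: "nat \<Rightarrow> int" and p :: nat
  assumes p: "prime p" "odd p" and g: "\<And>t. g t = 1 \<or> g t = - 1" and d: "int p dvd (\<Sum>t<p. g t)" and st: "s < p" "t < p"
  shows "g s = g t"
proof -
  define P where "P = {t\<in>{..<p}. g t = 1}"
  have fP: "finite P" "P \<subseteq> {..<p}" unfolding P_def by auto
  have "g t = 2 * (if t \<in> P then 1 else 0) - 1" if "t < p" for t using g[of t] that unfolding P_def by auto
  then have "(\<Sum>t<p. g t) = (\<Sum>t<p. 2 * (if t \<in> P then 1 else 0) - 1)" by (intro sum.cong) auto
  also have "\<dots> = 2 * (\<Sum>t<p. (if t \<in> P then 1 else 0)) - int p" by (simp add: sum_subtractf sum_distrib_left)
  also have "(\<Sum>t<p. (if t \<in> P then 1 else 0 :: int)) = int (card P)"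
    using fP by (simp add: sum.If_cases Int_absorb1)
  finally have "int p dvd 2 * int (card P) - int p" using d by simp
  then have "int p dvd 2 * int (card P)" by (metis dvd_add_right_iff dvd_refl diff_add_cancel add.commute)
  then have "p dvd 2 * card P" by (metis of_nat_dvd_iff of_nat_mult of_nat_numeral)
  then have "p dvd 2 \<or> p dvd card P" using p prime_dvd_mult_iff by blast
  moreover have "\<not> p dvd 2"
  proof
    assume "p dvd 2"
    then have "p \<le> 2" by (rule dvd_imp_le) simp
    then have "p = 2" using prime_gt_1_nat[OF p(1)] by simp
    then show False using p(2) by simp
  qed
  ultimately have "p dvd card P" by blast
  then consider "card P = 0" | "p \<le> card P" by (cases "card P = 0") (auto dest: dvd_imp_le)
  then show ?thesis
  proof cases
    case 1
    then have "P = {}" using fP by simp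
    then show ?thesis using st g[of s] g[of t] unfolding P_def by auto
  next
    case 2
    then have "P = {..<p}" using card_seteq[OF _ fP(2)] by simp
    then have "g s = 1" "g t = 1" using st unfolding P_def by blast+
    then show ?thesis by simp
  qed
qed

section \<open>Separating points of a block by characters\<close>

context common_sylow
begin

text \<open>The kernel of the action of \<open>A\<close> on the classes.\<close>

definition F :: "('a \<Rightarrow> 'a) set" where "F = {a\<in>A. \<forall>u\<in>\<Omega>. C u (a u)}"

lemma F_A: "f \<in> F \<Longrightarrow> f \<in> A" and F_C: "f \<in> F \<Longrightarrow> u \<in> \<Omega> \<Longrightarrow> C u (f u)" unfolding F_def by auto

lemma F_mem: "f \<in> F \<Longrightarrow> u \<in> \<Omega> \<Longrightarrow> f u \<in> \<Omega>" using A_mem[OF F_A] .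

lemma F_comp: assumes "f \<in> F" "g \<in> F" shows "(\<lambda>x. f (g x)) \<in> F"
  unfolding F_def using A_comp[OF F_A[OF assms(1)] F_A[OF assms(2)]] C_trans[OF F_C[OF assms(2)] F_C[OF assms(1) F_mem[OF assms(2)]]] by blast

lemma F_id: "(\<lambda>x. x) \<in> F" unfolding F_def using A_id C_refl by blast

lemma F_inv: assumes f: "f \<in> F" shows "finv f \<in> F"
proof -
  have "C u (finv f u)" if u: "u \<in> \<Omega>" for u
  proof -
    have "C (finv f u) (f (finv f u))" by (rule F_C[OF f A_mem[OF A_inv(1)[OF F_A[OF f]] u]])
    then show ?thesis unfolding A_inv(3)[OF F_A[OF f]] by (rule C_sym)
  qed
  then show ?thesis unfolding F_def using A_inv(1)[OF F_A[OF f]] by blast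
qed

lemma tr_F: assumes "l \<in> LV" shows "tr l t \<in> F"
proof -
  have "C u (tr l t u)" for u unfolding cl_def tr_def using assms by blast
  then show ?thesis unfolding F_def using tr_A by blast
qed

lemma tr'_F: assumes "l \<in> H.LV" shows "H.tr l t \<in> F"
proof -
  have "C' u (H.tr l t u)" for u unfolding H.cl_def H.tr_def using assms by blast
  then have "C u (H.tr l t u)" if "u \<in> \<Omega>" for u using classes(1)[OF that] by blast
  then show ?thesis unfolding F_def using H.tr_A by blast
qed

lemma LV0: "0 \<in> LV" "0 \<in> H.LV" using LV_sgv H.LV_sgv unfolding sgv_def by auto

lemma z_F: "(\<lambda>x. (z ^^ t) x) \<in> F" "(\<lambda>x. (z' ^^ t) x) \<in> F"
proof -
  have "tr 0 t = (\<lambda>x. (z ^^ t) x)" "H.tr 0 t = (\<lambda>x. (z' ^^ t) x)" by (simp_all add: fun_eq_iff tr_z H.tr_z)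
  then show "(\<lambda>x. (z ^^ t) x) \<in> F" "(\<lambda>x. (z' ^^ t) x) \<in> F" using tr_F[OF LV0(1), of t] tr'_F[OF LV0(2), of t] by simp_all
qed

context
  fixes w assumes w: "w \<in> \<Omega>"
begin

definition vc :: "'a \<Rightarrow> 'v" where "vc u = (THE v. \<exists>t. u = tr v t w)"
definition sc :: "'a \<Rightarrow> nat" where "sc u = (THE t. t < p \<and> (\<exists>v. u = tr v t w))"

lemma vc_tr: "vc (tr v t w) = v" unfolding vc_def using tr_eqD[OF w] by (intro the_equality) blast+

lemma sc_tr: "sc (tr v t w) = t mod p"
  unfolding sc_def
proof (rule the_equality)
  have "tr v t w = tr v (t mod p) w" unfolding tr_def rep_zmod[OF R] ..
  then show "t mod p < p \<and> (\<exists>u. tr v t w = tr u (t mod p) w)" using p_pos by auto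
  fix s assume "s < p \<and> (\<exists>u. tr v t w = tr u s w)"
  then show "s = t mod p" using tr_eqD[OF w] by (metis mod_less)
qed

lemma coord: assumes "u \<in> \<Omega>" shows "u = tr (vc u) (sc u) w" "sc u < p"
proof -
  obtain v t where vt: "t < p" "u = tr v t w" using tr_ex[OF w assms] by blast
  then show "u = tr (vc u) (sc u) w" "sc u < p" using vc_tr[of v t] sc_tr[of v t] by simp_all
qed

lemma vc_shift: assumes "u \<in> \<Omega>" shows "vc (tr v t u) = v + vc u"
proof -
  have "tr v t u = tr (v + vc u) (t + sc u) w" using coord(1)[OF assms] tr_tr by metis
  then show ?thesis using vc_tr by simp
qed

lemma C_vc: assumes "u \<in> \<Omega>" shows "C w u \<longleftrightarrow> vc u \<in> LV"
proof
  assume "C w u"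
  then obtain l t where "l \<in> LV" "u = tr l t w" unfolding cl_def tr_def by blast
  then show "vc u \<in> LV" using vc_tr by simp
next
  assume "vc u \<in> LV"
  then show "C w u" using coord(1)[OF assms] unfolding cl_def tr_def by blast
qed

text \<open>Seen through any element of \<open>F\<close>, the character does not notice rotation by
  \<open>z\<close> within the class of \<open>w\<close>. All other characters turn out to have
  vanishing coefficients on stabiliser orbits.\<close>

definition good :: "('v \<Rightarrow> int) \<Rightarrow> bool" where
  "good h \<longleftrightarrow> (\<forall>f\<in>F. \<forall>u. C w u \<longrightarrow> h (vc (f (z u))) = h (vc (f u)))"

text \<open>No good character separates the two points, even after an element of \<open>F\<close>.
  The quantifier over \<open>F\<close> makes this an \<open>F\<close>-invariant equivalence
  relation.\<close>

definition near :: "'a \<Rightarrow> 'a \<Rightarrow> bool" where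
  "near u y \<longleftrightarrow> (\<forall>h\<in>chars. good h \<longrightarrow> (\<forall>f\<in>F. h (vc (f u)) = h (vc (f y))))"

lemma nearI: "(\<And>h f. h \<in> chars \<Longrightarrow> good h \<Longrightarrow> f \<in> F \<Longrightarrow> h (vc (f u)) = h (vc (f y))) \<Longrightarrow> near u y" unfolding near_def by blast
lemma nearD: "near u y \<Longrightarrow> h \<in> chars \<Longrightarrow> good h \<Longrightarrow> f \<in> F \<Longrightarrow> h (vc (f u)) = h (vc (f y))" unfolding near_def by blast
lemma near_refl: "near u u" unfolding near_def by simp
lemma near_sym: assumes "near u y" shows "near y u"
  by (rule nearI) (rule nearD[OF assms, symmetric])
lemma near_trans: assumes "near u y" "near y x" shows "near u x"
  by (rule nearI) (rule trans[OF nearD[OF assms(1)] nearD[OF assms(2)]])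

lemma near_F: assumes "near u y" "g \<in> F" shows "near (g u) (g y)"
proof (rule nearI)
  fix h f assume h: "h \<in> chars" "good h" and f: "f \<in> F"
  show "h (vc (f (g u))) = h (vc (f (g y)))" by (rule nearD[OF assms(1) h F_comp[OF f assms(2)]])
qed

lemma near_pow: assumes "near u (g u)" "g \<in> F" shows "near u ((g ^^ i) u)"
proof (induction i)
  case (Suc i)
  from near_F[OF Suc assms(2)] show ?case using near_trans[OF assms(1)] by simp
qed (simp add: near_refl)

lemma C_mem: "C w u \<Longrightarrow> u \<in> \<Omega>" using cl_mem[OF w] .

lemma near_z: assumes "C w u" shows "near u ((z ^^ t) u)"
proof -
  have "near u (z u)" by (rule nearI) (use assms in \<open>simp add: good_def\<close>)
  then show ?thesis using near_pow[OF _ z_F(1)[of 1, simplified]] by blast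
qed

text \<open>\<open>z\<close> acts freely on the near-class of \<open>u\<close> inside the class of
  \<open>w\<close>, so \<open>p\<close> divides its size. If \<open>z'\<close> led out of it, it
  would be an orbit of a subgroup of \<open>E'\<close>, of 2-power size.\<close>

lemma near_z': assumes u: "C w u" shows "near u ((z' ^^ t) u)"
proof -
  note uO = C_mem[OF u]
  have "near u (z' u)"
  proof (rule ccontr)
    assume no: "\<not> near u (z' u)"
    define B where "B = {y. C w y \<and> near u y}"
    define K where "K = {l\<in>H.LV. near u (ep l u)}"
    have fB: "finite B" by (rule finite_subset[OF _ fin]) (use C_mem in \<open>auto simp: B_def\<close>)
    have d: "p dvd card (B - {y\<in>B. z y = y})"
    proof (rule card_cyclic_fixed[OF fB prime_p])
      fix y assume y: "y \<in> B"
      have "C w (z y)" using C_trans[OF _ C_z[of y 1]] y unfolding B_def by simp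
      moreover have "near u (z y)" using near_trans[OF _ near_z[of y 1]] y unfolding B_def by simp
      ultimately show "z y \<in> B" unfolding B_def by blast
      show "(z ^^ p) y = y" by (rule rep_zp[OF R])
    qed
    have "{y\<in>B. z y = y} = {}"
    proof -
      have "z y \<noteq> y" if "y \<in> B" for y
        using rep_z_ne[OF R C_mem, of y 1] that p_gt1 unfolding B_def by auto
      then show ?thesis by blast
    qed
    from d[unfolded this] have pB: "p dvd card B" by simp
    have "B = (\<lambda>l. ep l u) ` K"
    proof (intro equalityI subsetI)
      fix y assume "y \<in> B"
      then have y: "C w y" "near u y" unfolding B_def by auto
      have "C u y" using C_trans[OF C_sym[OF u] y(1)] .
      then have "C' u y" using classes(1)[OF uO] by blast
      then obtain l t where l: "l \<in> H.LV" "y = H.tr l t u" unfolding H.cl_def H.tr_def by blast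
      have "p dvd t"
      proof (rule ccontr)
        assume nt: "\<not> p dvd t"
        have np: "\<not> p dvd 2 * t"
        proof
          assume "p dvd 2 * t"
          then have "p dvd 2" using nt prime_dvd_mult_iff[OF prime_p] by blast
          then have "p \<le> 2" by (rule dvd_imp_le) simp
          then have "p = 2" using p_gt1 by simp
          then show False using odd_p by simp
        qed
        obtain i where i: "(2 * t * i) mod p = 1" using inverse_mod_p[OF np] by blast
        have "near (H.tr l t u) (H.tr l t (H.tr l t u))" using near_F[OF y(2) tr'_F[OF l(1), of t]] unfolding l(2) .
        then have "near u (H.tr l t (H.tr l t u))" using near_trans[OF y(2)] unfolding l(2) by blast
        moreover have "H.tr l t (H.tr l t u) = (z' ^^ (2 * t)) u" unfolding H.tr_tr by (simp add: H.tr_z mult_2)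
        ultimately have "near u ((z' ^^ (2 * t)) u)" by simp
        from near_pow[OF this z_F(2)] have "near u (((z' ^^ (2 * t)) ^^ i) u)" .
        moreover have "((z' ^^ (2 * t)) ^^ i) u = (z' ^^ (2 * t * i)) u" by (rule fun_cong[OF funpow_mult])
        moreover have "(z' ^^ (2 * t * i)) u = (z' ^^ 1) u" using rep_zmod[OF H.R, of "2 * t * i" u] unfolding i by simp
        ultimately show False using no by simp
      qed
      then have "(z' ^^ t) (ep l u) = ep l u" using rep_z_ne[OF H.R rep_eps_mem[OF H.R uO]] by blast
      then have "y = ep l u" unfolding l(2) H.tr_def .
      then show "y \<in> (\<lambda>l. ep l u) ` K" unfolding K_def using l(1) y(2) by blast
    next
      fix y assume "y \<in> (\<lambda>l. ep l u) ` K"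
      then obtain l where l: "l \<in> H.LV" "near u (ep l u)" "y = ep l u" unfolding K_def by blast
      have "C u y" using F_C[OF tr'_F[OF l(1), of 0] uO] unfolding H.tr_eps l(3) .
      then show "y \<in> B" unfolding B_def using C_trans[OF u] l by blast
    qed
    moreover have "card ((\<lambda>l. ep l u) ` K) = card K"
      by (rule card_image, rule inj_onI) (use rep_free(1)[OF H.R uO, of 0 _ 0] in simp)
    moreover have "sgv K" unfolding sgv_def
    proof (intro conjI ballI)
      show "0 \<in> K" unfolding K_def using LV0(2) near_refl rep_0[OF H.R] by simp
      fix l m assume l: "l \<in> K" and m: "m \<in> K"
      have "near (ep l u) (ep l (ep m u))"
        using near_F[OF _ tr'_F[of l 0], of u "ep m u"] l m unfolding K_def H.tr_eps by blast
      then have "near u (ep (l + m) u)" unfolding rep_add[OF H.R] using near_trans l unfolding K_def by blast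
      then show "l + m \<in> K" unfolding K_def using l m H.LV_sgv unfolding sgv_def K_def by blast
    qed
    ultimately show False using pB sgv_card_p by simp
  qed
  then show ?thesis using near_pow[OF _ z_F(2)[of 1, simplified]] by blast
qed

context
  fixes y1 X
  assumes y1: "C w y1" and nsim: "\<not> sim w y1"
  defines "X \<equiv> {f y1 | f. f \<in> F \<and> f w = w}"
begin

lemma X_C: "x \<in> X \<Longrightarrow> C w x" unfolding X_def using F_C[OF _ C_mem[OF y1]] C_trans[OF y1] by blast

lemma X_mem: "x \<in> X \<Longrightarrow> x \<in> \<Omega>" using C_mem[OF X_C] .

lemma finX: "finite X" by (rule finite_subset[OF _ fin]) (use X_mem in blast)

lemma X_step: assumes f: "f \<in> F" "f w = w" and x: "x \<in> X" shows "f x \<in> X"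
proof -
  obtain g where g: "x = g y1" "g \<in> F" "g w = w" using x unfolding X_def by blast
  have "f (g w) = w" using f g by simp
  then show ?thesis unfolding X_def g(1)
    by (intro CollectI exI[of _ "\<lambda>x. f (g x)"] conjI refl F_comp[OF f(1) g(2)])
qed

lemma X_bij: assumes f: "f \<in> F" "f w = w" shows "bij_betw f X X"
proof -
  have "inj_on f X" using A_inj[OF F_A[OF f(1)]] by (intro inj_onI) blast
  moreover have "f ` X \<subseteq> X" using X_step[OF f] by blast
  ultimately show ?thesis unfolding bij_betw_def using endo_inj_surj[OF finX] by blast
qed

lemma X_not_sim: assumes "x \<in> X" shows "sc x \<noteq> 0"
proof
  assume "sc x = 0"
  then have xe: "x = eps (vc x) w" using coord(1)[OF X_mem[OF assms]] tr_eps by simp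
  have "vc x \<in> LV" using C_vc[OF X_mem[OF assms]] X_C[OF assms] by blast
  then have s: "sim w x" using xe by (rule simI)
  obtain g where g: "x = g y1" "g \<in> F" "g w = w" using assms unfolding X_def by blast
  from sim_A[OF F_A[OF F_inv[OF g(2)]] w s] have "sim (finv g w) y1" unfolding g(1) A_inv(2)[OF F_A[OF g(2)]] .
  moreover have "finv g w = w" using A_inv(2)[OF F_A[OF g(2)], of w] g(3) by simp
  ultimately show False using nsim by simp
qed

text \<open>The coefficients \<open>c s\<close> of the slices of \<open>X\<close> form a function on
  the cyclic group of order \<open>p\<close>. A second character \<open>h'\<close> yields a function
  \<open>n\<close> with sum prime to \<open>p\<close> for which correlation with \<open>c\<close> is
  multiplication by \<open>lam\<close>. As \<open>n\<close> is a unit locally at \<open>p\<close>,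
  \<open>c\<close> is \<open>lam\<close> times the unit at 0; but \<open>X\<close> avoids the block
  of \<open>w\<close>, so \<open>c 0 = 0\<close> and everything vanishes.\<close>

lemma orbit_coefficients:
  assumes h: "h \<in> chars" and ng: "\<not> good h"
  shows "(\<Sum>l\<in>UNIV. (if tr l s w \<in> X then 1 else 0) * h l) = 0"
proof -
  have pm: "g v = 1 \<or> g v = - 1" if "g \<in> chars" for g v using charsD(1)[OF that] .
  have trp: "tr l (t + p) u = tr l t u" for l t u unfolding tr_def using rep_zmod[OF R, of "t + p"] rep_zmod[OF R, of t] by simp
  obtain f u where f: "f \<in> F" "C w u" "h (vc (f (z u))) \<noteq> h (vc (f u))" using ng unfolding good_def by blast
  define l1 where "l1 = vc u"
  have l1: "l1 \<in> LV" "u = tr l1 (sc u) w" unfolding l1_def using C_vc[OF C_mem[OF f(2)]] f(2) coord(1)[OF C_mem[OF f(2)]] by auto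
  define g where "g l t = h (vc (f (tr l t w)))" for l t
  define S where "S l = (if l \<in> LV then \<Sum>t<p. g l t else 0)" for l
  \<comment> \<open>The values of \<open>h\<close> along this fibre are signs and, by the choice of
    \<open>f\<close> and \<open>u\<close>, not all equal; see \<open>pm_one_sum\<close>.\<close>
  have nS: "\<not> int p dvd S l1"
  proof
    assume "int p dvd S l1"
    then have d: "int p dvd (\<Sum>t<p. g l1 t)" unfolding S_def using l1(1) by simp
    have "g l1 (sc u mod p) = g l1 (Suc (sc u) mod p)"
      by (rule pm_one_sum[OF prime_p odd_p _ d]) (use pm[OF h] p_pos in \<open>auto simp: g_def\<close>)
    moreover have "g l1 (t mod p) = g l1 t" for t unfolding g_def tr_def rep_zmod[OF R] ..
    ultimately have "g l1 (sc u) = g l1 (Suc (sc u))" by simp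
    moreover have "tr l1 (Suc (sc u)) w = z u"
    proof -
      have "z u = tr 0 1 (tr l1 (sc u) w)" using tr_z[of 1 u] l1(2) by simp
      then show ?thesis unfolding tr_tr by simp
    qed
    ultimately show False using f(3) unfolding g_def l1(2)[symmetric] by simp
  qed
  \<comment> \<open>Fourier inversion: otherwise \<open>p\<close> would divide
    \<open>32 * S l1\<close>.\<close>
  have "\<exists>h'\<in>chars. \<not> int p dvd (\<Sum>l\<in>UNIV. S l * h' l)"
  proof (rule ccontr)
    assume "\<not> ?thesis"
    then have no: "int p dvd (\<Sum>l\<in>UNIV. S l * h' l)" if "h' \<in> chars" for h' using that by blast
    have "int p dvd (\<Sum>h'\<in>chars. h' l1 * (\<Sum>l\<in>UNIV. S l * h' l))"
    proof (rule dvd_sum)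
      fix h' assume "h' \<in> chars"
      from no[OF this] show "int p dvd h' l1 * (\<Sum>l\<in>UNIV. S l * h' l)" by (rule dvd_mult)
    qed
    then have "int p dvd 2 ^ 5 * S l1" unfolding fourier_inversion by simp
    then have "int p dvd 2 ^ 5" using nS prime_p by (simp add: prime_dvd_mult_iff)
    then have "int p dvd 2" using prime_p prime_dvd_power[of "int p" 2 5] by simp
    then have "int p \<le> 2" by (rule zdvd_imp_le) simp
    then show False using odd_p p_gt1 by (cases "p = 2") auto
  qed
  then obtain h' where h': "h' \<in> chars" "\<not> int p dvd (\<Sum>l\<in>UNIV. S l * h' l)" by blast
  define f' where "f' = finv f"
  have f': "f' \<in> F" unfolding f'_def by (rule F_inv[OF f(1)])
  \<comment> \<open>The substitution of \<open>f' u\<close> for \<open>u\<close> turns the sum of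
    \<open>n\<close> into the coefficient of \<open>S\<close> at \<open>h'\<close>.\<close>
  define n where "n t = (\<Sum>l\<in>LV. h l * h' (vc (f' (tr l t w))))" for t
  define Cs where "Cs = {u. C w u}"
  have finC: "finite Cs" unfolding Cs_def by (rule finite_subset[OF _ fin]) (use C_mem in blast)
  have Cbij: "bij_betw (\<lambda>(l, t). tr l t w) (LV \<times> {..<p}) Cs"
  proof (rule bij_betwI[where g="\<lambda>u. (vc u, sc u)"])
    show "(\<lambda>(l, t). tr l t w) \<in> LV \<times> {..<p} \<rightarrow> Cs" unfolding Cs_def using C_vc[OF tr_mem[OF w]] vc_tr by auto
    show "(\<lambda>u. (vc u, sc u)) \<in> Cs \<rightarrow> LV \<times> {..<p}" unfolding Cs_def using C_vc C_mem coord(2) by blast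
    show "(\<lambda>u. (vc u, sc u)) ((\<lambda>(l, t). tr l t w) c) = c" if "c \<in> LV \<times> {..<p}" for c using that vc_tr sc_tr by auto
    show "(\<lambda>(l, t). tr l t w) ((\<lambda>u. (vc u, sc u)) u) = u" if "u \<in> Cs" for u
      using coord(1)[OF C_mem] that unfolding Cs_def by simp
  qed
  have sumC: "(\<Sum>u\<in>Cs. \<psi> u) = (\<Sum>l\<in>LV. \<Sum>t<p. \<psi> (tr l t w))" for \<psi> :: "'a \<Rightarrow> int"
    using sum.reindex_bij_betw[OF Cbij, of \<psi>] by (simp add: sum.cartesian_product split_beta)
  have "(\<Sum>l\<in>UNIV. S l * h' l) = (\<Sum>l\<in>LV. \<Sum>t<p. h (vc (f (tr l t w))) * h' (vc (tr l t w)))"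
  proof -
    have "(\<Sum>l\<in>UNIV. S l * h' l) = (\<Sum>l\<in>LV. S l * h' l)"
      by (rule sum.mono_neutral_right) (auto simp: S_def)
    also have "\<dots> = (\<Sum>l\<in>LV. \<Sum>t<p. h (vc (f (tr l t w))) * h' (vc (tr l t w)))"
      by (rule sum.cong[OF refl]) (simp add: S_def g_def sum_distrib_right vc_tr)
    finally show ?thesis .
  qed
  also have "\<dots> = (\<Sum>u\<in>Cs. h (vc (f u)) * h' (vc u))" by (rule sumC[symmetric])
  also have "\<dots> = (\<Sum>u\<in>Cs. h (vc u) * h' (vc (f' u)))"
  proof -
    have "bij_betw f' Cs Cs"
    proof (rule bij_betwI[where g=f])
      show "f' \<in> Cs \<rightarrow> Cs" "f \<in> Cs \<rightarrow> Cs" unfolding Cs_def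
        using C_trans[OF _ F_C[OF f' C_mem]] C_trans[OF _ F_C[OF f(1) C_mem]] by auto
    qed (simp_all add: f'_def A_inv[OF F_A[OF f(1)]])
    from sum.reindex_bij_betw[OF this, of "\<lambda>u. h (vc (f u)) * h' (vc u)"] show ?thesis
      by (simp add: f'_def A_inv[OF F_A[OF f(1)]])
  qed
  also have "\<dots> = (\<Sum>l\<in>LV. \<Sum>t<p. h l * h' (vc (f' (tr l t w))))" unfolding sumC vc_tr ..
  also have "\<dots> = (\<Sum>t<p. n t)" unfolding n_def by (rule sum.swap)
  finally have N: "\<not> int p dvd (\<Sum>t<p. n t)" using h'(2) by simp
  have pern: "n (t + p) = n t" for t unfolding n_def trp ..
  define ind where "ind l s = (if tr l s w \<in> X then 1 else 0 :: int)" for l s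
  define c where "c s = (\<Sum>l\<in>UNIV. ind l s * h l)" for s
  define lam where "lam = (\<Sum>x\<in>X. h' (vc x))"
  \<comment> \<open>After a translation taking \<open>w\<close> to its image, the map fixes
    \<open>w\<close> and so permutes \<open>X\<close>. Hence summation over \<open>X\<close>
    multiplies this function by the constant \<open>lam\<close>.\<close>
  have eig: "(\<Sum>x\<in>X. h' (vc (f' (tr l t x)))) = lam * h' (vc (f' (tr l t w)))" if l: "l \<in> LV" for l t
  proof -
    define q where "q = f' (tr l t w)"
    have qC: "C w q" unfolding q_def using C_trans[OF F_C[OF tr_F[OF l] w] F_C[OF f' tr_mem[OF w]]] .
    note qO = C_mem[OF qC]
    define G where "G = tr (vc q) (sc q)"
    have GF: "G \<in> F" unfolding G_def using tr_F C_vc[OF qO] qC by blast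
    have Gw: "G w = q" unfolding G_def using coord(1)[OF qO] by simp
    define f0 where "f0 x = finv G (f' (tr l t x))" for x
    have f0: "f0 \<in> F" unfolding f0_def by (rule F_comp[OF F_inv[OF GF] F_comp[OF f' tr_F[OF l]]])
    have f0w: "f0 w = w" unfolding f0_def q_def[symmetric] Gw[symmetric] A_inv(2)[OF F_A[OF GF]] ..
    have "h' (vc (f' (tr l t x))) = h' (vc q) * h' (vc (f0 x))" if x: "x \<in> X" for x
    proof -
      have "f' (tr l t x) = G (f0 x)" unfolding f0_def A_inv(3)[OF F_A[OF GF]] ..
      then have "vc (f' (tr l t x)) = vc q + vc (f0 x)" unfolding G_def using vc_shift[OF F_mem[OF f0 X_mem[OF x]]] by simp
      then show ?thesis using charsD(2)[OF h'(1)] by simp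
    qed
    then have "(\<Sum>x\<in>X. h' (vc (f' (tr l t x)))) = h' (vc q) * (\<Sum>x\<in>X. h' (vc (f0 x)))" by (simp add: sum_distrib_left)
    also have "(\<Sum>x\<in>X. h' (vc (f0 x))) = lam" unfolding lam_def by (rule sum.reindex_bij_betw[OF X_bij[OF f0 f0w]])
    finally show ?thesis unfolding q_def by simp
  qed
  have rel: "(\<Sum>s<p. c s * n (t + s)) = lam * n t" for t
  proof -
    have "lam * n t = (\<Sum>l\<in>LV. h l * (lam * h' (vc (f' (tr l t w)))))" unfolding n_def by (simp add: sum_distrib_left mult.left_commute)
    also have "\<dots> = (\<Sum>l\<in>LV. h l * (\<Sum>x\<in>X. h' (vc (f' (tr l t x)))))" by (rule sum.cong[OF refl]) (simp only: eig)
    also have "\<dots> = (\<Sum>l\<in>LV. \<Sum>x\<in>X. h l * h' (vc (f' (tr l t x))))" by (simp only: sum_distrib_left)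
    also have "\<dots> = (\<Sum>x\<in>X. \<Sum>l\<in>LV. h l * h' (vc (f' (tr l t x))))" by (rule sum.swap)
    also have "\<dots> = (\<Sum>x\<in>X. h (vc x) * n (t + sc x))"
    proof (rule sum.cong[OF refl])
      fix x assume x: "x \<in> X"
      have m: "vc x \<in> LV" using C_vc[OF X_mem[OF x]] X_C[OF x] by blast
      have "bij_betw (\<lambda>l. l + vc x) LV LV"
        by (rule bij_betwI[where g="\<lambda>l. l + vc x"]) (use m LV_sgv in \<open>auto simp: sgv_def add.assoc\<close>)
      from sum.reindex_bij_betw[OF this, of "\<lambda>l. h l * h' (vc (f' (tr l (t + sc x) w)))"]
      have "n (t + sc x) = (\<Sum>l\<in>LV. h (l + vc x) * h' (vc (f' (tr (l + vc x) (t + sc x) w))))" unfolding n_def by simp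
      also have "\<dots> = (\<Sum>l\<in>LV. h (l + vc x) * h' (vc (f' (tr l t x))))"
        using coord(1)[OF X_mem[OF x]] tr_tr by metis
      finally have "h (vc x) * n (t + sc x) = (\<Sum>l\<in>LV. h (vc x) * (h l * h (vc x) * h' (vc (f' (tr l t x)))))"
        by (simp add: sum_distrib_left charsD(2)[OF h])
      also have "\<dots> = (\<Sum>l\<in>LV. h l * h' (vc (f' (tr l t x))))"
      proof (rule sum.cong[OF refl])
        fix l
        have "h (vc x) * (h l * h (vc x) * k) = (h (vc x) * h (vc x)) * (h l * k)" for k by (simp only: ac_simps)
        then show "h (vc x) * (h l * h (vc x) * h' (vc (f' (tr l t x)))) = h l * h' (vc (f' (tr l t x)))" using chars_sq[OF h] by simp
      qed
      finally show "(\<Sum>l\<in>LV. h l * h' (vc (f' (tr l t x)))) = h (vc x) * n (t + sc x)" by simp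
    qed
    also have "\<dots> = (\<Sum>(s, l)\<in>{(s, l). s < p \<and> tr l s w \<in> X}. h l * n (t + s))"
    proof (rule sum.reindex_bij_witness[where i="\<lambda>(s, l). tr l s w" and j="\<lambda>x. (sc x, vc x)"])
      fix x assume x: "x \<in> X"
      show "(\<lambda>(s, l). tr l s w) (sc x, vc x) = x" using coord(1)[OF X_mem[OF x]] by simp
      show "(sc x, vc x) \<in> {(s, l). s < p \<and> tr l s w \<in> X}" using coord[OF X_mem[OF x]] x by simp
    qed (auto simp: vc_tr sc_tr)
    also have "\<dots> = (\<Sum>(s, l)\<in>{..<p} \<times> UNIV. ind l s * h l * n (t + s))"
      by (rule sum.mono_neutral_cong_left) (auto simp: ind_def split: if_splits)
    also have "\<dots> = (\<Sum>s<p. \<Sum>l\<in>UNIV. ind l s * h l * n (t + s))" by (simp add: sum.cartesian_product)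
    also have "\<dots> = (\<Sum>s<p. c s * n (t + s))" unfolding c_def by (simp add: sum_distrib_right)
    finally show ?thesis by simp
  qed
  have c0: "c s = 0" if "s mod p = 0" for s
  proof -
    have "ind l s = 0" for l
    proof -
      have "tr l s w \<notin> X" using X_not_sim[of "tr l s w"] sc_tr[of l s] that by auto
      then show ?thesis unfolding ind_def by simp
    qed
    then show ?thesis unfolding c_def by simp
  qed
  have perc: "c (s + p) = c s" for s unfolding c_def ind_def trp ..
  \<comment> \<open>\<open>c\<close> minus \<open>lam\<close> times the unit at 0; its correlation
    with \<open>n\<close> is zero at every shift.\<close>
  define d where "d s = c s - (if s mod p = 0 then lam else 0)" for s
  have d: "d s = 0" for s
  proof (rule cyclic_correlation_zero[OF prime_p odd_p pern N])
    show "d (t + p) = d t" for t unfolding d_def perc by simp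
    show "(\<Sum>s<p. d s * n (t + s)) = 0" for t
    proof -
      have "(\<Sum>s<p. (if s mod p = 0 then lam else 0) * n (t + s)) = (\<Sum>s<p. if s = 0 then lam * n t else 0)"
        by (rule sum.cong[OF refl]) auto
      also have "\<dots> = lam * n t" using p_pos by simp
      finally show ?thesis unfolding d_def using rel[of t] by (simp add: left_diff_distrib sum_subtractf)
    qed
  qed
  have "lam = 0" using d[of 0] c0[of 0] unfolding d_def by simp
  then have "c s = 0" using d[of s] unfolding d_def by (simp split: if_splits)
  then show ?thesis unfolding c_def ind_def .
qed

text \<open>The indicator of the slice of \<open>X\<close> through \<open>y1\<close> is expanded in
  characters. Those that are not good contribute nothing, and the good ones agree at the labels of
  \<open>y1\<close> and \<open>y2\<close>; so \<open>y2\<close> lies in \<open>X\<close> as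
  well.\<close>

lemma near_orbit:
  assumes sm: "sim y1 y2" and nr: "near y1 y2" shows "\<exists>f\<in>F. f w = w \<and> f y1 = y2"
proof -
  obtain l0 where l0: "l0 \<in> LV" "y2 = eps l0 y1" using sm by (rule simE)
  define s where "s = sc y1"
  define l1 where "l1 = vc y1"
  have y1e: "y1 = tr l1 s w" unfolding l1_def s_def by (rule coord(1)[OF C_mem[OF y1]])
  have y2e: "y2 = tr (l0 + l1) s w" unfolding l0(2) y1e using tr_tr[of l0 0 l1 s w] tr_eps by simp
  define S where "S l = (if tr l s w \<in> X then 1 else 0 :: int)" for l
  have "y1 \<in> X" unfolding X_def by (rule CollectI, rule exI[of _ "\<lambda>x. x"]) (simp add: F_id)
  then have S1: "S l1 = 1" unfolding S_def y1e[symmetric] by simp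
  have "32 * S (l0 + l1) = (\<Sum>h\<in>chars. h (l0 + l1) * (\<Sum>l\<in>UNIV. S l * h l))" by (rule fourier_inversion[symmetric])
  also have "\<dots> = (\<Sum>h\<in>chars. h l1 * (\<Sum>l\<in>UNIV. S l * h l))"
  proof (rule sum.cong[OF refl])
    fix h assume h: "h \<in> chars"
    show "h (l0 + l1) * (\<Sum>l\<in>UNIV. S l * h l) = h l1 * (\<Sum>l\<in>UNIV. S l * h l)"
    proof (cases "good h")
      case True
      have "h (vc y1) = h (vc y2)" by (rule nearD[OF nr h True F_id])
      then have "h l1 = h (l0 + l1)" unfolding y1e y2e vc_tr .
      then show ?thesis by simp
    next
      case False
      from orbit_coefficients[OF h False, of s] show ?thesis unfolding S_def by simp
    qed
  qed
  also have "\<dots> = 32 * S l1" by (rule fourier_inversion)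
  finally have "S (l0 + l1) = 1" using S1 by simp
  then have "y2 \<in> X" unfolding S_def y2e by (simp split: if_splits)
  then obtain f where f: "y2 = f y1" "f \<in> F" "f w = w" unfolding X_def by (elim CollectE exE conjE)
  show ?thesis by (rule bexI[OF _ f(2)]) (simp add: f(1,3))
qed

end

end

end

section \<open>The permutation that aligns \<open>P'\<close> with \<open>P\<close>\<close>

context common_sylow
begin

definition cr :: "'a \<Rightarrow> 'a" where "cr x = (SOME y. C x y)"

lemma cr_C: "C x (cr x)" unfolding cr_def using C_refl by (rule someI)

lemma cr_eq: assumes c: "C x y" shows "cr x = cr y"
proof -
  have "C x w \<longleftrightarrow> C y w" for w using C_trans[OF c] C_trans[OF C_sym[OF c]] by blast
  then have "C x = C y" by (simp add: fun_eq_iff)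
  then show ?thesis unfolding cr_def by (simp only:)
qed

definition kf :: "'a \<Rightarrow> nat" where "kf c = (SOME k. k < p \<and> (\<forall>y. C c y \<longrightarrow> sim ((z ^^ k) y) (z' y)))"
abbreviation "kk x \<equiv> kf (cr x)"
definition jf :: "'a \<Rightarrow> nat" where "jf c = (SOME i. (kf c * i) mod p = 1)"
abbreviation "ji x \<equiv> jf (cr x)"
definition tt :: "'a \<Rightarrow> nat" where "tt x = (SOME t. t < p \<and> sim ((z ^^ t) (cr x)) x)"
definition nn :: "'a \<Rightarrow> nat" where "nn x = (p - tt x) * ji x"
text \<open>On blocks \<open>z'\<close> acts as \<open>z ^^ kk x\<close>, and \<open>ji x\<close>
  inverts this exponent. So the power of \<open>z'\<close> brings \<open>x\<close> into the block of
  the class representative, and the power of \<open>z\<close> brings it back; blocks are preserved,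
  while orbits of \<open>z'\<close> are straightened to orbits of \<open>z\<close>.\<close>

definition del :: "'a \<Rightarrow> 'a" where "del x = (if x \<in> \<Omega> then (z ^^ tt x) ((z' ^^ nn x) x) else x)"

lemma cr_mem: "x \<in> \<Omega> \<Longrightarrow> cr x \<in> \<Omega>" using cl_mem[OF _ cr_C] .

lemma kk: assumes x: "x \<in> \<Omega>" shows "kk x < p" "sim ((z ^^ kk x) x) (z' x)"
proof -
  have "\<exists>k. k < p \<and> (\<forall>y. C (cr x) y \<longrightarrow> sim ((z ^^ k) y) (z' y))" using classes(2)[OF cr_mem[OF x]] by blast
  from someI_ex[OF this] have 1: "kk x < p \<and> (\<forall>y. C (cr x) y \<longrightarrow> sim ((z ^^ kk x) y) (z' y))" unfolding kf_def .
  then show "kk x < p" "sim ((z ^^ kk x) x) (z' x)" using C_sym[OF cr_C] by auto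
qed

lemma kk_ndvd: assumes x: "x \<in> \<Omega>" shows "\<not> p dvd kk x"
proof
  assume "p dvd kk x"
  then have "(z ^^ kk x) x = x" using rep_z_ne[OF R x] by blast
  then have "H.sim ((z' ^^ 0) x) ((z' ^^ 1) x)" using kk(2)[OF x] sim_eq[OF x] by simp
  then have "0 mod p = 1 mod p" using H.sim_z[OF x] by blast
  then show False using p_gt1 by simp
qed

lemma ji: assumes x: "x \<in> \<Omega>" shows "(kk x * ji x) mod p = 1"
  using someI_ex[OF inverse_mod_p[OF kk_ndvd[OF x]]] unfolding jf_def .

lemma tt: assumes x: "x \<in> \<Omega>" shows "tt x < p" "sim ((z ^^ tt x) (cr x)) x"
proof -
  have "\<exists>t. t < p \<and> sim ((z ^^ t) (cr x)) x" using cl_sim[OF C_sym[OF cr_C]] by blast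
  from someI_ex[OF this] have "tt x < p \<and> sim ((z ^^ tt x) (cr x)) x" unfolding tt_def .
  then show "tt x < p" "sim ((z ^^ tt x) (cr x)) x" by auto
qed

lemma zA: "(\<lambda>x. (z ^^ n) x) \<in> A" "(\<lambda>x. (z' ^^ n) x) \<in> A"
  using A_pow[OF rep_mem(2)[OF R]] A_pow[OF rep_mem(2)[OF H.R]] by auto

lemma z_mem: "x \<in> \<Omega> \<Longrightarrow> (z ^^ n) x \<in> \<Omega>" "x \<in> \<Omega> \<Longrightarrow> (z' ^^ n) x \<in> \<Omega>"
  using rep_zpow_mem[OF R] rep_zpow_mem[OF H.R] by auto

lemma C_z'C: "x \<in> \<Omega> \<Longrightarrow> C x ((z' ^^ n) x)" using classes(1) C'_z by blast

lemma sim_pow: assumes x: "x \<in> \<Omega>" shows "sim ((z ^^ (n * kk x)) x) ((z' ^^ n) x)"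
proof (induction n)
  case (Suc n)
  let ?y = "(z' ^^ n) x"
  have "kk ?y = kk x" using cr_eq[OF C_z'C[OF x]] by simp
  then have 1: "sim ((z ^^ kk x) ?y) (z' ?y)" using kk(2)[OF z_mem(2)[OF x, of n]] by simp
  have "sim ((z ^^ kk x) ((z ^^ (n * kk x)) x)) ((z ^^ kk x) ?y)" by (rule sim_A[OF zA(1) z_mem(1)[OF x] Suc])
  then have "sim ((z ^^ (Suc n * kk x)) x) ((z ^^ kk x) ?y)" unfolding zadd[OF R] by simp
  from sim_trans[OF this 1] show ?case by simp
qed (simp add: sim_refl)

lemma move_sim: assumes x: "x \<in> \<Omega>" and y: "y \<in> \<Omega>" and c: "C x y" shows "sim y ((z ^^ tt x) ((z' ^^ nn x) y))"
proof -
  have ky: "kk y = kk x" using cr_eq[OF c] by simp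
  have m: "(tt x + nn x * kk x) mod p = 0"
  proof -
    have "nn x * kk x = (p - tt x) * (kk x * ji x)" unfolding nn_def by (simp only: ac_simps)
    then have "(tt x + nn x * kk x) mod p = (tt x + ((p - tt x) * ((kk x * ji x) mod p)) mod p) mod p"
      by (simp only: mod_add_right_eq mod_mult_right_eq)
    also have "\<dots> = (tt x + (p - tt x)) mod p" unfolding ji[OF x] by (simp only: mult_1_right mod_add_right_eq)
    also have "tt x + (p - tt x) = p" using tt(1)[OF x] by simp
    finally show ?thesis by simp
  qed
  have "sim ((z ^^ tt x) ((z ^^ (nn x * kk x)) y)) ((z ^^ tt x) ((z' ^^ nn x) y))"
    by (rule sim_A[OF zA(1) z_mem(1)[OF y] sim_pow[OF y, of "nn x", unfolded ky]])
  moreover have "(z ^^ tt x) ((z ^^ (nn x * kk x)) y) = y"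
    unfolding zadd[OF R] using rep_zmod[OF R, of "tt x + nn x * kk x" y] unfolding m by simp
  ultimately show ?thesis by simp
qed

lemma del_sim: "x \<in> \<Omega> \<Longrightarrow> sim x (del x)" unfolding del_def using move_sim[of x x] C_refl by simp

lemma tt_uniq: assumes x: "x \<in> \<Omega>" and "t < p" "sim ((z ^^ t) (cr x)) x" shows "tt x = t"
proof -
  have "sim ((z ^^ tt x) (cr x)) ((z ^^ t) (cr x))" using sim_trans[OF tt(2)[OF x] sim_sym[OF assms(3)]] .
  then show ?thesis using sim_z[OF cr_mem[OF x]] tt(1)[OF x] assms(2) by simp
qed

lemma tt_sim: assumes x: "x \<in> \<Omega>" and s: "sim x y" shows "tt y = tt x" "cr y = cr x" "nn y = nn x"
proof -
  show c: "cr y = cr x" using cr_eq[OF sim_cl[OF s]] by simp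
  have "sim ((z ^^ tt x) (cr y)) y" unfolding c by (rule sim_trans[OF tt(2)[OF x] s])
  then show t: "tt y = tt x" by (rule tt_uniq[OF sim_mem[OF x s] tt(1)[OF x]])
  show "nn y = nn x" unfolding nn_def t c ..
qed

lemma del_perm: "del permutes \<Omega>"
proof (rule bij_imp_permutes)
  have inj: "inj_on del \<Omega>"
  proof (rule inj_onI)
    fix x y assume x: "x \<in> \<Omega>" and y: "y \<in> \<Omega>" and e: "del x = del y"
    have "sim x y" using sim_trans[OF del_sim[OF x]] sim_sym[OF del_sim[OF y]] unfolding e by blast
    note t = tt_sim[OF x this]
    have "(z ^^ tt x) ((z' ^^ nn x) x) = (z ^^ tt x) ((z' ^^ nn x) y)" using e x y t unfolding del_def by simp
    then show "x = y" using A_inj[OF zA(1)] A_inj[OF zA(2)] by blast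
  qed
  moreover have "del ` \<Omega> \<subseteq> \<Omega>" using sim_mem[OF _ del_sim] by blast
  ultimately show "bij_betw del \<Omega> \<Omega>" unfolding bij_betw_def using endo_inj_surj[OF fin] by blast
qed (simp add: del_def)

text \<open>Points of one block are moved by the same element \<open>g\<close>. For different
  classes, independent rotations from \<open>T\<close> are combined. For different blocks of one
  class, \<open>g y\<close> and \<open>del y\<close> lie in the same block and are near, so
  \<open>near_orbit\<close> corrects the second point while fixing the first.\<close>

lemma del_A: "del \<in> A"
proof (rule closed2[OF del_perm])
  fix x y assume x: "x \<in> \<Omega>" and y: "y \<in> \<Omega>"
  define g where "g u = (z ^^ tt x) ((z' ^^ nn x) u)" for u
  have gF: "g \<in> F" unfolding g_def by (rule F_comp[OF z_F])
  have gx: "g x = del x" unfolding g_def del_def using x by simp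
  show "\<exists>a\<in>A. a x = del x \<and> a y = del y"
  proof (cases "C x y")
    case True
    show ?thesis
    proof (cases "sim x y")
      case s: True
      have "g y = del y" unfolding g_def del_def using y tt_sim[OF x s] by simp
      then show ?thesis using gx F_A[OF gF] by blast
    next
      case False
      define w where "w = del x"
      have w: "w \<in> \<Omega>" unfolding w_def by (rule sim_mem[OF x del_sim[OF x]])
      have Cwy: "C w y" unfolding w_def using C_trans[OF C_sym[OF sim_cl[OF del_sim[OF x]]] True] .
      have y1: "sim y (g y)" unfolding g_def by (rule move_sim[OF x y True])
      have y2: "sim y (del y)" by (rule del_sim[OF y])
      have C1: "C w (g y)" using C_trans[OF Cwy sim_cl[OF y1]] .
      have ns: "\<not> sim w (g y)"
      proof
        assume "sim w (g y)"
        then have "sim x (g y)" unfolding w_def by (rule sim_trans[OF del_sim[OF x]])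
        then show False using False sim_trans[OF _ sim_sym[OF y1]] by blast
      qed
      have n1: "near w y ((z' ^^ n) y)" for n by (rule near_z'[OF w Cwy])
      have C2: "C w ((z' ^^ n) y)" for n using C_trans[OF Cwy C_z'C[OF y]] .
      have n2: "near w y ((z ^^ m) ((z' ^^ n) y))" for m n by (rule near_trans[OF w n1 near_z[OF w C2]])
      have "near w (g y) (del y)"
      proof (rule near_trans[OF w near_sym[OF w]])
        show "near w y (g y)" unfolding g_def by (rule n2)
        show "near w y (del y)" unfolding del_def using y n2 by simp
      qed
      from near_orbit[OF w C1 ns sim_trans[OF sim_sym[OF y1] y2] this]
      obtain f where f: "f \<in> F" "f w = w" "f (g y) = del y" by blast
      have "f (g x) = del x" unfolding gx using f(2) unfolding w_def .
      then show ?thesis using f(3) by (intro bexI[OF _ A_comp[OF F_A[OF f(1)] F_A[OF gF]]] conjI)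
    qed
  next
    case False
    have nC: "\<not> C y x" using False C_sym by blast
    define d where "d = dx y (tt y) \<circ> dx x (tt x)"
    define e where "e = dx' y (nn y) \<circ> dx' x (nn x)"
    have dA: "d \<in> A" "e \<in> A" unfolding d_def e_def
      using perm_groupD(3)[OF T(1) dx(1) dx(1)] perm_groupD(3)[OF T(1) dx'(1) dx'(1)] T_A by blast+
    have cC: "C' u v \<longleftrightarrow> C u v" if "u \<in> \<Omega>" for u v using classes(1)[OF that] by blast
    have ex: "e x = (z' ^^ nn x) x"
    proof -
      have "dx' x (nn x) x = (z' ^^ nn x) x" by (rule dx'(2)[OF x C'_refl])
      moreover have "\<not> C' y ((z' ^^ nn x) x)" unfolding cC[OF y] using C_trans[OF _ C_sym[OF C_z'C[OF x]]] nC by blast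
      ultimately show ?thesis unfolding e_def using dx'(3) by simp
    qed
    have ey: "e y = (z' ^^ nn y) y"
    proof -
      have "dx' x (nn x) y = y" using dx'(3) cC[OF x] False by blast
      then show ?thesis unfolding e_def using dx'(2)[OF y C'_refl] by simp
    qed
    have dxx: "d u = (z ^^ tt x) u" if u: "C x u" for u
    proof -
      note uO = cl_mem[OF x u]
      have "dx x (tt x) u = (z ^^ tt x) u" by (rule dx(2)[OF uO u])
      moreover have "\<not> C y ((z ^^ tt x) u)" using C_trans[OF _ C_sym[OF C_trans[OF u C_z]]] nC by blast
      ultimately show ?thesis unfolding d_def using dx(3) by simp
    qed
    have dyy: "d u = (z ^^ tt y) u" if u: "C y u" for u
    proof -
      have "\<not> C x u" using False C_trans[OF _ C_sym[OF u]] by blast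
      then have "dx x (tt x) u = u" by (rule dx(3))
      then show ?thesis unfolding d_def using dx(2)[OF cl_mem[OF y u] u] by simp
    qed
    have "d (e x) = del x" unfolding ex dxx[OF C_z'C[OF x]] del_def using x by simp
    moreover have "d (e y) = del y" unfolding ey dyy[OF C_z'C[OF y]] del_def using y by simp
    ultimately show ?thesis by (intro bexI[OF _ A_comp[OF dA]] conjI)
  qed
qed

text \<open>Passing from \<open>x\<close> to \<open>z' x\<close> raises \<open>tt\<close> by the
  exponent modulo \<open>p\<close> and lowers \<open>nn\<close> by one modulo \<open>p\<close>, so
  the total power of \<open>z'\<close> applied to \<open>x\<close> is unchanged.\<close>

lemma del_z': assumes x: "x \<in> \<Omega>" shows "del (z' x) = (z ^^ kk x) (del x)"
proof -
  let ?y = "z' x"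
  have y: "?y \<in> \<Omega>" using z_mem(2)[OF x, of 1] by simp
  have c: "cr ?y = cr x" using cr_eq[OF C_z'C[OF x, of 1]] by simp
  define t where "t = tt x"
  define k where "k = kk x"
  define i where "i = ji x"
  define t' where "t' = (k + t) mod p"
  have tp: "t < p" "k < p" unfolding t_def k_def using tt(1)[OF x] kk(1)[OF x] by auto
  have ki: "(k * i) mod p = 1" unfolding k_def i_def by (rule ji[OF x])
  have "sim ((z ^^ k) ((z ^^ t) (cr x))) ((z ^^ k) x)" unfolding t_def by (rule sim_A[OF zA(1) z_mem(1)[OF cr_mem[OF x]] tt(2)[OF x]])
  then have "sim ((z ^^ (k + t)) (cr x)) ?y" unfolding zadd[OF R] using sim_trans kk(2)[OF x] unfolding k_def by blast
  then have "sim ((z ^^ t') (cr ?y)) ?y" unfolding c t'_def rep_zmod[OF R] .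
  moreover have "t' < p" unfolding t'_def using p_pos by simp
  ultimately have ty: "tt ?y = t'" using tt_uniq[OF y] by blast
  have ny: "nn ?y = (p - t') * i" unfolding nn_def ty c i_def ..
  have A1: "((p - t') + k) mod p = (p - t) mod p"
  proof (cases "k + t < p")
    case True
    then have "(p - t') + k = p - t" unfolding t'_def by simp
    then show ?thesis by simp
  next
    case False
    have "t' = (k + t) - p" unfolding t'_def using False tp by (simp add: mod_if)
    then have "(p - t') + k = (p - t) + p" using False tp by linarith
    then show ?thesis by simp
  qed
  have "((p - t') * i + 1) mod p = ((p - t') * i + (k * i) mod p) mod p" unfolding ki ..
  also have "\<dots> = (((p - t') + k) * i) mod p" by (simp only: mod_add_right_eq distrib_right)
  also have "\<dots> = ((((p - t') + k) mod p) * i) mod p" by (rule mod_mult_left_eq[symmetric])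
  also have "\<dots> = ((p - t) * i) mod p" unfolding A1 by (rule mod_mult_left_eq)
  finally have m: "((p - t') * i + 1) mod p = ((p - t) * i) mod p" .
  have "del ?y = (z ^^ t') ((z' ^^ ((p - t') * i)) ((z' ^^ 1) x))" unfolding del_def ty ny using y by simp
  also have "\<dots> = (z ^^ t') ((z' ^^ ((p - t') * i + 1)) x)" unfolding zadd[OF H.R] ..
  also have "(z' ^^ ((p - t') * i + 1)) x = (z' ^^ ((p - t) * i)) x"
    using rep_zmod[OF H.R, of "(p - t') * i + 1" x] rep_zmod[OF H.R, of "(p - t) * i" x] unfolding m by simp
  also have "(z ^^ t') ((z' ^^ ((p - t) * i)) x) = (z ^^ k) ((z ^^ t) ((z' ^^ ((p - t) * i)) x))"
    unfolding t'_def rep_zmod[OF R] zadd[OF R] ..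
  also have "\<dots> = (z ^^ k) (del x)" unfolding del_def nn_def t_def i_def using x by simp
  finally show ?thesis unfolding k_def .
qed

lemma conj: "Conj eps z ep z'"
proof -
  have inv: "finv del x \<in> \<Omega>" "sim (finv del x) x" if x: "x \<in> \<Omega>" for x
  proof -
    show m: "finv del x \<in> \<Omega>" by (rule A_mem[OF A_inv(1)[OF del_A] x])
    show "sim (finv del x) x" using del_sim[OF m] unfolding A_inv(3)[OF del_A] .
  qed
  have "adm LV (\<lambda>v x. del (ep v (finv del x))) (\<lambda>x. del (z' (finv del x))) (\<lambda>x. kk x)"
    unfolding adm_def
  proof (intro conjI ballI allI impI)
    show "Rep (\<lambda>v x. del (ep v (finv del x))) (\<lambda>x. del (z' (finv del x)))" by (rule rep_conj[OF H.R del_A])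
    fix x assume x: "x \<in> \<Omega>"
    show "kk x < p" by (rule kk(1)[OF x])
    have "cr (finv del x) = cr x" by (rule cr_eq[OF sim_cl[OF inv(2)[OF x]]])
    then show "del (z' (finv del x)) = (z ^^ kk x) x" unfolding del_z'[OF inv(1)[OF x]] A_inv(3)[OF del_A] by simp
    fix y assume c: "C x y"
    show "kk x = kk y" using cr_eq[OF c] by simp
    fix v
    note y = cl_mem[OF x c]
    have "C (finv del x) (finv del y)"
      using C_trans[OF sim_cl[OF inv(2)[OF x]] C_trans[OF c C_sym[OF sim_cl[OF inv(2)[OF y]]]]] .
    then have "C' (finv del x) (finv del y)" using classes(1)[OF inv(1)[OF x]] by blast
    then have "C' (ep v (finv del x)) (ep v (finv del y))" by (rule H.cl_eps)
    note m = rep_eps_mem[OF H.R inv(1)[OF x], of v] rep_eps_mem[OF H.R inv(1)[OF y], of v]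
    have "C (ep v (finv del x)) (ep v (finv del y))" using classes(1)[OF m(1)] \<open>C' (ep v (finv del x)) (ep v (finv del y))\<close> by blast
    then show "C (del (ep v (finv del x))) (del (ep v (finv del y)))"
      using C_trans[OF C_sym[OF sim_cl[OF del_sim[OF m(1)]]] C_trans[OF _ sim_cl[OF del_sim[OF m(2)]]]] by blast
  qed
  from claim[OF this LV_sgv Dhyp_LV] show ?thesis by (rule Conj_conj[OF del_A])
qed

end

context base_rep
begin

text \<open>A rotation is determined by one residue modulo \<open>p\<close> for each class, so the
  order is \<open>p\<close> to the number of classes and the group can be used in
  \<open>sylow_conj\<close>.\<close>

lemma Dmap_group:
  defines "D \<equiv> {Dmap a | a. \<forall>x\<in>\<Omega>. \<forall>y. cl LV x y \<longrightarrow> a x = a y}"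
  shows "perm_group \<Omega> D" "D \<subseteq> A" "\<exists>k. card D = p ^ k"
proof -
  let ?C = "cl LV"
  define cst where "cst a \<longleftrightarrow> (\<forall>x\<in>\<Omega>. \<forall>y. ?C x y \<longrightarrow> a x = (a y :: nat))" for a
  have D: "D = {Dmap a | a. cst a}" unfolding D_def cst_def ..
  have cD: "a x = a y" if "cst a" "x \<in> \<Omega>" "?C x y" for a x y using that unfolding cst_def by blast
  show sub: "D \<subseteq> A"
  proof
    fix f assume "f \<in> D"
    then obtain a where a: "f = Dmap a" "cst a" unfolding D by blast
    have "Dmap a = (\<lambda>x. if x \<in> \<Omega> then (z ^^ a x) x else x)" by (simp add: fun_eq_iff Dmap_def)
    then show "f \<in> A" using Dhyp_LV a unfolding Dhyp_def cst_def by simp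
  qed
  have comp: "Dmap a \<circ> Dmap b = Dmap (\<lambda>x. a x + b x)" if a: "cst a" for a b
  proof -
    have "Dmap a (Dmap b x) = Dmap (\<lambda>x. a x + b x) x" for x by (rule Dmap_comp[OF LV_sgv cD[OF a]])
    then show ?thesis by (simp add: fun_eq_iff)
  qed
  have D0: "Dmap a = id" if "\<And>x. x \<in> \<Omega> \<Longrightarrow> a x mod p = 0" for a
  proof -
    have "Dmap a x = x" for x unfolding Dmap_def using rep_zmod[OF R, of "a x" x] that[of x] by auto
    then show ?thesis by (simp add: fun_eq_iff)
  qed
  show "perm_group \<Omega> D"
  proof (rule perm_groupI)
    fix f assume f: "f \<in> D"
    show "f permutes \<Omega>" using f sub A_perm by blast
    obtain a where a: "f = Dmap a" "cst a" using f unfolding D by blast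
    define b where "b x = (p - 1) * a x" for x
    have b: "cst b" using a(2) unfolding cst_def b_def by metis
    have e: "a x + b x = p * a x" "b x + a x = p * a x" for x unfolding b_def using p_pos by (cases p; simp)+
    have "Dmap a \<circ> Dmap b = id" "Dmap b \<circ> Dmap a = id"
      unfolding comp[OF a(2)] comp[OF b] e by (rule D0, simp)+
    then have "finv f = Dmap b" unfolding a(1) by (intro inv_unique_comp)
    then show "finv f \<in> D" unfolding D using b by blast
    fix g assume "g \<in> D"
    then obtain c where c: "g = Dmap c" "cst c" unfolding D by blast
    have "cst (\<lambda>x. a x + c x)" unfolding cst_def using cD[OF a(2)] cD[OF c(2)] by metis
    then show "f \<circ> g \<in> D" unfolding a(1) c(1) comp[OF a(2)] D by blast
  next
    have "id = Dmap (\<lambda>_. 0)" by (rule D0[symmetric]) simp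
    moreover have "cst (\<lambda>_. 0)" unfolding cst_def by simp
    ultimately show "id \<in> D" unfolding D by blast
  qed
  define cr where "cr x = (SOME y. ?C x y)" for x
  have crC: "?C x (cr x)" for x unfolding cr_def using cl_refl[OF LV_sgv] by (rule someI)
  have cre: "cr x = cr y" if c: "?C x y" for x y
  proof -
    have "?C x w \<longleftrightarrow> ?C y w" for w using cl_trans[OF LV_sgv c] cl_trans[OF LV_sgv cl_sym[OF LV_sgv c]] by blast
    then have "?C x = ?C y" by (simp add: fun_eq_iff)
    then show ?thesis unfolding cr_def by (simp only:)
  qed
  have crm: "cr x \<in> \<Omega>" if "x \<in> \<Omega>" for x by (rule cl_mem[OF that crC])
  have crr: "cr (cr x) = cr x" for x using cre[OF crC[of x]] by simp
  let ?P = "cr ` \<Omega> \<rightarrow>\<^sub>E {..<p}"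
  have fc: "finite (cr ` \<Omega>)" using fin by simp
  have "bij_betw (\<lambda>a. Dmap (\<lambda>x. a (cr x))) ?P D" unfolding bij_betw_def
  proof (intro conjI equalityI subsetI)
    show "inj_on (\<lambda>a. Dmap (\<lambda>x. a (cr x))) ?P"
    proof (rule inj_onI)
      fix a b assume a: "a \<in> ?P" and b: "b \<in> ?P" and e: "Dmap (\<lambda>x. a (cr x)) = Dmap (\<lambda>x. b (cr x))"
      show "a = b"
      proof (rule PiE_ext[OF a b])
        fix u assume "u \<in> cr ` \<Omega>"
        then obtain x where x: "x \<in> \<Omega>" "u = cr x" by blast
        have "(z ^^ a u) (eps 0 u) = (z ^^ b u) (eps 0 u)"
          using fun_cong[OF e, of u] crm[OF x(1)] crr[of x] unfolding Dmap_def x(2) rep_0[OF R] by simp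
        from rep_free(2)[OF R crm[OF x(1)], folded x(2), OF this] have "a u mod p = b u mod p" .
        moreover have "a u < p" "b u < p" using a b x by auto
        ultimately show "a u = b u" by simp
      qed
    qed
    fix f
    { assume "f \<in> (\<lambda>a. Dmap (\<lambda>x. a (cr x))) ` ?P"
      then obtain a where "f = Dmap (\<lambda>x. a (cr x))" by blast
      moreover have "cst (\<lambda>x. a (cr x))" unfolding cst_def using cre by metis
      ultimately show "f \<in> D" unfolding D by blast }
    assume "f \<in> D"
    then obtain a where a: "f = Dmap a" "cst a" unfolding D by blast
    let ?a = "\<lambda>u\<in>cr ` \<Omega>. a u mod p"
    have "Dmap a x = Dmap (\<lambda>x. ?a (cr x)) x" for x
    proof (cases "x \<in> \<Omega>")
      case True
      have "a (cr x) = a x" using cD[OF a(2) True crC] by simp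
      then show ?thesis unfolding Dmap_def using True rep_zmod[OF R, of "a x" x] by simp
    qed (simp add: Dmap_def)
    then have "f = Dmap (\<lambda>x. ?a (cr x))" unfolding a(1) by (simp add: fun_eq_iff)
    moreover have "?a \<in> ?P" using p_pos by auto
    ultimately show "f \<in> (\<lambda>a. Dmap (\<lambda>x. a (cr x))) ` ?P" by (rule image_eqI)
  qed
  from bij_betw_same_card[OF this] have "card D = p ^ card (cr ` \<Omega>)" using card_PiE[OF fc, of "\<lambda>_. {..<p}"] by simp
  then show "\<exists>k. card D = p ^ k" by blast
qed

end

text \<open>The second group is first conjugated so that the rotation groups of both lie in one
  \<open>p\<close>-group; \<open>LV\<close> and the classes are carried along by the
  conjugation.\<close>

theorem (in closed_group) regular_conj:
  assumes R: "Rep eps z" and R': "Rep ep z'" shows "Conj eps z ep z'"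
proof -
  interpret G: base_rep \<Omega> A p tv eps z by unfold_locales (rule R)
  interpret H: base_rep \<Omega> A p tv ep z' by unfold_locales (rule R')
  let ?D = "{G.Dmap a | a. \<forall>x\<in>\<Omega>. \<forall>y. G.cl G.LV x y \<longrightarrow> a x = a y}"
  let ?D' = "{H.Dmap a | a. \<forall>x\<in>\<Omega>. \<forall>y. H.cl H.LV x y \<longrightarrow> a x = a y}"
  obtain k1 k2 where k: "card ?D = p ^ k1" "card ?D' = p ^ k2" using G.Dmap_group(3) H.Dmap_group(3) by blast
  obtain g T k where g: "g \<in> A" and T: "perm_group \<Omega> T" "T \<subseteq> A" "card T = p ^ k" "?D \<subseteq> T" "\<forall>f\<in>?D'. g \<circ> f \<circ> finv g \<in> T"
    using sylow_conj[OF pgA fin prime_p G.Dmap_group(1,2) k(1) H.Dmap_group(1,2) k(2)] by blast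
  define ep2 where "ep2 = (\<lambda>v x. g (ep v (finv g x)))"
  define z2 where "z2 = (\<lambda>x. g (z' (finv g x)))"
  have R2: "Rep ep2 z2" unfolding ep2_def z2_def by (rule rep_conj[OF R' g])
  interpret K: base_rep \<Omega> A p tv ep2 z2 by unfold_locales (rule R2)
  note gi = A_inv[OF g]
  have z2p: "(z2 ^^ t) (g x) = g ((z' ^^ t) x)" for t x unfolding z2_def by (induction t) (simp_all add: gi)
  have LVs: "v \<in> K.LV" if v: "v \<in> H.LV" for v unfolding K.LV_def
  proof (intro CollectI ballI impI)
    fix x a assume x: "x \<in> \<Omega>" and a: "a \<in> A" "a x = x"
    define a' where "a' u = finv g (a (g u))" for u
    have a': "a' \<in> A" unfolding a'_def by (rule A_comp[OF gi(1) A_comp[OF a(1) g]])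
    have "a' (finv g x) = finv g x" unfolding a'_def gi a(2) ..
    from H.LV_D[OF v A_mem[OF gi(1) x] a' this] obtain u where "a' (ep v (finv g x)) = ep u (finv g x)" by blast
    then have "g (a' (ep v (finv g x))) = g (ep u (finv g x))" by (rule arg_cong)
    then have "a (ep2 v x) = ep2 u x" unfolding a'_def ep2_def gi .
    then show "\<exists>u. a (ep2 v x) = ep2 u x" by (rule exI)
  qed
  have clg: "K.cl K.LV (g x) (g y)" if c: "H.cl H.LV x y" for x y
  proof -
    obtain l t where l: "l \<in> H.LV" "y = (z' ^^ t) (ep l x)" using c unfolding H.cl_def by blast
    have "g y = (z2 ^^ t) (ep2 l (g x))" unfolding l(2) ep2_def gi z2p ..
    then show ?thesis unfolding K.cl_def using LVs[OF l(1)] by blast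
  qed
  interpret S: common_sylow \<Omega> A p tv eps z ep2 z2 T k
  proof unfold_locales
    show "perm_group \<Omega> T" "T \<subseteq> A" "card T = p ^ k" by (rule T)+
    fix a :: "'a \<Rightarrow> nat"
    { assume a: "\<And>x y. x \<in> \<Omega> \<Longrightarrow> G.cl G.LV x y \<Longrightarrow> a x = a y"
      have "G.Dmap a \<in> ?D" using a by blast
      then show "G.Dmap a \<in> T" using T(4) by blast }
    assume a: "\<And>x y. x \<in> \<Omega> \<Longrightarrow> K.cl K.LV x y \<Longrightarrow> a x = a y"
    have "a (g x) = a (g y)" if "x \<in> \<Omega>" "H.cl H.LV x y" for x y by (rule a[OF A_mem[OF g that(1)] clg[OF that(2)]])
    then have "H.Dmap (\<lambda>x. a (g x)) \<in> ?D'" by blast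
    then have m: "g \<circ> H.Dmap (\<lambda>x. a (g x)) \<circ> finv g \<in> T" using T(5) by blast
    have "K.Dmap a x = (g \<circ> H.Dmap (\<lambda>x. a (g x)) \<circ> finv g) x" for x
    proof (cases "x \<in> \<Omega>")
      case True
      have "g ((z' ^^ a x) (finv g x)) = (z2 ^^ a x) x" using z2p[of "a x" "finv g x"] unfolding gi by simp
      then show ?thesis unfolding K.Dmap_def H.Dmap_def using True A_mem[OF gi(1) True] by (simp add: gi)
    next
      case False
      then have "finv g x \<notin> \<Omega>" using A_out[OF gi(1)] by simp
      then show ?thesis unfolding K.Dmap_def H.Dmap_def using False by (simp add: gi)
    qed
    then have "K.Dmap a = g \<circ> H.Dmap (\<lambda>x. a (g x)) \<circ> finv g" by (rule ext)
    then show "K.Dmap a \<in> T" using m by (simp only:)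
  qed
  from S.conj show ?thesis unfolding ep2_def z2_def by (rule Conj_conj[OF g])
qed

section \<open>Cayley digraphs and the case p = 2\<close>

lemma cayley_arc: "(g, h) \<in> parcs (cayley_digraph G S) \<longleftrightarrow> g \<in> carrier G \<and> (\<exists>s\<in>S. h = s \<otimes>\<^bsub>G\<^esub> g)"
  unfolding cayley_digraph_def by auto

text \<open>Isomorphisms on vertices alone: in these digraphs an arc is the pair of its ends, so the
  arc map is determined by the vertex map.\<close>

definition cay_map :: "('a, 'b) monoid_scheme \<Rightarrow> 'a set \<Rightarrow> 'a set \<Rightarrow> ('a \<Rightarrow> 'a) \<Rightarrow> bool" where
  "cay_map G S T \<phi> \<longleftrightarrow> bij_betw \<phi> (carrier G) (carrier G) \<and>
    (\<forall>g\<in>carrier G. \<forall>h\<in>carrier G. (g, h) \<in> parcs (cayley_digraph G S) \<longleftrightarrow> (\<phi> g, \<phi> h) \<in> parcs (cayley_digraph G T))"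

context
  fixes G :: "('a, 'b) monoid_scheme" and S T :: "'a set"
  assumes G: "group G" and S: "S \<subseteq> carrier G" and T: "T \<subseteq> carrier G"
begin

interpretation group G by (rule G)

lemma arc_mem: "U \<subseteq> carrier G \<Longrightarrow> a \<in> parcs (cayley_digraph G U) \<Longrightarrow> fst a \<in> carrier G \<and> snd a \<in> carrier G"
  unfolding cayley_digraph_def by auto

lemma cay_mapI_iso:
  assumes iso: "pre_digraph.digraph_isomorphism (with_proj (cayley_digraph G S)) f"
    and eq: "with_proj (cayley_digraph G T) = app_iso f (with_proj (cayley_digraph G S))"
  shows "cay_map G S T (iso_verts f)"
proof -
  let ?\<phi> = "iso_verts f" and ?S = "parcs (cayley_digraph G S)" and ?T = "parcs (cayley_digraph G T)"
  have v: "pverts (cayley_digraph G U) = carrier G" for U unfolding cayley_digraph_def by simp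
  have inj: "inj_on ?\<phi> (carrier G)" using iso v unfolding pre_digraph.digraph_isomorphism_def by simp
  have img: "?\<phi> ` carrier G = carrier G" using arg_cong[OF eq, of verts] v by simp
  have arcs: "?T = iso_arcs f ` ?S" using arg_cong[OF eq, of arcs] by simp
  have tl: "iso_tail f = fst" "iso_head f = snd" using arg_cong[OF eq, of tail] arg_cong[OF eq, of head] by simp_all
  have ia: "iso_arcs f a = (?\<phi> (fst a), ?\<phi> (snd a))" if "a \<in> ?S" for a
    using iso that unfolding pre_digraph.digraph_isomorphism_def tl by (simp add: prod_eq_iff)
  show ?thesis unfolding cay_map_def
  proof (intro conjI ballI iffI)
    show "bij_betw ?\<phi> (carrier G) (carrier G)" using inj img unfolding bij_betw_def by blast
    fix g h assume g: "g \<in> carrier G" and h: "h \<in> carrier G"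
    { assume "(g, h) \<in> ?S" then show "(?\<phi> g, ?\<phi> h) \<in> ?T" unfolding arcs using ia by force }
    assume "(?\<phi> g, ?\<phi> h) \<in> ?T"
    then obtain a where a: "a \<in> ?S" "(?\<phi> g, ?\<phi> h) = (?\<phi> (fst a), ?\<phi> (snd a))" unfolding arcs using ia by auto
    have "g = fst a" "h = snd a" using a(2) inj_onD[OF inj] g h arc_mem[OF S a(1)] by auto
    then show "(g, h) \<in> ?S" using a(1) by simp
  qed
qed

lemma iso_of_cay_map:
  assumes c: "cay_map G S T \<phi>"
  shows "\<exists>f. pre_digraph.digraph_isomorphism (with_proj (cayley_digraph G S)) f \<and>
    with_proj (cayley_digraph G T) = app_iso f (with_proj (cayley_digraph G S)) \<and> iso_verts f = \<phi>"
proof -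
  let ?S = "parcs (cayley_digraph G S)" and ?T = "parcs (cayley_digraph G T)"
  let ?f = "\<lparr>iso_verts = \<phi>, iso_arcs = map_prod \<phi> \<phi>, iso_head = snd, iso_tail = fst\<rparr>"
  have v: "pverts (cayley_digraph G U) = carrier G" for U unfolding cayley_digraph_def by simp
  have bij: "inj_on \<phi> (carrier G)" "\<phi> ` carrier G = carrier G" using c unfolding cay_map_def bij_betw_def by auto
  have eq: "(g, h) \<in> ?S \<longleftrightarrow> (\<phi> g, \<phi> h) \<in> ?T" if "g \<in> carrier G" "h \<in> carrier G" for g h using c that unfolding cay_map_def by blast
  have img: "?T = map_prod \<phi> \<phi> ` ?S"
  proof (intro equalityI subsetI)
    fix a assume a: "a \<in> ?T"
    then have "fst a \<in> \<phi> ` carrier G" "snd a \<in> \<phi> ` carrier G" using arc_mem[OF T a] bij(2) by auto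
    then obtain g h where gh: "g \<in> carrier G" "h \<in> carrier G" "a = (\<phi> g, \<phi> h)" by (auto simp: prod_eq_iff)
    then have "(g, h) \<in> ?S" using eq a by simp
    then show "a \<in> map_prod \<phi> \<phi> ` ?S" using gh(3) by force
  next
    fix a assume "a \<in> map_prod \<phi> \<phi> ` ?S"
    then obtain g h where b: "(g, h) \<in> ?S" "a = (\<phi> g, \<phi> h)" by auto
    have "g \<in> carrier G" "h \<in> carrier G" using arc_mem[OF S b(1)] by auto
    then show "a \<in> ?T" unfolding b(2) using eq b(1) by blast
  qed
  have wf: "wf_digraph (with_proj (cayley_digraph G S))"
    by unfold_locales (use arc_mem[OF S] v in auto)
  have inj2: "inj_on (map_prod \<phi> \<phi>) ?S"
  proof (rule inj_onI)
    fix a b assume a: "a \<in> ?S" and b: "b \<in> ?S" and e: "map_prod \<phi> \<phi> a = map_prod \<phi> \<phi> b"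
    have e': "\<phi> (fst a) = \<phi> (fst b)" "\<phi> (snd a) = \<phi> (snd b)" using e by (cases a; cases b; simp)+
    have "fst a = fst b" by (rule inj_onD[OF bij(1) e'(1)]) (use arc_mem[OF S a] arc_mem[OF S b] in auto)
    moreover have "snd a = snd b" by (rule inj_onD[OF bij(1) e'(2)]) (use arc_mem[OF S a] arc_mem[OF S b] in auto)
    ultimately show "a = b" by (rule prod_eqI)
  qed
  have "pre_digraph.digraph_isomorphism (with_proj (cayley_digraph G S)) ?f"
    unfolding pre_digraph.digraph_isomorphism_def 
  proof (intro conjI ballI)
    fix a show "iso_verts ?f (tail (with_proj (cayley_digraph G S)) a) = iso_tail ?f (iso_arcs ?f a)"
      "iso_verts ?f (head (with_proj (cayley_digraph G S)) a) = iso_head ?f (iso_arcs ?f a)" by (cases a; simp)+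
  qed (simp_all add: wf bij(1) inj2 v)
  moreover have "with_proj (cayley_digraph G T) = app_iso ?f (with_proj (cayley_digraph G S))"
    unfolding app_iso_def with_proj_def using v bij(2) img by simp
  ultimately show ?thesis by (intro exI[of _ ?f]) simp
qed

lemma digraph_iso_cay_map:
  "digraph_iso (with_proj (cayley_digraph G S)) (with_proj (cayley_digraph G T)) \<longleftrightarrow> (\<exists>\<phi>. cay_map G S T \<phi>)"
  unfolding digraph_iso_def using cay_mapI_iso iso_of_cay_map by blast

lemma cayley_isomorphic_cay_map: "cayley_isomorphic G S T \<longleftrightarrow> (\<exists>\<phi>\<in>auto G. cay_map G S T \<phi>)"
  unfolding cayley_isomorphic_def using cay_mapI_iso iso_of_cay_map by blast

end

lemma cay_map_auto_mem:
  assumes G: "group G" and \<phi>: "cay_map G S T \<phi>" "\<phi> \<in> auto G" and S: "S \<subseteq> carrier G" "T \<subseteq> carrier G" and s: "s \<in> carrier G"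
  shows "s \<in> S \<longleftrightarrow> \<phi> s \<in> T"
proof -
  interpret group G by (rule G)
  have hom: "\<phi> \<in> hom G G" using \<phi>(2) unfolding auto_def by blast
  have one: "\<phi> \<one>\<^bsub>G\<^esub> = \<one>\<^bsub>G\<^esub>" using hom_one[OF hom G G] .
  have mem: "(\<one>\<^bsub>G\<^esub>, u) \<in> parcs (cayley_digraph G U) \<longleftrightarrow> u \<in> U" if "U \<subseteq> carrier G" for u U
    unfolding cayley_arc using that by (auto simp: subset_iff)
  have "\<phi> s \<in> carrier G" using hom s unfolding hom_def by blast
  have "(\<one>\<^bsub>G\<^esub>, s) \<in> parcs (cayley_digraph G S) \<longleftrightarrow> (\<phi> \<one>\<^bsub>G\<^esub>, \<phi> s) \<in> parcs (cayley_digraph G T)"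
    using \<phi>(1) s unfolding cay_map_def by blast
  then show ?thesis unfolding one mem[OF S(1)] mem[OF S(2)] .
qed

section \<open>The counterexample for \<open>p = 2\<close>\<close>

abbreviation "cube_times n \<equiv> group_power (integer_mod_group 2) 5 \<times>\<times> integer_mod_group n"

lemma group_cube_times: "group (cube_times n)"
  unfolding group_power_def by (intro DirProd_group product_group group_integer_mod_group)

lemma carrier_cube_times: "n > 0 \<Longrightarrow> carrier (cube_times n) = ({..<5} \<rightarrow>\<^sub>E {0..<2}) \<times> {0..<int n}"
  unfolding group_power_def by (simp add: carrier_integer_mod_group)

lemma fst_mult: "fst (g \<otimes>\<^bsub>cube_times n\<^esub> h) = (\<lambda>i\<in>{..<5}. (fst g i + fst h i) mod 2)"
  and snd_mult: "snd (g \<otimes>\<^bsub>cube_times n\<^esub> h) = (snd g + snd h) mod int n"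
  unfolding group_power_def product_group_def by (simp_all add: DirProd_def split_beta)

lemma fst_mult_at:
  "fst (g \<otimes>\<^bsub>cube_times n\<^esub> h) 0 = (fst g 0 + fst h 0) mod 2" "fst (g \<otimes>\<^bsub>cube_times n\<^esub> h) 1 = (fst g 1 + fst h 1) mod 2"
  "fst (g \<otimes>\<^bsub>cube_times n\<^esub> h) 2 = (fst g 2 + fst h 2) mod 2" "fst (g \<otimes>\<^bsub>cube_times n\<^esub> h) 3 = (fst g 3 + fst h 3) mod 2"
  "fst (g \<otimes>\<^bsub>cube_times n\<^esub> h) 4 = (fst g 4 + fst h 4) mod 2"
  unfolding fst_mult by simp_all

lemma fst_one: "fst \<one>\<^bsub>cube_times n\<^esub> = (\<lambda>i\<in>{..<5}. 0)" and snd_one: "snd \<one>\<^bsub>cube_times n\<^esub> = 0"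
  unfolding group_power_def product_group_def by (simp_all add: DirProd_def)

lemma even_mod2: "even (a mod 2) \<longleftrightarrow> even (a :: int)" by presburger

text \<open>Coordinates \<open>(c, b)\<close> with \<open>c = (x 0, x 1, x 2)\<close> and \<open>b = (x 3, x 4, y)\<close>. The quadric \<open>b \<cdot> c = 0\<close> and the
  cubic \<open>b \<cdot> c = c\<^sub>1 c\<^sub>2 c\<^sub>3\<close> define isomorphic Cayley digraphs via \<open>b \<mapsto> b + (c\<^sub>2 c\<^sub>3, c\<^sub>1 c\<^sub>3, c\<^sub>1 c\<^sub>2)\<close>; an automorphism
  preserves the degree of the indicator polynomial, detected by counting points on 3-dimensional subspaces.\<close>

definition quad :: "(nat \<Rightarrow> int) \<times> int \<Rightarrow> int" where
  "quad g = fst g 0 * fst g 3 + fst g 1 * fst g 4 + fst g 2 * snd g"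

definition cub :: "(nat \<Rightarrow> int) \<times> int \<Rightarrow> int" where
  "cub g = fst g 0 * fst g 1 * fst g 2"

definition quadric :: "((nat \<Rightarrow> int) \<times> int) set" where
  "quadric = {g \<in> carrier (cube_times 2). even (quad g)}"

definition cubic :: "((nat \<Rightarrow> int) \<times> int) set" where
  "cubic = {g \<in> carrier (cube_times 2). even (quad g + cub g)}"

definition shear :: "(nat \<Rightarrow> int) \<times> int \<Rightarrow> (nat \<Rightarrow> int) \<times> int" where
  "shear g = (\<lambda>i\<in>{..<5}. if i = 3 then (fst g 3 + fst g 1 * fst g 2) mod 2 else if i = 4 then (fst g 4 + fst g 0 * fst g 2) mod 2 else fst g i,
     (snd g + fst g 0 * fst g 1) mod 2)"

lemma shear_at:
  "fst (shear g) 0 = fst g 0" "fst (shear g) 1 = fst g 1" "fst (shear g) 2 = fst g 2"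
  "fst (shear g) 3 = (fst g 3 + fst g 1 * fst g 2) mod 2" "fst (shear g) 4 = (fst g 4 + fst g 0 * fst g 2) mod 2"
  "snd (shear g) = (snd g + fst g 0 * fst g 1) mod 2"
  unfolding shear_def by simp_all

lemma cube2_mem: "g \<in> carrier (cube_times 2) \<longleftrightarrow> fst g \<in> extensional {..<5} \<and> (\<forall>i<5. fst g i = 0 \<or> fst g i = 1) \<and> (snd g = 0 \<or> snd g = 1)"
  using carrier_cube_times[of 2] by (cases g) (auto simp: PiE_def Pi_def extensional_def)

lemma mod2_cases: "(a :: int) mod 2 = 0 \<or> a mod 2 = 1" by presburger

lemma shear_shear: assumes "g \<in> carrier (cube_times 2)" shows "shear (shear g) = g"
proof -
  have *: "fst g \<in> extensional {..<5}" "\<forall>i<5. fst g i = 0 \<or> fst g i = 1" "snd g = 0 \<or> snd g = 1" using assms cube2_mem by auto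
  have b: "((b + c) mod 2 + c) mod 2 = b" if "b = 0 \<or> b = 1" for b c :: int using that by presburger
  have "fst (shear (shear g)) i = fst g i" for i
    using *(1,2) b unfolding shear_def by (auto simp: extensional_def)
  then have "fst (shear (shear g)) = fst g" by (simp add: fun_eq_iff)
  moreover have "snd (shear (shear g)) = snd g" using *(3) b unfolding shear_def by simp
  ultimately show ?thesis by (simp add: prod_eq_iff)
qed

lemma shear_mem: assumes "g \<in> carrier (cube_times 2)" shows "shear g \<in> carrier (cube_times 2)"
proof -
  have m: "fst g i = 0 \<or> fst g i = 1" if "i < 5" for i using assms that unfolding cube2_mem by blast
  have "fst (shear g) \<in> extensional {..<5}" unfolding shear_def by simp
  moreover have "fst (shear g) i = 0 \<or> fst (shear g) i = 1" if i: "i < 5" for i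
  proof -
    consider "i = 3" | "i = 4" | "i \<noteq> 3" "i \<noteq> 4" by blast
    then show ?thesis
    proof cases
      case 1 show ?thesis unfolding 1 shear_at by (rule mod2_cases)
    next
      case 2 show ?thesis unfolding 2 shear_at by (rule mod2_cases)
    next
      case 3
      then have "fst (shear g) i = fst g i" unfolding shear_def using i by simp
      then show ?thesis using m[OF i] by simp
    qed
  qed
  moreover have "snd (shear g) = 0 \<or> snd (shear g) = 1" unfolding shear_at by (rule mod2_cases)
  ultimately show ?thesis unfolding cube2_mem by blast
qed

lemma cay_map_shear: "cay_map (cube_times 2) quadric cubic shear"
proof -
  let ?G = "cube_times 2"
  interpret group ?G by (rule group_cube_times)
  have bij: "bij_betw shear (carrier ?G) (carrier ?G)"
    by (rule bij_betwI[where g=shear]) (use shear_shear shear_mem in auto)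
  have arcs: "(g, h) \<in> parcs (cayley_digraph ?G U) \<longleftrightarrow> h \<otimes>\<^bsub>?G\<^esub> g \<in> U"
    if g: "g \<in> carrier ?G" and h: "h \<in> carrier ?G" and U: "U \<subseteq> carrier ?G" for g h U
  proof -
    have gg: "g \<otimes>\<^bsub>?G\<^esub> g = \<one>\<^bsub>?G\<^esub>"
      by (rule prod_eqI) (simp_all only: fst_mult snd_mult fst_one snd_one, simp_all add: restrict_def fun_eq_iff)
    show ?thesis unfolding cayley_arc
    proof
      assume "g \<in> carrier ?G \<and> (\<exists>s\<in>U. h = s \<otimes>\<^bsub>?G\<^esub> g)"
      then obtain s where "s \<in> U" "h = s \<otimes>\<^bsub>?G\<^esub> g" by blast
      then have s: "s \<in> carrier ?G" "s \<in> U" "h = s \<otimes>\<^bsub>?G\<^esub> g" using U by (blast+)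
      have "h \<otimes>\<^bsub>?G\<^esub> g = s" unfolding s(3) m_assoc[OF s(1) g g] gg by (rule r_one[OF s(1)])
      then show "h \<otimes>\<^bsub>?G\<^esub> g \<in> U" using s(2) by (simp only:)
    next
      assume u: "h \<otimes>\<^bsub>?G\<^esub> g \<in> U"
      have "h = (h \<otimes>\<^bsub>?G\<^esub> g) \<otimes>\<^bsub>?G\<^esub> g" unfolding m_assoc[OF h g g] gg by (rule r_one[OF h, symmetric])
      then show "g \<in> carrier ?G \<and> (\<exists>s\<in>U. h = s \<otimes>\<^bsub>?G\<^esub> g)" using g by (intro conjI bexI[OF _ u])
    qed
  qed
  have key: "h \<otimes>\<^bsub>?G\<^esub> g \<in> quadric \<longleftrightarrow> shear h \<otimes>\<^bsub>?G\<^esub> shear g \<in> cubic"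
    if g: "g \<in> carrier ?G" and h: "h \<in> carrier ?G" for g h
  proof -
    have m: "h \<otimes>\<^bsub>?G\<^esub> g \<in> carrier ?G" "shear h \<otimes>\<^bsub>?G\<^esub> shear g \<in> carrier ?G" by (intro m_closed g h shear_mem)+
    let ?g = "fst g" and ?h = "fst h"
    define q1 where "q1 = (?h 0 + ?g 0) * (?h 3 + ?g 3) + (?h 1 + ?g 1) * (?h 4 + ?g 4) + (?h 2 + ?g 2) * (snd h + snd g)"
    define q2 where "q2 = (?h 0 + ?g 0) * (?h 3 + ?h 1 * ?h 2 + (?g 3 + ?g 1 * ?g 2)) + (?h 1 + ?g 1) * (?h 4 + ?h 0 * ?h 2 + (?g 4 + ?g 0 * ?g 2)) +
      (?h 2 + ?g 2) * (snd h + ?h 0 * ?h 1 + (snd g + ?g 0 * ?g 1)) + (?h 0 + ?g 0) * (?h 1 + ?g 1) * (?h 2 + ?g 2)"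
    \<comment> \<open>Every monomial of \<open>q2 - q1\<close> has an even coefficient; the bracket
      is half the difference.\<close>
    have "q2 = q1 + 2 * (2 * ?h 0 * ?h 1 * ?h 2 + 2 * ?g 0 * ?g 1 * ?g 2 + ?h 0 * ?h 1 * ?g 2 + ?h 0 * ?g 1 * ?h 2 + ?g 0 * ?h 1 * ?h 2 +
      ?g 0 * ?g 1 * ?h 2 + ?g 0 * ?h 1 * ?g 2 + ?h 0 * ?g 1 * ?g 2)" unfolding q1_def q2_def by (simp add: algebra_simps)
    then have "even q1 \<longleftrightarrow> even q2" by simp
    moreover have "even (quad (h \<otimes>\<^bsub>?G\<^esub> g)) \<longleftrightarrow> even q1"
      unfolding quad_def q1_def fst_mult_at snd_mult of_nat_numeral by (simp only: even_add even_mult_iff even_mod2)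
    moreover have "even (quad (shear h \<otimes>\<^bsub>?G\<^esub> shear g) + cub (shear h \<otimes>\<^bsub>?G\<^esub> shear g)) \<longleftrightarrow> even q2"
      unfolding quad_def cub_def q2_def shear_at fst_mult_at snd_mult of_nat_numeral by (simp only: even_add even_mult_iff even_mod2)
    ultimately have "even (quad (h \<otimes>\<^bsub>?G\<^esub> g)) \<longleftrightarrow> even (quad (shear h \<otimes>\<^bsub>?G\<^esub> shear g) + cub (shear h \<otimes>\<^bsub>?G\<^esub> shear g))" by blast
    then show ?thesis unfolding quadric_def cubic_def using m by blast
  qed
  have sub: "quadric \<subseteq> carrier ?G" "cubic \<subseteq> carrier ?G" unfolding quadric_def cubic_def by auto
  show ?thesis unfolding cay_map_def
  proof (intro conjI ballI)
    fix g h assume g: "g \<in> carrier ?G" and h: "h \<in> carrier ?G"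
    show "(g, h) \<in> parcs (cayley_digraph ?G quadric) \<longleftrightarrow> (shear g, shear h) \<in> parcs (cayley_digraph ?G cubic)"
      unfolding arcs[OF g h sub(1)] arcs[OF shear_mem[OF g] shear_mem[OF h] sub(2)] by (rule key[OF g h])
  qed (rule bij)
qed

lemma not_cayley_isomorphic: "\<not> cayley_isomorphic (cube_times 2) quadric cubic"
proof
  let ?G = "cube_times 2"
  interpret group ?G by (rule group_cube_times)
  have sub: "quadric \<subseteq> carrier ?G" "cubic \<subseteq> carrier ?G" unfolding quadric_def cubic_def by auto
  assume "cayley_isomorphic ?G quadric cubic"
  then obtain \<phi> where \<phi>: "cay_map ?G quadric cubic \<phi>" "\<phi> \<in> auto ?G"
    using cayley_isomorphic_cay_map[OF group_cube_times sub] by blast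
  have hom: "\<And>x y. x \<in> carrier ?G \<Longrightarrow> y \<in> carrier ?G \<Longrightarrow> \<phi> (x \<otimes>\<^bsub>?G\<^esub> y) = \<phi> x \<otimes>\<^bsub>?G\<^esub> \<phi> y"
    "\<And>x. x \<in> carrier ?G \<Longrightarrow> \<phi> x \<in> carrier ?G" using \<phi>(2) unfolding auto_def hom_def by auto
  have img: "\<phi> ` carrier ?G = carrier ?G" using \<phi>(1) unfolding cay_map_def bij_betw_def by blast
  have mem: "even (quad g) \<longleftrightarrow> even (quad (\<phi> g) + cub (\<phi> g))" if "g \<in> carrier ?G" for g
    using cay_map_auto_mem[OF group_cube_times \<phi> sub that] that hom(2) unfolding quadric_def cubic_def by blast
  \<comment> \<open>The first three unit vectors span a subspace on which the quadratic part
    vanishes and the cubic part is 1 at the sum of all three only.\<close>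
  define E where "E k = (\<lambda>i\<in>{..<5}. if i = k then 1 else 0 :: int, 0 :: int)" for k :: nat
  have E: "E k \<in> carrier ?G" for k unfolding cube2_mem E_def by auto
  have pre: "\<exists>x. x \<in> carrier ?G \<and> \<phi> x = E k" for k 
  proof -
    have "E k \<in> \<phi> ` carrier ?G" unfolding img by (rule E)
    then obtain x where "E k = \<phi> x" "x \<in> carrier ?G" by (rule imageE)
    then show ?thesis by (intro exI[of _ x] conjI) simp_all
  qed
  obtain x where x: "x \<in> carrier ?G" "\<phi> x = E 0" using pre by blast
  obtain y where y: "y \<in> carrier ?G" "\<phi> y = E 1" using pre by blast
  obtain w where w: "w \<in> carrier ?G" "\<phi> w = E 2" using pre by blast
  define B where "B x y = (fst x 0 + fst y 0) * (fst x 3 + fst y 3) + (fst x 1 + fst y 1) * (fst x 4 + fst y 4) + (fst x 2 + fst y 2) * (snd x + snd y)"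
    for x y :: "(nat \<Rightarrow> int) \<times> int"
  define B3 where "B3 = (fst x 0 + fst y 0 + fst w 0) * (fst x 3 + fst y 3 + fst w 3) + (fst x 1 + fst y 1 + fst w 1) * (fst x 4 + fst y 4 + fst w 4) +
    (fst x 2 + fst y 2 + fst w 2) * (snd x + snd y + snd w)"
  have b: "even (quad (u \<otimes>\<^bsub>?G\<^esub> v)) \<longleftrightarrow> even (B u v)" for u v
    unfolding quad_def B_def fst_mult_at snd_mult of_nat_numeral by (simp only: even_add even_mult_iff even_mod2)
  have b3: "even (quad (x \<otimes>\<^bsub>?G\<^esub> y \<otimes>\<^bsub>?G\<^esub> w)) \<longleftrightarrow> even B3"
    unfolding quad_def B3_def fst_mult_at snd_mult of_nat_numeral by (simp only: even_add even_mult_iff even_mod2)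
  \<comment> \<open>Third differences of a quadratic form vanish: modulo 2 its values at the seven
    nonzero combinations of \<open>x\<close>, \<open>y\<close>, \<open>w\<close> add up to 0. On the
    images \<open>E 0\<close>, \<open>E 1\<close>, \<open>E 2\<close> exactly one of the seven
    points lies outside the cubic.\<close>
  have "B x y + B x w + B y w + quad x + quad y + quad w = B3 + 2 * (quad x + quad y + quad w)"
    unfolding B_def B3_def quad_def by (simp add: algebra_simps)
  then have "even (B x y + B x w + B y w + quad x + quad y + quad w) \<longleftrightarrow> even (B3 + 2 * (quad x + quad y + quad w))" by (simp only:)
  then have add: "even (B x y + B x w + B y w + quad x + quad y + quad w) \<longleftrightarrow> even B3" by (simp only: even_add even_mult_iff) simp
  have e1: "even (quad (E k) + cub (E k))" if "k = 0 \<or> k = 1 \<or> k = 2" for k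
    unfolding quad_def cub_def E_def using that by auto
  have e2: "even (quad (E 0 \<otimes>\<^bsub>?G\<^esub> E 1) + cub (E 0 \<otimes>\<^bsub>?G\<^esub> E 1))" "even (quad (E 0 \<otimes>\<^bsub>?G\<^esub> E 2) + cub (E 0 \<otimes>\<^bsub>?G\<^esub> E 2))"
    "even (quad (E 1 \<otimes>\<^bsub>?G\<^esub> E 2) + cub (E 1 \<otimes>\<^bsub>?G\<^esub> E 2))"
    "odd (quad (E 0 \<otimes>\<^bsub>?G\<^esub> E 1 \<otimes>\<^bsub>?G\<^esub> E 2) + cub (E 0 \<otimes>\<^bsub>?G\<^esub> E 1 \<otimes>\<^bsub>?G\<^esub> E 2))"
    unfolding quad_def cub_def fst_mult_at snd_mult by (simp_all add: E_def)
  have "even (quad x)" "even (quad y)" "even (quad w)"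
    unfolding mem[OF x(1)] mem[OF y(1)] mem[OF w(1)] x(2) y(2) w(2) by (rule e1, simp)+
  moreover have "even (quad (x \<otimes>\<^bsub>?G\<^esub> y))"
    unfolding mem[OF m_closed[OF x(1) y(1)]] hom(1)[OF x(1) y(1)] x(2) y(2) by (rule e2)
  moreover have "even (quad (x \<otimes>\<^bsub>?G\<^esub> w))"
    unfolding mem[OF m_closed[OF x(1) w(1)]] hom(1)[OF x(1) w(1)] x(2) w(2) by (rule e2)
  moreover have "even (quad (y \<otimes>\<^bsub>?G\<^esub> w))"
    unfolding mem[OF m_closed[OF y(1) w(1)]] hom(1)[OF y(1) w(1)] y(2) w(2) by (rule e2)
  moreover have "odd (quad (x \<otimes>\<^bsub>?G\<^esub> y \<otimes>\<^bsub>?G\<^esub> w))"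
    unfolding mem[OF m_closed[OF m_closed[OF x(1) y(1)] w(1)]] hom(1)[OF m_closed[OF x(1) y(1)] w(1)] hom(1)[OF x(1) y(1)] x(2) y(2) w(2) by (rule e2)
  ultimately show False using add unfolding b3 unfolding b by simp
qed

lemma not_DCI_two: "\<not> DCI_group (cube_times 2)"
proof
  assume D: "DCI_group (cube_times 2)"
  have sub: "quadric \<subseteq> carrier (cube_times 2)" "cubic \<subseteq> carrier (cube_times 2)" unfolding quadric_def cubic_def by auto
  have "digraph_iso (with_proj (cayley_digraph (cube_times 2) quadric)) (with_proj (cayley_digraph (cube_times 2) cubic))"
    using digraph_iso_cay_map[OF group_cube_times sub] cay_map_shear by blast
  then show False using D sub not_cayley_isomorphic unfolding DCI_group_def CI_subset_def by blast
qed

section \<open>Babai's criterion\<close>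

text \<open>A concrete finite type of class \<open>ab_group_add\<close> for the labels, as the
  locales take them from a type: vectors over the field with two elements as subsets, added by
  symmetric difference.\<close>

typedef cube = "Pow {..<5 :: nat}" by auto

instantiation cube :: ab_group_add
begin

definition "0 = Abs_cube {}"
definition "u + v = Abs_cube ((Rep_cube u - Rep_cube v) \<union> (Rep_cube v - Rep_cube u))"
definition "(u :: cube) - v = u + v"
definition "- (u :: cube) = u"

lemma Rep_cube_plus: "Rep_cube (u + v) = (Rep_cube u - Rep_cube v) \<union> (Rep_cube v - Rep_cube u)"
  unfolding plus_cube_def by (rule Abs_cube_inverse) (use Rep_cube[of u] Rep_cube[of v] in auto)

lemma Rep_cube_zero: "Rep_cube 0 = {}" unfolding zero_cube_def by (rule Abs_cube_inverse) simp

instance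
  by standard (auto simp: Rep_cube_inject[symmetric] Rep_cube_plus Rep_cube_zero minus_cube_def uminus_cube_def)

end

instance cube :: finite
proof
  have "inj_on Rep_cube UNIV" by (simp add: inj_on_def Rep_cube_inject)
  moreover have "finite (range Rep_cube)" by (rule finite_subset[of _ "Pow {..<5}"]) (use Rep_cube in auto)
  ultimately show "finite (UNIV :: cube set)" by (rule finite_imageD[rotated])
qed

lemma card_cube: "card (UNIV :: cube set) = 32"
proof -
  have "card (range Rep_cube) = card (UNIV :: cube set)" by (rule card_image) (simp add: inj_on_def Rep_cube_inject)
  then show ?thesis unfolding type_definition.Rep_range[OF type_definition_cube] by (simp add: card_Pow)
qed

lemma cube_double: "(u :: cube) + u = 0"
  by (simp add: Rep_cube_inject[symmetric] Rep_cube_plus Rep_cube_zero)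

definition cvec :: "cube \<Rightarrow> (nat \<Rightarrow> int) \<times> int" where
  "cvec v = (\<lambda>i\<in>{..<5}. if i \<in> Rep_cube v then 1 else 0, 0)"

definition zvec :: "nat \<Rightarrow> nat \<Rightarrow> (nat \<Rightarrow> int) \<times> int" where
  "zvec p t = (\<lambda>i\<in>{..<5}. 0, int t mod int p)"

definition aut_cay :: "('a, 'b) monoid_scheme \<Rightarrow> 'a set \<Rightarrow> ('a \<Rightarrow> 'a) set" where
  "aut_cay G S = {a. a permutes carrier G \<and> (\<forall>g\<in>carrier G. \<forall>h\<in>carrier G.
     (g, h) \<in> parcs (cayley_digraph G S) \<longleftrightarrow> (a g, a h) \<in> parcs (cayley_digraph G S))}"

lemma perm_group_aut_cay: "perm_group (carrier G) (aut_cay G S)"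
proof (rule perm_groupI)
  fix f assume f: "f \<in> aut_cay G S"
  then have fp: "f permutes carrier G" and fa: "\<And>g h. g \<in> carrier G \<Longrightarrow> h \<in> carrier G \<Longrightarrow>
      (g, h) \<in> parcs (cayley_digraph G S) \<longleftrightarrow> (f g, f h) \<in> parcs (cayley_digraph G S)" unfolding aut_cay_def by auto
  show "f permutes carrier G" by (rule fp)
  note ip = permutes_inv[OF fp]
  have "(g, h) \<in> parcs (cayley_digraph G S) \<longleftrightarrow> (finv f g, finv f h) \<in> parcs (cayley_digraph G S)"
    if g: "g \<in> carrier G" and h: "h \<in> carrier G" for g h
  proof -
    have m: "finv f g \<in> carrier G" "finv f h \<in> carrier G" using permutes_in_image[OF ip] g h by auto
    show ?thesis using fa[OF m] permutes_inverses(1)[OF fp] by simp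
  qed
  then show "finv f \<in> aut_cay G S" unfolding aut_cay_def using ip by blast
  fix g assume g: "g \<in> aut_cay G S"
  then have gp: "g permutes carrier G" and ga: "\<And>x y. x \<in> carrier G \<Longrightarrow> y \<in> carrier G \<Longrightarrow>
      (x, y) \<in> parcs (cayley_digraph G S) \<longleftrightarrow> (g x, g y) \<in> parcs (cayley_digraph G S)" unfolding aut_cay_def by auto
  have "(x, y) \<in> parcs (cayley_digraph G S) \<longleftrightarrow> ((f \<circ> g) x, (f \<circ> g) y) \<in> parcs (cayley_digraph G S)"
    if x: "x \<in> carrier G" and y: "y \<in> carrier G" for x y
    using ga[OF x y] fa[of "g x" "g y"] permutes_in_image[OF gp] x y by simp
  then show "f \<circ> g \<in> aut_cay G S" unfolding aut_cay_def using permutes_compose[OF gp fp] by blast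
qed (simp add: aut_cay_def permutes_id)

text \<open>Preservation of arcs concerns two points at a time, so it can be checked with a
  different automorphism for each pair.\<close>

lemma aut_cay_closed:
  assumes perm: "\<delta> permutes carrier G"
    and pair: "\<And>x y. x \<in> carrier G \<Longrightarrow> y \<in> carrier G \<Longrightarrow> \<exists>a\<in>aut_cay G S. a x = \<delta> x \<and> a y = \<delta> y"
  shows "\<delta> \<in> aut_cay G S"
proof -
  have "(x, y) \<in> parcs (cayley_digraph G S) \<longleftrightarrow> (\<delta> x, \<delta> y) \<in> parcs (cayley_digraph G S)"
    if x: "x \<in> carrier G" and y: "y \<in> carrier G" for x y
  proof -
    obtain a where a: "a \<in> aut_cay G S" "a x = \<delta> x" "a y = \<delta> y" using pair[OF x y] by blast
    then show ?thesis using x y unfolding aut_cay_def by force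
  qed
  then show ?thesis unfolding aut_cay_def using perm by blast
qed

text \<open>An isomorphism \<open>\<phi>\<close> carries the regular group of the first digraph to a
  second regular group of automorphisms of the other one. With \<open>\<delta>\<close> from
  \<open>regular_conj\<close>, the composite \<open>\<delta> \<circ> \<phi>\<close> normalises the
  regular group, so after a translation that makes it fix the identity it is a group
  automorphism.\<close>

lemma DCI_odd:
  fixes p :: nat
  assumes p: "prime p" and odd: "odd p"
  shows "DCI_group (cube_times p)"
proof -
  define G where "G = cube_times p"
  define \<Omega> where "\<Omega> = carrier G"
  have p0: "p > 0" using prime_gt_0_nat[OF p] .
  have grp: "group G" unfolding G_def by (rule group_cube_times)
  interpret group G by (rule grp)
  have car: "\<Omega> = ({..<5} \<rightarrow>\<^sub>E {0..<2}) \<times> {0..<int p}" unfolding \<Omega>_def G_def by (rule carrier_cube_times[OF p0])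
  have fin: "finite \<Omega>" unfolding car by (intro finite_cartesian_product finite_PiE) auto
  have card: "card \<Omega> = 32 * p" unfolding car by (simp add: card_cartesian_product card_PiE)
  note fm = fst_mult[of p, folded G_def] and sm = snd_mult[of p, folded G_def]
  have comm: "x \<otimes>\<^bsub>G\<^esub> y = y \<otimes>\<^bsub>G\<^esub> x" for x y
    by (rule prod_eqI) (simp_all add: fm sm add.commute)
  have cm: "cvec v \<in> \<Omega>" for v unfolding car cvec_def using p0 by (auto simp: PiE_def)
  have zm: "zvec p t \<in> \<Omega>" for t unfolding car zvec_def using p0 by (auto simp: PiE_def)
  have cadd: "cvec (u + v) = cvec u \<otimes>\<^bsub>G\<^esub> cvec v" for u v
    by (rule prod_eqI) (auto simp: fm sm cvec_def Rep_cube_plus fun_eq_iff)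
  have zadd: "zvec p (s + t) = zvec p s \<otimes>\<^bsub>G\<^esub> zvec p t" for s t
    by (rule prod_eqI) (auto simp: fm sm zvec_def fun_eq_iff mod_add_eq)
  have one: "\<one>\<^bsub>G\<^esub> = zvec p 0" "zvec p p = zvec p 0"
    by (rule prod_eqI, simp_all add: fst_one[of p, folded G_def] snd_one[of p, folded G_def] zvec_def)
  have dec: "\<exists>v t. g = zvec p t \<otimes>\<^bsub>G\<^esub> cvec v" if g: "g \<in> \<Omega>" for g
  proof -
    have f: "fst g \<in> extensional {..<5}" "\<And>i. i < 5 \<Longrightarrow> fst g i = 0 \<or> fst g i = 1" "0 \<le> snd g" "snd g < int p"
      using g unfolding car by (auto simp: PiE_def Pi_def)
    define v where "v = Abs_cube {i\<in>{..<5}. fst g i = 1}"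
    have v: "Rep_cube v = {i\<in>{..<5}. fst g i = 1}" unfolding v_def by (rule Abs_cube_inverse) auto
    have "fst g i = fst (zvec p (nat (snd g)) \<otimes>\<^bsub>G\<^esub> cvec v) i" for i
      unfolding fm zvec_def cvec_def v using f(1) f(2)[of i] by (auto simp: extensional_def)
    then have "fst g = fst (zvec p (nat (snd g)) \<otimes>\<^bsub>G\<^esub> cvec v)" by (rule ext)
    moreover have "snd g = snd (zvec p (nat (snd g)) \<otimes>\<^bsub>G\<^esub> cvec v)" unfolding sm zvec_def cvec_def using f(3,4) by simp
    ultimately have "g = zvec p (nat (snd g)) \<otimes>\<^bsub>G\<^esub> cvec v" by (rule prod_eqI)
    then show ?thesis by blast
  qed
  define L where "L g x = (if x \<in> \<Omega> then g \<otimes>\<^bsub>G\<^esub> x else x)" for g x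
  have Lm: "L g x \<in> \<Omega>" if "g \<in> \<Omega>" "x \<in> \<Omega>" for g x using that unfolding L_def \<Omega>_def by simp
  have LL: "L g (L h x) = L (g \<otimes>\<^bsub>G\<^esub> h) x" if "g \<in> \<Omega>" "h \<in> \<Omega>" for g h x
    using that unfolding L_def \<Omega>_def by (simp add: m_assoc)
  have L1: "L \<one>\<^bsub>G\<^esub> x = x" for x unfolding L_def \<Omega>_def by simp
  have invm: "inv\<^bsub>G\<^esub> g \<in> \<Omega>" if "g \<in> \<Omega>" for g using that unfolding \<Omega>_def by simp
  have Linv: "L (inv\<^bsub>G\<^esub> g) (L g x) = x" "L g (L (inv\<^bsub>G\<^esub> g) x) = x" if g: "g \<in> \<Omega>" for g x
  proof -
    have "inv\<^bsub>G\<^esub> g \<otimes>\<^bsub>G\<^esub> g = \<one>\<^bsub>G\<^esub>" "g \<otimes>\<^bsub>G\<^esub> inv\<^bsub>G\<^esub> g = \<one>\<^bsub>G\<^esub>" using g unfolding \<Omega>_def by simp_all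
    then show "L (inv\<^bsub>G\<^esub> g) (L g x) = x" "L g (L (inv\<^bsub>G\<^esub> g) x) = x"
      unfolding LL[OF invm[OF g] g] LL[OF g invm[OF g]] using L1 by simp_all
  qed
  have Lperm: "L g permutes \<Omega>" if g: "g \<in> \<Omega>" for g unfolding permutes_def
  proof (intro conjI allI impI)
    fix x assume "x \<notin> \<Omega>" then show "L g x = x" unfolding L_def by simp
  next
    fix y show "\<exists>!x. L g x = y"
    proof (rule ex1I)
      show "L g (L (inv\<^bsub>G\<^esub> g) y) = y" by (rule Linv(2)[OF g])
      fix x assume "L g x = y" then show "x = L (inv\<^bsub>G\<^esub> g) y" using Linv(1)[OF g, of x] by simp
    qed
  qed
  \<comment> \<open>Arcs join \<open>x\<close> to \<open>s \<otimes> x\<close>, so it is right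
    multiplication that preserves them; left multiplication does so because the group is
    commutative.\<close>
  have Larc1: "(L g x, L g y) \<in> parcs (cayley_digraph G U)" if g: "g \<in> \<Omega>" and U: "U \<subseteq> \<Omega>" and xy: "(x, y) \<in> parcs (cayley_digraph G U)" for g x y U
  proof -
    obtain s where s: "x \<in> \<Omega>" "s \<in> U" "y = s \<otimes>\<^bsub>G\<^esub> x" using xy unfolding cayley_arc \<Omega>_def by blast
    have sO: "s \<in> \<Omega>" using s U by blast
    have "L g y = s \<otimes>\<^bsub>G\<^esub> (L g x)"

    proof -
      have m: "g \<in> carrier G" "s \<in> carrier G" "x \<in> carrier G" using s(1) sO g unfolding \<Omega>_def by auto
      have "g \<otimes>\<^bsub>G\<^esub> (s \<otimes>\<^bsub>G\<^esub> x) = (g \<otimes>\<^bsub>G\<^esub> s) \<otimes>\<^bsub>G\<^esub> x" by (rule m_assoc[OF m, symmetric])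
      also have "\<dots> = s \<otimes>\<^bsub>G\<^esub> (g \<otimes>\<^bsub>G\<^esub> x)" unfolding comm[of g s] by (rule m_assoc[OF m(2,1,3)])
      finally have "g \<otimes>\<^bsub>G\<^esub> (s \<otimes>\<^bsub>G\<^esub> x) = s \<otimes>\<^bsub>G\<^esub> (g \<otimes>\<^bsub>G\<^esub> x)" .
      moreover have "s \<otimes>\<^bsub>G\<^esub> x \<in> \<Omega>" unfolding \<Omega>_def using m by simp
      ultimately show ?thesis unfolding L_def s(3) using s(1) by simp
    qed
    then show ?thesis unfolding cayley_arc using s(2) Lm[OF g s(1)] unfolding \<Omega>_def by blast
  qed
  have LA: "L g \<in> aut_cay G U" if g: "g \<in> \<Omega>" and U: "U \<subseteq> \<Omega>" for g U
    unfolding aut_cay_def \<Omega>_def[symmetric]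
  proof (intro CollectI conjI ballI iffI)
    show "L g permutes \<Omega>" by (rule Lperm[OF g])
    fix x y
    { assume "(x, y) \<in> parcs (cayley_digraph G U)" then show "(L g x, L g y) \<in> parcs (cayley_digraph G U)" by (rule Larc1[OF g U]) }
    assume "(L g x, L g y) \<in> parcs (cayley_digraph G U)"
    from Larc1[OF invm[OF g] U this] show "(x, y) \<in> parcs (cayley_digraph G U)" unfolding Linv[OF g] .
  qed
  define eps where "eps v = L (cvec v)" for v
  define zz where "zz = L (zvec p 1)"
  have zpow: "(zz ^^ t) x = L (zvec p t) x" for t x
  proof (induction t)
    case 0 then show ?case using L1 one(1) by simp
  next
    case (Suc t)
    have "(zz ^^ Suc t) x = L (zvec p 1 \<otimes>\<^bsub>G\<^esub> zvec p t) x" using Suc LL[OF zm zm] unfolding zz_def by simp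
    then show ?case using zadd[of 1 t] by simp
  qed
  have main: "cayley_isomorphic G S T" if S: "S \<subseteq> \<Omega>" and T: "T \<subseteq> \<Omega>" and c0: "cay_map G S T \<phi>0" for S T \<phi>0
  proof -
    define A where "A = aut_cay G T"
    interpret cgp: closed_group \<Omega> A p "TYPE(cube)"
    proof
      show "perm_group \<Omega> A" unfolding A_def \<Omega>_def by (rule perm_group_aut_cay)
      show "\<delta> \<in> A" if "\<delta> permutes \<Omega>" "\<And>x y. x \<in> \<Omega> \<Longrightarrow> y \<in> \<Omega> \<Longrightarrow> \<exists>a\<in>A. a x = \<delta> x \<and> a y = \<delta> y" for \<delta>
        using that unfolding A_def \<Omega>_def by (rule aut_cay_closed)
    qed (use fin p odd cube_double card_cube in auto)
    have R: "rep \<Omega> A p eps zz" unfolding rep_def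
    proof (intro conjI allI ballI)
      show "eps v \<in> A" for v unfolding eps_def A_def by (rule LA[OF cm T])
      show "zz \<in> A" unfolding zz_def A_def by (rule LA[OF zm T])
      show "eps (u + v) x = eps u (eps v x)" for u v x unfolding eps_def LL[OF cm cm] cadd ..
      show "eps v (zz x) = zz (eps v x)" for v x unfolding eps_def zz_def LL[OF cm zm] LL[OF zm cm] comm[of "cvec v"] ..
      show "(zz ^^ p) x = x" for x unfolding zpow one(2) one(1)[symmetric] by (rule L1)
      show "card \<Omega> = 32 * p" by (rule card)
      fix x y assume x: "x \<in> \<Omega>" and y: "y \<in> \<Omega>"
      have "y \<otimes>\<^bsub>G\<^esub> inv\<^bsub>G\<^esub> x \<in> \<Omega>" using x y unfolding \<Omega>_def by simp
      then obtain v t where vt: "y \<otimes>\<^bsub>G\<^esub> inv\<^bsub>G\<^esub> x = zvec p t \<otimes>\<^bsub>G\<^esub> cvec v" using dec by blast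
      have "y = (y \<otimes>\<^bsub>G\<^esub> inv\<^bsub>G\<^esub> x) \<otimes>\<^bsub>G\<^esub> x" using x y unfolding \<Omega>_def by (simp add: m_assoc)
      then have "y = L (zvec p t \<otimes>\<^bsub>G\<^esub> cvec v) x" unfolding vt L_def using x by simp
      then have "y = (zz ^^ t) (eps v x)" unfolding zpow eps_def LL[OF zm cm] .
      then show "\<exists>v t. y = (zz ^^ t) (eps v x)" by blast
    qed
    define \<phi> where "\<phi> x = (if x \<in> \<Omega> then \<phi>0 x else x)" for x
    have bij0: "bij_betw \<phi>0 \<Omega> \<Omega>" using c0 unfolding cay_map_def \<Omega>_def by blast
    have "bij_betw \<phi> \<Omega> \<Omega> \<longleftrightarrow> bij_betw \<phi>0 \<Omega> \<Omega>" by (rule bij_betw_cong) (simp add: \<phi>_def)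
    then have \<phi>p: "\<phi> permutes \<Omega>" using bij0 by (intro bij_imp_permutes) (auto simp: \<phi>_def)
    have \<phi>m: "\<phi> x \<in> \<Omega> \<longleftrightarrow> x \<in> \<Omega>" for x by (rule permutes_in_image[OF \<phi>p])
    have \<phi>i: "finv \<phi> (\<phi> x) = x" "\<phi> (finv \<phi> x) = x" for x using permutes_inverses[OF \<phi>p] by auto
    have im: "finv \<phi> x \<in> \<Omega> \<longleftrightarrow> x \<in> \<Omega>" for x by (rule permutes_in_image[OF permutes_inv[OF \<phi>p]])
    have arc: "(x, y) \<in> parcs (cayley_digraph G S) \<longleftrightarrow> (\<phi> x, \<phi> y) \<in> parcs (cayley_digraph G T)" if "x \<in> \<Omega>" "y \<in> \<Omega>" for x y
      using c0 that unfolding cay_map_def \<phi>_def \<Omega>_def by simp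
    define ep where "ep v x = \<phi> (eps v (finv \<phi> x))" for v x
    define z' where "z' x = \<phi> (zz (finv \<phi> x))" for x
    have conjA: "(\<lambda>x. \<phi> (L g (finv \<phi> x))) \<in> A" if g: "g \<in> \<Omega>" for g
      unfolding A_def aut_cay_def \<Omega>_def[symmetric]
    proof (intro CollectI conjI ballI)
      have "\<phi> \<circ> (L g \<circ> finv \<phi>) permutes \<Omega>" by (intro permutes_compose permutes_inv \<phi>p Lperm[OF g])
      then show "(\<lambda>x. \<phi> (L g (finv \<phi> x))) permutes \<Omega>" by (simp add: comp_def)
      fix x y assume x: "x \<in> \<Omega>" and y: "y \<in> \<Omega>"
      have ix: "finv \<phi> x \<in> \<Omega>" "finv \<phi> y \<in> \<Omega>" using im x y by auto
      have "(x, y) \<in> parcs (cayley_digraph G T) \<longleftrightarrow> (finv \<phi> x, finv \<phi> y) \<in> parcs (cayley_digraph G S)"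
        unfolding arc[OF ix] \<phi>i ..
      also have "\<dots> \<longleftrightarrow> (L g (finv \<phi> x), L g (finv \<phi> y)) \<in> parcs (cayley_digraph G S)"
        using LA[OF g S] ix unfolding aut_cay_def \<Omega>_def by blast
      also have "\<dots> \<longleftrightarrow> (\<phi> (L g (finv \<phi> x)), \<phi> (L g (finv \<phi> y))) \<in> parcs (cayley_digraph G T)"
        by (rule arc[OF Lm[OF g ix(1)] Lm[OF g ix(2)]])
      finally show "(x, y) \<in> parcs (cayley_digraph G T) \<longleftrightarrow> (\<phi> (L g (finv \<phi> x)), \<phi> (L g (finv \<phi> y))) \<in> parcs (cayley_digraph G T)" .
    qed
    have z'pow: "(z' ^^ t) x = \<phi> ((zz ^^ t) (finv \<phi> x))" for t x
      by (induction t) (simp_all add: z'_def \<phi>i)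
    have R': "rep \<Omega> A p ep z'" unfolding rep_def
    proof (intro conjI allI ballI)
      show "ep v \<in> A" for v using conjA[OF cm[of v]] unfolding ep_def[abs_def] eps_def .
      show "z' \<in> A" using conjA[OF zm[of 1]] unfolding z'_def[abs_def] zz_def .
      show "ep (u + v) x = ep u (ep v x)" for u v x unfolding ep_def \<phi>i cgp.rep_add[OF R] ..
      show "ep v (z' x) = z' (ep v x)" for v x unfolding ep_def z'_def \<phi>i cgp.rep_z[OF R] ..
      show "(z' ^^ p) x = x" for x unfolding z'pow cgp.rep_zp[OF R] \<phi>i ..
      show "card \<Omega> = 32 * p" by (rule card)
      fix x y assume x: "x \<in> \<Omega>" and y: "y \<in> \<Omega>"
      obtain v t where "finv \<phi> y = (zz ^^ t) (eps v (finv \<phi> x))" using cgp.rep_trans[OF R] im x y by blast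
      then have "\<phi> (finv \<phi> y) = \<phi> ((zz ^^ t) (eps v (finv \<phi> x)))" by (rule arg_cong)
      then have "y = (z' ^^ t) (ep v x)" unfolding z'pow ep_def \<phi>i .
      then show "\<exists>v t. y = (z' ^^ t) (ep v x)" by blast
    qed
    obtain \<delta> k where \<delta>: "\<delta> \<in> A" "\<And>v. \<exists>u. \<forall>x\<in>\<Omega>. \<delta> (ep v x) = eps u (\<delta> x)" "\<And>x. x \<in> \<Omega> \<Longrightarrow> \<delta> (z' x) = (zz ^^ k) (\<delta> x)"
      using cgp.regular_conj[OF R R'] unfolding cgp.Conj_def by blast
    define \<chi> where "\<chi> x = \<delta> (\<phi> x)" for x
    have \<delta>p: "\<delta> permutes \<Omega>" by (rule cgp.A_perm[OF \<delta>(1)])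
    have \<chi>p: "\<chi> permutes \<Omega>" using permutes_compose[OF \<phi>p \<delta>p] unfolding \<chi>_def[abs_def] comp_def .
    have \<chi>m: "\<chi> x \<in> \<Omega>" if "x \<in> \<Omega>" for x using permutes_in_image[OF \<chi>p] that by blast
    have \<chi>c: "\<exists>u. \<forall>y\<in>\<Omega>. \<chi> (eps v y) = eps u (\<chi> y)" for v
    proof -
      obtain u where u: "\<And>x. x \<in> \<Omega> \<Longrightarrow> \<delta> (ep v x) = eps u (\<delta> x)" using \<delta>(2) by blast
      have "\<chi> (eps v y) = eps u (\<chi> y)" if "y \<in> \<Omega>" for y
        using u[of "\<phi> y"] \<phi>m that unfolding \<chi>_def ep_def \<phi>i by simp
      then show ?thesis by blast
    qed
    have \<chi>z1: "\<chi> (zz y) = (zz ^^ k) (\<chi> y)" if "y \<in> \<Omega>" for y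
      using \<delta>(3)[of "\<phi> y"] \<phi>m that unfolding \<chi>_def z'_def \<phi>i by simp
    have \<chi>z: "\<chi> ((zz ^^ t) y) = (zz ^^ (t * k)) (\<chi> y)" if y: "y \<in> \<Omega>" for y t
    proof (induction t)
      case (Suc t)
      have "\<chi> ((zz ^^ Suc t) y) = (zz ^^ k) ((zz ^^ (t * k)) (\<chi> y))"
        using \<chi>z1[OF cgp.rep_zpow_mem[OF R y, of t]] Suc by simp
      then show ?case unfolding cgp.zadd[OF R] by simp
    qed simp
    have E: "\<exists>g'\<in>\<Omega>. \<forall>y\<in>\<Omega>. \<chi> (g \<otimes>\<^bsub>G\<^esub> y) = g' \<otimes>\<^bsub>G\<^esub> \<chi> y" if g: "g \<in> \<Omega>" for g
    proof -
      obtain v t where vt: "g = zvec p t \<otimes>\<^bsub>G\<^esub> cvec v" using dec[OF g] by blast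
      obtain u where u: "\<And>y. y \<in> \<Omega> \<Longrightarrow> \<chi> (eps v y) = eps u (\<chi> y)" using \<chi>c by blast
      have gm: "zvec p (t * k) \<otimes>\<^bsub>G\<^esub> cvec u \<in> \<Omega>" using zm cm unfolding \<Omega>_def by simp
      have "\<chi> (g \<otimes>\<^bsub>G\<^esub> y) = (zvec p (t * k) \<otimes>\<^bsub>G\<^esub> cvec u) \<otimes>\<^bsub>G\<^esub> \<chi> y" if y: "y \<in> \<Omega>" for y
      proof -
        have "g \<otimes>\<^bsub>G\<^esub> y = L g y" unfolding L_def using y by simp
        also have "\<dots> = (zz ^^ t) (eps v y)" unfolding zpow eps_def LL[OF zm cm] vt ..
        finally have "\<chi> (g \<otimes>\<^bsub>G\<^esub> y) = (zz ^^ (t * k)) (eps u (\<chi> y))"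
          using \<chi>z[OF cgp.rep_eps_mem[OF R y, of v], of t] u[OF y] by simp
        also have "\<dots> = L (zvec p (t * k) \<otimes>\<^bsub>G\<^esub> cvec u) (\<chi> y)" unfolding zpow eps_def LL[OF zm cm] ..
        finally show ?thesis unfolding L_def using \<chi>m[OF y] by simp
      qed
      then show ?thesis using gm by blast
    qed
    have o1: "\<one>\<^bsub>G\<^esub> \<in> \<Omega>" unfolding \<Omega>_def by simp
    \<comment> \<open>The translation that brings the image of the identity back to the
      identity.\<close>
    define c where "c = inv\<^bsub>G\<^esub> (\<chi> \<one>\<^bsub>G\<^esub>)"
    have c: "c \<in> \<Omega>" unfolding c_def by (rule invm[OF \<chi>m[OF o1]])
    define \<alpha> where "\<alpha> = restrict (\<lambda>x. L c (\<chi> x)) \<Omega>"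
    have \<alpha>x: "\<alpha> x = c \<otimes>\<^bsub>G\<^esub> \<chi> x" if "x \<in> \<Omega>" for x unfolding \<alpha>_def L_def using that \<chi>m[OF that] by simp
    have hom: "\<alpha> (g \<otimes>\<^bsub>G\<^esub> y) = \<alpha> g \<otimes>\<^bsub>G\<^esub> \<alpha> y" if g: "g \<in> \<Omega>" and y: "y \<in> \<Omega>" for g y
    proof -
      obtain g' where g': "g' \<in> \<Omega>" "\<And>y. y \<in> \<Omega> \<Longrightarrow> \<chi> (g \<otimes>\<^bsub>G\<^esub> y) = g' \<otimes>\<^bsub>G\<^esub> \<chi> y" using E[OF g] by blast
      have car: "g \<in> carrier G" "y \<in> carrier G" "g' \<in> carrier G" "c \<in> carrier G" "\<chi> y \<in> carrier G" "\<chi> \<one>\<^bsub>G\<^esub> \<in> carrier G"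
        using g y g'(1) c \<chi>m[OF y] \<chi>m[OF o1] unfolding \<Omega>_def by auto
      have gy: "g \<otimes>\<^bsub>G\<^esub> y \<in> \<Omega>" using car unfolding \<Omega>_def by simp
      have "\<chi> g = g' \<otimes>\<^bsub>G\<^esub> \<chi> \<one>\<^bsub>G\<^esub>" using g'(2)[OF o1] car by simp
      then have "\<alpha> g = c \<otimes>\<^bsub>G\<^esub> (g' \<otimes>\<^bsub>G\<^esub> \<chi> \<one>\<^bsub>G\<^esub>)" using \<alpha>x[OF g] by simp
      also have "\<dots> = (g' \<otimes>\<^bsub>G\<^esub> \<chi> \<one>\<^bsub>G\<^esub>) \<otimes>\<^bsub>G\<^esub> c" by (rule comm)
      also have "\<dots> = g' \<otimes>\<^bsub>G\<^esub> (\<chi> \<one>\<^bsub>G\<^esub> \<otimes>\<^bsub>G\<^esub> c)" by (rule m_assoc[OF car(3,6,4)])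
      also have "\<chi> \<one>\<^bsub>G\<^esub> \<otimes>\<^bsub>G\<^esub> c = \<one>\<^bsub>G\<^esub>" unfolding c_def by (rule r_inv[OF car(6)])
      also have "g' \<otimes>\<^bsub>G\<^esub> \<one>\<^bsub>G\<^esub> = g'" by (rule r_one[OF car(3)])
      finally have ag: "\<alpha> g = g'" .
      have "\<alpha> (g \<otimes>\<^bsub>G\<^esub> y) = c \<otimes>\<^bsub>G\<^esub> (g' \<otimes>\<^bsub>G\<^esub> \<chi> y)" using \<alpha>x[OF gy] g'(2)[OF y] by simp
      also have "\<dots> = (c \<otimes>\<^bsub>G\<^esub> g') \<otimes>\<^bsub>G\<^esub> \<chi> y" using m_assoc[OF car(4,3,5)] by simp
      also have "\<dots> = (g' \<otimes>\<^bsub>G\<^esub> c) \<otimes>\<^bsub>G\<^esub> \<chi> y" unfolding comm[of c] ..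
      also have "\<dots> = g' \<otimes>\<^bsub>G\<^esub> (c \<otimes>\<^bsub>G\<^esub> \<chi> y)" by (rule m_assoc[OF car(3,4,5)])
      finally show ?thesis unfolding ag \<alpha>x[OF y] .
    qed
    have "L c \<circ> \<chi> permutes \<Omega>" by (rule permutes_compose[OF \<chi>p Lperm[OF c]])
    then have "bij_betw (L c \<circ> \<chi>) \<Omega> \<Omega>" by (rule permutes_imp_bij)
    moreover have "bij_betw \<alpha> \<Omega> \<Omega> \<longleftrightarrow> bij_betw (L c \<circ> \<chi>) \<Omega> \<Omega>" by (rule bij_betw_cong) (simp add: \<alpha>_def)
    ultimately have bij: "bij_betw \<alpha> \<Omega> \<Omega>" by blast
    have "\<alpha> \<in> auto G" unfolding auto_def Bij_def hom_def \<Omega>_def[symmetric]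
      using bij hom bij_betw_apply[OF bij] by (auto simp: \<alpha>_def)
    moreover have "cay_map G S T \<alpha>" unfolding cay_map_def \<Omega>_def[symmetric]
    proof (intro conjI ballI)
      fix x y assume x: "x \<in> \<Omega>" and y: "y \<in> \<Omega>"
      have "(x, y) \<in> parcs (cayley_digraph G S) \<longleftrightarrow> (\<phi> x, \<phi> y) \<in> parcs (cayley_digraph G T)" by (rule arc[OF x y])
      also have "\<dots> \<longleftrightarrow> (\<chi> x, \<chi> y) \<in> parcs (cayley_digraph G T)"
        using \<delta>(1) \<phi>m x y unfolding A_def aut_cay_def \<chi>_def \<Omega>_def by blast
      also have "\<dots> \<longleftrightarrow> (L c (\<chi> x), L c (\<chi> y)) \<in> parcs (cayley_digraph G T)"
        using LA[OF c T] \<chi>m[OF x] \<chi>m[OF y] unfolding aut_cay_def \<Omega>_def by blast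
      finally show "(x, y) \<in> parcs (cayley_digraph G S) \<longleftrightarrow> (\<alpha> x, \<alpha> y) \<in> parcs (cayley_digraph G T)"
        unfolding \<alpha>_def using x y by simp
    qed (rule bij)
    ultimately show ?thesis using cayley_isomorphic_cay_map[OF grp] S T unfolding \<Omega>_def by blast
  qed
  show ?thesis unfolding G_def[symmetric] DCI_group_def CI_subset_def
  proof (intro conjI allI impI)
    show "group G" by (rule grp)
    show "finite (carrier G)" using fin unfolding \<Omega>_def .
    fix S T assume S: "S \<subseteq> carrier G" and T: "T \<subseteq> carrier G"
      and "digraph_iso (with_proj (cayley_digraph G S)) (with_proj (cayley_digraph G T))"
    then obtain \<phi> where "cay_map G S T \<phi>" using digraph_iso_cay_map[OF grp S T] by blast
    from main[OF _ _ this] show "cayley_isomorphic G S T" using S T unfolding \<Omega>_def by blast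
  qed
qed

theorem theorem1p1:
  fixes p :: nat
  assumes "prime p"
  shows "DCI_group (group_power (integer_mod_group 2) 5 \<times>\<times> integer_mod_group p) \<longleftrightarrow> p \<noteq> 2"
  using DCI_odd[OF assms] not_DCI_two primes_dvd_imp_eq[OF two_is_prime_nat assms] by blast

end
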